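(* Let $Y=(Y_1,\dots,Y_d)$ be an $\mathbb{R}^d$-valued random variable, and for $n\ge1$ put $Y_n=Y+\frac1n\theta(nY)$ where $\theta(y)=(\frac12-\{y_1\},\dots,\frac12-\{y_d\})$. Let $X$ be an $\mathbb{R}^m$-valued random variable on the same probability space. Let $V=(V_1,\dots,V_d)$ where the $V_i$ are independent, identically distributed, uniform on $(-\frac12,\frac12)$, and $V$ is independent of $(X,Y)$. (a) If $\mathbb{P}_Y$ is Rajchman, then $$(X,n(Y_n-Y))\stackrel{d}{\Longrightarrow}(X,(V_1,\dots,V_d)).$$ Moreover, for every $\varphi:\mathbb{R}^d\to\mathbb{R}$ of class $\mathcal{C}^1$ and Lipschitz, $$(X,n(\varphi(Y_n)-\varphi(Y)))\stackrel{d}{\Longrightarrow}\Big(X,\sum_{i=1}^dV_i\varphi'_i(Y)\Big),$$ $$n^2\,\mathbb{E}[(\varphi(Y_n)-\varphi(Y))^2\,|\,Y=y]\to\frac1{12}\sum_{i=1}^d\varphi_i'^2(y)\quad\text{in }L^1(\mathbb{P}_Y),$$ and in particular $$n^2\,\mathbb{E}[(\varphi(Y_n)-\varphi(Y))^2]\to\mathbb{E}_Y\Big[\frac1{12}\sum_{i=1}^d\varphi_i'^2\Big].$$ (b) If $\varphi$ is of class $\mathcal{C}^2$, the conditional expectation $n^2\mathbb{E}[\varphi(Y_n)-\varphi(Y)\,|\,Y=y]$ possesses a version, namely $n^2(\varphi(y+\frac1n\theta(ny))-\varphi(y))$, which does not depend on the probability measure $\mathbb{P}$ and which converges, as $n\to\infty$,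 in the sense of distributions to the function $\frac1{24}\Delta\varphi$. (c) If $\mathbb{P}_Y\ll dy$ on $\mathbb{R}^d$, then for every $\psi\in L^1((-\frac12,\frac12)^d)$, $$(X,\psi(n(Y_n-Y)))\stackrel{d}{\Longrightarrow}(X,\psi(V)).$$ (d) Consider the algebra $\mathcal{D}=\mathcal{C}^2_b$ of bounded functions on $\mathbb{R}^d$ with bounded derivatives up to order 2, and the sequence $\alpha_n=n^2$. If $\mathbb{P}_Y$ is Rajchman and if one of the following conditions holds: (i) for all $i=1,\dots,d$ the partial derivative $\partial_i\mathbb{P}_Y$ in the sense of distributions is a measure absolutely continuous with respect to $\mathbb{P}_Y$, of the form $\rho_i\mathbb{P}_Y$ with $\rho_i\in L^2(\mathbb{P}_Y)$; (ii) $\mathbb{P}_Y=h\,1_G\frac{dy}{|G|}$ with $G$ an open set, $h\in H^1\cap L^\infty(G)$, $h>0$; then hypotheses (H1) to (H4) stated in the context are satisfied and, for $\varphi\in\mathcal{D}$, $$\overline{A}[\varphi]=\frac1{24}\Delta\varphi,\qquad \Gamma[\varphi]=\frac1{12}\sum_i\varphi_i'^2,$$ $$\widetilde{A}[\varphi]=\frac1{24}\Delta\varphi+\frac1{24}\sum_i\varphi'_i\rho_i\ \text{ in case (i)},\qquad \widetilde{A}[\varphi]=\frac1{24}\Delta\varphi+\frac1{24}\frac1h\sum_ih'_i\varphi'_i\ \text{ in case (ii)}.$$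
   Context: $\{x\}=x-[x]$ is the fractional part of a real $x$, where $[x]$ is its integer part. $\stackrel{d}{\Longrightarrow}$ is convergence in law as $n\to\infty$. $\mathbb{P}_Y$ is the law of $Y$, $\mathbb{E}_Y$ the expectation under $\mathbb{P}_Y$, $\varphi'_i=\partial\varphi/\partial x_i$, and $|G|$ the Lebesgue measure of $G$. The law $\mathbb{P}_Y$ on $\mathbb{R}^d$ is called Rajchman if $\mathbb{E}e^{i\langle u,Y\rangle}\to0$ as $|u|\to\infty$, $u\in\mathbb{R}^d$. For an algebra $\mathcal{D}$ of bounded functions containing the constants and dense in $L^2(\mathbb{P}_Y)$, and a sequence $\alpha_n>0$, the hypotheses are: for every $\varphi\in\mathcal{D}$ there exist $\overline{A}[\varphi]$, $\underline{A}[\varphi]$, $\widetilde{A}[\varphi]$, $A^{s}[\varphi]$ (respectively) in $L^2(\mathbb{P}_Y)$ such that for all $\chi\in\mathcal{D}$: (H1) $\lim_n\alpha_n\mathbb{E}[(\varphi(Y_n)-\varphi(Y))\chi(Y)]=\mathbb{E}_Y[\overline{A}[\varphi]\chi]$; (H2) $\lim_n\alpha_n\mathbb{E}[(\varphi(Y)-\varphi(Y_n))\chi(Y_n)]=\mathbb{E}_Y[\underline{A}[\varphi]\chi]$; (H3) $\lim_n\alpha_n\mathbb{E}[(\varphi(Y_n)-\varphi(Y))(\chi(Y_n)-\chi(Y))]=-2\mathbb{E}_Y[\widetilde{A}[\varphi]\chi]$; (H4) $\lim_n\alpha_n\mathbb{E}[(\varphi(Y_n)-\varphi(Y))(\chi(Y_n)+\chi(Y))]=2\mathbb{E}_Y[A^{s}[\varphi]\chi]$.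 Under (H3), $\mathcal{E}[\varphi,\chi]=\lim_n\frac{\alpha_n}2\mathbb{E}[(\varphi(Y_n)-\varphi(Y))(\chi(Y_n)-\chi(Y))]$ on $\mathcal{D}$ is closable, its smallest closed extension is a Dirichlet form, and $\Gamma$ denotes its square field operator, given on $\mathcal{D}$ by $\Gamma[\varphi]=\widetilde{A}[\varphi^2]-2\varphi\widetilde{A}[\varphi]$.
   Formalization: In (a), the L¹(P_Y) convergence is weak (against bounded functions), as norm convergence fails for φ(y)=y; in (d)(ii), h extended by zero is required to be in H¹(R^d) and h'_i/h in L²(P_Y), since (H3) fails otherwise (e.g. h=1 on (0,1)). *)

theory Defs
  imports "HOL-Probability.Probability"
begin

definition theta :: "real^'d \<Rightarrow> real^'d" where
  "theta y = (\<chi> i. 1/2 - frac (y $ i))"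

definition graduated :: "nat \<Rightarrow> real^'d \<Rightarrow> real^'d" where
  "graduated n y = y + (1 / real n) *\<^sub>R theta (real n *\<^sub>R y)"

definition open_cube :: "(real^'d) set" where
  "open_cube = {y. \<forall>i. -1/2 < y $ i \<and> y $ i < 1/2}"

definition partial_deriv :: "'d \<Rightarrow> (real^'d \<Rightarrow> real) \<Rightarrow> real^'d \<Rightarrow> real" where
  "partial_deriv i f x = deriv (\<lambda>t. f (x + t *\<^sub>R axis i 1)) 0"

definition laplacian :: "(real^'d \<Rightarrow> real) \<Rightarrow> real^'d \<Rightarrow> real" where
  "laplacian f x = (\<Sum>i\<in>UNIV. partial_deriv i (partial_deriv i f) x)"

fun of_class_C :: "nat \<Rightarrow> (real^'d \<Rightarrow> real) \<Rightarrow> bool" where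
  "of_class_C 0 f \<longleftrightarrow> continuous_on UNIV f"
| "of_class_C (Suc k) f \<longleftrightarrow> (\<forall>x. f differentiable (at x)) \<and> (\<forall>i. of_class_C k (partial_deriv i f))"

definition C2_bounded :: "(real^'d \<Rightarrow> real) set" where
  "C2_bounded = {f. of_class_C 2 f \<and> bounded (range f)
     \<and> (\<forall>i. bounded (range (partial_deriv i f)))
     \<and> (\<forall>i j. bounded (range (partial_deriv j (partial_deriv i f))))}"

definition test_function :: "(real^'d) set \<Rightarrow> (real^'d \<Rightarrow> real) \<Rightarrow> bool" where
  "test_function \<Omega> \<xi> \<longleftrightarrow> (\<forall>k. of_class_C k \<xi>)
     \<and> (\<exists>K. compact K \<and> K \<subseteq> \<Omega> \<and> (\<forall>x. x \<notin> K \<longrightarrow> \<xi> x = 0))"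

definition converges_in_law ::
    "'a measure \<Rightarrow> (nat \<Rightarrow> 'a \<Rightarrow> 'b::topological_space) \<Rightarrow> ('a \<Rightarrow> 'b) \<Rightarrow> bool" where
  "converges_in_law M Z Z' \<longleftrightarrow>
     (\<forall>n. Z n \<in> borel_measurable M) \<and> Z' \<in> borel_measurable M
     \<and> (\<forall>f::'b \<Rightarrow> real. continuous_on UNIV f \<longrightarrow> bounded (range f) \<longrightarrow>
          (\<lambda>n. \<integral>\<omega>. f (Z n \<omega>) \<partial>M) \<longlonglongrightarrow> (\<integral>\<omega>. f (Z' \<omega>) \<partial>M))"

definition converges_in_distributions ::
    "(nat \<Rightarrow> real^'d \<Rightarrow> real) \<Rightarrow> (real^'d \<Rightarrow> real) \<Rightarrow> bool" where
  "converges_in_distributions f g \<longleftrightarrow>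
     (\<forall>\<xi>. test_function UNIV \<xi> \<longrightarrow>
        (\<forall>n. integrable lborel (\<lambda>y. f n y * \<xi> y)) \<and> integrable lborel (\<lambda>y. g y * \<xi> y)
        \<and> (\<lambda>n. \<integral>y. f n y * \<xi> y \<partial>lborel) \<longlonglongrightarrow> (\<integral>y. g y * \<xi> y \<partial>lborel))"

text \<open>
  Convergence in \<open>L\<^sup>1\<close> is taken for the weak topology \<open>\<sigma>(L\<^sup>1, L\<^sup>\<infinity>)\<close>.  Norm convergence would be
  false for the conditional quadratic errors considered here: they are deterministic functions of
  \<open>y\<close> which keep oscillating, for example \<open>(1/2 - frac (n y))\<^sup>2\<close> for the identity in dimension one.
\<close>

definition converges_weakly_L1 ::
    "'b measure \<Rightarrow> (nat \<Rightarrow> 'b \<Rightarrow> real) \<Rightarrow> ('b \<Rightarrow> real) \<Rightarrow> bool" where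
  "converges_weakly_L1 P f g \<longleftrightarrow>
     (\<forall>n. integrable P (f n)) \<and> integrable P g
     \<and> (\<forall>\<psi>\<in>borel_measurable P. bounded (range \<psi>) \<longrightarrow>
          (\<lambda>n. \<integral>y. f n y * \<psi> y \<partial>P) \<longlonglongrightarrow> (\<integral>y. g y * \<psi> y \<partial>P))"

definition rajchman :: "(real^'d) measure \<Rightarrow> bool" where
  "rajchman P \<longleftrightarrow> ((\<lambda>u. CLINT y|P. iexp (u \<bullet> y)) \<longlongrightarrow> 0) at_infinity"

text \<open>The function \<open>g\<close> is a version of \<open>y \<mapsto> E[Z | Y = y]\<close>.\<close>

definition cond_exp_version ::
    "'a measure \<Rightarrow> ('a \<Rightarrow> 'b::topological_space) \<Rightarrow> ('a \<Rightarrow> real) \<Rightarrow> ('b \<Rightarrow> real) \<Rightarrow> bool" where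
  "cond_exp_version M Y Z g \<longleftrightarrow> g \<in> borel_measurable borel
     \<and> (AE \<omega> in M. real_cond_exp M (vimage_algebra (space M) Y borel) Z \<omega> = g (Y \<omega>))"

definition in_L2 :: "'b measure \<Rightarrow> ('b \<Rightarrow> real) \<Rightarrow> bool" where
  "in_L2 P f \<longleftrightarrow> f \<in> borel_measurable P \<and> integrable P (\<lambda>y. (f y)\<^sup>2)"

text \<open>
  In the following four hypotheses \<open>A\<close> is an operator on \<open>D\<close> whose values are representatives of
  elements of \<open>L\<^sup>2\<close> of the law of \<open>Y\<close>; its values outside \<open>D\<close> are irrelevant.
\<close>

definition hyp_H1 ::
    "'a measure \<Rightarrow> ('a \<Rightarrow> 'b::topological_space) \<Rightarrow> (nat \<Rightarrow> 'a \<Rightarrow> 'b) \<Rightarrow> (nat \<Rightarrow> real)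
     \<Rightarrow> ('b \<Rightarrow> real) set \<Rightarrow> (('b \<Rightarrow> real) \<Rightarrow> 'b \<Rightarrow> real) \<Rightarrow> bool" where
  "hyp_H1 M Y Yn \<alpha> D A \<longleftrightarrow> (\<forall>\<phi>\<in>D. in_L2 (distr M borel Y) (A \<phi>) \<and> (\<forall>\<eta>\<in>D.
     (\<lambda>n. \<alpha> n * (\<integral>\<omega>. (\<phi> (Yn n \<omega>) - \<phi> (Y \<omega>)) * \<eta> (Y \<omega>) \<partial>M))
       \<longlonglongrightarrow> (\<integral>y. A \<phi> y * \<eta> y \<partial>distr M borel Y)))"

definition hyp_H2 ::
    "'a measure \<Rightarrow> ('a \<Rightarrow> 'b::topological_space) \<Rightarrow> (nat \<Rightarrow> 'a \<Rightarrow> 'b) \<Rightarrow> (nat \<Rightarrow> real)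
     \<Rightarrow> ('b \<Rightarrow> real) set \<Rightarrow> (('b \<Rightarrow> real) \<Rightarrow> 'b \<Rightarrow> real) \<Rightarrow> bool" where
  "hyp_H2 M Y Yn \<alpha> D A \<longleftrightarrow> (\<forall>\<phi>\<in>D. in_L2 (distr M borel Y) (A \<phi>) \<and> (\<forall>\<eta>\<in>D.
     (\<lambda>n. \<alpha> n * (\<integral>\<omega>. (\<phi> (Y \<omega>) - \<phi> (Yn n \<omega>)) * \<eta> (Yn n \<omega>) \<partial>M))
       \<longlonglongrightarrow> (\<integral>y. A \<phi> y * \<eta> y \<partial>distr M borel Y)))"

definition hyp_H3 ::
    "'a measure \<Rightarrow> ('a \<Rightarrow> 'b::topological_space) \<Rightarrow> (nat \<Rightarrow> 'a \<Rightarrow> 'b) \<Rightarrow> (nat \<Rightarrow> real)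
     \<Rightarrow> ('b \<Rightarrow> real) set \<Rightarrow> (('b \<Rightarrow> real) \<Rightarrow> 'b \<Rightarrow> real) \<Rightarrow> bool" where
  "hyp_H3 M Y Yn \<alpha> D A \<longleftrightarrow> (\<forall>\<phi>\<in>D. in_L2 (distr M borel Y) (A \<phi>) \<and> (\<forall>\<eta>\<in>D.
     (\<lambda>n. \<alpha> n * (\<integral>\<omega>. (\<phi> (Yn n \<omega>) - \<phi> (Y \<omega>)) * (\<eta> (Yn n \<omega>) - \<eta> (Y \<omega>)) \<partial>M))
       \<longlonglongrightarrow> - 2 * (\<integral>y. A \<phi> y * \<eta> y \<partial>distr M borel Y)))"

definition hyp_H4 ::
    "'a measure \<Rightarrow> ('a \<Rightarrow> 'b::topological_space) \<Rightarrow> (nat \<Rightarrow> 'a \<Rightarrow> 'b) \<Rightarrow> (nat \<Rightarrow> real)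
     \<Rightarrow> ('b \<Rightarrow> real) set \<Rightarrow> (('b \<Rightarrow> real) \<Rightarrow> 'b \<Rightarrow> real) \<Rightarrow> bool" where
  "hyp_H4 M Y Yn \<alpha> D A \<longleftrightarrow> (\<forall>\<phi>\<in>D. in_L2 (distr M borel Y) (A \<phi>) \<and> (\<forall>\<eta>\<in>D.
     (\<lambda>n. \<alpha> n * (\<integral>\<omega>. (\<phi> (Yn n \<omega>) - \<phi> (Y \<omega>)) * (\<eta> (Yn n \<omega>) + \<eta> (Y \<omega>)) \<partial>M))
       \<longlonglongrightarrow> 2 * (\<integral>y. A \<phi> y * \<eta> y \<partial>distr M borel Y)))"

text \<open>
  Square field operator, on \<open>D\<close>, of the Dirichlet form associated with the symmetric operator \<open>A\<close>
  of the third hypothesis.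
\<close>

definition square_field :: "(('b \<Rightarrow> real) \<Rightarrow> 'b \<Rightarrow> real) \<Rightarrow> ('b \<Rightarrow> real) \<Rightarrow> 'b \<Rightarrow> real" where
  "square_field A \<phi> y = A (\<lambda>z. (\<phi> z)\<^sup>2) y - 2 * \<phi> y * A \<phi> y"

text \<open>The distributional derivatives of \<open>P\<close> are the measures with densities \<open>\<rho> i\<close> in \<open>L\<^sup>2\<close> of \<open>P\<close>.\<close>

definition L2_logarithmic_gradient :: "(real^'d) measure \<Rightarrow> ('d \<Rightarrow> real^'d \<Rightarrow> real) \<Rightarrow> bool" where
  "L2_logarithmic_gradient P \<rho> \<longleftrightarrow> (\<forall>i. in_L2 P (\<rho> i)
     \<and> (\<forall>\<xi>. test_function UNIV \<xi> \<longrightarrow>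
          (\<integral>y. partial_deriv i \<xi> y \<partial>P) = - (\<integral>y. \<xi> y * \<rho> i y \<partial>P)))"

text \<open>The function \<open>f\<close> belongs to the Sobolev space \<open>H\<^sup>1(G)\<close> and has weak gradient \<open>df\<close>.\<close>

definition sobolev_H1 ::
    "(real^'d) set \<Rightarrow> (real^'d \<Rightarrow> real) \<Rightarrow> ('d \<Rightarrow> real^'d \<Rightarrow> real) \<Rightarrow> bool" where
  "sobolev_H1 G f df \<longleftrightarrow>
     set_borel_measurable lborel G f \<and> set_integrable lborel G (\<lambda>y. (f y)\<^sup>2)
     \<and> (\<forall>i. set_borel_measurable lborel G (df i) \<and> set_integrable lborel G (\<lambda>y. (df i y)\<^sup>2)
          \<and> (\<forall>\<xi>. test_function G \<xi> \<longrightarrow>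
               (LINT y:G|lborel. f y * partial_deriv i \<xi> y) = - (LINT y:G|lborel. df i y * \<xi> y)))"

text \<open>
  The law \<open>P\<close> is \<open>h 1\<^sub>G dy / |G|\<close>, where \<open>h\<close> has weak gradient \<open>dh\<close>.  Since \<open>P\<close> is applied to
  probability measures, the volume of \<open>G\<close> is automatically finite and positive.  The last two
  conditions cannot be omitted.  Extension by zero preserves \<open>H\<^sup>1\<close>, that is, there is no boundary
  term in the integration by parts on \<open>G\<close> (this excludes \<open>h = 1\<close> on an interval); and the logarithmic
  gradient of \<open>h\<close> is in \<open>L\<^sup>2\<close> of \<open>P\<close> (this excludes \<open>h\<close> vanishing linearly at the boundary).
\<close>

definition sobolev_density ::
    "(real^'d) measure \<Rightarrow> (real^'d) set \<Rightarrow> (real^'d \<Rightarrow> real) \<Rightarrow> ('d \<Rightarrow> real^'d \<Rightarrow> real) \<Rightarrow> bool" where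
  "sobolev_density P G h dh \<longleftrightarrow>
     open G
     \<and> P = density lborel (\<lambda>y. ennreal (h y * indicator G y / measure lborel G))
     \<and> sobolev_H1 G h dh
     \<and> (\<exists>C. AE y in lborel. y \<in> G \<longrightarrow> \<bar>h y\<bar> \<le> C)
     \<and> (AE y in lborel. y \<in> G \<longrightarrow> 0 < h y)
     \<and> sobolev_H1 UNIV (\<lambda>y. indicator G y * h y) (\<lambda>i y. indicator G y * dh i y)
     \<and> (\<forall>i. set_integrable P G (\<lambda>y. (dh i y / h y)\<^sup>2))"

end

(* Write theta_n = theta (n Y), so that n (Y_n - Y) = theta_n. A trigonometric monomial of theta_n is, up
   to sign, exp (i <2 pi n k, Y>) with k an integer vector. If the law of Y is Rajchman these functions are
   asymptotically uncorrelated, hence weakly null in L^2; by Stone-Weierstrass E[W f(theta_n)] tends to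
   E[W] E[f(V)] for all continuous f and integrable W, which is stable convergence of theta_n to V.
   For an absolutely continuous law it holds for all bounded Borel f, because theta (z + V) has the law of V.
   A first order Taylor expansion gives (a).

   In the second order expansion of n^2 (phi(Y_n) - phi(Y)) the quadratic term tends to Delta phi / 24
   by the previous remark. In the linear term, n theta_i (n y) is the derivative with respect to y_i of
   q_i (n y), where q_i = (1/12 - theta_i^2) / 2 is bounded, periodic and of mean zero; so an integration by
   parts turns n E[F(Y) theta_i (n Y)] into - E[(d_i F + rho_i F)(Y) q_i (n Y)], which tends to 0.
   The measure dy (with rho = 0) gives (b), the law of Y gives (d). *)
theory Submission
  imports Defs
begin

section \<open>Decorrelated oscillations\<close>

text \<open>Three irregularities shape the proof. The map \<open>theta\<close> jumps on hyperplanes,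
  so f(theta) lives on the torus only if f agrees on opposite faces of the cube; a general f is
  multiplied by a cutoff vanishing on the faces, and the mass lost near them is controlled by
  applying the limit theorem to the cutoff itself. The primitive q_i has corners at the integers, so
  the integration by parts is done for C1 periodic functions in which arccos (r cos x) replaces the
  folded angle x, and r tends to 1; the corners are negligible because a Rajchman law charges no
  hyperplane y_i = c. Finally, the discontinuous functions of (c) cannot be approximated uniformly
  by trigonometric polynomials; there the weight is approximated instead, and an exact average over
  translations replaces Fourier analysis. Test functions for the logarithmic gradient are smooth
  with compact support, whereas the functions to be integrated by parts are only C1 and bounded;
  mollifiers and growing cutoffs bridge the gap. Case (ii) of (d) becomes case (i) with rho_i = h'_i
  / h.\<close>

text \<open>Otherwise \<open>W\<close> would have a nonnegligible correlation with each term of an almost orthogonal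
  subsequence, against Bessel's inequality.\<close>

lemma (in prob_space) weak_null_of_decorrelated:
  fixes e :: "nat \<Rightarrow> 'a \<Rightarrow> real"
  assumes e[measurable]: "\<And>n. e n \<in> borel_measurable M" and bd: "\<And>n x. \<bar>e n x\<bar> \<le> 1"
    and corr: "\<And>\<delta>. \<delta> > 0 \<Longrightarrow> \<exists>L. \<forall>n m. L \<le> m \<and> m + L \<le> n \<longrightarrow> \<bar>\<integral>x. e n x * e m x \<partial>M\<bar> \<le> \<delta>"
    and W[measurable]: "W \<in> borel_measurable M" and W2: "integrable M (\<lambda>x. (W x)\<^sup>2)"
  shows "(\<lambda>n. \<integral>x. W x * e n x \<partial>M) \<longlonglongrightarrow> 0"
proof (rule ccontr)
  define a where "a n = (\<integral>x. W x * e n x \<partial>M)" for n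
  define w where "w = (\<integral>x. (W x)\<^sup>2 \<partial>M)"
  have w0: "0 \<le> w" by (simp add: w_def)
  have iW: "integrable M W" using W2 by (rule square_integrable_imp_integrable[OF W])
  have iWe: "integrable M (\<lambda>x. W x * e n x)" for n
    by (rule Bochner_Integration.integrable_bound[OF iW]) (use bd in \<open>auto simp: abs_mult mult_left_le\<close>)
  have iee: "integrable M (\<lambda>x. e n x * e m x)" for n m
    by (rule integrable_const_bound[where B=1]) (use bd in \<open>auto simp: abs_mult mult_le_one\<close>)
  assume "\<not> (\<lambda>n. \<integral>x. W x * e n x \<partial>M) \<longlonglongrightarrow> 0"
  then obtain \<epsilon> where \<epsilon>: "\<epsilon> > 0" and far: "\<And>N. \<exists>n\<ge>N. \<epsilon> \<le> \<bar>a n\<bar>"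
    unfolding LIMSEQ_def a_def by (auto simp: not_less)
  \<comment> \<open>The value keeps \<open>w * \<delta>\<close> below half of
    \<open>\<epsilon>\<^sup>2\<close>, so that in \<open>key\<close> the linear term on the right
    cannot keep up with the left side; the \<open>+ 1\<close> covers \<open>w = 0\<close>.\<close>
  define \<delta> where "\<delta> = \<epsilon>\<^sup>2 / (2 * (w + 1))"
  have \<delta>: "\<delta> > 0" using \<epsilon> w0 by (simp add: \<delta>_def)
  from corr[OF this] obtain L where
    L: "\<And>n m. L \<le> m \<Longrightarrow> m + L \<le> n \<Longrightarrow> \<bar>\<integral>x. e n x * e m x \<partial>M\<bar> \<le> \<delta>" by blast
  \<comment> \<open>All indices are at least \<open>L\<close> and consecutive ones are at least
    \<open>L\<close> apart, so \<open>corr\<close> covers every pair of distinct terms, the smaller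
    index playing the role of \<open>m\<close>.\<close>
  have "\<exists>f. \<forall>j::nat. (L \<le> f j \<and> \<epsilon> \<le> \<bar>a (f j)\<bar>) \<and> f j + L \<le> f (Suc j)"
  proof (rule dependent_nat_choice)
    show "\<exists>x. L \<le> x \<and> \<epsilon> \<le> \<bar>a x\<bar>" using far by blast
    show "\<exists>y. (L \<le> y \<and> \<epsilon> \<le> \<bar>a y\<bar>) \<and> x + L \<le> y" for x using far[of "x + L"] by (meson add_leE)
  qed
  then obtain f where f: "\<And>j. L \<le> f j" "\<And>j. \<epsilon> \<le> \<bar>a (f j)\<bar>" "\<And>j. f j + L \<le> f (Suc j)" by blast
  have mono: "f i \<le> f j" if "i \<le> j" for i j
    using that by (rule lift_Suc_mono_le[of f, rotated]) (use f(3) le_add1 order_trans in blast)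
  have gap: "f i + L \<le> f j" if "i < j" for i j
    using f(3)[of i] mono[of "Suc i" j] that by linarith
  have cross: "\<bar>\<integral>x. e (f i) x * e (f j) x \<partial>M\<bar> \<le> \<delta>" if "i \<noteq> j" for i j
  proof (cases "i < j")
    case True then show ?thesis using L[OF f(1)[of i] gap[OF True]] by (simp add: mult.commute)
  next
    case False
    with that have "j < i" by simp
    then show ?thesis using L[OF f(1)[of j] gap[of j i]] by simp
  qed
  have diag: "\<bar>\<integral>x. e (f i) x * e (f i) x \<partial>M\<bar> \<le> 1" for i
  proof -
    have "(\<integral>x. e (f i) x * e (f i) x \<partial>M) \<le> (\<integral>x. 1 \<partial>M)"
      by (rule integral_mono[OF iee]) (use bd[of "f i"] abs_le_square_iff[of "e (f i) _" 1] in \<open>auto simp: power2_eq_square\<close>)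
    then show ?thesis by (simp add: prob_space)
  qed
  define b where "b j = a (f j)" for j
  \<comment> \<open>The Gram matrix of the chosen terms is bounded entrywise by the identity plus
    \<delta> times the all-ones matrix, and the quadratic form of the latter is at most
    \<open>J\<close> times the sum of squares \<open>A\<close>.\<close>
  have key: "real J * \<epsilon>\<^sup>2 \<le> w * (1 + \<delta> * real J)" for J
  proof -
    define A where "A = (\<Sum>j<J. (b j)\<^sup>2)"
    define S where "S x = (\<Sum>j<J. b j * e (f j) x)" for x
    have [measurable]: "S \<in> borel_measurable M" unfolding S_def by measurable
    have WS: "W x * S x = (\<Sum>j<J. b j * (W x * e (f j) x))" for x
      by (simp add: S_def sum_distrib_left algebra_simps)
    have SS: "S x * S x = (\<Sum>i<J. \<Sum>j<J. b i * b j * (e (f i) x * e (f j) x))" for x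
      by (simp add: S_def sum_product algebra_simps)
    have iWS: "integrable M (\<lambda>x. W x * S x)" unfolding WS using iWe by simp
    have iSS: "integrable M (\<lambda>x. S x * S x)" unfolding SS using iee by simp
    have EWS: "(\<integral>x. W x * S x \<partial>M) = A"
      unfolding WS A_def using iWe by (simp add: b_def a_def power2_eq_square)
    have "(\<integral>x. S x * S x \<partial>M) = (\<Sum>i<J. \<Sum>j<J. b i * b j * (\<integral>x. e (f i) x * e (f j) x \<partial>M))"
      unfolding SS using iee by simp
    also have "\<dots> \<le> (\<Sum>i<J. \<Sum>j<J. (if i = j then (b i)\<^sup>2 else 0) + \<delta> * (\<bar>b i\<bar> * \<bar>b j\<bar>))"
    proof (intro sum_mono)
      fix i j
      have "b i * b j * (\<integral>x. e (f i) x * e (f j) x \<partial>M) \<le> \<bar>b i\<bar> * \<bar>b j\<bar> * \<bar>\<integral>x. e (f i) x * e (f j) x \<partial>M\<bar>"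
        by (metis abs_ge_self abs_mult)
      also have "\<dots> \<le> \<bar>b i\<bar> * \<bar>b j\<bar> * (if i = j then 1 else \<delta>)"
        using cross diag by (intro mult_left_mono) auto
      also have "\<dots> \<le> (if i = j then (b i)\<^sup>2 else 0) + \<delta> * (\<bar>b i\<bar> * \<bar>b j\<bar>)"
        using \<delta> by (auto simp: power2_eq_square)
      finally show "b i * b j * (\<integral>x. e (f i) x * e (f j) x \<partial>M) \<le> (if i = j then (b i)\<^sup>2 else 0) + \<delta> * (\<bar>b i\<bar> * \<bar>b j\<bar>)" .
    qed
    also have "\<dots> = A + \<delta> * (\<Sum>i<J. \<bar>b i\<bar>)\<^sup>2"
    proof -
      have "(\<Sum>i<J. \<bar>b i\<bar>)\<^sup>2 = (\<Sum>i<J. \<Sum>j<J. \<bar>b i\<bar> * \<bar>b j\<bar>)"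
        by (simp add: power2_eq_square sum_product)
      then show ?thesis by (simp add: sum.distrib A_def sum_distrib_left)
    qed
    also have "(\<Sum>i<J. \<bar>b i\<bar>)\<^sup>2 \<le> real J * A"
      using Cauchy_Schwarz_ineq_sum[of "\<lambda>_. 1" "\<lambda>i. \<bar>b i\<bar>" "{..<J}"] by (simp add: A_def)
    finally have ESS: "(\<integral>x. S x * S x \<partial>M) \<le> A * (1 + \<delta> * real J)" using \<delta> by (simp add: algebra_simps)
    \<comment> \<open>Minimiser of the quadratic
      \<open>w - 2 * t * A + t\<^sup>2 * A * (1 + \<delta> * J)\<close>, whose nonnegativity bounds
      \<open>A\<close>.\<close>
    define t where "t = 1 / (1 + \<delta> * real J)"
    have t: "t > 0" "t * (1 + \<delta> * real J) = 1" unfolding t_def using \<delta>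
      by (auto simp: add_pos_nonneg add_eq_0_iff) (smt (verit) mult_nonneg_nonneg of_nat_0_le_iff)+
    have "0 \<le> (\<integral>x. (W x - t * S x)\<^sup>2 \<partial>M)" by simp
    also have "\<dots> = (\<integral>x. ((W x)\<^sup>2 - 2 * t * (W x * S x)) + t\<^sup>2 * (S x * S x) \<partial>M)"
      by (intro Bochner_Integration.integral_cong) (auto simp: power2_eq_square algebra_simps)
    also have "\<dots> = w - 2 * t * A + t\<^sup>2 * (\<integral>x. S x * S x \<partial>M)"
      using W2 iWS iSS EWS by (simp add: w_def)
    also have "\<dots> \<le> w - 2 * t * A + t\<^sup>2 * (A * (1 + \<delta> * real J))"
      using ESS by (intro add_left_mono mult_left_mono) auto
    also have "t\<^sup>2 * (A * (1 + \<delta> * real J)) = t * A * (t * (1 + \<delta> * real J))"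
      by (simp add: power2_eq_square)
    finally have "t * A \<le> w" by (simp add: t(2) mult.commute)
    then have "A \<le> w * (1 + \<delta> * real J)"
      by (metis t mult.commute mult.left_commute mult.right_neutral mult_le_cancel_left_pos)
    moreover have "real J * \<epsilon>\<^sup>2 \<le> A"
    proof -
      have "(\<Sum>j<J. \<epsilon>\<^sup>2) \<le> A" unfolding A_def
        using f(2) \<epsilon> by (intro sum_mono) (simp add: b_def abs_le_square_iff[symmetric])
      then show ?thesis by simp
    qed
    ultimately show ?thesis by linarith
  qed
  have wd: "w * \<delta> \<le> \<epsilon>\<^sup>2 / 2"
    using w0 \<epsilon> by (simp add: \<delta>_def field_simps)
  \<comment> \<open>By \<open>key\<close> and \<open>wd\<close>, half of
    \<open>J * \<epsilon>\<^sup>2\<close> never exceeds \<open>w\<close>; this fails once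
    \<open>J\<close> is beyond \<open>2 * w / \<epsilon>\<^sup>2\<close>.\<close>
  obtain J :: nat where J: "real J > 2 * w / \<epsilon>\<^sup>2" using reals_Archimedean2 by blast
  have "w * \<delta> * real J \<le> \<epsilon>\<^sup>2 / 2 * real J" by (intro mult_right_mono wd) auto
  with key[of J] have "real J * \<epsilon>\<^sup>2 \<le> 2 * w" by (simp add: algebra_simps)
  moreover have "2 * w < real J * \<epsilon>\<^sup>2" using J \<epsilon> by (simp add: field_simps)
  ultimately show False by linarith
qed

text \<open>The points n v go to infinity along a ray, so the characteristic function tends to 0 on
  them; multiplying it by \<open>cis \<beta>\<close> before taking the real part handles every phase
  at once. Phases are carried along because products of cosines and the substitution of
  \<open>theta\<close> change them.\<close>

lemma rajchman_cos_integral: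
  fixes Y :: "'a \<Rightarrow> real^'d"
  assumes "prob_space M" and Y[measurable]: "Y \<in> borel_measurable M"
    and R: "rajchman (distr M borel Y)" and v: "v \<noteq> 0"
  shows "(\<lambda>n. \<integral>\<omega>. cos (real n * (v \<bullet> Y \<omega>) + \<beta>) \<partial>M) \<longlonglongrightarrow> 0"
proof -
  interpret prob_space M by fact
  have "filterlim (\<lambda>n. real n *\<^sub>R v) at_infinity sequentially"
    unfolding filterlim_at_infinity_conv_norm_at_top
    using v by (auto intro!: filterlim_at_top_mult_tendsto_pos[OF tendsto_const _ filterlim_real_sequentially])
  then have "(\<lambda>n. CLINT y|distr M borel Y. iexp ((real n *\<^sub>R v) \<bullet> y)) \<longlonglongrightarrow> 0"
    using R unfolding rajchman_def by (rule filterlim_compose[rotated])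
  then have "(\<lambda>n. cis \<beta> * (CLINT y|distr M borel Y. iexp ((real n *\<^sub>R v) \<bullet> y))) \<longlonglongrightarrow> 0"
    by (auto intro: tendsto_mult_right_zero)
  then have "(\<lambda>n. Re (cis \<beta> * (CLINT y|distr M borel Y. iexp ((real n *\<^sub>R v) \<bullet> y)))) \<longlonglongrightarrow> 0"
    using tendsto_Re by fastforce
  moreover have "Re (cis \<beta> * (CLINT y|distr M borel Y. iexp ((real n *\<^sub>R v) \<bullet> y)))
      = (\<integral>\<omega>. cos (real n * (v \<bullet> Y \<omega>) + \<beta>) \<partial>M)" for n
  proof -
    have int: "integrable M (\<lambda>\<omega>. cis \<beta> * iexp ((real n *\<^sub>R v) \<bullet> Y \<omega>))"
      by (rule integrable_const_bound[where B=1]) (auto simp: norm_mult)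
    have "cis \<beta> * (CLINT y|distr M borel Y. iexp ((real n *\<^sub>R v) \<bullet> y))
       = (CLINT \<omega>|M. cis \<beta> * iexp ((real n *\<^sub>R v) \<bullet> Y \<omega>))"
      by (subst integral_distr) auto
    then have "Re (cis \<beta> * (CLINT y|distr M borel Y. iexp ((real n *\<^sub>R v) \<bullet> y)))
       = (\<integral>\<omega>. Re (cis \<beta> * iexp ((real n *\<^sub>R v) \<bullet> Y \<omega>)) \<partial>M)"
      using integral_Re[OF int] by simp
    also have "\<dots> = (\<integral>\<omega>. cos (real n * (v \<bullet> Y \<omega>) + \<beta>) \<partial>M)"
      by (intro Bochner_Integration.integral_cong refl)
        (simp only: cis_conv_exp[symmetric] cis_mult, simp add: add.commute)
    finally show ?thesis .
  qed
  ultimately show ?thesis by simp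
qed

text \<open>A product of two cosines is half the sum of cosines at the frequencies n - m and n + m,
  with phases 0 and 2 \<beta>. Vanishing of the means therefore already gives vanishing of the
  correlations, once both the gap and the indices are large.\<close>

lemma rajchman_weak_cos:
  fixes Y :: "'a \<Rightarrow> real^'d"
  assumes M: "prob_space M" and Y[measurable]: "Y \<in> borel_measurable M"
    and R: "rajchman (distr M borel Y)" and v: "v \<noteq> 0"
    and W: "W \<in> borel_measurable M" "integrable M (\<lambda>x. (W x)\<^sup>2)"
  shows "(\<lambda>n. \<integral>\<omega>. W \<omega> * cos (real n * (v \<bullet> Y \<omega>) + \<beta>) \<partial>M) \<longlonglongrightarrow> 0"
proof -
  interpret prob_space M by fact
  show ?thesis
  proof (rule weak_null_of_decorrelated[OF _ _ _ W])
    fix \<delta> :: real assume \<delta>: "\<delta> > 0"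
    obtain L1 where L1: "\<And>n. n \<ge> L1 \<Longrightarrow> \<bar>\<integral>\<omega>. cos (real n * (v \<bullet> Y \<omega>) + 0) \<partial>M\<bar> < \<delta>"
      using rajchman_cos_integral[OF M Y R v, of 0] \<delta> unfolding LIMSEQ_def by auto
    obtain L2 where L2: "\<And>n. n \<ge> L2 \<Longrightarrow> \<bar>\<integral>\<omega>. cos (real n * (v \<bullet> Y \<omega>) + 2 * \<beta>) \<partial>M\<bar> < \<delta>"
      using rajchman_cos_integral[OF M Y R v, of "2 * \<beta>"] \<delta> unfolding LIMSEQ_def by auto
    show "\<exists>L. \<forall>n m. L \<le> m \<and> m + L \<le> n \<longrightarrow>
        \<bar>\<integral>x. cos (real n * (v \<bullet> Y x) + \<beta>) * cos (real m * (v \<bullet> Y x) + \<beta>) \<partial>M\<bar> \<le> \<delta>"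
    proof (intro exI allI impI)
      \<comment> \<open>One threshold bounds both the indices and the gap: it gives
        \<open>n - m \<ge> L1\<close> and \<open>n + m \<ge> L2\<close>.\<close>
      fix n m assume nm: "L1 + L2 \<le> m \<and> m + (L1 + L2) \<le> n"
      have ic: "integrable M (\<lambda>\<omega>. cos (c * (v \<bullet> Y \<omega>) + d))" for c d
        by (rule integrable_const_bound[where B=1]) auto
      have prod: "cos (real n * z + \<beta>) * cos (real m * z + \<beta>)
        = (1/2) * cos (real (n - m) * z + 0) + (1/2) * cos (real (n + m) * z + 2 * \<beta>)" for z
      proof -
        have "real n * z + \<beta> - (real m * z + \<beta>) = real (n - m) * z + 0"
          using nm by (simp add: of_nat_diff left_diff_distrib)
        moreover have "real n * z + \<beta> + (real m * z + \<beta>) = real (n + m) * z + 2 * \<beta>"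
          by (simp add: algebra_simps)
        ultimately show ?thesis by (simp only: cos_times_cos) (simp add: add_divide_distrib)
      qed
      have "(\<integral>x. cos (real n * (v \<bullet> Y x) + \<beta>) * cos (real m * (v \<bullet> Y x) + \<beta>) \<partial>M)
        = (1/2) * (\<integral>x. cos (real (n - m) * (v \<bullet> Y x) + 0) \<partial>M) + (1/2) * (\<integral>x. cos (real (n + m) * (v \<bullet> Y x) + 2 * \<beta>) \<partial>M)"
        unfolding prod using ic[of _ 0] by (simp add: ic)
      moreover have "n - m \<ge> L1" "n + m \<ge> L2" using nm by auto
      ultimately show "\<bar>\<integral>x. cos (real n * (v \<bullet> Y x) + \<beta>) * cos (real m * (v \<bullet> Y x) + \<beta>) \<partial>M\<bar> \<le> \<delta>"
        using L1[of "n - m"] L2[of "n + m"] by linarith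
    qed
  qed auto
qed

section \<open>Uniform vectors\<close>

lemma theta_nth: "theta y $ i = 1/2 - frac (y $ i)"
  by (simp add: theta_def)

lemma abs_theta_nth_le: "\<bar>theta y $ i\<bar> \<le> 1/2"
  using frac_ge_0[of "y $ i"] frac_lt_1[of "y $ i"] unfolding theta_nth by linarith

lemma borel_measurable_vec_nth [measurable (raw)]:
  fixes f :: "'a \<Rightarrow> real^'d"
  assumes "f \<in> borel_measurable M"
  shows "(\<lambda>x. f x $ i) \<in> borel_measurable M"
  by (rule measurable_compose[OF assms]) (intro borel_measurable_continuous_onI continuous_intros)

lemma borel_measurable_vec_iff:
  fixes f :: "'a \<Rightarrow> real^'d"
  shows "f \<in> borel_measurable M \<longleftrightarrow> (\<forall>i. (\<lambda>x. f x $ i) \<in> borel_measurable M)"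
proof
  assume "f \<in> borel_measurable M"
  then show "\<forall>i. (\<lambda>x. f x $ i) \<in> borel_measurable M" using borel_measurable_vec_nth by blast
next
  assume "\<forall>i. (\<lambda>x. f x $ i) \<in> borel_measurable M"
  then show "f \<in> borel_measurable M"
    by (subst borel_measurable_euclidean_space) (auto simp: Basis_vec_def inner_axis)
qed

lemma borel_measurable_frac [measurable]: "(frac :: real \<Rightarrow> real) \<in> borel_measurable borel"
  unfolding frac_def by measurable

lemma borel_measurable_theta [measurable]: "theta \<in> borel_measurable borel"
  by (subst borel_measurable_vec_iff) (simp add: theta_nth)

text \<open>On the circle this is a rotation followed by a reflection. On the interval,
  \<open>z + t\<close> meets an integer only at the point \<open>c\<close>, and each of the two
  pieces cut off by \<open>c\<close> is reflected onto itself, up to endpoints, by an affine map of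
  slope -1.\<close>

lemma distr_uniform_reflect:
  "distr (uniform_measure lborel {-1/2<..<1/2}) borel (\<lambda>t. 1/2 - frac (z + t))
     = uniform_measure lborel {-1/2<..<1/2::real}" (is "?L = ?U")
proof (rule measure_eqI)
  fix A assume "A \<in> sets ?L"
  then have A[measurable]: "A \<in> sets borel" by simp
  define I where "I = {-1/2<..<1/2::real}"
  have [measurable]: "I \<in> sets borel" by (simp add: I_def)
  have I: "emeasure lborel I = 1" by (simp add: I_def)
  \<comment> \<open>The integer nearest to \<open>z\<close>, so that the jump \<open>c\<close> falls
    into the interval or on its right end.\<close>
  define m where "m = \<lfloor>z + 1/2\<rfloor>"
  define c where "c = of_int m - z"
  have c: "-1/2 < c" "c \<le> 1/2" unfolding c_def m_def by linarith+
  have low: "1/2 - frac (z + t) = c - 1/2 - t" if "t \<in> {-1/2<..<c}" for t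
  proof -
    have "\<lfloor>z + t\<rfloor> = m - 1" using that c unfolding c_def by (intro floor_unique) auto
    then show ?thesis by (simp add: frac_def c_def)
  qed
  have high: "1/2 - frac (z + t) = c + 1/2 - t" if "t \<in> {c..<1/2}" for t
  proof -
    have "\<lfloor>z + t\<rfloor> = m" using that c unfolding c_def by (intro floor_unique) auto
    then show ?thesis by (simp add: frac_def c_def)
  qed
  have "emeasure ?L A = emeasure lborel (I \<inter> {t. 1/2 - frac (z + t) \<in> A})"
    using I by (subst emeasure_distr) (auto simp: I_def divide_ennreal_def vimage_def)
  also have "\<dots> = (\<integral>\<^sup>+t. indicator {-1/2<..<c} t * indicator A (c - 1/2 - t)
      + indicator {c..<1/2} t * indicator A (c + 1/2 - t) \<partial>lborel)"
  proof (subst nn_integral_indicator[symmetric], simp, rule nn_integral_cong)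
    fix t
    consider "t \<in> {-1/2<..<c}" | "t \<in> {c..<1/2}" | "t \<notin> I" by (fastforce simp: I_def)
    then show "indicator (I \<inter> {t. 1/2 - frac (z + t) \<in> A}) t =
      (indicator {-1/2<..<c} t * indicator A (c - 1/2 - t) + indicator {c..<1/2} t * indicator A (c + 1/2 - t) :: ennreal)"
    proof cases
      case 1
      then have "t \<in> I" "t \<notin> {c..<1/2}" using c by (auto simp: I_def)
      with 1 show ?thesis by (simp add: indicator_def low[OF 1])
    next
      case 2
      then have "t \<in> I" "t \<notin> {-1/2<..<c}" using c by (auto simp: I_def)
      with 2 show ?thesis by (simp add: indicator_def high[OF 2])
    next
      case 3
      then have "t \<notin> {-1/2<..<c}" "t \<notin> {c..<1/2}" using c by (auto simp: I_def)
      with 3 show ?thesis by (simp add: indicator_def)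
    qed
  qed
  also have "\<dots> = (\<integral>\<^sup>+t. indicator {-1/2<..<c} t * indicator A (c - 1/2 - t) \<partial>lborel)
      + (\<integral>\<^sup>+t. indicator {c..<1/2} t * indicator A (c + 1/2 - t) \<partial>lborel)"
    by (rule nn_integral_add) measurable
  also have "(\<integral>\<^sup>+t. indicator {-1/2<..<c} t * indicator A (c - 1/2 - t) \<partial>lborel)
      = (\<integral>\<^sup>+t. indicator {-1/2<..<c} t * indicator A t \<partial>lborel)"
    by (subst nn_integral_real_affine[where c="-1" and t="c - 1/2"])
       (auto intro!: nn_integral_cong split: split_indicator)
  also have "(\<integral>\<^sup>+t. indicator {c..<1/2} t * indicator A (c + 1/2 - t) \<partial>lborel)
      = (\<integral>\<^sup>+t. indicator {c<..1/2} t * indicator A t \<partial>lborel)"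
    by (subst nn_integral_real_affine[where c="-1" and t="c + 1/2"])
       (auto intro!: nn_integral_cong split: split_indicator)
  also have "(\<integral>\<^sup>+t. indicator {-1/2<..<c} t * indicator A t \<partial>lborel) + \<dots>
      = (\<integral>\<^sup>+t. indicator {-1/2<..<c} t * indicator A t + indicator {c<..1/2} t * indicator A t \<partial>lborel)"
    by (rule nn_integral_add[symmetric]) measurable
  also have "\<dots> = (\<integral>\<^sup>+t. indicator (I \<inter> A) t \<partial>lborel)"
  proof (rule nn_integral_cong_AE)
    show "AE t in lborel. indicator {-1/2<..<c} t * indicator A t + indicator {c<..1/2} t * indicator A t
      = (indicator (I \<inter> A) t :: ennreal)"
      using AE_lborel_singleton[of c] AE_lborel_singleton[of "1/2"]
      by eventually_elim (use c in \<open>auto simp: I_def split: split_indicator\<close>)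
  qed
  also have "\<dots> = emeasure ?U A"
    using I by (simp add: I_def divide_ennreal_def)
  finally show "emeasure ?L A = emeasure ?U A" .
qed simp

locale uniform_vector = prob_space M for M :: "'a measure" +
  fixes V :: "'a \<Rightarrow> real^'d"
  assumes V_uniform: "\<And>i. distr M borel (\<lambda>\<omega>. V \<omega> $ i) = uniform_measure lborel {-1/2<..<1/2}"
    and V_indep: "indep_vars (\<lambda>_. borel) (\<lambda>i \<omega>. V \<omega> $ i) UNIV"
begin

lemma V_measurable [measurable]: "V \<in> borel_measurable M"
  using V_indep by (auto simp: borel_measurable_vec_iff indep_vars_def)

lemma AE_V: "AE \<omega> in M. \<forall>i. \<bar>V \<omega> $ i\<bar> < 1/2"
proof (subst AE_all_countable, intro allI)
  fix i
  have "AE t in uniform_measure lborel {-1/2<..<1/2::real}. \<bar>t\<bar> < 1/2"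
    by (rule AE_uniform_measureI) auto
  then have "AE t in distr M borel (\<lambda>\<omega>. V \<omega> $ i). \<bar>t\<bar> < 1/2" by (simp only: V_uniform)
  then show "AE \<omega> in M. \<bar>V \<omega> $ i\<bar> < 1/2" by (subst (asm) AE_distr_iff) auto
qed

text \<open>The coordinates of \<open>theta (z + V)\<close> are again independent and, by the
  one-dimensional case, uniform, so the two laws agree as product measures. This exact invariance
  yields both the vanishing of the nonconstant characters of \<open>V\<close> and the
  equidistribution under absolutely continuous laws.\<close>

lemma distr_theta_shift: "distr M borel (\<lambda>\<omega>. theta (z + V \<omega>)) = distr M borel V"
proof -
  let ?P = "\<Pi>\<^sub>M i\<in>(UNIV::'d set). (borel :: real measure)"
  define W where "W = (\<lambda>i \<omega>. 1/2 - frac (z $ i + V \<omega> $ i))"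
  have mW[measurable]: "W i \<in> borel_measurable M" for i unfolding W_def by measurable
  have iW: "indep_vars (\<lambda>_. borel) W UNIV"
    unfolding W_def by (rule indep_vars_compose2[OF V_indep]) measurable
  have dW: "distr M borel (W i) = distr M borel (\<lambda>\<omega>. V \<omega> $ i)" for i
  proof -
    have "distr M borel (W i) = distr (distr M borel (\<lambda>\<omega>. V \<omega> $ i)) borel (\<lambda>t. 1/2 - frac (z $ i + t))"
      by (subst distr_distr) (auto simp: W_def comp_def)
    then show ?thesis by (simp only: V_uniform distr_uniform_reflect)
  qed
  have eq: "distr M ?P (\<lambda>x. \<lambda>i\<in>UNIV. W i x) = distr M ?P (\<lambda>x. \<lambda>i\<in>UNIV. V x $ i)"
    using iW V_indep by (simp add: indep_vars_iff_distr_eq_PiM dW)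
  have [measurable]: "(\<lambda>f. \<chi> i. f i) \<in> ?P \<rightarrow>\<^sub>M (borel :: (real^'d) measure)"
    by (subst borel_measurable_vec_iff) simp
  have m1: "(\<lambda>x. \<lambda>i\<in>UNIV. W i x) \<in> M \<rightarrow>\<^sub>M ?P" "(\<lambda>x. \<lambda>i\<in>UNIV. V x $ i) \<in> M \<rightarrow>\<^sub>M ?P"
    by (intro measurable_restrict; measurable)+
  have "distr M borel (\<lambda>\<omega>. theta (z + V \<omega>)) = distr (distr M ?P (\<lambda>x. \<lambda>i\<in>UNIV. W i x)) borel (\<lambda>f. \<chi> i. f i)"
    by (subst distr_distr[OF _ m1(1)]) (auto simp: W_def comp_def theta_def restrict_def)
  also have "\<dots> = distr M borel V"
    unfolding eq by (subst distr_distr[OF _ m1(2)]) (auto simp: comp_def restrict_def)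
  finally show ?thesis .
qed

lemma integral_theta_shift:
  fixes f :: "real^'d \<Rightarrow> real"
  assumes [measurable]: "f \<in> borel_measurable borel"
  shows "(\<integral>\<omega>. f (theta (z + V \<omega>)) \<partial>M) = (\<integral>\<omega>. f (V \<omega>) \<partial>M)"
proof -
  have "(\<integral>\<omega>. f (theta (z + V \<omega>)) \<partial>M) = (\<integral>x. f x \<partial>distr M borel (\<lambda>\<omega>. theta (z + V \<omega>)))"
    by (subst integral_distr) auto
  also have "\<dots> = (\<integral>\<omega>. f (V \<omega>) \<partial>M)"
    unfolding distr_theta_shift by (subst integral_distr) auto
  finally show ?thesis .
qed

section \<open>Moments of the uniform vector up to order two\<close>

lemma integral_component:
  fixes f :: "real \<Rightarrow> real"
  assumes "\<And>x. -1/2 \<le> x \<Longrightarrow> x \<le> 1/2 \<Longrightarrow> (F has_real_derivative f x) (at x)"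
    and "continuous_on UNIV f"
  shows "(\<integral>\<omega>. f (V \<omega> $ i) \<partial>M) = F (1/2) - F (-1/2)"
proof -
  have [measurable]: "f \<in> borel_measurable borel" using assms(2) by (rule borel_measurable_continuous_onI)
  have "(\<integral>\<omega>. f (V \<omega> $ i) \<partial>M) = (\<integral>t. f t \<partial>distr M borel (\<lambda>\<omega>. V \<omega> $ i))"
    by (subst integral_distr) auto
  also have "\<dots> = (\<integral>t. f t \<partial>density lborel (\<lambda>t. ennreal (indicator {-1/2<..<1/2} t)))"
    unfolding V_uniform uniform_measure_def
    by (intro arg_cong[where f="\<lambda>m. integral\<^sup>L m f"] density_cong)
       (auto simp: divide_ennreal_def ennreal_indicator)
  also have "\<dots> = (\<integral>t. indicator {-1/2<..<1/2} t *\<^sub>R f t \<partial>lborel)"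
    by (rule integral_density) auto
  also have "\<dots> = (\<integral>t. indicator {-1/2..1/2} t *\<^sub>R f t \<partial>lborel)"
  proof (rule integral_cong_AE)
    show "AE t in lborel. indicator {-1/2<..<1/2} t *\<^sub>R f t = indicator {-1/2..1/2} t *\<^sub>R f t"
      using AE_lborel_singleton[of "-1/2"] AE_lborel_singleton[of "1/2"]
      by eventually_elim (auto split: split_indicator)
  qed auto
  also have "\<dots> = F (1/2) - F (-1/2)"
  proof (rule integral_FTC_Icc)
    show "(F has_vector_derivative f x) (at x within {-1/2..1/2})" if "-1/2 \<le> x" "x \<le> 1/2" for x
      using assms(1)[OF that]
      by (simp add: has_field_derivative_at_within has_real_derivative_iff_has_vector_derivative[symmetric])
  qed (use assms(2) in \<open>auto intro: continuous_on_subset\<close>)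
  finally show ?thesis .
qed

lemma integrable_bounded_V:
  assumes f: "f \<in> borel_measurable borel" and "\<And>v. (\<forall>i. \<bar>v $ i\<bar> \<le> 1/2) \<Longrightarrow> \<bar>f v\<bar> \<le> (C::real)"
  shows "integrable M (\<lambda>\<omega>. f (V \<omega>))"
proof (rule integrable_const_bound[where B=C])
  show "AE x in M. norm (f (V x)) \<le> C"
    using AE_V by eventually_elim (auto intro!: assms(2) simp: less_imp_le)
qed (use f in measurable)

lemma integral_V_nth: "(\<integral>\<omega>. V \<omega> $ i \<partial>M) = 0"
  by (subst integral_component[where F="\<lambda>x. x\<^sup>2 / 2"])
     (auto intro!: derivative_eq_intros simp: power2_eq_square)

lemma integral_V_nth_square: "(\<integral>\<omega>. V \<omega> $ i * V \<omega> $ i \<partial>M) = 1/12"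
  by (subst integral_component[where F="\<lambda>x. x ^ 3 / 3" and f="\<lambda>x. x * x"])
     (auto intro!: derivative_eq_intros continuous_intros simp: power2_eq_square power3_eq_cube)

lemma integral_V_nth_mult: "(\<integral>\<omega>. V \<omega> $ i * V \<omega> $ j \<partial>M) = (if i = j then 1/12 else 0)"
proof (cases "i = j")
  case False
  have "indep_vars (\<lambda>_. borel) (\<lambda>i \<omega>. V \<omega> $ i) {i, j}"
    using V_indep by (rule indep_vars_subset) simp
  then have "(\<integral>\<omega>. (\<Prod>k\<in>{i,j}. V \<omega> $ k) \<partial>M) = (\<Prod>k\<in>{i,j}. \<integral>\<omega>. V \<omega> $ k \<partial>M)"
    by (intro indep_vars_lebesgue_integral)
       (auto intro!: integrable_bounded_V[where f="\<lambda>v. v $ _" and C="1/2"])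
  then show ?thesis using False by (simp add: integral_V_nth)
qed (simp add: integral_V_nth_square)

section \<open>Characters of the torus evaluated at \<open>theta\<close> and at
  \<open>V\<close>\<close>

text \<open>Since \<open>k\<close> is an integer vector, the integer parts hidden in
  \<open>frac\<close> shift the argument by a multiple of 2 pi. The constant 1/2 in
  \<open>theta\<close> contributes the phase pi times the sum of the k_i, and the minus sign in
  front of \<open>frac\<close> is absorbed by the evenness of the cosine.\<close>

lemma cos_theta:
  assumes "\<And>i. k $ i \<in> \<int>"
  shows "cos (2 * pi * (k \<bullet> theta y) + \<beta>) = cos (2 * pi * (k \<bullet> y) - (pi * (\<Sum>i\<in>UNIV. k $ i) + \<beta>))"
proof -
  define N where "N = (\<Sum>i\<in>UNIV. k $ i * of_int \<lfloor>y $ i\<rfloor>)"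
  have "N \<in> \<int>" unfolding N_def using assms by (intro Ints_sum Ints_mult) auto
  then obtain z where z: "N = of_int z" by (auto elim: Ints_cases)
  have "k \<bullet> theta y = (\<Sum>i\<in>UNIV. k $ i) / 2 - k \<bullet> y + N"
    by (simp add: inner_vec_def theta_nth frac_def N_def sum.distrib[symmetric] sum_subtractf[symmetric]
        sum_divide_distrib algebra_simps)
  then have th: "k \<bullet> theta y = (\<Sum>i\<in>UNIV. k $ i) / 2 - k \<bullet> y + of_int z" by (simp only: z)
  have "2 * pi * (k \<bullet> theta y) + \<beta> = - (2 * pi * (k \<bullet> y) - (pi * (\<Sum>i\<in>UNIV. k $ i) + \<beta>)) + 2 * pi * of_int z"
    unfolding th by (simp add: algebra_simps)
  moreover have "cos (x + 2 * pi * of_int z) = cos x" for x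
    by (simp add: cos_add sin_int_2pin cos_int_2pin)
  ultimately show ?thesis by (simp only: cos_minus)
qed

text \<open>By \<open>integral_theta_shift\<close> the integral does not change when
  \<open>V\<close> is translated. A translation by \<open>z\<close> with
  \<open>k \<bullet> z = 1/2\<close> moves the phase by pi, so the integral equals its own
  negative.\<close>

lemma integral_cos_V:
  assumes k: "\<And>i. k $ i \<in> \<int>" "k \<noteq> 0"
  shows "(\<integral>\<omega>. cos (2 * pi * (k \<bullet> V \<omega>) + \<beta>) \<partial>M) = 0"
proof -
  define g where "g = pi * (\<Sum>i\<in>UNIV. k $ i) + \<beta>"
  have shift: "(\<integral>\<omega>. cos (2 * pi * (k \<bullet> V \<omega>) + \<beta>) \<partial>M) = (\<integral>\<omega>. cos (2 * pi * (k \<bullet> (z + V \<omega>)) - g) \<partial>M)" for z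
    using integral_theta_shift[of "\<lambda>v. cos (2 * pi * (k \<bullet> v) + \<beta>)" z] by (simp add: cos_theta[OF k(1)] g_def)
  define z where "z = (1 / (2 * (k \<bullet> k))) *\<^sub>R k"
  have kz: "k \<bullet> z = 1/2" using k(2) by (simp add: z_def)
  have "2 * pi * (k \<bullet> (z + v)) - g = (2 * pi * (k \<bullet> (0 + v)) - g) + pi" for v
    by (simp add: inner_add_right kz algebra_simps)
  then have "(\<integral>\<omega>. cos (2 * pi * (k \<bullet> (z + V \<omega>)) - g) \<partial>M) = - (\<integral>\<omega>. cos (2 * pi * (k \<bullet> (0 + V \<omega>)) - g) \<partial>M)"
    by (simp only: cos_periodic_pi) simp
  with shift[of z] shift[of 0] show ?thesis by linarith
qed

end

section \<open>Rajchman laws and the oscillating part\<close>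

lemma integrable_mult_bounded:
  fixes W f :: "'a \<Rightarrow> real"
  assumes W: "integrable M W" and [measurable]: "f \<in> borel_measurable M" and f: "\<And>x. \<bar>f x\<bar> \<le> C"
  shows "integrable M (\<lambda>x. W x * f x)"
proof (rule Bochner_Integration.integrable_bound[OF integrable_mult_right[OF W, of C]])
  have [measurable]: "W \<in> borel_measurable M" using W by simp
  show "(\<lambda>x. W x * f x) \<in> borel_measurable M" by measurable
  have "0 \<le> C" using f[of undefined] by linarith
  then have "\<bar>W x * f x\<bar> \<le> \<bar>C * W x\<bar>" for x
    using f[of x] by (simp add: abs_mult mult.commute[of "\<bar>W x\<bar>"] mult_right_mono)
  then show "AE x in M. norm (W x * f x) \<le> norm (C * W x)" by simp
qed

text \<open>The exchange of limits behind all density arguments below. Closeness is asked for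
  eventually rather than for all n, because in some uses the error bound is itself only known
  through its limit.\<close>

lemma tendsto_of_approximations:
  fixes a :: "nat \<Rightarrow> real"
  assumes "\<And>e. e > 0 \<Longrightarrow> \<exists>b l'. b \<longlonglongrightarrow> l' \<and> (\<forall>\<^sub>F n in sequentially. \<bar>a n - b n\<bar> \<le> e) \<and> \<bar>l' - l\<bar> \<le> e"
  shows "a \<longlonglongrightarrow> l"
  unfolding tendsto_iff
proof (intro allI impI)
  fix e :: real assume "e > 0"
  then have e4: "e / 4 > 0" by simp
  from assms[OF this] obtain b l' where b: "b \<longlonglongrightarrow> l'"
    and ab: "\<forall>\<^sub>F n in sequentially. \<bar>a n - b n\<bar> \<le> e / 4" and l: "\<bar>l' - l\<bar> \<le> e / 4" by blast
  have "\<forall>\<^sub>F n in sequentially. dist (b n) l' < e / 4" using b e4 by (rule tendstoD)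
  with ab show "\<forall>\<^sub>F n in sequentially. dist (a n) l < e"
    by eventually_elim (use l \<open>e > 0\<close> in \<open>unfold dist_real_def, linarith\<close>)
qed

section \<open>Trigonometric polynomials and their density on the torus\<close>

text \<open>The free phase lets one generator cover cosines, sines and, with \<open>k = 0\<close>,
  constants, and makes the class closed under products through the addition formulas.\<close>

inductive trig_poly :: "(real^'d \<Rightarrow> real) \<Rightarrow> bool" where
  cos: "(\<And>i. k $ i \<in> \<int>) \<Longrightarrow> trig_poly (\<lambda>v. c * cos (2 * pi * (k \<bullet> v) + \<beta>))"
| add: "trig_poly f \<Longrightarrow> trig_poly g \<Longrightarrow> trig_poly (\<lambda>v. f v + g v)"

lemma trig_poly_mult:
  assumes "trig_poly f" "trig_poly g"
  shows "trig_poly (\<lambda>v. f v * g v)"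
  using assms(1)
proof induction
  case (cos k c \<beta>)
  from assms(2) show ?case
  proof induction
    case (cos k' c' \<beta>')
    have "(\<lambda>v. (c * cos (2 * pi * (k \<bullet> v) + \<beta>)) * (c' * cos (2 * pi * (k' \<bullet> v) + \<beta>')))
      = (\<lambda>v. c * c' / 2 * cos (2 * pi * ((k - k') \<bullet> v) + (\<beta> - \<beta>')) + c * c' / 2 * cos (2 * pi * ((k + k') \<bullet> v) + (\<beta> + \<beta>')))"
    proof
      fix v
      have "2 * pi * ((k - k') \<bullet> v) + (\<beta> - \<beta>') = (2 * pi * (k \<bullet> v) + \<beta>) - (2 * pi * (k' \<bullet> v) + \<beta>')"
        "2 * pi * ((k + k') \<bullet> v) + (\<beta> + \<beta>') = (2 * pi * (k \<bullet> v) + \<beta>) + (2 * pi * (k' \<bullet> v) + \<beta>')"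
        by (simp_all add: inner_add_left inner_diff_left algebra_simps)
      then show "(c * cos (2 * pi * (k \<bullet> v) + \<beta>)) * (c' * cos (2 * pi * (k' \<bullet> v) + \<beta>'))
        = c * c' / 2 * cos (2 * pi * ((k - k') \<bullet> v) + (\<beta> - \<beta>')) + c * c' / 2 * cos (2 * pi * ((k + k') \<bullet> v) + (\<beta> + \<beta>'))"
        by (simp only: cos_add cos_diff) (simp add: field_simps)
    qed
    then show ?case using cos \<open>\<And>i. k $ i \<in> \<int>\<close> by (simp only:) (intro trig_poly.intros; simp)
  next
    case (add f g)
    then show ?case by (simp only: distrib_left) (rule trig_poly.add)
  qed
next
  case (add f g)
  then show ?case by (simp only: distrib_right) (rule trig_poly.add)
qed

lemma trig_poly_continuous: "trig_poly f \<Longrightarrow> continuous_on UNIV f"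
  by (induction rule: trig_poly.induct) (auto intro!: continuous_intros)

text \<open>The d-dimensional torus embedded in Euclidean space of dimension 2d: opposite faces of
  the cube are glued together, and the image of the cube is compact, as Stone-Weierstrass
  requires.\<close>

definition circ :: "real^'d \<Rightarrow> (real^'d) \<times> (real^'d)" where
  "circ v = ((\<chi> i. cos (2 * pi * v $ i)), (\<chi> i. sin (2 * pi * v $ i)))"

text \<open>Each factor is 1 minus the 2m-th power of sin (pi v_i). It vanishes on the faces of the
  cube and tends to 1 inside as m grows; as a function of the cosines alone it is continuous on the
  torus.\<close>

definition fade :: "nat \<Rightarrow> real^'d \<Rightarrow> real" where
  "fade m v = (\<Prod>i\<in>UNIV. 1 - ((1 - cos (2 * pi * v $ i)) / 2) ^ m)"

lemma fade_factor: "0 \<le> 1 - ((1 - cos x) / 2) ^ m" "1 - ((1 - cos x) / 2) ^ m \<le> (1::real)"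
proof -
  have "0 \<le> (1 - cos x) / 2" using cos_le_one[of x] by simp
  moreover have "(1 - cos x) / 2 \<le> 1" using cos_ge_minus_one[of x] by (simp del: cos_ge_minus_one)
  ultimately show "0 \<le> 1 - ((1 - cos x) / 2) ^ m" "1 - ((1 - cos x) / 2) ^ m \<le> (1::real)"
    by (simp_all add: power_le_one)
qed

lemma fade_bounds: "0 \<le> fade m v" "fade m v \<le> 1"
  unfolding fade_def by (intro prod_nonneg prod_le_1 ballI conjI fade_factor)+

lemma continuous_on_fade: "continuous_on UNIV (fade m)"
  unfolding fade_def by (intro continuous_intros) auto

lemma fade_tendsto_1:
  assumes "\<forall>i. \<bar>v $ i\<bar> < 1/2"
  shows "(\<lambda>m. fade m v) \<longlonglongrightarrow> 1"
proof -
  have "(\<lambda>m. ((1 - cos (2 * pi * v $ i)) / 2) ^ m) \<longlonglongrightarrow> 0" for i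
  proof -
    have "cos (2 * pi * \<bar>v $ i\<bar>) > cos pi"
      using assms by (intro cos_monotone_0_pi) (auto simp: field_simps)
    then have "cos (2 * pi * v $ i) > -1"
      by (cases "v $ i \<ge> 0") (auto simp: abs_if)
    then show ?thesis using cos_le_one[of "2 * pi * v $ i"] by (intro LIMSEQ_power_zero) (simp add: abs_less_iff del: cos_le_one cos_ge_minus_one)
  qed
  then have "(\<lambda>m. fade m v) \<longlonglongrightarrow> (\<Prod>i\<in>(UNIV::'a set). 1 - 0)"
    unfolding fade_def by (rule tendsto_prod[OF tendsto_diff[OF tendsto_const]])
  then show ?thesis by simp
qed

text \<open>The cutoff vanishes on the boundary of the cube, so that the product descends to a continuous
  function on the torus, where the Stone-Weierstrass theorem applies.\<close>

lemma trig_poly_approx_fade: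
  fixes f :: "real^'d \<Rightarrow> real"
  assumes f: "continuous_on UNIV f" and m: "m > 0" and e: "e > 0"
  obtains q where "trig_poly q" "\<And>v. (\<forall>i. -1/2 < v $ i \<and> v $ i \<le> 1/2) \<Longrightarrow> \<bar>f v * fade m v - q v\<bar> < e"
proof -
  define S where "S = circ ` cbox (\<chi> i. -1/2) (\<chi> i. 1/2 :: real^'d)"
  have "continuous_on UNIV (circ :: real^'d \<Rightarrow> _)"
    unfolding circ_def by (intro continuous_intros continuous_on_vec_lambda)
  then have S: "compact S"
    unfolding S_def by (intro compact_continuous_image) (auto intro: continuous_on_subset)
  \<comment> \<open>Inverse of \<open>circ\<close> on the half-open cube, since \<open>Arg\<close>
    takes its values between -pi, excluded, and pi, included.\<close>
  define G :: "(real^'d) \<times> (real^'d) \<Rightarrow> real^'d" where "G z = (\<chi> i. Arg (Complex (fst z $ i) (snd z $ i)) / (2 * pi))" for z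
  define X where "X z = (\<Prod>i\<in>UNIV. 1 - ((1 - fst z $ i) / 2) ^ m)" for z :: "(real^'d) \<times> (real^'d)"
  define h where "h z = f (G z) * X z" for z
  have G_circ: "G (circ v) = v" if "\<forall>i. -1/2 < v $ i \<and> v $ i \<le> 1/2" for v
  proof -
    have "Arg (Complex (cos (2 * pi * v $ i)) (sin (2 * pi * v $ i))) = 2 * pi * v $ i" for i
    proof -
      have "-1/2 < v $ i" "v $ i \<le> 1/2" using that by auto
      then have "2 * pi * (-1/2) < 2 * pi * v $ i" "2 * pi * v $ i \<le> 2 * pi * (1/2)"
        by (intro mult_strict_left_mono mult_left_mono; simp)+
      then have "Arg (cis (2 * pi * v $ i)) = 2 * pi * v $ i" by (intro Arg_cis) auto
      then show ?thesis by (simp add: cis.code)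
    qed
    then show ?thesis by (simp add: G_def circ_def vec_eq_iff)
  qed
  have h_circ: "h (circ v) = f v * fade m v" if "\<forall>i. -1/2 < v $ i \<and> v $ i \<le> 1/2" for v
    using G_circ[OF that] by (simp add: h_def X_def fade_def circ_def)
  have "compact (f ` cbox (\<chi> i. -1/2) (\<chi> i. 1/2))"
    by (intro compact_continuous_image continuous_on_subset[OF f]) auto
  then obtain C where C: "\<And>v. v \<in> cbox (\<chi> i. -1/2) (\<chi> i. 1/2) \<Longrightarrow> \<bar>f v\<bar> \<le> C"
    by (meson bounded_real compact_imp_bounded imageI)
  have G_cube: "G z \<in> cbox (\<chi> i. -1/2) (\<chi> i. 1/2)" for z
  proof -
    have "-1/2 \<le> Arg w / (2 * pi)" "Arg w / (2 * pi) \<le> 1/2" for w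
      using Arg_bounded[of w] by (simp_all add: field_simps)
    then show ?thesis by (simp add: G_def mem_box_cart)
  qed
  have contX: "continuous_on UNIV X" unfolding X_def by (intro continuous_intros) auto
  then have isContX: "isCont X w" for w using continuous_on_eq_continuous_at[OF open_UNIV] by blast
  have "continuous_on S h"
  proof (rule continuous_at_imp_continuous_on, intro ballI)
    fix z assume "z \<in> S"
    then obtain v where z: "z = circ v" by (auto simp: S_def)
    show "isCont h z"
    proof (cases "\<exists>i. fst z $ i = -1")
      case True
      then obtain i where i: "fst z $ i = -1" by blast
      \<comment> \<open>At such a point \<open>G\<close> jumps between opposite faces. The product
        \<open>h\<close> is nevertheless continuous there, because \<open>f (G w)\<close> stays
        bounded by \<open>C\<close> while \<open>X\<close> vanishes.\<close>
      have X0: "X z = 0" unfolding X_def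
        using m i by (intro prod_zero) (auto intro!: exI[of _ i])
      have "X \<midarrow>z\<rightarrow> X z" using isContX[of z] unfolding isCont_def .
      then have "(\<lambda>w. C * \<bar>X w\<bar>) \<midarrow>z\<rightarrow> 0"
        unfolding X0 by (intro tendsto_mult_right_zero tendsto_rabs_zero)
      then have "h \<midarrow>z\<rightarrow> 0"
        by (rule Lim_null_comparison[rotated])
           (auto intro!: always_eventually mult_right_mono C[OF G_cube] simp: h_def abs_mult)
      then show ?thesis by (simp add: isCont_def h_def X0)
    next
      case False
      have "isCont (\<lambda>z. Arg (Complex (fst z $ i) (snd z $ i))) z" for i
      proof -
        have "(fst z $ i)\<^sup>2 + (snd z $ i)\<^sup>2 = 1" by (simp add: z circ_def)
        then have "Complex (fst z $ i) (snd z $ i) \<notin> \<real>\<^sub>\<le>\<^sub>0"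
          using False by (auto simp: complex_nonpos_Reals_iff power2_eq_1_iff)
        moreover have "isCont (\<lambda>z. Complex (fst z $ i) (snd z $ i)) z"
          unfolding Complex_eq by (intro continuous_intros)
        ultimately show ?thesis by (intro continuous_at_compose[unfolded o_def, of z _ Arg] continuous_at_Arg)
      qed
      then have "isCont G z" unfolding G_def isCont_def
        by (intro tendsto_vec_lambda tendsto_divide tendsto_const) simp_all
      then have "isCont (\<lambda>z. f (G z)) z"
        using f by (auto intro: continuous_at_compose[unfolded o_def] simp: continuous_on_eq_continuous_at)
      then show ?thesis unfolding h_def by (intro isCont_mult isContX)
    qed
  qed
  have trig_const: "trig_poly (\<lambda>v::real^'d. c)" for c
    using trig_poly.cos[of 0 c 0] by simp
  have axis_Ints: "(axis i 1 :: real^'d) $ j \<in> \<int>" for i j by (simp add: axis_def)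
  have trig_fst: "trig_poly (\<lambda>v. fst (circ v) $ i)" for i :: 'd
    using trig_poly.cos[of "axis i 1" 1 0, OF axis_Ints] by (simp add: circ_def inner_axis')
  have trig_snd: "trig_poly (\<lambda>v. snd (circ v) $ i)" for i :: 'd
    using trig_poly.cos[of "axis i 1" 1 "-pi/2", OF axis_Ints] by (simp add: circ_def inner_axis' cos_diff)
  \<comment> \<open>Stone-Weierstrass on the embedded torus, for the algebra of the functions whose
    pullback by \<open>circ\<close> is a trigonometric polynomial; the coordinate functions belong
    to it and separate points.\<close>
  have "\<exists>g. (continuous_on S g \<and> trig_poly (\<lambda>v. g (circ v))) \<and> (\<forall>x\<in>S. \<bar>h x - g x\<bar> < e)"
  proof (rule Stone_Weierstrass_HOL[OF S _ _ _ _ _ \<open>continuous_on S h\<close> e])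
    fix x y assume xy: "x \<in> S \<and> y \<in> S \<and> x \<noteq> y"
    then consider i where "fst x $ i \<noteq> fst y $ i" | i where "snd x $ i \<noteq> snd y $ i"
      by (metis prod_eq_iff vec_eq_iff)
    then show "\<exists>f. (continuous_on S f \<and> trig_poly (\<lambda>v. f (circ v))) \<and> f x \<noteq> f y"
    proof cases
      case 1
      then show ?thesis using trig_fst[of i]
        by (intro exI[of _ "\<lambda>z. fst z $ i"]) (auto intro!: continuous_intros)
    next
      case 2
      then show ?thesis using trig_snd[of i]
        by (intro exI[of _ "\<lambda>z. snd z $ i"]) (auto intro!: continuous_intros)
    qed
  qed (auto intro!: continuous_intros trig_const trig_poly.add trig_poly_mult)
  then obtain g where g: "trig_poly (\<lambda>v. g (circ v))" "\<And>x. x \<in> S \<Longrightarrow> \<bar>h x - g x\<bar> < e" by blast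
  have "\<bar>f v * fade m v - g (circ v)\<bar> < e" if "\<forall>i. -1/2 < v $ i \<and> v $ i \<le> 1/2" for v
    using g(2)[of "circ v"] that h_circ[OF that] by (auto simp: S_def mem_box_cart less_imp_le)
  then show ?thesis using g(1) by (rule that[rotated]) auto
qed

lemma continuous_bounded_on_cube:
  fixes f :: "real^'d \<Rightarrow> real"
  assumes "continuous_on UNIV f"
  obtains C where "\<And>v. \<forall>i. \<bar>v $ i\<bar> \<le> 1/2 \<Longrightarrow> \<bar>f v\<bar> \<le> C"
proof -
  have "compact (f ` cbox (\<chi> i. -1/2) (\<chi> i. 1/2))"
    by (intro compact_continuous_image continuous_on_subset[OF assms]) auto
  then obtain C where C: "\<And>v. v \<in> cbox (\<chi> i. -1/2) (\<chi> i. 1/2) \<Longrightarrow> \<bar>f v\<bar> \<le> C"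
    by (meson bounded_real compact_imp_bounded imageI)
  have "v \<in> cbox (\<chi> i. -1/2) (\<chi> i. 1/2)" if "\<forall>i. \<bar>v $ i\<bar> \<le> 1/2" for v :: "real^'d"
  proof -
    have "-1/2 \<le> v $ i \<and> v $ i \<le> 1/2" for i using that[rule_format, of i] by linarith
    then show ?thesis by (simp add: mem_box_cart)
  qed
  then show thesis using C that by blast
qed

section \<open>Stable convergence of the oscillating part under a Rajchman law\<close>

locale rajchman_vector = uniform_vector M V for M :: "'a measure" and V :: "'a \<Rightarrow> real^'d" +
  fixes Y :: "'a \<Rightarrow> real^'d"
  assumes Y_measurable [measurable]: "Y \<in> borel_measurable M"
    and rajchman: "rajchman (distr M borel Y)"
begin

abbreviation osc :: "nat \<Rightarrow> 'a \<Rightarrow> real^'d" where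
  "osc n \<omega> \<equiv> theta (real n *\<^sub>R Y \<omega>)"

text \<open>The frequency 0 contributes the same constant on both sides. Every other frequency is
  weakly null on the left by decorrelation and has mean zero under \<open>V\<close> on the
  right.\<close>

lemma weak_trig_poly:
  assumes "trig_poly f"
    and W[measurable]: "W \<in> borel_measurable M" and W2: "integrable M (\<lambda>x. (W x)\<^sup>2)"
  shows "(\<lambda>n. \<integral>\<omega>. W \<omega> * f (osc n \<omega>) \<partial>M) \<longlonglongrightarrow> (\<integral>\<omega>. W \<omega> \<partial>M) * (\<integral>\<omega>. f (V \<omega>) \<partial>M)"
  using assms(1)
proof induction
  case (cos k c \<beta>)
  show ?case
  proof (cases "k = 0")
    case True
    then show ?thesis by (simp add: prob_space)
  next
    case False
    define g where "g = pi * (\<Sum>i\<in>UNIV. k $ i) + \<beta>"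
    have "(\<lambda>n. c * (\<integral>\<omega>. W \<omega> * cos (real n * (((2 * pi) *\<^sub>R k) \<bullet> Y \<omega>) + (- g)) \<partial>M)) \<longlonglongrightarrow> c * 0"
      by (intro tendsto_intros rajchman_weak_cos[OF _ Y_measurable rajchman _ W W2])
         (use False in \<open>auto intro: prob_space_axioms\<close>)
    moreover have "(\<lambda>\<omega>. W \<omega> * (c * cos (2 * pi * (k \<bullet> osc n \<omega>) + \<beta>)))
        = (\<lambda>\<omega>. c * (W \<omega> * cos (real n * (((2 * pi) *\<^sub>R k) \<bullet> Y \<omega>) + (- g))))" for n
      using cos_theta[OF cos(1), of "real n *\<^sub>R Y _" \<beta>] by (auto simp: g_def algebra_simps)
    ultimately show ?thesis using integral_cos_V[OF cos(1) False] by simp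
  qed
next
  case (add f g)
  have iW: "integrable M W" using W2 by (rule square_integrable_imp_integrable[OF W])
  have cont: "continuous_on UNIV f" "continuous_on UNIV g" using add.hyps trig_poly_continuous by auto
  have [measurable]: "f \<in> borel_measurable borel" "g \<in> borel_measurable borel"
    using cont by (auto intro: borel_measurable_continuous_onI)
  have bd: "\<exists>C. \<forall>v. \<bar>f v\<bar> \<le> C" if "trig_poly f" for f :: "real^'d \<Rightarrow> real"
    using that
  proof induction
    case (cos k c \<beta>)
    have "\<bar>c * cos (2 * pi * (k \<bullet> v) + \<beta>)\<bar> \<le> \<bar>c\<bar>" for v
      using mult_left_mono[OF abs_cos_le_one, of "\<bar>c\<bar>"] by (simp add: abs_mult)
    then show ?case by blast
  next
    case (add f g)
    then show ?case by (meson abs_triangle_ineq add_mono order_trans)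
  qed
  obtain C where C: "\<And>v. \<bar>f v\<bar> \<le> C" using bd add.hyps by blast
  obtain D where D: "\<And>v. \<bar>g v\<bar> \<le> D" using bd add.hyps by blast
  have iWf: "integrable M (\<lambda>\<omega>. W \<omega> * f (Z \<omega>))" "integrable M (\<lambda>\<omega>. W \<omega> * g (Z \<omega>))"
    if [measurable]: "Z \<in> borel_measurable M" for Z
    using C D by (auto intro!: integrable_mult_bounded[OF iW])
  have ifV: "integrable M (\<lambda>\<omega>. f (V \<omega>))" "integrable M (\<lambda>\<omega>. g (V \<omega>))"
    using C D by (auto intro!: integrable_bounded_V)
  show ?case
    using tendsto_add[OF add.IH] iWf ifV by (simp add: distrib_left)
qed

text \<open>The trigonometric approximation is uniform on the half-open cube, which contains every
  value of \<open>osc\<close> and almost every value of \<open>V\<close>; both errors are then at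
  most the L1 norm of \<open>W\<close> times the uniform error.\<close>

lemma weak_fade:
  fixes f :: "real^'d \<Rightarrow> real" and W :: "'a \<Rightarrow> real"
  assumes f: "continuous_on UNIV f" and m: "m > 0"
    and W[measurable]: "W \<in> borel_measurable M" and W2: "integrable M (\<lambda>x. (W x)\<^sup>2)"
  shows "(\<lambda>n. \<integral>\<omega>. W \<omega> * (f (osc n \<omega>) * fade m (osc n \<omega>)) \<partial>M)
     \<longlonglongrightarrow> (\<integral>\<omega>. W \<omega> \<partial>M) * (\<integral>\<omega>. f (V \<omega>) * fade m (V \<omega>) \<partial>M)"
proof (rule tendsto_of_approximations)
  fix e :: real assume e: "e > 0"
  have iW: "integrable M W" using W2 by (rule square_integrable_imp_integrable[OF W])
  define w where "w = (\<integral>\<omega>. \<bar>W \<omega>\<bar> \<partial>M)"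
  have w: "0 \<le> w" by (simp add: w_def)
  define e' where "e' = e / (w + 1)"
  have e': "e' > 0" "w * e' \<le> e" using e w by (simp_all add: e'_def field_simps)
  define g where "g v = f v * fade m v" for v
  have g: "continuous_on UNIV g" unfolding g_def by (intro continuous_intros f continuous_on_fade)
  obtain q where q: "trig_poly q"
    and gq: "\<And>v. (\<forall>i. -1/2 < v $ i \<and> v $ i \<le> 1/2) \<Longrightarrow> \<bar>g v - q v\<bar> < e'"
    using trig_poly_approx_fade[OF f m e'(1)] unfolding g_def by blast
  have qc: "continuous_on UNIV q" by (rule trig_poly_continuous[OF q])
  have [measurable]: "g \<in> borel_measurable borel" "q \<in> borel_measurable borel"
    using g qc by (auto intro: borel_measurable_continuous_onI)
  have gq_osc: "\<bar>g (osc n \<omega>) - q (osc n \<omega>)\<bar> \<le> e'" for n \<omega>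
    by (intro less_imp_le gq allI) (simp add: theta_nth frac_lt_1 frac_ge_0)
  have gq_V: "AE \<omega> in M. \<bar>g (V \<omega>) - q (V \<omega>)\<bar> \<le> e'"
    using AE_V
  proof eventually_elim
    case (elim \<omega>)
    have "-1/2 < V \<omega> $ i \<and> V \<omega> $ i \<le> 1/2" for i using elim[rule_format, of i] by linarith
    then show ?case by (intro less_imp_le gq allI)
  qed
  obtain D where D: "\<And>v. \<forall>i. \<bar>v $ i\<bar> \<le> 1/2 \<Longrightarrow> \<bar>g v\<bar> \<le> D"
    using continuous_bounded_on_cube[OF g] by blast
  obtain D' where D': "\<And>v. \<forall>i. \<bar>v $ i\<bar> \<le> 1/2 \<Longrightarrow> \<bar>q v\<bar> \<le> D'"
    using continuous_bounded_on_cube[OF qc] by blast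
  have int: "integrable M (\<lambda>\<omega>. W \<omega> * g (osc n \<omega>))" "integrable M (\<lambda>\<omega>. W \<omega> * q (osc n \<omega>))" for n
    using D D' abs_theta_nth_le by (auto intro!: integrable_mult_bounded[OF iW])
  have intV: "integrable M (\<lambda>\<omega>. g (V \<omega>))" "integrable M (\<lambda>\<omega>. q (V \<omega>))"
    using D D' by (auto intro!: integrable_bounded_V)
  have "\<bar>(\<integral>\<omega>. W \<omega> * g (osc n \<omega>) \<partial>M) - (\<integral>\<omega>. W \<omega> * q (osc n \<omega>) \<partial>M)\<bar> \<le> e" for n
  proof -
    have "\<bar>(\<integral>\<omega>. W \<omega> * g (osc n \<omega>) \<partial>M) - (\<integral>\<omega>. W \<omega> * q (osc n \<omega>) \<partial>M)\<bar>
      = \<bar>\<integral>\<omega>. W \<omega> * (g (osc n \<omega>) - q (osc n \<omega>)) \<partial>M\<bar>"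
      using int by (simp add: right_diff_distrib)
    also have "\<dots> \<le> (\<integral>\<omega>. \<bar>W \<omega> * (g (osc n \<omega>) - q (osc n \<omega>))\<bar> \<partial>M)" by (rule integral_abs_bound)
    also have "\<dots> \<le> (\<integral>\<omega>. \<bar>W \<omega>\<bar> * e' \<partial>M)"
      using iW int[of n] gq_osc
      by (intro integral_mono) (auto simp: abs_mult right_diff_distrib[symmetric] intro!: mult_left_mono integrable_abs,
        simp only: right_diff_distrib abs_mult[symmetric], auto)
    also have "\<dots> \<le> e" using e'(2) by (simp add: w_def)
    finally show ?thesis .
  qed
  moreover have "\<bar>(\<integral>\<omega>. W \<omega> \<partial>M) * (\<integral>\<omega>. q (V \<omega>) \<partial>M) - (\<integral>\<omega>. W \<omega> \<partial>M) * (\<integral>\<omega>. g (V \<omega>) \<partial>M)\<bar> \<le> e"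
  proof -
    have "\<bar>(\<integral>\<omega>. q (V \<omega>) \<partial>M) - (\<integral>\<omega>. g (V \<omega>) \<partial>M)\<bar> = \<bar>\<integral>\<omega>. q (V \<omega>) - g (V \<omega>) \<partial>M\<bar>"
      using intV by simp
    also have "\<dots> \<le> (\<integral>\<omega>. \<bar>q (V \<omega>) - g (V \<omega>)\<bar> \<partial>M)" by (rule integral_abs_bound)
    also have "\<dots> \<le> (\<integral>\<omega>. e' \<partial>M)"
      using intV gq_V by (intro integral_mono_AE) (auto simp: abs_minus_commute)
    finally have "\<bar>(\<integral>\<omega>. q (V \<omega>) \<partial>M) - (\<integral>\<omega>. g (V \<omega>) \<partial>M)\<bar> \<le> e'" by (simp add: prob_space)
    moreover have "\<bar>\<integral>\<omega>. W \<omega> \<partial>M\<bar> \<le> w" unfolding w_def by (rule integral_abs_bound)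
    ultimately have "\<bar>\<integral>\<omega>. W \<omega> \<partial>M\<bar> * \<bar>(\<integral>\<omega>. q (V \<omega>) \<partial>M) - (\<integral>\<omega>. g (V \<omega>) \<partial>M)\<bar> \<le> w * e'"
      using w by (intro mult_mono) auto
    then show ?thesis using e'(2) by (simp add: abs_mult[symmetric] right_diff_distrib)
  qed
  ultimately show "\<exists>b l'. b \<longlonglongrightarrow> l' \<and>
      (\<forall>\<^sub>F n in sequentially. \<bar>(\<integral>\<omega>. W \<omega> * (f (osc n \<omega>) * fade m (osc n \<omega>)) \<partial>M) - b n\<bar> \<le> e) \<and>
      \<bar>l' - (\<integral>\<omega>. W \<omega> \<partial>M) * (\<integral>\<omega>. f (V \<omega>) * fade m (V \<omega>) \<partial>M)\<bar> \<le> e"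
    using weak_trig_poly[OF q W W2] unfolding g_def[symmetric] by (auto intro!: exI)
qed

text \<open>Removing the cutoff costs the mass of \<open>1 - fade m\<close> near the faces, and
  nothing is known beforehand about how often \<open>osc\<close> comes close to them. The answer is
  supplied by \<open>weak_fade\<close> with the weight \<open>\<bar>W\<bar>\<close>: the lost mass
  converges to the one computed for \<open>V\<close>, which is small for large
  \<open>m\<close>.\<close>

lemma weak_continuous_L2:
  fixes f :: "real^'d \<Rightarrow> real" and W :: "'a \<Rightarrow> real"
  assumes f: "continuous_on UNIV f"
    and W[measurable]: "W \<in> borel_measurable M" and W2: "integrable M (\<lambda>x. (W x)\<^sup>2)"
  shows "(\<lambda>n. \<integral>\<omega>. W \<omega> * f (osc n \<omega>) \<partial>M) \<longlonglongrightarrow> (\<integral>\<omega>. W \<omega> \<partial>M) * (\<integral>\<omega>. f (V \<omega>) \<partial>M)"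
proof (rule tendsto_of_approximations)
  fix e :: real assume e: "e > 0"
  have iW: "integrable M W" using W2 by (rule square_integrable_imp_integrable[OF W])
  define w where "w = (\<integral>\<omega>. \<bar>W \<omega>\<bar> \<partial>M)"
  have w: "0 \<le> w" by (simp add: w_def)
  have [measurable]: "f \<in> borel_measurable borel" "fade m \<in> borel_measurable borel" for m
    using f continuous_on_fade by (auto intro: borel_measurable_continuous_onI)
  obtain C where C: "\<And>v. \<forall>i. \<bar>v $ i\<bar> \<le> 1/2 \<Longrightarrow> \<bar>f v\<bar> \<le> C"
    using continuous_bounded_on_cube[OF f] by blast
  have C0: "0 \<le> C" using C[of 0] by simp
  have "(\<lambda>m. \<integral>\<omega>. fade m (V \<omega>) \<partial>M) \<longlonglongrightarrow> (\<integral>\<omega>. 1 \<partial>M)"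
  proof (rule integral_dominated_convergence[where w="\<lambda>_. 1"])
    show "AE x in M. (\<lambda>m. fade m (V x)) \<longlonglongrightarrow> 1" using AE_V by eventually_elim (rule fade_tendsto_1)
  qed (auto simp: fade_bounds)
  then have "(\<lambda>m. C * w * (1 - (\<integral>\<omega>. fade m (V \<omega>) \<partial>M))) \<longlonglongrightarrow> C * w * (1 - 1)"
    by (intro tendsto_intros) (simp add: prob_space)
  then have "\<forall>\<^sub>F m in sequentially. C * w * (1 - (\<integral>\<omega>. fade m (V \<omega>) \<partial>M)) < e / 2"
    using e by (intro order_tendstoD) auto
  then have "\<forall>\<^sub>F m in sequentially. C * w * (1 - (\<integral>\<omega>. fade m (V \<omega>) \<partial>M)) < e / 2 \<and> m > 0"
    using eventually_gt_at_top[of 0] by eventually_elim simp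
  then obtain m where m: "C * w * (1 - (\<integral>\<omega>. fade m (V \<omega>) \<partial>M)) < e / 2" "m > 0"
    by (auto simp: eventually_sequentially)
  have fade_le: "\<bar>fade m v\<bar> \<le> 1" for v using fade_bounds[of m v] by simp
  have C2: "\<bar>f v * fade m v\<bar> \<le> C" if "\<forall>i. \<bar>v $ i\<bar> \<le> 1/2" for v
    using mult_mono[OF C[OF that] fade_le[of v] C0] by (simp add: abs_mult)
  have cube: "\<forall>i. \<bar>osc n \<omega> $ i\<bar> \<le> 1/2" for n \<omega> using abs_theta_nth_le by blast
  have int: "integrable M (\<lambda>\<omega>. W \<omega> * f (osc n \<omega>))"
    "integrable M (\<lambda>\<omega>. W \<omega> * (f (osc n \<omega>) * fade m (osc n \<omega>)))"
    "integrable M (\<lambda>\<omega>. \<bar>W \<omega>\<bar> * fade m (osc n \<omega>))" for n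
    by (rule integrable_mult_bounded[where C=C]; use iW C[OF cube] C2[OF cube] in auto)+
      (rule integrable_mult_bounded[where C=1]; use iW fade_le in auto)
  have intV: "integrable M (\<lambda>\<omega>. f (V \<omega>))" "integrable M (\<lambda>\<omega>. f (V \<omega>) * fade m (V \<omega>))"
     "integrable M (\<lambda>\<omega>. fade m (V \<omega>))"
    by (rule integrable_bounded_V[where f=f] integrable_bounded_V[where f="\<lambda>v. f v * fade m v"] integrable_bounded_V[where f="fade m"];
        use C C2 fade_le in auto)+
  have diff: "\<bar>(\<integral>\<omega>. W \<omega> * f (osc n \<omega>) \<partial>M) - (\<integral>\<omega>. W \<omega> * (f (osc n \<omega>) * fade m (osc n \<omega>)) \<partial>M)\<bar>
      \<le> C * (w - (\<integral>\<omega>. \<bar>W \<omega>\<bar> * (1 * fade m (osc n \<omega>)) \<partial>M))" for n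
  proof -
    have pt: "\<bar>W \<omega> * f (osc n \<omega>) - W \<omega> * (f (osc n \<omega>) * fade m (osc n \<omega>))\<bar>
      \<le> C * (\<bar>W \<omega>\<bar> - \<bar>W \<omega>\<bar> * fade m (osc n \<omega>))" for \<omega>
    proof -
      have "\<bar>W \<omega> * f (osc n \<omega>) - W \<omega> * (f (osc n \<omega>) * fade m (osc n \<omega>))\<bar>
        = \<bar>f (osc n \<omega>)\<bar> * (\<bar>W \<omega>\<bar> * \<bar>1 - fade m (osc n \<omega>)\<bar>)"
        by (simp add: abs_mult[symmetric] algebra_simps)
      also have "\<dots> \<le> C * (\<bar>W \<omega>\<bar> * \<bar>1 - fade m (osc n \<omega>)\<bar>)"
        using C abs_theta_nth_le by (intro mult_right_mono) auto
      also have "\<bar>1 - fade m (osc n \<omega>)\<bar> = 1 - fade m (osc n \<omega>)" using fade_bounds[of m "osc n \<omega>"] by simp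
      finally show ?thesis by (simp add: right_diff_distrib)
    qed
    have "\<bar>(\<integral>\<omega>. W \<omega> * f (osc n \<omega>) \<partial>M) - (\<integral>\<omega>. W \<omega> * (f (osc n \<omega>) * fade m (osc n \<omega>)) \<partial>M)\<bar>
      = \<bar>\<integral>\<omega>. W \<omega> * f (osc n \<omega>) - W \<omega> * (f (osc n \<omega>) * fade m (osc n \<omega>)) \<partial>M\<bar>"
      using int by simp
    also have "\<dots> \<le> (\<integral>\<omega>. \<bar>W \<omega> * f (osc n \<omega>) - W \<omega> * (f (osc n \<omega>) * fade m (osc n \<omega>))\<bar> \<partial>M)"
      by (rule integral_abs_bound)
    also have "\<dots> \<le> (\<integral>\<omega>. C * (\<bar>W \<omega>\<bar> - \<bar>W \<omega>\<bar> * fade m (osc n \<omega>)) \<partial>M)"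
      using int iW by (intro integral_mono pt integrable_abs Bochner_Integration.integrable_diff integrable_mult_right) auto
    also have "\<dots> = C * (w - (\<integral>\<omega>. \<bar>W \<omega>\<bar> * (1 * fade m (osc n \<omega>)) \<partial>M))"
      using int iW by (simp add: w_def integrable_abs)
    finally show ?thesis .
  qed
  \<comment> \<open>The factor \<open>1\<close> is written out so that the expression is an instance
    of \<open>weak_fade\<close> with the constant function 1.\<close>
  have "(\<lambda>n. \<integral>\<omega>. \<bar>W \<omega>\<bar> * (1 * fade m (osc n \<omega>)) \<partial>M) \<longlonglongrightarrow> w * (\<integral>\<omega>. 1 * fade m (V \<omega>) \<partial>M)"
    unfolding w_def by (rule weak_fade) (use m W2 in auto)
  then have "(\<lambda>n. C * (w - (\<integral>\<omega>. \<bar>W \<omega>\<bar> * (1 * fade m (osc n \<omega>)) \<partial>M))) \<longlonglongrightarrow> C * (w - w * (\<integral>\<omega>. 1 * fade m (V \<omega>) \<partial>M))"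
    by (intro tendsto_intros)
  moreover have "C * (w - w * (\<integral>\<omega>. 1 * fade m (V \<omega>) \<partial>M)) < e"
    using m(1) e by (simp add: algebra_simps)
  ultimately have "\<forall>\<^sub>F n in sequentially. C * (w - (\<integral>\<omega>. \<bar>W \<omega>\<bar> * (1 * fade m (osc n \<omega>)) \<partial>M)) < e"
    by (rule order_tendstoD)
  then have near: "\<forall>\<^sub>F n in sequentially. \<bar>(\<integral>\<omega>. W \<omega> * f (osc n \<omega>) \<partial>M) - (\<integral>\<omega>. W \<omega> * (f (osc n \<omega>) * fade m (osc n \<omega>)) \<partial>M)\<bar> \<le> e"
    by eventually_elim (use diff in \<open>auto intro: order_trans less_imp_le\<close>)
  have "\<bar>(\<integral>\<omega>. W \<omega> \<partial>M) * (\<integral>\<omega>. f (V \<omega>) * fade m (V \<omega>) \<partial>M) - (\<integral>\<omega>. W \<omega> \<partial>M) * (\<integral>\<omega>. f (V \<omega>) \<partial>M)\<bar> \<le> e"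
  proof -
    have "\<bar>(\<integral>\<omega>. f (V \<omega>) * fade m (V \<omega>) \<partial>M) - (\<integral>\<omega>. f (V \<omega>) \<partial>M)\<bar> = \<bar>\<integral>\<omega>. f (V \<omega>) * fade m (V \<omega>) - f (V \<omega>) \<partial>M\<bar>"
      using intV by simp
    also have "\<dots> \<le> (\<integral>\<omega>. \<bar>f (V \<omega>) * fade m (V \<omega>) - f (V \<omega>)\<bar> \<partial>M)" by (rule integral_abs_bound)
    also have "\<dots> \<le> (\<integral>\<omega>. C * (1 - fade m (V \<omega>)) \<partial>M)"
    proof (rule integral_mono_AE)
      show "AE \<omega> in M. \<bar>f (V \<omega>) * fade m (V \<omega>) - f (V \<omega>)\<bar> \<le> C * (1 - fade m (V \<omega>))"
        using AE_V
      proof eventually_elim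
        case (elim \<omega>)
        have "\<bar>f (V \<omega>) * fade m (V \<omega>) - f (V \<omega>)\<bar> = \<bar>f (V \<omega>)\<bar> * \<bar>1 - fade m (V \<omega>)\<bar>"
          by (subst abs_minus_commute) (simp add: abs_mult[symmetric] algebra_simps)
        moreover have "\<bar>f (V \<omega>)\<bar> \<le> C" using elim by (intro C) (auto intro: less_imp_le)
        ultimately show ?case using fade_bounds[of m "V \<omega>"] by (simp add: mult_right_mono)
      qed
    qed (use intV in auto)
    also have "\<dots> = C * (1 - (\<integral>\<omega>. fade m (V \<omega>) \<partial>M))" using intV by (simp add: prob_space)
    finally have 1: "\<bar>(\<integral>\<omega>. f (V \<omega>) * fade m (V \<omega>) \<partial>M) - (\<integral>\<omega>. f (V \<omega>) \<partial>M)\<bar> \<le> C * (1 - (\<integral>\<omega>. fade m (V \<omega>) \<partial>M))" .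
    have 2: "\<bar>\<integral>\<omega>. W \<omega> \<partial>M\<bar> \<le> w" unfolding w_def by (rule integral_abs_bound)
    have "\<bar>\<integral>\<omega>. W \<omega> \<partial>M\<bar> * \<bar>(\<integral>\<omega>. f (V \<omega>) * fade m (V \<omega>) \<partial>M) - (\<integral>\<omega>. f (V \<omega>) \<partial>M)\<bar> \<le> w * (C * (1 - (\<integral>\<omega>. fade m (V \<omega>) \<partial>M)))"
      by (intro mult_mono 1 2 w) auto
    then show ?thesis using m(1) e by (simp add: abs_mult[symmetric] algebra_simps)
  qed
  then show "\<exists>b l'. b \<longlonglongrightarrow> l' \<and> (\<forall>\<^sub>F n in sequentially. \<bar>(\<integral>\<omega>. W \<omega> * f (osc n \<omega>) \<partial>M) - b n\<bar> \<le> e) \<and>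
      \<bar>l' - (\<integral>\<omega>. W \<omega> \<partial>M) * (\<integral>\<omega>. f (V \<omega>) \<partial>M)\<bar> \<le> e"
    using weak_fade[OF f m(2) W W2] near by (auto intro!: exI)
qed

text \<open>Square-integrability enters only through Bessel's inequality. As \<open>f\<close> is
  bounded on the cube, truncating \<open>W\<close> changes both sides by at most a constant times an
  L1 error, uniformly in n.\<close>

lemma weak_continuous:
  fixes f :: "real^'d \<Rightarrow> real" and W :: "'a \<Rightarrow> real"
  assumes f: "continuous_on UNIV f" and W: "integrable M W"
  shows "(\<lambda>n. \<integral>\<omega>. W \<omega> * f (osc n \<omega>) \<partial>M) \<longlonglongrightarrow> (\<integral>\<omega>. W \<omega> \<partial>M) * (\<integral>\<omega>. f (V \<omega>) \<partial>M)"
proof (rule tendsto_of_approximations)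
  fix e :: real assume e: "e > 0"
  have [measurable]: "f \<in> borel_measurable borel" "W \<in> borel_measurable M"
    using f W by (auto intro: borel_measurable_continuous_onI)
  obtain C where C: "\<And>v. \<forall>i. \<bar>v $ i\<bar> \<le> 1/2 \<Longrightarrow> \<bar>f v\<bar> \<le> C"
    using continuous_bounded_on_cube[OF f] by blast
  have C0: "0 \<le> C" using C[of 0] by simp
  define U where "U N \<omega> = (if \<bar>W \<omega>\<bar> \<le> real N then W \<omega> else 0)" for N :: nat and \<omega>
  have [measurable]: "U N \<in> borel_measurable M" for N unfolding U_def by measurable
  have U_le: "\<bar>U N \<omega>\<bar> \<le> real N" for N \<omega> by (simp add: U_def)
  have U2: "integrable M (\<lambda>\<omega>. (U N \<omega>)\<^sup>2)" for N
    by (rule integrable_const_bound[where B="(real N)\<^sup>2"]) (use power_mono[OF U_le abs_ge_zero, of N _ 2] in auto)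
  have iU: "integrable M (U N)" for N
    by (rule integrable_const_bound[where B="real N"]) (use U_le in auto)
  have "(\<lambda>N. \<integral>\<omega>. \<bar>W \<omega> - U N \<omega>\<bar> \<partial>M) \<longlonglongrightarrow> (\<integral>\<omega>. 0 \<partial>M)"
  proof (rule integral_dominated_convergence[where w="\<lambda>\<omega>. \<bar>W \<omega>\<bar>"])
    show "AE \<omega> in M. (\<lambda>N. \<bar>W \<omega> - U N \<omega>\<bar>) \<longlonglongrightarrow> 0"
    proof (rule AE_I2, rule tendsto_eventually)
      fix \<omega>
      obtain N0 :: nat where "\<bar>W \<omega>\<bar> \<le> real N0" using real_arch_simple by blast
      then have "\<bar>W \<omega> - U N \<omega>\<bar> = 0" if "N \<ge> N0" for N using that by (auto simp: U_def)
      then show "\<forall>\<^sub>F N in sequentially. \<bar>W \<omega> - U N \<omega>\<bar> = 0"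
        by (auto simp: eventually_sequentially)
    qed
  qed (use W in \<open>auto simp: U_def\<close>)
  then have "(\<lambda>N. (C + 1) * (\<integral>\<omega>. \<bar>W \<omega> - U N \<omega>\<bar> \<partial>M)) \<longlonglongrightarrow> 0"
    by (intro tendsto_mult_right_zero) simp
  then have "\<forall>\<^sub>F N in sequentially. (C + 1) * (\<integral>\<omega>. \<bar>W \<omega> - U N \<omega>\<bar> \<partial>M) < e"
    using e by (rule order_tendstoD)
  then obtain N where "(C + 1) * (\<integral>\<omega>. \<bar>W \<omega> - U N \<omega>\<bar> \<partial>M) < e" by (auto simp: eventually_sequentially)
  then have N: "C * (\<integral>\<omega>. \<bar>W \<omega> - U N \<omega>\<bar> \<partial>M) \<le> e"
    by (rule order_trans[OF mult_right_mono less_imp_le, rotated 2]) auto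
  have "\<bar>(\<integral>\<omega>. W \<omega> * f (osc n \<omega>) \<partial>M) - (\<integral>\<omega>. U N \<omega> * f (osc n \<omega>) \<partial>M)\<bar> \<le> e" for n
  proof -
    have int: "integrable M (\<lambda>\<omega>. W \<omega> * f (osc n \<omega>))" "integrable M (\<lambda>\<omega>. U N \<omega> * f (osc n \<omega>))"
      using C abs_theta_nth_le by (auto intro!: integrable_mult_bounded W iU)
    have "\<bar>(\<integral>\<omega>. W \<omega> * f (osc n \<omega>) \<partial>M) - (\<integral>\<omega>. U N \<omega> * f (osc n \<omega>) \<partial>M)\<bar>
      = \<bar>\<integral>\<omega>. W \<omega> * f (osc n \<omega>) - U N \<omega> * f (osc n \<omega>) \<partial>M\<bar>" using int by simp
    also have "\<dots> \<le> (\<integral>\<omega>. \<bar>W \<omega> * f (osc n \<omega>) - U N \<omega> * f (osc n \<omega>)\<bar> \<partial>M)" by (rule integral_abs_bound)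
    also have "\<dots> \<le> (\<integral>\<omega>. C * \<bar>W \<omega> - U N \<omega>\<bar> \<partial>M)"
    proof (rule integral_mono)
      show "\<bar>W \<omega> * f (osc n \<omega>) - U N \<omega> * f (osc n \<omega>)\<bar> \<le> C * \<bar>W \<omega> - U N \<omega>\<bar>" for \<omega>
        using C[of "osc n \<omega>"] abs_theta_nth_le[of "real n *\<^sub>R Y \<omega>"]
        by (simp only: left_diff_distrib[symmetric] abs_mult mult.commute[of C] mult_left_mono abs_ge_zero) (simp add: left_diff_distrib[symmetric] abs_mult mult.commute[of C] mult_left_mono)
    qed (use int W iU in auto)
    finally show ?thesis using N by simp
  qed
  moreover have "\<bar>(\<integral>\<omega>. U N \<omega> \<partial>M) * (\<integral>\<omega>. f (V \<omega>) \<partial>M) - (\<integral>\<omega>. W \<omega> \<partial>M) * (\<integral>\<omega>. f (V \<omega>) \<partial>M)\<bar> \<le> e"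
  proof -
    have "\<bar>\<integral>\<omega>. f (V \<omega>) \<partial>M\<bar> \<le> (\<integral>\<omega>. \<bar>f (V \<omega>)\<bar> \<partial>M)" by (rule integral_abs_bound)
    also have "\<dots> \<le> (\<integral>\<omega>. C \<partial>M)"
    proof (rule integral_mono_AE)
      show "integrable M (\<lambda>\<omega>. \<bar>f (V \<omega>)\<bar>)"
        by (rule integrable_bounded_V[where f="\<lambda>v. \<bar>f v\<bar>"]) (use C in auto)
      show "AE \<omega> in M. \<bar>f (V \<omega>)\<bar> \<le> C" using AE_V
      proof eventually_elim
        case (elim \<omega>)
        then show ?case by (intro C) (auto intro: less_imp_le)
      qed
    qed simp
    finally have 1: "\<bar>\<integral>\<omega>. f (V \<omega>) \<partial>M\<bar> \<le> C" by (simp add: prob_space)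
    have "\<bar>(\<integral>\<omega>. W \<omega> \<partial>M) - (\<integral>\<omega>. U N \<omega> \<partial>M)\<bar> = \<bar>\<integral>\<omega>. W \<omega> - U N \<omega> \<partial>M\<bar>" using W iU by simp
    also have "\<dots> \<le> (\<integral>\<omega>. \<bar>W \<omega> - U N \<omega>\<bar> \<partial>M)" by (rule integral_abs_bound)
    finally have "\<bar>\<integral>\<omega>. f (V \<omega>) \<partial>M\<bar> * \<bar>(\<integral>\<omega>. W \<omega> \<partial>M) - (\<integral>\<omega>. U N \<omega> \<partial>M)\<bar> \<le> C * (\<integral>\<omega>. \<bar>W \<omega> - U N \<omega>\<bar> \<partial>M)"
      using 1 C0 by (intro mult_mono) auto
    moreover have "\<bar>(\<integral>\<omega>. U N \<omega> \<partial>M) * (\<integral>\<omega>. f (V \<omega>) \<partial>M) - (\<integral>\<omega>. W \<omega> \<partial>M) * (\<integral>\<omega>. f (V \<omega>) \<partial>M)\<bar>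
        = \<bar>\<integral>\<omega>. f (V \<omega>) \<partial>M\<bar> * \<bar>(\<integral>\<omega>. W \<omega> \<partial>M) - (\<integral>\<omega>. U N \<omega> \<partial>M)\<bar>"
      by (subst abs_minus_commute) (simp add: abs_mult[symmetric] algebra_simps)
    ultimately show ?thesis using N by linarith
  qed
  ultimately show "\<exists>b l'. b \<longlonglongrightarrow> l' \<and> (\<forall>\<^sub>F n in sequentially. \<bar>(\<integral>\<omega>. W \<omega> * f (osc n \<omega>) \<partial>M) - b n\<bar> \<le> e) \<and>
      \<bar>l' - (\<integral>\<omega>. W \<omega> \<partial>M) * (\<integral>\<omega>. f (V \<omega>) \<partial>M)\<bar> \<le> e"
    using weak_continuous_L2[OF f _ U2, of N] by (auto intro!: exI)
qed

end

section \<open>Joint convergence in law\<close>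

definition cutoff :: "real \<Rightarrow> 'b::real_normed_vector \<Rightarrow> real" where
  "cutoff R x = max 0 (min 1 (R + 1 - norm x))"

lemma cutoff_bounds: "0 \<le> cutoff R x" "cutoff R x \<le> 1" "\<bar>cutoff R x\<bar> \<le> 1"
  by (auto simp: cutoff_def)

lemma cutoff_eq_1: "norm x \<le> R \<Longrightarrow> cutoff R x = 1"
  by (auto simp: cutoff_def)

lemma cutoff_eq_0: "R + 1 \<le> norm x \<Longrightarrow> cutoff R x = 0"
  by (auto simp: cutoff_def)

lemma continuous_on_cutoff [continuous_intros]: "continuous_on S (cutoff R)"
  unfolding cutoff_def by (intro continuous_intros)

lemma cutoff_tendsto_1: "(\<lambda>N. cutoff (real N) x) \<longlonglongrightarrow> 1"
proof (rule tendsto_eventually)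
  obtain N0 :: nat where "norm x \<le> real N0" using real_arch_simple by blast
  then have "cutoff (real N) x = 1" if "N \<ge> N0" for N using that by (intro cutoff_eq_1) auto
  then show "\<forall>\<^sub>F N in sequentially. cutoff (real N) x = 1" by (auto simp: eventually_sequentially)
qed

lemma bounded_cutoff_mult:
  fixes g :: "'b::euclidean_space \<Rightarrow> real"
  assumes "continuous_on UNIV g"
  obtains C where "\<And>x. \<bar>cutoff R x * g x\<bar> \<le> C"
proof -
  have "compact (g ` cball 0 (R + 1))"
    by (intro compact_continuous_image continuous_on_subset[OF assms]) auto
  then obtain C where C: "\<And>x. x \<in> cball 0 (R + 1) \<Longrightarrow> \<bar>g x\<bar> \<le> C"
    by (meson bounded_real compact_imp_bounded imageI)
  have "\<bar>cutoff R x * g x\<bar> \<le> \<bar>C\<bar>" for x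
  proof (cases "norm x \<le> R + 1")
    case True
    then have "\<bar>g x\<bar> \<le> \<bar>C\<bar>" using C[of x] by simp
    then have "\<bar>cutoff R x\<bar> * \<bar>g x\<bar> \<le> 1 * \<bar>C\<bar>" by (intro mult_mono cutoff_bounds) auto
    then show ?thesis by (simp add: abs_mult)
  qed (simp add: cutoff_eq_0)
  then show thesis by (rule that)
qed

text \<open>Finite sums of products of a function of the first and a function of the second
  variable. The factors may be unbounded, so that the coordinates belong to the class and separate
  points.\<close>

inductive tensor_sum :: "('b::topological_space \<times> 'c::topological_space \<Rightarrow> real) \<Rightarrow> bool" where
  prod: "continuous_on UNIV g \<Longrightarrow> continuous_on UNIV f \<Longrightarrow> tensor_sum (\<lambda>z. g (fst z) * f (snd z))"
| add: "tensor_sum p \<Longrightarrow> tensor_sum q \<Longrightarrow> tensor_sum (\<lambda>z. p z + q z)"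

lemma tensor_sum_continuous: "tensor_sum p \<Longrightarrow> continuous_on S p"
proof (induction rule: tensor_sum.induct)
  case (prod g f)
  then have "continuous_on S (\<lambda>z. g (fst z))" "continuous_on S (\<lambda>z. f (snd z))"
    by (auto intro!: continuous_on_compose2[OF _ continuous_on_fst] continuous_on_compose2[OF _ continuous_on_snd])
  then show ?case by (intro continuous_intros)
qed (intro continuous_intros)

lemma tensor_sum_mult:
  assumes "tensor_sum p" "tensor_sum q"
  shows "tensor_sum (\<lambda>z. p z * q z)"
  using assms(1)
proof induction
  case (prod g f)
  note gf = this
  from assms(2) show ?case
  proof induction
    case (prod g' f')
    have "(\<lambda>z. g (fst z) * f (snd z) * (g' (fst z) * f' (snd z)))
      = (\<lambda>z. (g (fst z) * g' (fst z)) * (f (snd z) * f' (snd z)))" by (auto simp: mult_ac)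
    then show ?case using gf prod by (simp only:) (intro tensor_sum.prod[where g="\<lambda>x. g x * g' x" and f="\<lambda>x. f x * f' x"] continuous_intros)
  next
    case (add p q)
    then show ?case by (simp only: distrib_left) (rule tensor_sum.add)
  qed
next
  case (add p q)
  then show ?case by (simp only: distrib_right) (rule tensor_sum.add)
qed

text \<open>On a compact set Stone-Weierstrass reduces a test function to products. Tightness is
  obtained from \<open>lim\<close> itself: the cutoff \<open>k R\<close> is a product of two bounded
  continuous functions, so its expectation converges, and a radius chosen for the limit
  \<open>T\<close> also serves for \<open>S n\<close> when n is large.\<close>

lemma converges_jointly:
  fixes X :: "'a \<Rightarrow> 'b::euclidean_space" and S :: "nat \<Rightarrow> 'a \<Rightarrow> 'c::euclidean_space"
  assumes "prob_space M" and [measurable]: "X \<in> borel_measurable M" "\<And>n. S n \<in> borel_measurable M" "T \<in> borel_measurable M"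
    and lim: "\<And>g f. continuous_on UNIV g \<Longrightarrow> bounded (range g) \<Longrightarrow> continuous_on UNIV f \<Longrightarrow> bounded (range f)
      \<Longrightarrow> (\<lambda>n. \<integral>\<omega>. g (X \<omega>) * f (S n \<omega>) \<partial>M) \<longlonglongrightarrow> (\<integral>\<omega>. g (X \<omega>) * f (T \<omega>) \<partial>M :: real)"
    and F: "continuous_on UNIV F" "bounded (range F)"
  shows "(\<lambda>n. \<integral>\<omega>. F (X \<omega>, S n \<omega>) \<partial>M) \<longlonglongrightarrow> (\<integral>\<omega>. F (X \<omega>, T \<omega>) \<partial>M :: real)"
proof (rule tendsto_of_approximations)
  interpret prob_space M by fact
  fix e :: real assume e: "e > 0"
  obtain C where C: "\<And>z. \<bar>F z\<bar> \<le> C" using F(2) by (auto simp: bounded_iff)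
  have C0: "0 \<le> C" using C[of undefined] by linarith
  define k where "k R z = cutoff R (fst z) * cutoff R (snd z)" for R and z :: "'b \<times> 'c"
  have k: "0 \<le> k R z" "k R z \<le> 1" "\<bar>k R z\<bar> \<le> 1" for R z
    unfolding k_def using cutoff_bounds[of R "fst z"] cutoff_bounds[of R "snd z"] by (auto simp: mult_le_one)
  have kc: "continuous_on UNIV (k R)" for R
    unfolding k_def by (intro continuous_intros continuous_on_compose2[OF continuous_on_cutoff[of UNIV]]) auto
  have [measurable]: "k R \<in> borel_measurable borel" "F \<in> borel_measurable borel" for R
    using kc F by (auto intro: borel_measurable_continuous_onI)
  have ik: "integrable M (\<lambda>\<omega>. k R (X \<omega>, Z \<omega>))" if [measurable]: "Z \<in> borel_measurable M" for R Z
    by (rule integrable_const_bound[where B=1]) (use k in auto)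
  have iF: "integrable M (\<lambda>\<omega>. F (X \<omega>, Z \<omega>))" if [measurable]: "Z \<in> borel_measurable M" for Z
    by (rule integrable_const_bound[where B=C]) (use C in auto)
  have "(\<lambda>N. \<integral>\<omega>. k (real N) (X \<omega>, T \<omega>) \<partial>M) \<longlonglongrightarrow> (\<integral>\<omega>. 1 \<partial>M)"
  proof (rule integral_dominated_convergence[where w="\<lambda>_. 1"])
    show "AE x in M. (\<lambda>N. k (real N) (X x, T x)) \<longlonglongrightarrow> 1"
      unfolding k_def by (intro AE_I2) (use tendsto_mult[OF cutoff_tendsto_1 cutoff_tendsto_1] in simp)
  qed (use k in auto)
  then have "(\<lambda>N. C * (1 - (\<integral>\<omega>. k (real N) (X \<omega>, T \<omega>) \<partial>M))) \<longlonglongrightarrow> C * (1 - 1)"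
    by (intro tendsto_intros) (simp add: prob_space)
  then have "\<forall>\<^sub>F N in sequentially. C * (1 - (\<integral>\<omega>. k (real N) (X \<omega>, T \<omega>) \<partial>M)) < e / 2"
    using e by (intro order_tendstoD) auto
  then obtain N where "C * (1 - (\<integral>\<omega>. k (real N) (X \<omega>, T \<omega>) \<partial>M)) < e / 2"
    by (auto simp: eventually_sequentially)
  then obtain R where R: "C * (1 - (\<integral>\<omega>. k R (X \<omega>, T \<omega>) \<partial>M)) < e / 2" by blast
  define K :: "('b \<times> 'c) set" where "K = cball 0 (R + 1) \<times> cball 0 (R + 1)"
  have "compact K" unfolding K_def by (intro compact_Times) auto
  have k0: "k R z = 0" if "z \<notin> K" for z
    using that by (auto simp: K_def k_def mem_Times_iff cutoff_eq_0)
  have "\<exists>p. tensor_sum p \<and> (\<forall>x\<in>K. \<bar>F x - p x\<bar> < e / 2)"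
  proof (rule Stone_Weierstrass_HOL[OF \<open>compact K\<close>])
    show "tensor_sum (\<lambda>x. c)" for c :: real
      using tensor_sum.prod[of "\<lambda>_. c" "\<lambda>_. 1"] by simp
    fix x y :: "'b \<times> 'c" assume xy: "x \<in> K \<and> y \<in> K \<and> x \<noteq> y"
    consider b where "fst x \<bullet> b \<noteq> fst y \<bullet> b" | b where "snd x \<bullet> b \<noteq> snd y \<bullet> b"
      using xy by (metis euclidean_eqI prod_eq_iff)
    then show "\<exists>f. tensor_sum f \<and> f x \<noteq> f y"
    proof cases
      case 1
      then show ?thesis using tensor_sum.prod[of "\<lambda>u::'b. u \<bullet> b" "\<lambda>_::'c. 1", OF continuous_on_inner[OF continuous_on_id continuous_on_const] continuous_on_const]
        by (intro exI[of _ "\<lambda>z. fst z \<bullet> b"]) (auto intro!: continuous_intros)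
    next
      case 2
      then show ?thesis using tensor_sum.prod[of "\<lambda>_::'b. 1" "\<lambda>u::'c. u \<bullet> b", OF continuous_on_const continuous_on_inner[OF continuous_on_id continuous_on_const]]
        by (intro exI[of _ "\<lambda>z. snd z \<bullet> b"]) (auto intro!: continuous_intros)
    qed
  qed (use F e in \<open>auto intro: tensor_sum_continuous tensor_sum.add tensor_sum_mult continuous_on_subset\<close>)
  then obtain p where p: "tensor_sum p" "\<And>x. x \<in> K \<Longrightarrow> \<bar>F x - p x\<bar> < e / 2" by blast
  \<comment> \<open>The tensor factors are unbounded, so \<open>lim\<close> does not apply to them
    directly; \<open>k R\<close> splits into one cutoff for each variable, and each cutoff makes its
    factor bounded.\<close>
  have tensor: "(\<forall>Z\<in>borel_measurable M. integrable M (\<lambda>\<omega>. k R (X \<omega>, Z \<omega>) * p (X \<omega>, Z \<omega>)))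
    \<and> (\<lambda>n. \<integral>\<omega>. k R (X \<omega>, S n \<omega>) * p (X \<omega>, S n \<omega>) \<partial>M) \<longlonglongrightarrow> (\<integral>\<omega>. k R (X \<omega>, T \<omega>) * p (X \<omega>, T \<omega>) \<partial>M)"
    using p(1)
  proof induction
    case (prod g f)
    obtain A where A: "\<And>x. \<bar>cutoff R x * g x\<bar> \<le> A" using bounded_cutoff_mult[OF prod(1)] by blast
    obtain B where B: "\<And>x. \<bar>cutoff R x * f x\<bar> \<le> B" using bounded_cutoff_mult[OF prod(2)] by blast
    have c: "continuous_on UNIV (\<lambda>x. cutoff R x * g x)" "continuous_on UNIV (\<lambda>x. cutoff R x * f x)"
      using prod by (auto intro!: continuous_intros)
    have [measurable]: "(\<lambda>x. cutoff R x * g x) \<in> borel_measurable borel" "(\<lambda>x. cutoff R x * f x) \<in> borel_measurable borel"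
      using c by (auto intro: borel_measurable_continuous_onI)
    have eq: "k R (X \<omega>, z) * (g (fst (X \<omega>, z)) * f (snd (X \<omega>, z))) = (cutoff R (X \<omega>) * g (X \<omega>)) * (cutoff R z * f z)" for \<omega> z
      by (simp add: k_def mult_ac)
    have int: "integrable M (\<lambda>\<omega>. (cutoff R (X \<omega>) * g (X \<omega>)) * (cutoff R (Z \<omega>) * f (Z \<omega>)))"
      if [measurable]: "Z \<in> borel_measurable M" for Z
    proof (rule integrable_const_bound[where B="A * B"])
      have "0 \<le> A" using A[of 0] by linarith
      then show "AE x in M. norm ((cutoff R (X x) * g (X x)) * (cutoff R (Z x) * f (Z x))) \<le> A * B"
        unfolding real_norm_def abs_mult[of "cutoff R _ * g _"] by (intro AE_I2 mult_mono A B) auto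
    qed measurable
    have "(\<lambda>n. \<integral>\<omega>. (cutoff R (X \<omega>) * g (X \<omega>)) * (cutoff R (S n \<omega>) * f (S n \<omega>)) \<partial>M)
      \<longlonglongrightarrow> (\<integral>\<omega>. (cutoff R (X \<omega>) * g (X \<omega>)) * (cutoff R (T \<omega>) * f (T \<omega>)) \<partial>M)"
      by (rule lim[OF c(1) _ c(2)]) (use A B in \<open>auto simp: bounded_iff\<close>)
    with int show ?case unfolding eq by blast
  next
    case (add p q)
    then show ?case by (auto simp: distrib_left intro: tendsto_add)
  qed
  have kp: "\<bar>F z - k R z * p z\<bar> \<le> C * (1 - k R z) + e / 2" for z
  proof (cases "z \<in> K")
    case True
    have "F z - k R z * p z = F z * (1 - k R z) + k R z * (F z - p z)" by (simp add: algebra_simps)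
    moreover have "\<bar>F z * (1 - k R z)\<bar> \<le> C * (1 - k R z)"
      using C[of z] k[of R z] by (simp add: abs_mult mult_right_mono)
    moreover have "\<bar>k R z * (F z - p z)\<bar> \<le> 1 * (e / 2)"
      unfolding abs_mult using p(2)[OF True] k[of R z] by (intro mult_mono) auto
    ultimately show ?thesis by linarith
  next
    case False
    then show ?thesis using C[of z] e by (simp add: k0)
  qed
  have diff: "\<bar>(\<integral>\<omega>. F (X \<omega>, Z \<omega>) \<partial>M) - (\<integral>\<omega>. k R (X \<omega>, Z \<omega>) * p (X \<omega>, Z \<omega>) \<partial>M)\<bar>
      \<le> C * (1 - (\<integral>\<omega>. k R (X \<omega>, Z \<omega>) \<partial>M)) + e / 2" if [measurable]: "Z \<in> borel_measurable M" for Z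
  proof -
    have int: "integrable M (\<lambda>\<omega>. k R (X \<omega>, Z \<omega>) * p (X \<omega>, Z \<omega>))" using tensor that by blast
    have "\<bar>(\<integral>\<omega>. F (X \<omega>, Z \<omega>) \<partial>M) - (\<integral>\<omega>. k R (X \<omega>, Z \<omega>) * p (X \<omega>, Z \<omega>) \<partial>M)\<bar>
      = \<bar>\<integral>\<omega>. F (X \<omega>, Z \<omega>) - k R (X \<omega>, Z \<omega>) * p (X \<omega>, Z \<omega>) \<partial>M\<bar>"
      using int iF[OF that] by simp
    also have "\<dots> \<le> (\<integral>\<omega>. \<bar>F (X \<omega>, Z \<omega>) - k R (X \<omega>, Z \<omega>) * p (X \<omega>, Z \<omega>)\<bar> \<partial>M)" by (rule integral_abs_bound)
    also have "\<dots> \<le> (\<integral>\<omega>. C * (1 - k R (X \<omega>, Z \<omega>)) + e / 2 \<partial>M)"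
      using int iF[OF that] ik[OF that] by (intro integral_mono kp) auto
    also have "\<dots> = C * (1 - (\<integral>\<omega>. k R (X \<omega>, Z \<omega>) \<partial>M)) + e / 2"
      using ik[OF that] by (simp add: prob_space)
    finally show ?thesis .
  qed
  have "(\<lambda>n. \<integral>\<omega>. k R (X \<omega>, S n \<omega>) \<partial>M) \<longlonglongrightarrow> (\<integral>\<omega>. k R (X \<omega>, T \<omega>) \<partial>M)"
    unfolding k_def fst_conv snd_conv
    by (rule lim) (auto intro!: continuous_intros simp: bounded_iff intro: exI[of _ 1] cutoff_bounds)
  then have "(\<lambda>n. C * (1 - (\<integral>\<omega>. k R (X \<omega>, S n \<omega>) \<partial>M))) \<longlonglongrightarrow> C * (1 - (\<integral>\<omega>. k R (X \<omega>, T \<omega>) \<partial>M))"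
    by (intro tendsto_intros)
  then have "\<forall>\<^sub>F n in sequentially. C * (1 - (\<integral>\<omega>. k R (X \<omega>, S n \<omega>) \<partial>M)) < e / 2"
    using R by (rule order_tendstoD)
  then have near: "\<forall>\<^sub>F n in sequentially. \<bar>(\<integral>\<omega>. F (X \<omega>, S n \<omega>) \<partial>M) - (\<integral>\<omega>. k R (X \<omega>, S n \<omega>) * p (X \<omega>, S n \<omega>) \<partial>M)\<bar> \<le> e"
  proof eventually_elim
    case (elim n)
    then show ?case using diff[of "S n"] by simp
  qed
  moreover have "\<bar>(\<integral>\<omega>. k R (X \<omega>, T \<omega>) * p (X \<omega>, T \<omega>) \<partial>M) - (\<integral>\<omega>. F (X \<omega>, T \<omega>) \<partial>M)\<bar> \<le> e"
    using diff[of T] R by simp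
  ultimately show "\<exists>b l'. b \<longlonglongrightarrow> l' \<and> (\<forall>\<^sub>F n in sequentially. \<bar>(\<integral>\<omega>. F (X \<omega>, S n \<omega>) \<partial>M) - b n\<bar> \<le> e) \<and>
      \<bar>l' - (\<integral>\<omega>. F (X \<omega>, T \<omega>) \<partial>M)\<bar> \<le> e"
    using tensor by blast
qed

section \<open>First order increments\<close>

text \<open>As \<open>partial_deriv\<close> is built on \<open>deriv\<close>, it has a value for
  every function. Under differentiability that value is the total derivative applied to a basis
  vector, and linearity recovers the whole derivative.\<close>

lemma has_derivative_partial_deriv:
  fixes f :: "real^'d \<Rightarrow> real"
  assumes "f differentiable (at x)"
  shows "(f has_derivative (\<lambda>h. \<Sum>i\<in>UNIV. h $ i * partial_deriv i f x)) (at x)"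
proof -
  obtain D where D: "(f has_derivative D) (at x)" using assms by (auto simp: differentiable_def)
  then interpret D: bounded_linear D by (rule has_derivative_bounded_linear)
  have partial: "partial_deriv i f x = D (axis i 1)" for i
  proof -
    have "((\<lambda>t. x + t *\<^sub>R axis i 1) has_derivative (\<lambda>t. t *\<^sub>R axis i 1)) (at (0::real))"
      by (auto intro!: derivative_eq_intros)
    then have "((\<lambda>t. f (x + t *\<^sub>R axis i 1)) has_derivative (\<lambda>t. D (t *\<^sub>R axis i 1))) (at 0)"
      by (rule has_derivative_compose[where g=f]) (use D in simp)
    then have "((\<lambda>t. f (x + t *\<^sub>R axis i 1)) has_real_derivative D (axis i 1)) (at 0)"
      by (simp add: has_field_derivative_def D.scaleR mult.commute[of _ "D _"])
    then show ?thesis unfolding partial_deriv_def by (rule DERIV_imp_deriv)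
  qed
  have "D h = (\<Sum>i\<in>UNIV. h $ i * partial_deriv i f x)" for h
  proof -
    have "h = (\<Sum>i\<in>UNIV. (h $ i) *\<^sub>R axis i 1)"
      using basis_expansion[of h] by (simp add: scalar_mult_eq_scaleR)
    then have "D h = D (\<Sum>i\<in>UNIV. (h $ i) *\<^sub>R axis i 1)" by simp
    then show ?thesis by (simp add: D.sum D.scaleR partial)
  qed
  then have "D = (\<lambda>h. \<Sum>i\<in>UNIV. h $ i * partial_deriv i f x)" by blast
  with D show ?thesis by simp
qed

lemma partial_deriv_eqI:
  fixes f :: "real^'d \<Rightarrow> real"
  assumes "((\<lambda>t. f (x + t *\<^sub>R axis i 1)) has_real_derivative d) (at 0)"
  shows "partial_deriv i f x = d"
  unfolding partial_deriv_def using assms by (rule DERIV_imp_deriv)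

lemma DERIV_along_line:
  fixes f :: "real^'d \<Rightarrow> real"
  assumes "\<And>x. f differentiable (at x)"
  shows "((\<lambda>t. f (x + t *\<^sub>R v)) has_real_derivative (\<Sum>i\<in>UNIV. v $ i * partial_deriv i f (x + t *\<^sub>R v))) (at t)"
proof -
  have "((\<lambda>t. x + t *\<^sub>R v) has_derivative (\<lambda>t. t *\<^sub>R v)) (at t)"
    by (auto intro!: derivative_eq_intros)
  then have "((\<lambda>t. f (x + t *\<^sub>R v)) has_derivative (\<lambda>s. \<Sum>i\<in>UNIV. (s *\<^sub>R v) $ i * partial_deriv i f (x + t *\<^sub>R v))) (at t)"
    by (rule has_derivative_compose[where g=f]) (rule has_derivative_partial_deriv[OF assms])
  then show ?thesis
    by (simp add: has_field_derivative_def sum_distrib_left[symmetric] mult.assoc mult.commute[of _ "sum _ _"])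
qed

lemma DERIV_partial_deriv:
  fixes f :: "real^'d \<Rightarrow> real"
  assumes "\<And>x. f differentiable (at x)"
  shows "((\<lambda>t. f (x + t *\<^sub>R axis i 1)) has_real_derivative partial_deriv i f (x + t *\<^sub>R axis i 1)) (at t)"
proof -
  have "axis i 1 $ j * r = (if j = i then r else 0)" for j and r :: real by (simp add: axis_def)
  then have "(\<Sum>j\<in>UNIV. axis i 1 $ j * partial_deriv j f (x + t *\<^sub>R axis i 1)) = partial_deriv i f (x + t *\<^sub>R axis i 1)"
    by simp
  then show ?thesis using DERIV_along_line[OF assms, of x "axis i 1" t] by simp
qed

lemma of_class_C_continuous:
  assumes "of_class_C k f" shows "continuous_on S f"
proof (cases k)
  case (Suc n)
  then have "isCont f x" for x using assms by (auto intro: differentiable_imp_continuous_within)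
  then show ?thesis by (simp add: continuous_at_imp_continuous_on)
qed (use assms in \<open>auto intro: continuous_on_subset\<close>)

lemma of_class_C_SucD: "of_class_C (Suc k) f \<Longrightarrow> of_class_C k f"
proof (induction k arbitrary: f)
  case 0 then show ?case using of_class_C_continuous[of 1 f] by simp
next
  case (Suc k)
  then show ?case by (metis of_class_C.simps(2))
qed

lemma of_class_C_1: "of_class_C 1 f \<longleftrightarrow> (\<forall>x. f differentiable (at x)) \<and> (\<forall>i. continuous_on UNIV (partial_deriv i f))"
  by simp

lemma of_class_C_2:
  "of_class_C 2 f \<longleftrightarrow> (\<forall>x. f differentiable (at x)) \<and> (\<forall>i. of_class_C 1 (partial_deriv i f))"
  by (simp add: numeral_2_eq_2)

lemma mean_value_partial_deriv:
  fixes f :: "real^'d \<Rightarrow> real"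
  assumes "\<And>x. f differentiable (at x)"
  obtains s where "0 < s" "s < 1" "f (x + v) - f x = (\<Sum>i\<in>UNIV. v $ i * partial_deriv i f (x + s *\<^sub>R v))"
proof -
  have "\<exists>s. 0 < s \<and> s < 1 \<and> f (x + 1 *\<^sub>R v) - f (x + 0 *\<^sub>R v)
      = (1 - 0) * (\<Sum>i\<in>UNIV. v $ i * partial_deriv i f (x + s *\<^sub>R v))"
    by (rule MVT2) (use DERIV_along_line[OF assms] in auto)
  then show thesis using that by auto
qed

lemma borel_measurable_graduated [measurable]: "graduated n \<in> borel_measurable borel"
  unfolding graduated_def by measurable

lemma norm_theta_le: "norm (theta (y :: real^'d)) \<le> real CARD('d)"
proof -
  have "norm (theta y) \<le> (\<Sum>i\<in>UNIV. \<bar>theta y $ i\<bar>)" by (rule norm_le_l1_cart)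
  also have "\<dots> \<le> (\<Sum>i\<in>(UNIV::'d set). 1)"
    by (rule sum_mono) (rule order_trans[OF abs_theta_nth_le], simp)
  finally show ?thesis by simp
qed

lemma graduated_tendsto_step:
  fixes y :: "real^'d"
  assumes "\<And>n. 0 < s n" "\<And>n. s n < 1"
  shows "(\<lambda>n. y + s n *\<^sub>R ((1 / real n) *\<^sub>R theta (real n *\<^sub>R y))) \<longlonglongrightarrow> y"
proof -
  have "(\<lambda>n. s n *\<^sub>R ((1 / real n) *\<^sub>R theta (real n *\<^sub>R y))) \<longlonglongrightarrow> 0"
  proof (rule Lim_null_comparison)
    show "(\<lambda>n. 1 / real n * real CARD('d)) \<longlonglongrightarrow> 0" by (intro tendsto_mult_left_zero lim_1_over_n)
    have "norm (s n *\<^sub>R ((1 / real n) *\<^sub>R theta (real n *\<^sub>R y))) \<le> 1 / real n * real CARD('d)" for n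
    proof -
      have "\<bar>s n\<bar> * (1 / real n * norm (theta (real n *\<^sub>R y))) \<le> 1 * (1 / real n * real CARD('d))"
        using assms[of n] by (intro mult_mono norm_theta_le) auto
      then show ?thesis by simp
    qed
    then show "\<forall>\<^sub>F n in sequentially. norm (s n *\<^sub>R ((1 / real n) *\<^sub>R theta (real n *\<^sub>R y))) \<le> 1 / real n * real CARD('d)"
      by simp
  qed
  from tendsto_add[OF tendsto_const this] show ?thesis by simp
qed

text \<open>The mean value theorem evaluates the gradient at a point of the segment from y to
  \<open>graduated n y\<close>, and this point tends to y. Since \<open>theta\<close> is bounded but
  has no limit, the statement compares two oscillating sequences instead of asserting that either of
  them converges.\<close>

lemma first_order_expansion:
  fixes \<phi> :: "real^'d \<Rightarrow> real"
  assumes \<phi>: "of_class_C 1 \<phi>"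
  shows "(\<lambda>n. real n * (\<phi> (graduated n y) - \<phi> y)
     - (\<Sum>i\<in>UNIV. theta (real n *\<^sub>R y) $ i * partial_deriv i \<phi> y)) \<longlonglongrightarrow> 0"
proof -
  have d: "\<And>x. \<phi> differentiable (at x)" and c: "\<And>i. continuous_on UNIV (partial_deriv i \<phi>)"
    using \<phi> by (auto simp: of_class_C_1)
  define v where "v n = (1 / real n) *\<^sub>R theta (real n *\<^sub>R y)" for n
  have "\<exists>s. 0 < s \<and> s < 1 \<and> \<phi> (y + v n) - \<phi> y = (\<Sum>i\<in>UNIV. v n $ i * partial_deriv i \<phi> (y + s *\<^sub>R v n))" for n
    using mean_value_partial_deriv[OF d, of y "v n"] by metis
  then obtain s where s: "\<And>n. 0 < s n" "\<And>n. s n < 1"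
    and eq: "\<And>n. \<phi> (y + v n) - \<phi> y = (\<Sum>i\<in>UNIV. v n $ i * partial_deriv i \<phi> (y + s n *\<^sub>R v n))" by metis
  have "(\<lambda>n. y + s n *\<^sub>R v n) \<longlonglongrightarrow> y" unfolding v_def by (rule graduated_tendsto_step[OF s])
  then have "(\<lambda>n. partial_deriv i \<phi> (y + s n *\<^sub>R v n)) \<longlonglongrightarrow> partial_deriv i \<phi> y" for i
    by (rule continuous_on_tendsto_compose[OF c]) auto
  then have "(\<lambda>n. partial_deriv i \<phi> (y + s n *\<^sub>R v n) - partial_deriv i \<phi> y) \<longlonglongrightarrow> 0" for i
    by (simp add: LIM_zero)
  then have lim: "(\<lambda>n. theta (real n *\<^sub>R y) $ i * (partial_deriv i \<phi> (y + s n *\<^sub>R v n) - partial_deriv i \<phi> y)) \<longlonglongrightarrow> 0" for i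
  proof (rule Lim_null_comparison[rotated, OF tendsto_rabs_zero])
    show "\<forall>\<^sub>F n in sequentially. norm (theta (real n *\<^sub>R y) $ i * (partial_deriv i \<phi> (y + s n *\<^sub>R v n) - partial_deriv i \<phi> y))
      \<le> \<bar>partial_deriv i \<phi> (y + s n *\<^sub>R v n) - partial_deriv i \<phi> y\<bar>"
    proof (rule always_eventually, rule allI)
      fix n
      have "\<bar>theta (real n *\<^sub>R y) $ i\<bar> \<le> 1" by (rule order_trans[OF abs_theta_nth_le]) simp
      then show "norm (theta (real n *\<^sub>R y) $ i * (partial_deriv i \<phi> (y + s n *\<^sub>R v n) - partial_deriv i \<phi> y))
        \<le> \<bar>partial_deriv i \<phi> (y + s n *\<^sub>R v n) - partial_deriv i \<phi> y\<bar>"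
        by (simp add: abs_mult mult_left_le_one_le)
    qed
  qed
  have "(\<lambda>n. \<Sum>i\<in>UNIV. theta (real n *\<^sub>R y) $ i * (partial_deriv i \<phi> (y + s n *\<^sub>R v n) - partial_deriv i \<phi> y)) \<longlonglongrightarrow> 0"
    by (rule tendsto_null_sum) (rule lim)
  \<comment> \<open>The identity starts at n = 1: for n = 0 the increment term vanishes whereas the
    linear sum need not.\<close>
  moreover have "\<forall>\<^sub>F n in sequentially. (\<Sum>i\<in>UNIV. theta (real n *\<^sub>R y) $ i * (partial_deriv i \<phi> (y + s n *\<^sub>R v n) - partial_deriv i \<phi> y))
     = real n * (\<phi> (graduated n y) - \<phi> y) - (\<Sum>i\<in>UNIV. theta (real n *\<^sub>R y) $ i * partial_deriv i \<phi> y)"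
    using eventually_gt_at_top[of 0]
  proof eventually_elim
    case (elim n)
    have "real n * (\<phi> (graduated n y) - \<phi> y) = (\<Sum>i\<in>UNIV. real n * (v n $ i * partial_deriv i \<phi> (y + s n *\<^sub>R v n)))"
      using eq[of n] by (simp add: graduated_def v_def sum_distrib_left)
    also have "\<dots> = (\<Sum>i\<in>UNIV. theta (real n *\<^sub>R y) $ i * partial_deriv i \<phi> (y + s n *\<^sub>R v n))"
      using elim by (simp add: v_def)
    finally show ?case by (simp add: sum_subtractf right_diff_distrib)
  qed
  ultimately show ?thesis by (rule Lim_transform_eventually)
qed

lemma lipschitz_scaled_increment:
  fixes \<phi> :: "real^'d \<Rightarrow> real"
  assumes "L-lipschitz_on UNIV \<phi>"
  shows "\<bar>real n * (\<phi> (graduated n y) - \<phi> y)\<bar> \<le> L * real CARD('d)"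
proof (cases "n = 0")
  case True
  then show ?thesis using lipschitz_on_nonneg[OF assms] by simp
next
  case False
  have "\<bar>\<phi> (graduated n y) - \<phi> y\<bar> \<le> L * norm (graduated n y - y)"
    using lipschitz_onD[OF assms, of "graduated n y" y] by (simp add: dist_norm)
  also have "\<dots> = L * ((1 / real n) * norm (theta (real n *\<^sub>R y)))" by (simp add: graduated_def)
  also have "\<dots> \<le> L * ((1 / real n) * real CARD('d))"
    using lipschitz_on_nonneg[OF assms] by (intro mult_left_mono norm_theta_le) auto
  finally have "real n * \<bar>\<phi> (graduated n y) - \<phi> y\<bar> \<le> real n * (L * ((1 / real n) * real CARD('d)))"
    by (rule mult_left_mono) simp
  then show ?thesis using False by (simp add: abs_mult)
qed

lemma lipschitz_partial_deriv:
  fixes \<phi> :: "real^'d \<Rightarrow> real"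
  assumes L: "L-lipschitz_on UNIV \<phi>" and d: "\<And>x. \<phi> differentiable (at x)"
  shows "\<bar>partial_deriv i \<phi> x\<bar> \<le> L"
proof -
  have "((\<lambda>t. \<phi> (x + t *\<^sub>R axis i 1)) has_real_derivative partial_deriv i \<phi> x) (at 0)"
    using DERIV_partial_deriv[OF d, of x i 0] by simp
  then have "((\<lambda>t. (\<phi> (x + t *\<^sub>R axis i 1) - \<phi> x) / t) \<longlongrightarrow> partial_deriv i \<phi> x) (at 0)"
    by (simp add: DERIV_def)
  then have "((\<lambda>t. \<bar>(\<phi> (x + t *\<^sub>R axis i 1) - \<phi> x) / t\<bar>) \<longlongrightarrow> \<bar>partial_deriv i \<phi> x\<bar>) (at 0)"
    by (rule tendsto_rabs)
  then show ?thesis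
  proof (rule tendsto_upperbound)
    show "\<forall>\<^sub>F t in at (0::real). \<bar>(\<phi> (x + t *\<^sub>R axis i 1) - \<phi> x) / t\<bar> \<le> L"
      unfolding eventually_at_filter
    proof (intro always_eventually allI impI)
      fix t :: real assume "t \<noteq> 0"
      moreover have "\<bar>\<phi> (x + t *\<^sub>R axis i 1) - \<phi> x\<bar> \<le> L * \<bar>t\<bar>"
        using lipschitz_onD[OF L, of "x + t *\<^sub>R axis i 1" x] by (simp add: dist_norm)
      ultimately show "\<bar>(\<phi> (x + t *\<^sub>R axis i 1) - \<phi> x) / t\<bar> \<le> L" by (simp add: field_simps)
    qed
  qed simp
qed

text \<open>The constant \<open>indep_var\<close> requires both variables to have values in the same type.\<close>

definition (in prob_space) indep_rvs :: "('a \<Rightarrow> 'b::topological_space) \<Rightarrow> ('a \<Rightarrow> 'c::topological_space) \<Rightarrow> bool" where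
  "indep_rvs V Z \<longleftrightarrow> V \<in> borel_measurable M \<and> Z \<in> borel_measurable M \<and>
     indep_set (sets (vimage_algebra (space M) V borel)) (sets (vimage_algebra (space M) Z borel))"

lemma sets_vimage_algebra_compose_subset:
  assumes "h \<in> borel_measurable borel"
  shows "sets (vimage_algebra S (\<lambda>x. h (Z x)) borel) \<subseteq> sets (vimage_algebra S Z borel)"
proof -
  have "Z \<in> borel_measurable (vimage_algebra S Z borel)" by (rule measurable_vimage_algebra1) auto
  then have "(\<lambda>x. h (Z x)) \<in> borel_measurable (vimage_algebra S Z borel)"
    using assms by (rule measurable_compose)
  then have "(\<lambda>x. h (Z x)) -` A \<inter> S \<in> sets (vimage_algebra S Z borel)" if "A \<in> sets borel" for A
    using measurable_sets[of "\<lambda>x. h (Z x)" "vimage_algebra S Z borel" borel A] that by simp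
  then show ?thesis by (subst sets_vimage_algebra2) auto
qed

lemma (in prob_space) indep_rvs_compose:
  assumes "indep_rvs V Z" and f: "f \<in> borel_measurable borel" and g: "g \<in> borel_measurable borel"
  shows "indep_rvs (\<lambda>\<omega>. f (V \<omega>)) (\<lambda>\<omega>. g (Z \<omega>))"
proof -
  have [measurable]: "V \<in> borel_measurable M" "Z \<in> borel_measurable M" "f \<in> borel_measurable borel" "g \<in> borel_measurable borel"
    and i: "indep_set (sets (vimage_algebra (space M) V borel)) (sets (vimage_algebra (space M) Z borel))"
    using assms by (auto simp: indep_rvs_def)
  have "indep_set (sets (vimage_algebra (space M) (\<lambda>\<omega>. f (V \<omega>)) borel)) (sets (vimage_algebra (space M) (\<lambda>\<omega>. g (Z \<omega>)) borel))"
    using i unfolding indep_set_def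
    by (rule indep_sets_mono_sets) (auto simp: sets_vimage_algebra_compose_subset[OF f, THEN subsetD] sets_vimage_algebra_compose_subset[OF g, THEN subsetD] split: bool.splits)
  then show ?thesis unfolding indep_rvs_def by simp
qed

lemma (in prob_space) indep_rvs_fst:
  fixes X :: "'a \<Rightarrow> 'b::second_countable_topology" and Y :: "'a \<Rightarrow> 'c::second_countable_topology"
  assumes "indep_rvs V (\<lambda>\<omega>. (X \<omega>, Y \<omega>))"
  shows "indep_rvs V X"
proof -
  have "(fst :: 'b \<times> 'c \<Rightarrow> 'b) \<in> borel_measurable borel"
    by (intro borel_measurable_continuous_onI continuous_intros)
  from indep_rvs_compose[OF assms _ this, of "\<lambda>v. v"] show ?thesis by simp
qed

lemma (in prob_space) indep_rvs_integral_mult: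
  fixes f g :: "_ \<Rightarrow> real"
  assumes ind: "indep_rvs V Z"
    and [measurable]: "f \<in> borel_measurable borel" "g \<in> borel_measurable borel"
    and bd: "\<And>x. \<bar>f x\<bar> \<le> A" "\<And>x. \<bar>g x\<bar> \<le> B"
  shows "(\<integral>\<omega>. g (Z \<omega>) * f (V \<omega>) \<partial>M) = (\<integral>\<omega>. g (Z \<omega>) \<partial>M) * (\<integral>\<omega>. f (V \<omega>) \<partial>M)"
proof -
  have [measurable]: "V \<in> borel_measurable M" "Z \<in> borel_measurable M"
    using ind by (auto simp: indep_rvs_def)
  have eq: "sigma_sets (space M) {h -` A \<inter> space M |A. A \<in> sets borel} = sets (vimage_algebra (space M) h borel)"
    for h :: "'a \<Rightarrow> real" by (simp add: sets_vimage_algebra)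
  have "indep_var borel (\<lambda>\<omega>. f (V \<omega>)) borel (\<lambda>\<omega>. g (Z \<omega>))"
    using indep_rvs_compose[OF ind, of f g] unfolding indep_var_eq eq indep_rvs_def by simp
  moreover have "integrable M (\<lambda>\<omega>. f (V \<omega>))" "integrable M (\<lambda>\<omega>. g (Z \<omega>))"
    by (rule integrable_const_bound[where B=A], use bd in auto) (rule integrable_const_bound[where B=B], use bd in auto)
  ultimately show ?thesis
    using indep_var_lebesgue_integral[of "\<lambda>\<omega>. f (V \<omega>)" "\<lambda>\<omega>. g (Z \<omega>)"]
    by (simp add: mult.commute)
qed

text \<open>Neither sequence has to converge, so continuity at a limit point is of no use; uniform
  continuity on a compact interval containing both sequences replaces it.\<close>

lemma continuous_differences_vanish:
  fixes g :: "real \<Rightarrow> real"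
  assumes g: "continuous_on UNIV g" and d: "(\<lambda>n. a n - b n) \<longlonglongrightarrow> 0"
    and bd: "\<And>n. \<bar>a n\<bar> \<le> B" "\<And>n. \<bar>b n\<bar> \<le> B"
  shows "(\<lambda>n. g (a n) - g (b n)) \<longlonglongrightarrow> 0"
proof -
  have uc: "uniformly_continuous_on {-B..B} g"
    by (intro compact_uniformly_continuous continuous_on_subset[OF g]) auto
  have "a n \<in> {-B..B}" "b n \<in> {-B..B}" for n using bd[of n] by (auto simp: abs_le_iff)
  moreover have "(\<lambda>n. dist (a n) (b n)) \<longlonglongrightarrow> 0" using tendsto_rabs_zero[OF d] by (simp add: dist_real_def)
  ultimately have "(\<lambda>n. dist (g (a n)) (g (b n))) \<longlonglongrightarrow> 0"
    using uc unfolding uniformly_continuous_on_sequentially by blast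
  then show ?thesis by (simp add: dist_real_def tendsto_rabs_zero_iff)
qed

section \<open>Increments under a Rajchman law: laws and quadratic limits\<close>

context rajchman_vector
begin

lemma scaled_increment: "n > 0 \<Longrightarrow> real n *\<^sub>R (graduated n (Y \<omega>) - Y \<omega>) = osc n \<omega>"
  by (simp add: graduated_def)

lemma osc_nth_bound: "\<bar>osc n \<omega> $ i\<bar> \<le> 1"
  by (rule order_trans[OF abs_theta_nth_le]) simp

text \<open>In \<open>weak_continuous\<close> the weight is arbitrary, so it may be any bounded
  continuous function of \<open>Z\<close>. The product of expectations in the limit is the
  expectation of a product because \<open>V\<close> is independent of \<open>Z\<close>.\<close>

lemma osc_joint_integral:
  fixes Z :: "'a \<Rightarrow> 'b::euclidean_space"
  assumes ind: "indep_rvs V Z"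
    and F: "continuous_on UNIV F" "bounded (range F)"
  shows "(\<lambda>n. \<integral>\<omega>. F (Z \<omega>, osc n \<omega>) \<partial>M) \<longlonglongrightarrow> (\<integral>\<omega>. F (Z \<omega>, V \<omega>) \<partial>M :: real)"
proof (rule converges_jointly[OF prob_space_axioms _ _ _ _ F])
  show Z[measurable]: "Z \<in> borel_measurable M" using ind by (auto simp: indep_rvs_def)
  fix g :: "'b \<Rightarrow> real" and f :: "real^'d \<Rightarrow> real"
  assume gf: "continuous_on UNIV g" "bounded (range g)" "continuous_on UNIV f" "bounded (range f)"
  then have [measurable]: "g \<in> borel_measurable borel" "f \<in> borel_measurable borel"
    by (auto intro: borel_measurable_continuous_onI)
  obtain A B where bd: "\<And>x. \<bar>f x\<bar> \<le> A" "\<And>x. \<bar>g x\<bar> \<le> B" using gf by (auto simp: bounded_iff)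
  have "integrable M (\<lambda>\<omega>. g (Z \<omega>))" by (rule integrable_const_bound[where B=B]) (use bd in auto)
  from weak_continuous[OF gf(3) this]
  show "(\<lambda>n. \<integral>\<omega>. g (Z \<omega>) * f (osc n \<omega>) \<partial>M) \<longlonglongrightarrow> (\<integral>\<omega>. g (Z \<omega>) * f (V \<omega>) \<partial>M)"
    by (subst indep_rvs_integral_mult[OF ind _ _ bd]) auto
qed measurable

lemma law_osc:
  fixes X :: "'a \<Rightarrow> real^'m"
  assumes ind: "indep_rvs V (\<lambda>\<omega>. (X \<omega>, Y \<omega>))"
  shows "converges_in_law M (\<lambda>n \<omega>. (X \<omega>, real n *\<^sub>R (graduated n (Y \<omega>) - Y \<omega>))) (\<lambda>\<omega>. (X \<omega>, V \<omega>))"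
proof -
  note ind' = indep_rvs_fst[OF ind]
  then have X[measurable]: "X \<in> borel_measurable M" by (simp add: indep_rvs_def)
  show ?thesis unfolding converges_in_law_def
  proof (intro conjI allI impI)
    fix f :: "(real^'m) \<times> (real^'d) \<Rightarrow> real"
    assume f: "continuous_on UNIV f" "bounded (range f)"
    have "(\<lambda>n. \<integral>\<omega>. f (X \<omega>, osc n \<omega>) \<partial>M) \<longlonglongrightarrow> (\<integral>\<omega>. f (X \<omega>, V \<omega>) \<partial>M)"
      by (rule osc_joint_integral[OF ind' f])
    then show "(\<lambda>n. \<integral>\<omega>. f (X \<omega>, real n *\<^sub>R (graduated n (Y \<omega>) - Y \<omega>)) \<partial>M) \<longlonglongrightarrow> (\<integral>\<omega>. f (X \<omega>, V \<omega>) \<partial>M)"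
      by (rule Lim_transform_eventually) (use eventually_gt_at_top[of 0] in eventually_elim, simp add: scaled_increment)
  qed measurable
qed

text \<open>The limit contains the gradient at \<open>Y\<close>, so the joint convergence is used
  for the pair \<open>(X, Y)\<close> together with \<open>osc\<close>, not for \<open>X\<close>
  alone. The linear part is a continuous function of this triple, and dominated convergence
  transfers the result to the true increment.\<close>

lemma law_increment:
  fixes X :: "'a \<Rightarrow> real^'m"
  assumes ind: "indep_rvs V (\<lambda>\<omega>. (X \<omega>, Y \<omega>))"
    and \<phi>: "of_class_C 1 \<phi>" and L: "L-lipschitz_on UNIV \<phi>"
  shows "converges_in_law M (\<lambda>n \<omega>. (X \<omega>, real n * (\<phi> (graduated n (Y \<omega>)) - \<phi> (Y \<omega>))))
               (\<lambda>\<omega>. (X \<omega>, \<Sum>i\<in>UNIV. V \<omega> $ i * partial_deriv i \<phi> (Y \<omega>)))"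
proof -
  have XY[measurable]: "(\<lambda>\<omega>. (X \<omega>, Y \<omega>)) \<in> borel_measurable M" using ind by (auto simp: indep_rvs_def)
  have X[measurable]: "X \<in> borel_measurable M" using indep_rvs_fst[OF ind] by (simp add: indep_rvs_def)
  have d: "\<And>x. \<phi> differentiable (at x)" and c: "\<And>i. continuous_on UNIV (partial_deriv i \<phi>)"
    using \<phi> by (auto simp: of_class_C_1)
  have [measurable]: "\<phi> \<in> borel_measurable borel" "\<And>i. partial_deriv i \<phi> \<in> borel_measurable borel"
    using of_class_C_continuous[OF \<phi>] c by (auto intro: borel_measurable_continuous_onI)
  define a where "a n \<omega> = real n * (\<phi> (graduated n (Y \<omega>)) - \<phi> (Y \<omega>))" for n \<omega>
  define b where "b n \<omega> = (\<Sum>i\<in>UNIV. osc n \<omega> $ i * partial_deriv i \<phi> (Y \<omega>))" for n \<omega>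
  have [measurable]: "a n \<in> borel_measurable M" "b n \<in> borel_measurable M" for n
    unfolding a_def b_def by measurable
  have ab: "\<bar>a n \<omega>\<bar> \<le> L * real CARD('d)" "\<bar>b n \<omega>\<bar> \<le> L * real CARD('d)" for n \<omega>
  proof -
    show "\<bar>a n \<omega>\<bar> \<le> L * real CARD('d)" unfolding a_def by (rule lipschitz_scaled_increment[OF L])
    have "\<bar>b n \<omega>\<bar> \<le> (\<Sum>i\<in>(UNIV::'d set). 1 * L)" unfolding b_def
      by (rule order_trans[OF sum_abs]) (unfold abs_mult, intro sum_mono mult_mono osc_nth_bound lipschitz_partial_deriv[OF L d], auto)
    then show "\<bar>b n \<omega>\<bar> \<le> L * real CARD('d)" by (simp add: mult.commute)
  qed
  show ?thesis unfolding converges_in_law_def a_def[symmetric]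
  proof (intro conjI allI impI)
    fix f :: "(real^'m) \<times> real \<Rightarrow> real"
    assume f: "continuous_on UNIV f" "bounded (range f)"
    then have [measurable]: "f \<in> borel_measurable borel" by (auto intro: borel_measurable_continuous_onI)
    obtain C where C: "\<And>z. \<bar>f z\<bar> \<le> C" using f(2) by (auto simp: bounded_iff)
    define F where "F z = f (fst (fst z), \<Sum>i\<in>UNIV. snd z $ i * partial_deriv i \<phi> (snd (fst z)))" for z :: "((real^'m) \<times> (real^'d)) \<times> (real^'d)"
    have "continuous_on UNIV F" unfolding F_def
      by (rule continuous_on_compose2[OF f(1)])
         (auto intro!: continuous_intros continuous_on_compose2[OF c])
    moreover have "bounded (range F)" using C by (auto simp: bounded_iff F_def)
    ultimately have "(\<lambda>n. \<integral>\<omega>. F ((X \<omega>, Y \<omega>), osc n \<omega>) \<partial>M) \<longlonglongrightarrow> (\<integral>\<omega>. F ((X \<omega>, Y \<omega>), V \<omega>) \<partial>M)"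
      by (rule osc_joint_integral[OF ind])
    then have 1: "(\<lambda>n. \<integral>\<omega>. f (X \<omega>, b n \<omega>) \<partial>M) \<longlonglongrightarrow> (\<integral>\<omega>. f (X \<omega>, \<Sum>i\<in>UNIV. V \<omega> $ i * partial_deriv i \<phi> (Y \<omega>)) \<partial>M)"
      by (simp add: F_def b_def)
    have "(\<lambda>n. \<integral>\<omega>. f (X \<omega>, a n \<omega>) - f (X \<omega>, b n \<omega>) \<partial>M) \<longlonglongrightarrow> (\<integral>\<omega>. 0 \<partial>M)"
    proof (rule integral_dominated_convergence[where w="\<lambda>_. 2 * C"])
      show "AE \<omega> in M. (\<lambda>n. f (X \<omega>, a n \<omega>) - f (X \<omega>, b n \<omega>)) \<longlonglongrightarrow> 0"
      proof (intro AE_I2)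
        fix \<omega>
        show "(\<lambda>n. f (X \<omega>, a n \<omega>) - f (X \<omega>, b n \<omega>)) \<longlonglongrightarrow> 0"
        proof (rule continuous_differences_vanish[where g="\<lambda>t. f (X \<omega>, t)"])
          show "continuous_on UNIV (\<lambda>t. f (X \<omega>, t))"
            by (rule continuous_on_compose2[OF f(1)]) (auto intro!: continuous_intros)
          show "(\<lambda>n. a n \<omega> - b n \<omega>) \<longlonglongrightarrow> 0"
            unfolding a_def b_def by (rule first_order_expansion[OF \<phi>])
        qed (rule ab)+
      qed
      show "AE \<omega> in M. norm (f (X \<omega>, a n \<omega>) - f (X \<omega>, b n \<omega>)) \<le> 2 * C" for n
      proof (intro AE_I2)
        fix \<omega>
        show "norm (f (X \<omega>, a n \<omega>) - f (X \<omega>, b n \<omega>)) \<le> 2 * C"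
          using C[of "(X \<omega>, a n \<omega>)"] C[of "(X \<omega>, b n \<omega>)"] unfolding real_norm_def by linarith
      qed
    qed auto
    moreover have "integrable M (\<lambda>\<omega>. f (X \<omega>, a n \<omega>))" "integrable M (\<lambda>\<omega>. f (X \<omega>, b n \<omega>))" for n
      using C by (auto intro!: integrable_const_bound[where B=C])
    ultimately have "(\<lambda>n. (\<integral>\<omega>. f (X \<omega>, a n \<omega>) \<partial>M) - (\<integral>\<omega>. f (X \<omega>, b n \<omega>) \<partial>M)) \<longlonglongrightarrow> 0" by simp
    from tendsto_add[OF this 1]
    show "(\<lambda>n. \<integral>\<omega>. f (X \<omega>, a n \<omega>) \<partial>M) \<longlonglongrightarrow> (\<integral>\<omega>. f (X \<omega>, \<Sum>i\<in>UNIV. V \<omega> $ i * partial_deriv i \<phi> (Y \<omega>)) \<partial>M)"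
      by simp
  qed measurable
qed

text \<open>One polarised and weighted version serves three purposes: a weight depending on
  \<open>Y\<close> gives the weak L1 limit, the weight 1 gives the mean square error, and two
  different functions give the bilinear form in (H3). After linearisation the limit of theta_i
  theta_j is the covariance of \<open>V\<close>, of which only the diagonal survives.\<close>

lemma quadratic_increment:
  assumes \<phi>: "of_class_C 1 \<phi>" "L-lipschitz_on UNIV \<phi>" and \<eta>: "of_class_C 1 \<eta>" "K-lipschitz_on UNIV \<eta>"
    and W[measurable]: "W \<in> borel_measurable M" and Wb: "\<And>\<omega>. \<bar>W \<omega>\<bar> \<le> C"
  shows "(\<lambda>n. (real n)\<^sup>2 * (\<integral>\<omega>. (\<phi> (graduated n (Y \<omega>)) - \<phi> (Y \<omega>)) * (\<eta> (graduated n (Y \<omega>)) - \<eta> (Y \<omega>)) * W \<omega> \<partial>M))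
    \<longlonglongrightarrow> (\<integral>\<omega>. 1/12 * (\<Sum>i\<in>UNIV. partial_deriv i \<phi> (Y \<omega>) * partial_deriv i \<eta> (Y \<omega>)) * W \<omega> \<partial>M)"
proof -
  have d: "\<And>x. \<phi> differentiable (at x)" "\<And>x. \<eta> differentiable (at x)"
    and c: "\<And>i. continuous_on UNIV (partial_deriv i \<phi>)" "\<And>i. continuous_on UNIV (partial_deriv i \<eta>)"
    using \<phi> \<eta> by (auto simp: of_class_C_1)
  have [measurable]: "\<phi> \<in> borel_measurable borel" "\<And>i. partial_deriv i \<phi> \<in> borel_measurable borel"
    "\<eta> \<in> borel_measurable borel" "\<And>i. partial_deriv i \<eta> \<in> borel_measurable borel"
    using of_class_C_continuous[OF \<phi>(1)] of_class_C_continuous[OF \<eta>(1)] c by (auto intro: borel_measurable_continuous_onI)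
  define a where "a n \<omega> = real n * (\<phi> (graduated n (Y \<omega>)) - \<phi> (Y \<omega>))" for n \<omega>
  define b where "b n \<omega> = real n * (\<eta> (graduated n (Y \<omega>)) - \<eta> (Y \<omega>))" for n \<omega>
  define p where "p n \<omega> = (\<Sum>i\<in>UNIV. osc n \<omega> $ i * partial_deriv i \<phi> (Y \<omega>))" for n \<omega>
  define q where "q n \<omega> = (\<Sum>i\<in>UNIV. osc n \<omega> $ i * partial_deriv i \<eta> (Y \<omega>))" for n \<omega>
  have [measurable]: "a n \<in> borel_measurable M" "b n \<in> borel_measurable M"
    "p n \<in> borel_measurable M" "q n \<in> borel_measurable M" for n
    unfolding a_def b_def p_def q_def by measurable
  have L0: "0 \<le> L" "0 \<le> K" using \<phi> \<eta> lipschitz_on_nonneg by auto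
  define A where "A = L * real CARD('d)"
  define B where "B = K * real CARD('d)"
  have AB: "0 \<le> A" "0 \<le> B" "0 \<le> C" using L0 Wb[of undefined] by (auto simp: A_def B_def)
  have bd: "\<bar>a n \<omega>\<bar> \<le> A" "\<bar>b n \<omega>\<bar> \<le> B" "\<bar>p n \<omega>\<bar> \<le> A" "\<bar>q n \<omega>\<bar> \<le> B" for n \<omega>
  proof -
    show "\<bar>a n \<omega>\<bar> \<le> A" "\<bar>b n \<omega>\<bar> \<le> B"
      unfolding a_def b_def A_def B_def by (rule lipschitz_scaled_increment, rule \<phi> \<eta>)+
    have "\<bar>p n \<omega>\<bar> \<le> (\<Sum>i\<in>(UNIV::'d set). 1 * L)" unfolding p_def
      by (rule order_trans[OF sum_abs]) (unfold abs_mult, intro sum_mono mult_mono osc_nth_bound lipschitz_partial_deriv[OF \<phi>(2) d(1)], auto)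
    then show "\<bar>p n \<omega>\<bar> \<le> A" by (simp add: A_def mult.commute)
    have "\<bar>q n \<omega>\<bar> \<le> (\<Sum>i\<in>(UNIV::'d set). 1 * K)" unfolding q_def
      by (rule order_trans[OF sum_abs]) (unfold abs_mult, intro sum_mono mult_mono osc_nth_bound lipschitz_partial_deriv[OF \<eta>(2) d(2)], auto)
    then show "\<bar>q n \<omega>\<bar> \<le> B" by (simp add: B_def mult.commute)
  qed
  have prod_bd: "\<bar>x * y * W \<omega>\<bar> \<le> A * B * C" if "\<bar>x\<bar> \<le> A" "\<bar>y\<bar> \<le> B" for x y \<omega>
    unfolding abs_mult using that Wb AB by (intro mult_mono) auto
  have int: "integrable M (\<lambda>\<omega>. a n \<omega> * b n \<omega> * W \<omega>)" "integrable M (\<lambda>\<omega>. p n \<omega> * q n \<omega> * W \<omega>)" for n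
    by (rule integrable_const_bound[where B="A * B * C"]; use prod_bd bd in auto)+
  have "(\<lambda>n. \<integral>\<omega>. a n \<omega> * b n \<omega> * W \<omega> - p n \<omega> * q n \<omega> * W \<omega> \<partial>M) \<longlonglongrightarrow> (\<integral>\<omega>. 0 \<partial>M)"
  proof (rule integral_dominated_convergence[where w="\<lambda>_. 2 * (A * B * C)"])
    show "AE \<omega> in M. (\<lambda>n. a n \<omega> * b n \<omega> * W \<omega> - p n \<omega> * q n \<omega> * W \<omega>) \<longlonglongrightarrow> 0"
    proof (intro AE_I2)
      fix \<omega>
      have 1: "(\<lambda>n. a n \<omega> - p n \<omega>) \<longlonglongrightarrow> 0" "(\<lambda>n. b n \<omega> - q n \<omega>) \<longlonglongrightarrow> 0"
        unfolding a_def b_def p_def q_def by (rule first_order_expansion, rule \<phi> \<eta>)+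
      \<comment> \<open>The difference a b - p q is split as (a - p) b + p (b - q): the single
        factors only stay bounded, the differences tend to 0.\<close>
      have "(\<lambda>n. (a n \<omega> - p n \<omega>) * b n \<omega>) \<longlonglongrightarrow> 0"
      proof (rule Lim_null_comparison)
        show "(\<lambda>n. \<bar>a n \<omega> - p n \<omega>\<bar> * B) \<longlonglongrightarrow> 0" using 1 by (intro tendsto_mult_left_zero tendsto_rabs_zero)
      qed (use bd in \<open>auto simp: abs_mult intro!: always_eventually mult_left_mono\<close>)
      moreover have "(\<lambda>n. p n \<omega> * (b n \<omega> - q n \<omega>)) \<longlonglongrightarrow> 0"
      proof (rule Lim_null_comparison)
        show "(\<lambda>n. A * \<bar>b n \<omega> - q n \<omega>\<bar>) \<longlonglongrightarrow> 0" using 1 by (intro tendsto_mult_right_zero tendsto_rabs_zero)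
      qed (use bd in \<open>auto simp: abs_mult intro!: always_eventually mult_right_mono\<close>)
      ultimately have "(\<lambda>n. ((a n \<omega> - p n \<omega>) * b n \<omega> + p n \<omega> * (b n \<omega> - q n \<omega>)) * W \<omega>) \<longlonglongrightarrow> (0 + 0) * W \<omega>"
        by (intro tendsto_mult tendsto_add tendsto_const)
      then show "(\<lambda>n. a n \<omega> * b n \<omega> * W \<omega> - p n \<omega> * q n \<omega> * W \<omega>) \<longlonglongrightarrow> 0"
        by (simp add: algebra_simps)
    qed
    show "AE \<omega> in M. norm (a n \<omega> * b n \<omega> * W \<omega> - p n \<omega> * q n \<omega> * W \<omega>) \<le> 2 * (A * B * C)" for n
    proof (intro AE_I2)
      fix \<omega>
      show "norm (a n \<omega> * b n \<omega> * W \<omega> - p n \<omega> * q n \<omega> * W \<omega>) \<le> 2 * (A * B * C)"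
        using prod_bd[OF bd(1)[of n \<omega>] bd(2)[of n \<omega>], of \<omega>] prod_bd[OF bd(3)[of n \<omega>] bd(4)[of n \<omega>], of \<omega>]
        unfolding real_norm_def by linarith
    qed
  qed auto
  then have 1: "(\<lambda>n. (\<integral>\<omega>. a n \<omega> * b n \<omega> * W \<omega> \<partial>M) - (\<integral>\<omega>. p n \<omega> * q n \<omega> * W \<omega> \<partial>M)) \<longlonglongrightarrow> 0"
    using int by simp
  define D where "D i j \<omega> = partial_deriv i \<phi> (Y \<omega>) * partial_deriv j \<eta> (Y \<omega>) * W \<omega>" for i j \<omega>
  have [measurable]: "D i j \<in> borel_measurable M" for i j unfolding D_def by measurable
  have D_bd: "\<bar>D i j \<omega>\<bar> \<le> L * K * C" for i j \<omega>
    unfolding D_def abs_mult using AB L0 Wb lipschitz_partial_deriv[OF \<phi>(2) d(1)] lipschitz_partial_deriv[OF \<eta>(2) d(2)]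
    by (intro mult_mono) auto
  have iD: "integrable M (D i j)" for i j
    by (rule integrable_const_bound[where B="L * K * C"]) (use D_bd in auto)
  have pq: "p n \<omega> * q n \<omega> * W \<omega> = (\<Sum>i\<in>UNIV. \<Sum>j\<in>UNIV. D i j \<omega> * (osc n \<omega> $ i * osc n \<omega> $ j))" for n \<omega>
    unfolding p_def q_def D_def by (simp add: sum_product sum_distrib_left sum_distrib_right mult_ac)
  have iDo: "integrable M (\<lambda>\<omega>. D i j \<omega> * (osc n \<omega> $ i * osc n \<omega> $ j))" for i j n
    by (rule integrable_mult_bounded[OF iD, where C=1]) (auto simp: abs_mult intro!: mult_le_one osc_nth_bound)
  have "(\<lambda>n. \<Sum>i\<in>UNIV. \<Sum>j\<in>UNIV. \<integral>\<omega>. D i j \<omega> * (osc n \<omega> $ i * osc n \<omega> $ j) \<partial>M)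
     \<longlonglongrightarrow> (\<Sum>i\<in>UNIV. \<Sum>j\<in>UNIV. (\<integral>\<omega>. D i j \<omega> \<partial>M) * (\<integral>\<omega>. V \<omega> $ i * V \<omega> $ j \<partial>M))"
    by (intro tendsto_sum weak_continuous[where f="\<lambda>v. v $ _ * v $ _"] iD) (intro continuous_intros)
  also have "(\<lambda>n. \<Sum>i\<in>UNIV. \<Sum>j\<in>UNIV. \<integral>\<omega>. D i j \<omega> * (osc n \<omega> $ i * osc n \<omega> $ j) \<partial>M) = (\<lambda>n. \<integral>\<omega>. p n \<omega> * q n \<omega> * W \<omega> \<partial>M)"
    unfolding pq using iDo by simp
  also have "(\<Sum>i\<in>UNIV. \<Sum>j\<in>UNIV. (\<integral>\<omega>. D i j \<omega> \<partial>M) * (\<integral>\<omega>. V \<omega> $ i * V \<omega> $ j \<partial>M)) = (\<Sum>i\<in>UNIV. (\<integral>\<omega>. D i i \<omega> \<partial>M) * (1/12))"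
    by (simp add: integral_V_nth_mult if_distrib cong: if_cong)
  also have "\<dots> = (\<integral>\<omega>. (\<Sum>i\<in>UNIV. D i i \<omega> * (1/12)) \<partial>M)" using iD by simp
  also have "\<dots> = (\<integral>\<omega>. 1/12 * (\<Sum>i\<in>UNIV. partial_deriv i \<phi> (Y \<omega>) * partial_deriv i \<eta> (Y \<omega>)) * W \<omega> \<partial>M)"
    by (intro Bochner_Integration.integral_cong refl) (simp add: D_def sum_distrib_left sum_distrib_right)
  finally have 2: "(\<lambda>n. \<integral>\<omega>. p n \<omega> * q n \<omega> * W \<omega> \<partial>M) \<longlonglongrightarrow> (\<integral>\<omega>. 1/12 * (\<Sum>i\<in>UNIV. partial_deriv i \<phi> (Y \<omega>) * partial_deriv i \<eta> (Y \<omega>)) * W \<omega> \<partial>M)" .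
  have "(\<integral>\<omega>. a n \<omega> * b n \<omega> * W \<omega> \<partial>M) = (real n)\<^sup>2 * (\<integral>\<omega>. (\<phi> (graduated n (Y \<omega>)) - \<phi> (Y \<omega>)) * (\<eta> (graduated n (Y \<omega>)) - \<eta> (Y \<omega>)) * W \<omega> \<partial>M)" for n
    by (subst integral_mult_right_zero[symmetric]) (simp add: a_def b_def power2_eq_square mult_ac)
  with tendsto_add[OF 1 2] show ?thesis by simp
qed

text \<open>Testing an arbitrary version of the conditional expectation against a bounded function
  of \<open>Y\<close> removes the conditioning, and the limit becomes a weighted instance of
  \<open>quadratic_increment\<close>.\<close>

lemma weak_L1_increment:
  assumes \<phi>: "of_class_C 1 \<phi>" "L-lipschitz_on UNIV \<phi>"
    and g: "\<And>n. cond_exp_version M Y (\<lambda>\<omega>. (\<phi> (graduated n (Y \<omega>)) - \<phi> (Y \<omega>))\<^sup>2) (g n)"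
  shows "converges_weakly_L1 (distr M borel Y) (\<lambda>n y. (real n)\<^sup>2 * g n y)
                    (\<lambda>y. 1/12 * (\<Sum>i\<in>UNIV. (partial_deriv i \<phi> y)\<^sup>2))"
proof -
  define F where "F = vimage_algebra (space M) Y borel"
  have "subalgebra M F"
    unfolding F_def subalgebra_def using Y_measurable by (auto simp: sets_vimage_algebra2 measurable_sets)
  then interpret sub: finite_measure_subalgebra M F
    by unfold_locales
  have Y_F: "Y \<in> borel_measurable F" unfolding F_def by (rule measurable_vimage_algebra1) auto
  have d: "\<And>x. \<phi> differentiable (at x)" and c: "\<And>i. continuous_on UNIV (partial_deriv i \<phi>)"
    using \<phi> by (auto simp: of_class_C_1)
  have [measurable]: "\<phi> \<in> borel_measurable borel" "\<And>i. partial_deriv i \<phi> \<in> borel_measurable borel"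
    using of_class_C_continuous[OF \<phi>(1)] c by (auto intro: borel_measurable_continuous_onI)
  define Z where "Z n = (\<lambda>\<omega>. (\<phi> (graduated n (Y \<omega>)) - \<phi> (Y \<omega>))\<^sup>2)" for n
  have [measurable]: "Z n \<in> borel_measurable M" for n unfolding Z_def by measurable
  have gm[measurable]: "g n \<in> borel_measurable borel" for n using g by (simp add: cond_exp_version_def)
  have gZ: "AE \<omega> in M. real_cond_exp M F (Z n) \<omega> = g n (Y \<omega>)" for n
    using g by (simp add: cond_exp_version_def F_def Z_def)
  have L0: "0 \<le> L" using \<phi> lipschitz_on_nonneg by auto
  have iZ: "integrable M (Z n)" if "n > 0" for n
  proof (rule integrable_const_bound[where B="(L * real CARD('d))\<^sup>2"])
    have "\<bar>\<phi> (graduated n y) - \<phi> y\<bar> \<le> L * real CARD('d)" for y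
    proof -
      have "\<bar>\<phi> (graduated n y) - \<phi> y\<bar> \<le> real n * \<bar>\<phi> (graduated n y) - \<phi> y\<bar>"
        using that by (simp add: mult_le_cancel_right1)
      also have "\<dots> \<le> L * real CARD('d)"
        using lipschitz_scaled_increment[OF \<phi>(2), of n y] by (simp add: abs_mult)
      finally show ?thesis .
    qed
    then have "\<bar>\<phi> (graduated n y) - \<phi> y\<bar>\<^sup>2 \<le> (L * real CARD('d))\<^sup>2" for y by (rule power_mono) simp
    then show "AE x in M. norm (Z n x) \<le> (L * real CARD('d))\<^sup>2" by (simp add: Z_def)
  qed simp
  have ig: "integrable M (\<lambda>\<omega>. (real n)\<^sup>2 * g n (Y \<omega>))" for n
  \<comment> \<open>For n = 0 the prefactor is 0; for n at least 1 the Lipschitz bound makes the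
    squared increment bounded.\<close>
  proof (cases "n = 0")
    case False
    have "integrable M (real_cond_exp M F (Z n))" using sub.real_cond_exp_int(1)[OF iZ] False by simp
    then have "integrable M (\<lambda>\<omega>. g n (Y \<omega>))"
      by (rule Bochner_Integration.integrable_cong_AE_imp) (use gZ[of n] in auto)
    then show ?thesis by simp
  qed simp
  show ?thesis unfolding converges_weakly_L1_def
  proof (intro conjI ballI allI impI)
    show "integrable (distr M borel Y) (\<lambda>y. (real n)\<^sup>2 * g n y)" for n
      using ig by (subst integrable_distr_eq) auto
    show "integrable (distr M borel Y) (\<lambda>y. 1/12 * (\<Sum>i\<in>UNIV. (partial_deriv i \<phi> y)\<^sup>2))"
    proof (subst integrable_distr_eq)
      have "integrable M (\<lambda>\<omega>. (partial_deriv i \<phi> (Y \<omega>))\<^sup>2)" for i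
        by (rule integrable_const_bound[where B="L\<^sup>2"])
           (use power_mono[OF lipschitz_partial_deriv[OF \<phi>(2) d], where n=2] in auto)
      then show "integrable M (\<lambda>\<omega>. 1/12 * (\<Sum>i\<in>UNIV. (partial_deriv i \<phi> (Y \<omega>))\<^sup>2))" by simp
    qed auto
    fix \<psi> :: "real^'d \<Rightarrow> real" assume "\<psi> \<in> borel_measurable (distr M borel Y)" and b: "bounded (range \<psi>)"
    then have [measurable]: "\<psi> \<in> borel_measurable borel" by simp
    obtain C where C: "\<And>y. \<bar>\<psi> y\<bar> \<le> C" using b by (auto simp: bounded_iff)
    have "(\<integral>y. (real n)\<^sup>2 * g n y * \<psi> y \<partial>distr M borel Y)
       = (real n)\<^sup>2 * (\<integral>\<omega>. (\<phi> (graduated n (Y \<omega>)) - \<phi> (Y \<omega>)) * (\<phi> (graduated n (Y \<omega>)) - \<phi> (Y \<omega>)) * \<psi> (Y \<omega>) \<partial>M)" for n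
    proof (cases "n = 0")
      case False
      have "(\<integral>y. (real n)\<^sup>2 * g n y * \<psi> y \<partial>distr M borel Y) = (real n)\<^sup>2 * (\<integral>\<omega>. \<psi> (Y \<omega>) * g n (Y \<omega>) \<partial>M)"
        by (subst integral_distr, measurable) (subst integral_mult_right_zero[symmetric], simp add: mult_ac)
      also have "(\<integral>\<omega>. \<psi> (Y \<omega>) * g n (Y \<omega>) \<partial>M) = (\<integral>\<omega>. \<psi> (Y \<omega>) * real_cond_exp M F (Z n) \<omega> \<partial>M)"
        by (rule integral_cong_AE) (use gZ[of n] in \<open>auto elim!: eventually_mono\<close>)
      also have "\<dots> = (\<integral>\<omega>. \<psi> (Y \<omega>) * Z n \<omega> \<partial>M)"
      proof (rule sub.real_cond_exp_intg(2))
        show "integrable M (\<lambda>\<omega>. \<psi> (Y \<omega>) * Z n \<omega>)"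
          using integrable_mult_bounded[OF iZ, of n "\<lambda>\<omega>. \<psi> (Y \<omega>)" C] False C by (simp add: mult.commute)
        show "(\<lambda>\<omega>. \<psi> (Y \<omega>)) \<in> borel_measurable F" using Y_F by measurable
      qed measurable
      finally show ?thesis by (simp add: Z_def power2_eq_square mult_ac)
    qed simp
    moreover have "(\<integral>y. 1/12 * (\<Sum>i\<in>UNIV. (partial_deriv i \<phi> y)\<^sup>2) * \<psi> y \<partial>distr M borel Y)
      = (\<integral>\<omega>. 1/12 * (\<Sum>i\<in>UNIV. partial_deriv i \<phi> (Y \<omega>) * partial_deriv i \<phi> (Y \<omega>)) * \<psi> (Y \<omega>) \<partial>M)"
      by (subst integral_distr) (auto simp: power2_eq_square)
    ultimately show "(\<lambda>n. \<integral>y. (real n)\<^sup>2 * g n y * \<psi> y \<partial>distr M borel Y)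
      \<longlonglongrightarrow> (\<integral>y. 1/12 * (\<Sum>i\<in>UNIV. (partial_deriv i \<phi> y)\<^sup>2) * \<psi> y \<partial>distr M borel Y)"
      using quadratic_increment[OF \<phi> \<phi>, of "\<lambda>\<omega>. \<psi> (Y \<omega>)" C] C by simp
  qed
qed

lemma mean_square_increment:
  assumes \<phi>: "of_class_C 1 \<phi>" "L-lipschitz_on UNIV \<phi>"
  shows "(\<lambda>n. (real n)\<^sup>2 * (\<integral>\<omega>. (\<phi> (graduated n (Y \<omega>)) - \<phi> (Y \<omega>))\<^sup>2 \<partial>M))
     \<longlonglongrightarrow> (\<integral>y. 1/12 * (\<Sum>i\<in>UNIV. (partial_deriv i \<phi> y)\<^sup>2) \<partial>distr M borel Y)"
proof -
  have [measurable]: "\<And>i. partial_deriv i \<phi> \<in> borel_measurable borel"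
    using \<phi>(1) by (auto simp: of_class_C_1 intro: borel_measurable_continuous_onI)
  have "(\<integral>y. 1/12 * (\<Sum>i\<in>UNIV. (partial_deriv i \<phi> y)\<^sup>2) \<partial>distr M borel Y)
     = (\<integral>\<omega>. 1/12 * (\<Sum>i\<in>UNIV. partial_deriv i \<phi> (Y \<omega>) * partial_deriv i \<phi> (Y \<omega>)) * 1 \<partial>M)"
    by (subst integral_distr) (auto simp: power2_eq_square)
  then show ?thesis using quadratic_increment[OF \<phi> \<phi>, of "\<lambda>_. 1" 1] by (simp add: power2_eq_square)
qed

end

section \<open>Equidistribution for absolutely continuous laws\<close>

text \<open>Boxes generate the Borel sets and are stable under intersection, so complements and
  disjoint countable unions suffice.\<close>

lemma borel_box_induct [consumes 1, case_names box empty compl union]: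
  fixes A :: "'a::euclidean_space set"
  assumes "A \<in> sets borel"
    and "\<And>a b. P (box a b)" "P {}" "\<And>A. A \<in> sets borel \<Longrightarrow> P A \<Longrightarrow> P (- A)"
    and "\<And>A. disjoint_family A \<Longrightarrow> range A \<subseteq> sets borel \<Longrightarrow> (\<And>i::nat. P (A i)) \<Longrightarrow> P (\<Union>i. A i)"
  shows "P A"
proof -
  let ?G = "range (\<lambda>(a, b). box a b :: 'a set)"
  have b: "sets borel = sigma_sets UNIV ?G" by (subst borel_eq_box) simp
  have "Int_stable ?G" by (auto simp: Int_stable_def box_Int_box)
  moreover have "?G \<subseteq> Pow UNIV" by simp
  moreover have "A \<in> sigma_sets UNIV ?G" using assms(1) b by simp
  ultimately show ?thesis
    by (induction rule: sigma_sets_induct_disjoint) (use assms b in \<open>auto simp: Compl_eq_Diff_UNIV\<close>)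
qed

context uniform_vector
begin

text \<open>As \<open>f\<close> is merely Borel, it is left untouched and the weight is perturbed.
  Translating y by v / n turns \<open>theta (n y)\<close> into \<open>theta (n y + v)\<close> and
  changes the continuous weight very little; averaging v over the law of \<open>V\<close> then gives
  the limit exactly, by invariance.\<close>

lemma equidistribution_continuous:
  fixes w f :: "real^'d \<Rightarrow> real"
  assumes w: "continuous_on UNIV w" and supp: "\<And>y. norm y > R \<Longrightarrow> w y = 0"
    and f[measurable]: "f \<in> borel_measurable borel" and C: "\<And>v. \<bar>f v\<bar> \<le> C"
  shows "integrable lborel w"
    and "(\<lambda>n. \<integral>y. w y * f (theta (real n *\<^sub>R y)) \<partial>lborel) \<longlonglongrightarrow> (\<integral>y. w y \<partial>lborel) * (\<integral>\<omega>. f (V \<omega>) \<partial>M)"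
proof -
  have w_m[measurable]: "w \<in> borel_measurable borel" using w by (rule borel_measurable_continuous_onI)
  have C0: "0 \<le> C" using C[of undefined] by linarith
  show iw: "integrable lborel w"
  proof -
    have "integrable lborel (\<lambda>x. indicator (cball 0 R) x *\<^sub>R w x)"
      by (rule borel_integrable_compact[OF compact_cball continuous_on_subset[OF w]]) auto
    then show ?thesis by (rule Bochner_Integration.integrable_cong[THEN iffD1, rotated 2])
      (auto simp: indicator_def not_le supp)
  qed
  interpret pair_sigma_finite M lborel by unfold_locales
  \<comment> \<open>The oscillating factor is shifted by \<open>V\<close> while \<open>w\<close>
    stays in place. By Fubini and \<open>integral_theta_shift\<close> the mean of \<open>G n\<close>
    over \<omega> is exactly the claimed limit, for every n.\<close>
  define G where "G n \<omega> = (\<integral>y. w y * f (theta (real n *\<^sub>R y + V \<omega>)) \<partial>lborel)" for n \<omega>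
  have iG2: "integrable (M \<Otimes>\<^sub>M lborel) (\<lambda>(\<omega>, y). w y * f (theta (real n *\<^sub>R y + V \<omega>)))" for n
  proof (rule Fubini_integrable)
    have b: "\<bar>w y * f v\<bar> \<le> C * \<bar>w y\<bar>" for y v
      using mult_left_mono[OF C[of v] abs_ge_zero[of "w y"]] by (simp add: abs_mult mult.commute)
    show "AE \<omega> in M. integrable lborel (\<lambda>y. case (\<omega>, y) of (\<omega>, y) \<Rightarrow> w y * f (theta (real n *\<^sub>R y + V \<omega>)))"
      by (rule AE_I2) (auto intro!: Bochner_Integration.integrable_bound[OF integrable_mult_right[OF integrable_abs[OF iw], of C]] simp: b C0)
    show "integrable M (\<lambda>\<omega>. \<integral>y. norm (case (\<omega>, y) of (\<omega>, y) \<Rightarrow> w y * f (theta (real n *\<^sub>R y + V \<omega>))) \<partial>lborel)"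
    proof (rule integrable_const_bound[where B="C * (\<integral>y. \<bar>w y\<bar> \<partial>lborel)"])
      show "AE \<omega> in M. norm (\<integral>y. norm (case (\<omega>, y) of (\<omega>, y) \<Rightarrow> w y * f (theta (real n *\<^sub>R y + V \<omega>))) \<partial>lborel) \<le> C * (\<integral>y. \<bar>w y\<bar> \<partial>lborel)"
      proof (rule AE_I2)
        fix \<omega>
        have "(\<integral>y. \<bar>w y * f (theta (real n *\<^sub>R y + V \<omega>))\<bar> \<partial>lborel) \<le> (\<integral>y. C * \<bar>w y\<bar> \<partial>lborel)"
          by (rule integral_mono')  (use iw b C0 in auto)
        then show "norm (\<integral>y. norm (case (\<omega>, y) of (\<omega>, y) \<Rightarrow> w y * f (theta (real n *\<^sub>R y + V \<omega>))) \<partial>lborel) \<le> C * (\<integral>y. \<bar>w y\<bar> \<partial>lborel)"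
          by simp
      qed
    qed measurable
  qed measurable
  have EG: "(\<integral>\<omega>. G n \<omega> \<partial>M) = (\<integral>y. w y \<partial>lborel) * (\<integral>\<omega>. f (V \<omega>) \<partial>M)" for n
  proof -
    have "(\<integral>\<omega>. G n \<omega> \<partial>M) = (\<integral>y. \<integral>\<omega>. w y * f (theta (real n *\<^sub>R y + V \<omega>)) \<partial>M \<partial>lborel)"
      unfolding G_def using Fubini_integral[OF iG2[of n]] by simp
    also have "\<dots> = (\<integral>y. w y * (\<integral>\<omega>. f (V \<omega>) \<partial>M) \<partial>lborel)"
      by (simp add: integral_theta_shift)
    finally show ?thesis by simp
  qed
  have iG: "integrable M (G n)" for n
    unfolding G_def using integrable_fst'[OF iG2[of n]] by simp
  show "(\<lambda>n. \<integral>y. w y * f (theta (real n *\<^sub>R y)) \<partial>lborel) \<longlonglongrightarrow> (\<integral>y. w y \<partial>lborel) * (\<integral>\<omega>. f (V \<omega>) \<partial>M)"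
    unfolding LIMSEQ_iff
  proof (intro allI impI)
    fix e :: real assume e: "e > 0"
    define D where "D = real CARD('d)"
    have D0: "0 \<le> D" by (simp add: D_def)
    \<comment> \<open>Volume of a ball outside which \<open>w\<close> and all its translates by
      vectors of norm at most \<open>D\<close> vanish.\<close>
    define B where "B = measure lborel (cball (0::real^'d) (R + D))"
    define e' where "e' = e / (C * B + 1)"
    have CB: "0 \<le> C * B" using C0 by (simp add: B_def)
    have e': "e' > 0" "C * B * e' < e" using e CB by (simp_all add: e'_def field_simps add_pos_nonneg)
    have "uniformly_continuous_on (cball 0 (R + 2 * D)) w"
      by (intro compact_uniformly_continuous continuous_on_subset[OF w]) auto
    then obtain d where d: "d > 0" and uc: "\<And>x y. x \<in> cball 0 (R + 2 * D) \<Longrightarrow> y \<in> cball 0 (R + 2 * D) \<Longrightarrow> dist y x < d \<Longrightarrow> dist (w y) (w x) < e'"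
      unfolding uniformly_continuous_on_def using e'(1) by metis
    obtain N :: nat where N: "D / d < real N" using reals_Archimedean2 by blast
    moreover have "0 \<le> D / d" using D0 d by simp
    ultimately have N0: "N > 0" by (cases N) auto
    have near: "\<bar>w (y + (1 / real n) *\<^sub>R v) - w y\<bar> \<le> indicator (cball 0 (R + D)) y * e'"
      if n: "n \<ge> N" and v: "norm v \<le> D" for n y v
    proof -
      have n1: "real n \<ge> 1" using n N0 by simp
      have nv: "norm ((1 / real n) *\<^sub>R v) \<le> D" "norm ((1 / real n) *\<^sub>R v) < d"
      proof -
        have "norm v / real n \<le> D / real n" using v by (intro divide_right_mono) auto
        moreover have "D / real n \<le> D" using D0 n1 by (simp add: divide_le_eq mult_le_cancel_left1)
        ultimately show "norm ((1 / real n) *\<^sub>R v) \<le> D" by simp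
        have "D / real n < d"
        proof -
          have "D < d * real N" using N d by (simp add: field_simps)
          also have "\<dots> \<le> d * real n" using d n by simp
          finally show ?thesis using n1 by (simp add: field_simps)
        qed
        with \<open>norm v / real n \<le> D / real n\<close> show "norm ((1 / real n) *\<^sub>R v) < d" by simp
      qed
      show ?thesis
      proof (cases "y \<in> cball 0 (R + D)")
        case True
        have "norm (y + (1 / real n) *\<^sub>R v) \<le> R + 2 * D"
          using True nv(1) norm_triangle_ineq[of y "(1 / real n) *\<^sub>R v"] by (simp del: norm_scaleR)
        then have "dist (w (y + (1 / real n) *\<^sub>R v)) (w y) < e'"
          using True D0 nv(2) by (intro uc) (auto simp: mem_cball_0 dist_norm[of "y + _" y] simp del: norm_scaleR mem_cball)
        then show ?thesis using True by (simp add: dist_real_def)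
      next
        case False
        then have "norm y > R + D" by simp
        moreover have "norm (y + (1 / real n) *\<^sub>R v) \<ge> norm y - norm ((1 / real n) *\<^sub>R v)"
          by (metis add.commute add_diff_cancel_left' norm_triangle_ineq2 norm_minus_commute norm_triangle_ineq4 diff_le_eq)
        ultimately have "norm (y + (1 / real n) *\<^sub>R v) > R" "norm y > R" using nv(1) D0 by linarith+
        then show ?thesis using e'(1) supp by simp
      qed
    qed
    show "\<exists>N. \<forall>n\<ge>N. norm ((\<integral>y. w y * f (theta (real n *\<^sub>R y)) \<partial>lborel) - (\<integral>y. w y \<partial>lborel) * (\<integral>\<omega>. f (V \<omega>) \<partial>M)) < e"
    proof (intro exI allI impI)
      fix n assume n: "n \<ge> N"
      then have n0: "real n > 0" using N0 by simp
      define I where "I = (\<integral>y. w y * f (theta (real n *\<^sub>R y)) \<partial>lborel)"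
      have iwf: "integrable lborel (\<lambda>y. w y * f (g y))" if [measurable]: "g \<in> borel_measurable borel" for g
        by (rule integrable_mult_bounded[OF iw _ C]) measurable
      \<comment> \<open>Change of variables by v / n: the oscillating factor sees the whole of v,
        the weight only v / n.\<close>
      have shift: "I = (\<integral>y. w (y + (1 / real n) *\<^sub>R v) * f (theta (real n *\<^sub>R y + v)) \<partial>lborel)"
        and ishift: "integrable lborel (\<lambda>y. w (y + (1 / real n) *\<^sub>R v) * f (theta (real n *\<^sub>R y + v)))" for v
      proof -
        let ?c = "(1 / real n) *\<^sub>R v"
        have eq: "real n *\<^sub>R (?c + y) = real n *\<^sub>R y + v" for y
          using n0 by (simp add: scaleR_add_right)
        have "I = (\<integral>y. w y * f (theta (real n *\<^sub>R y)) \<partial>distr lborel borel ((+) ?c))"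
          by (simp add: I_def lborel_distr_plus)
        also have "\<dots> = (\<integral>y. w (?c + y) * f (theta (real n *\<^sub>R (?c + y))) \<partial>lborel)"
          by (subst integral_distr) auto
        finally show "I = (\<integral>y. w (y + ?c) * f (theta (real n *\<^sub>R y + v)) \<partial>lborel)"
          unfolding eq by (simp add: add.commute)
        have "integrable (distr lborel borel ((+) ?c)) (\<lambda>y. w y * f (theta (real n *\<^sub>R y)))"
          using iwf[of "\<lambda>y. theta (real n *\<^sub>R y)"] by (simp add: lborel_distr_plus)
        then have "integrable lborel (\<lambda>y. w (?c + y) * f (theta (real n *\<^sub>R (?c + y))))"
          by (subst (asm) integrable_distr_eq) auto
        then show "integrable lborel (\<lambda>y. w (y + ?c) * f (theta (real n *\<^sub>R y + v)))"
          unfolding eq by (simp add: add.commute)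
      qed
      have close: "\<bar>I - G n \<omega>\<bar> \<le> C * B * e'" if v: "norm (V \<omega>) \<le> D" for \<omega>
      proof -
        have "\<bar>I - G n \<omega>\<bar> = \<bar>\<integral>y. w (y + (1 / real n) *\<^sub>R V \<omega>) * f (theta (real n *\<^sub>R y + V \<omega>)) - w y * f (theta (real n *\<^sub>R y + V \<omega>)) \<partial>lborel\<bar>"
          unfolding shift[of "V \<omega>"] G_def using ishift[of "V \<omega>"] iwf by simp
        also have "\<dots> \<le> (\<integral>y. \<bar>w (y + (1 / real n) *\<^sub>R V \<omega>) * f (theta (real n *\<^sub>R y + V \<omega>)) - w y * f (theta (real n *\<^sub>R y + V \<omega>))\<bar> \<partial>lborel)"
          by (rule integral_abs_bound)
        also have "\<dots> \<le> (\<integral>y. indicator (cball 0 (R + D)) y * (e' * C) \<partial>(lborel :: (real^'d) measure))"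
        proof (rule integral_mono')
          show "integrable lborel (\<lambda>y::real^'d. indicator (cball 0 (R + D)) y * (e' * C))"
            by (intro integrable_mult_left) (auto intro!: integrable_real_indicator emeasure_bounded_finite)
          fix y
          have "\<bar>w (y + (1 / real n) *\<^sub>R V \<omega>) - w y\<bar> * \<bar>f (theta (real n *\<^sub>R y + V \<omega>))\<bar> \<le> (indicator (cball 0 (R + D)) y * e') * C"
            by (intro mult_mono near n v C) (use e' in auto)
          then show "\<bar>w (y + (1 / real n) *\<^sub>R V \<omega>) * f (theta (real n *\<^sub>R y + V \<omega>)) - w y * f (theta (real n *\<^sub>R y + V \<omega>))\<bar>
            \<le> indicator (cball 0 (R + D)) y * (e' * C)"
            by (simp add: abs_mult[symmetric] left_diff_distrib mult.assoc)
        qed (use e' C0 in auto)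
        also have "\<dots> = C * B * e'" by (simp add: B_def)
        finally show ?thesis .
      qed
      have "AE \<omega> in M. norm (V \<omega>) \<le> D"
        using AE_V
      proof eventually_elim
        case (elim \<omega>)
        have "norm (V \<omega>) \<le> (\<Sum>i\<in>UNIV. \<bar>V \<omega> $ i\<bar>)" by (rule norm_le_l1_cart)
        also have "\<dots> \<le> (\<Sum>i\<in>(UNIV::'d set). 1)" using elim by (intro sum_mono) (smt (verit) field_sum_of_halves)
        finally show ?case by (simp add: D_def)
      qed
      then have AEc: "AE \<omega> in M. \<bar>I - G n \<omega>\<bar> \<le> C * B * e'" by eventually_elim (rule close)
      have "I - (\<integral>y. w y \<partial>lborel) * (\<integral>\<omega>. f (V \<omega>) \<partial>M) = (\<integral>\<omega>. I - G n \<omega> \<partial>M)"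
        using iG[of n] by (simp add: EG prob_space)
      also have "\<bar>\<dots>\<bar> \<le> (\<integral>\<omega>. \<bar>I - G n \<omega>\<bar> \<partial>M)" by (rule integral_abs_bound)
      also have "\<dots> \<le> (\<integral>\<omega>. C * B * e' \<partial>M)" using AEc iG[of n] by (intro integral_mono_AE) auto
      also have "\<dots> < e" using e'(2) by (simp add: prob_space)
      finally show "norm ((\<integral>y. w y * f (theta (real n *\<^sub>R y)) \<partial>lborel) - (\<integral>y. w y \<partial>lborel) * (\<integral>\<omega>. f (V \<omega>) \<partial>M)) < e"
        by (simp add: I_def)
    qed
  qed
qed

section \<open>From continuous weights to integrable weights\<close>

text \<open>To be read as a property of the weight \<open>w\<close> for fixed \<open>f\<close>: the
  aim is to show that such weights are closed under the operations that generate L1. Integrability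
  is included so that these steps can be chained.\<close>

definition equidistributed :: "(real^'d \<Rightarrow> real) \<Rightarrow> (real^'d \<Rightarrow> real) \<Rightarrow> bool" where
  "equidistributed f w \<longleftrightarrow> integrable lborel w \<and>
    (\<lambda>n. \<integral>y. w y * f (theta (real n *\<^sub>R y)) \<partial>lborel) \<longlonglongrightarrow> (\<integral>y. w y \<partial>lborel) * (\<integral>\<omega>. f (V \<omega>) \<partial>M)"

context
  fixes f :: "real^'d \<Rightarrow> real" and C :: real
  assumes f[measurable]: "f \<in> borel_measurable borel" and C: "\<And>v. \<bar>f v\<bar> \<le> C"
begin

text \<open>As \<open>f\<close> is bounded by \<open>C\<close>, replacing the weight costs at most
  \<open>C\<close> times an L1 distance, for every n and in the limit alike.\<close>

lemma equidistributed_approx: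
  assumes w: "integrable lborel w"
    and app: "\<And>e. e > 0 \<Longrightarrow> \<exists>w'. equidistributed f w' \<and> (\<integral>y. \<bar>w y - w' y\<bar> \<partial>lborel) \<le> e"
  shows "equidistributed f w"
  unfolding equidistributed_def
proof (intro conjI w tendsto_of_approximations)
  fix e :: real assume e: "e > 0"
  have C0: "0 \<le> C" using C[of undefined] by linarith
  obtain w' where w': "equidistributed f w'" and ww': "(\<integral>y. \<bar>w y - w' y\<bar> \<partial>lborel) \<le> e / (C + 1)"
    using app[of "e / (C + 1)"] e C0 by auto
  have iw': "integrable lborel w'" using w' by (simp add: equidistributed_def)
  have "C * (\<integral>y. \<bar>w y - w' y\<bar> \<partial>lborel) \<le> C * (e / (C + 1))" using ww' C0 by (intro mult_left_mono)
  also have "\<dots> \<le> e" using e C0 by (simp add: field_simps)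
  finally have Ce: "C * (\<integral>y. \<bar>w y - w' y\<bar> \<partial>lborel) \<le> e" .
  have "\<bar>(\<integral>y. w y * f (theta (real n *\<^sub>R y)) \<partial>lborel) - (\<integral>y. w' y * f (theta (real n *\<^sub>R y)) \<partial>lborel)\<bar> \<le> e" for n
  proof -
    have int: "integrable lborel (\<lambda>y. w y * f (theta (real n *\<^sub>R y)))" "integrable lborel (\<lambda>y. w' y * f (theta (real n *\<^sub>R y)))"
      by (rule integrable_mult_bounded[OF w _ C] integrable_mult_bounded[OF iw' _ C]; measurable)+
    have "\<bar>(\<integral>y. w y * f (theta (real n *\<^sub>R y)) \<partial>lborel) - (\<integral>y. w' y * f (theta (real n *\<^sub>R y)) \<partial>lborel)\<bar>
      = \<bar>\<integral>y. w y * f (theta (real n *\<^sub>R y)) - w' y * f (theta (real n *\<^sub>R y)) \<partial>lborel\<bar>" using int by simp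
    also have "\<dots> \<le> (\<integral>y. \<bar>w y * f (theta (real n *\<^sub>R y)) - w' y * f (theta (real n *\<^sub>R y))\<bar> \<partial>lborel)" by (rule integral_abs_bound)
    also have "\<dots> \<le> (\<integral>y. C * \<bar>w y - w' y\<bar> \<partial>lborel)"
    proof (rule integral_mono')
      show "\<bar>w y * f (theta (real n *\<^sub>R y)) - w' y * f (theta (real n *\<^sub>R y))\<bar> \<le> C * \<bar>w y - w' y\<bar>" for y
        using mult_left_mono[OF C[of "theta (real n *\<^sub>R y)"] abs_ge_zero[of "w y - w' y"]]
        by (simp add: left_diff_distrib[symmetric] abs_mult mult.commute)
    qed (use w iw' C0 in auto)
    finally show ?thesis using Ce by simp
  qed
  moreover have "\<bar>(\<integral>y. w' y \<partial>lborel) * (\<integral>\<omega>. f (V \<omega>) \<partial>M) - (\<integral>y. w y \<partial>lborel) * (\<integral>\<omega>. f (V \<omega>) \<partial>M)\<bar> \<le> e"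
  proof -
    have "\<bar>\<integral>\<omega>. f (V \<omega>) \<partial>M\<bar> \<le> (\<integral>\<omega>. \<bar>f (V \<omega>)\<bar> \<partial>M)" by (rule integral_abs_bound)
    also have "\<dots> \<le> (\<integral>\<omega>. C \<partial>M)" by (rule integral_mono') (use C C0 in auto)
    finally have 1: "\<bar>\<integral>\<omega>. f (V \<omega>) \<partial>M\<bar> \<le> C" by (simp add: prob_space)
    have "\<bar>(\<integral>y. w' y \<partial>lborel) - (\<integral>y. w y \<partial>lborel)\<bar> = \<bar>\<integral>y. w y - w' y \<partial>lborel\<bar>" using w iw' by simp
    also have "\<dots> \<le> (\<integral>y. \<bar>w y - w' y\<bar> \<partial>lborel)" by (rule integral_abs_bound)
    finally have "\<bar>\<integral>\<omega>. f (V \<omega>) \<partial>M\<bar> * \<bar>(\<integral>y. w' y \<partial>lborel) - (\<integral>y. w y \<partial>lborel)\<bar> \<le> C * (\<integral>y. \<bar>w y - w' y\<bar> \<partial>lborel)"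
      using 1 C0 by (intro mult_mono) auto
    then show ?thesis using Ce by (simp add: abs_mult[symmetric] right_diff_distrib mult.commute)
  qed
  ultimately show "\<exists>b l'. b \<longlonglongrightarrow> l' \<and>
     (\<forall>\<^sub>F n in sequentially. \<bar>(\<integral>y. w y * f (theta (real n *\<^sub>R y)) \<partial>lborel) - b n\<bar> \<le> e) \<and>
     \<bar>l' - (\<integral>y. w y \<partial>lborel) * (\<integral>\<omega>. f (V \<omega>) \<partial>M)\<bar> \<le> e"
    using w' unfolding equidistributed_def by (auto intro!: exI)
qed

lemma equidistributed_limit:
  assumes w: "integrable lborel w" and s: "\<And>k::nat. equidistributed f (s k)"
    and lim: "\<And>y. (\<lambda>k. s k y) \<longlonglongrightarrow> w y" and dom: "integrable lborel g" "\<And>k y. \<bar>w y - s k y\<bar> \<le> g y"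
  shows "equidistributed f w"
proof (rule equidistributed_approx[OF w])
  fix e :: real assume e: "e > 0"
  have [measurable]: "w \<in> borel_measurable borel" "s k \<in> borel_measurable borel" for k
    using borel_measurable_integrable[OF w] s[of k, unfolded equidistributed_def, THEN conjunct1, THEN borel_measurable_integrable]
    by simp_all
  have "(\<lambda>k. \<integral>y. \<bar>w y - s k y\<bar> \<partial>lborel) \<longlonglongrightarrow> (\<integral>y. 0 \<partial>(lborel :: (real^'d) measure))"
  proof (rule integral_dominated_convergence[where w=g])
    show "AE y in lborel. (\<lambda>k. \<bar>w y - s k y\<bar>) \<longlonglongrightarrow> 0"
    proof (intro AE_I2 tendsto_rabs_zero)
      show "(\<lambda>k. w y - s k y) \<longlonglongrightarrow> 0" for y using tendsto_diff[OF tendsto_const[of "w y"] lim[of y]] by simp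
    qed
  qed (use dom in auto)
  then have "\<forall>\<^sub>F k in sequentially. (\<integral>y. \<bar>w y - s k y\<bar> \<partial>lborel) < e"
    using e by (intro order_tendstoD) auto
  then show "\<exists>w'. equidistributed f w' \<and> (\<integral>y. \<bar>w y - w' y\<bar> \<partial>lborel) \<le> e"
    using s by (auto simp: eventually_sequentially intro: less_imp_le)
qed

lemma equidistributed_add:
  assumes "equidistributed f w" "equidistributed f u"
  shows "equidistributed f (\<lambda>y. w y + u y)"
proof -
  have int: "integrable lborel w" "integrable lborel u" using assms by (auto simp: equidistributed_def)
  have "integrable lborel (\<lambda>y. w y * f (theta (real n *\<^sub>R y)))" "integrable lborel (\<lambda>y. u y * f (theta (real n *\<^sub>R y)))" for n
    by (rule integrable_mult_bounded[OF int(1) _ C] integrable_mult_bounded[OF int(2) _ C]; measurable)+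
  then show ?thesis using assms int tendsto_add by (fastforce simp: equidistributed_def distrib_right)
qed

lemma equidistributed_scale: "equidistributed f w \<Longrightarrow> equidistributed f (\<lambda>y. c * w y)"
  using tendsto_mult_left[of _ _ sequentially c] by (fastforce simp: equidistributed_def mult.assoc)

lemma equidistributed_box: "equidistributed f (indicator (box a b))"
proof (cases "box a b = {}")
  case True
  then show ?thesis by (simp add: equidistributed_def)
next
  case False
  have int: "integrable lborel (indicator (box a b) :: real^'d \<Rightarrow> real)"
    by (auto intro!: integrable_real_indicator emeasure_bounded_finite)
  have closed: "closed (- box a b)" by (simp add: open_box closed_Compl)
  have ne: "- box a b \<noteq> {}" using bounded_box[of a b] not_bounded_UNIV by (metis double_complement Compl_empty_eq)
  \<comment> \<open>Continuous functions vanishing off the box that increase to its indicator. That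
    the complement is nonempty matters because the distance to the empty set is 0 by
    convention.\<close>
  define s where "s k y = min 1 (real k * infdist y (- box a b))" for k :: nat and y
  obtain R where R: "\<And>y. y \<in> box a b \<Longrightarrow> norm y \<le> R" using bounded_box[of a b] by (auto simp: bounded_iff)
  have s0: "s k y = 0" if "y \<notin> box a b" for k y using that by (simp add: s_def)
  have s1: "0 \<le> s k y" "s k y \<le> 1" for k y using infdist_nonneg[of y "- box a b"] by (auto simp: s_def)
  show ?thesis
  proof (rule equidistributed_limit[OF int _ _ int])
    show "equidistributed f (s k)" for k
      unfolding equidistributed_def
    proof (intro conjI)
      have c: "continuous_on UNIV (s k)" unfolding s_def by (intro continuous_intros)
      have z: "s k y = 0" if "norm y > R" for y using R that by (intro s0) force
      show "integrable lborel (s k)" by (rule equidistribution_continuous(1)[OF c z f C])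
      show "(\<lambda>n. \<integral>y. s k y * f (theta (real n *\<^sub>R y)) \<partial>lborel) \<longlonglongrightarrow> (\<integral>y. s k y \<partial>lborel) * (\<integral>\<omega>. f (V \<omega>) \<partial>M)"
        by (rule equidistribution_continuous(2)[OF c z f C])
    qed
    show "(\<lambda>k. s k y) \<longlonglongrightarrow> indicator (box a b) y" for y
    proof (cases "y \<in> box a b")
      case True
      then have pos: "infdist y (- box a b) > 0" using infdist_pos_not_in_closed[OF closed ne] by simp
      obtain k0 :: nat where k0: "real k0 * infdist y (- box a b) > 1" using reals_Archimedean3[OF pos] by blast
      have "s k y = 1" if "k \<ge> k0" for k
      proof -
        have "real k0 * infdist y (- box a b) \<le> real k * infdist y (- box a b)" using pos that by simp
        then show ?thesis using k0 by (simp add: s_def)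
      qed
      then show ?thesis using True by (intro tendsto_eventually) (auto simp: eventually_sequentially)
    qed (simp add: s0)
    show "\<bar>indicator (box a b) y - s k y\<bar> \<le> indicator (box a b) y" for k y
      using s1[of k y] s0[of y k] by (cases "y \<in> box a b") auto
  qed
qed

text \<open>Intersecting with a fixed box keeps complements integrable, so that the induction over
  Borel sets never leaves L1.\<close>

lemma equidistributed_indicator_bounded:
  assumes "A \<in> sets borel"
  shows "equidistributed f (indicator (A \<inter> box a b))"
  using assms
proof (induction rule: borel_box_induct)
  case (box c d)
  then show ?case by (simp only: box_Int_box equidistributed_box)
next
  case empty
  then show ?case by (simp add: equidistributed_def)
next
  case (compl A)
  have "(\<lambda>y. indicator (box a b) y + (-1) * indicator (A \<inter> box a b) y) = (indicator (- A \<inter> box a b) :: real^'d \<Rightarrow> real)"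
    by (auto simp: indicator_def)
  then show ?case
    using equidistributed_add[OF equidistributed_box[of a b] equidistributed_scale[OF compl(2), of "-1"]] by simp
next
  case (union A)
  have A[measurable]: "A i \<in> sets borel" for i using union by auto
  have ibox: "integrable lborel (indicator (box a b) :: real^'d \<Rightarrow> real)"
    by (auto intro!: integrable_real_indicator emeasure_bounded_finite)
  have int: "integrable lborel (indicator (B \<inter> box a b) :: real^'d \<Rightarrow> real)" if [measurable]: "B \<in> sets borel" for B
    by (rule Bochner_Integration.integrable_bound[OF ibox]) (auto simp: indicator_def)
  define s where "s k = (indicator ((\<Union>i<k. A i) \<inter> box a b) :: real^'d \<Rightarrow> real)" for k :: nat
  show ?case
  proof (rule equidistributed_limit[where s=s, OF int _ _ ibox])
    show "equidistributed f (s k)" for k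
    proof (induction k)
      case 0 then show ?case by (simp add: s_def equidistributed_def)
    next
      case (Suc k)
      have "A k \<inter> A i = {}" if "i < k" for i using union(1) that by (auto simp: disjoint_family_on_def)
      then have "s (Suc k) = (\<lambda>y. s k y + indicator (A k \<inter> box a b) y)"
        by (auto simp: s_def indicator_def fun_eq_iff less_Suc_eq)
      then show ?case using equidistributed_add[OF Suc union(3)] by simp
    qed
    show "(\<lambda>k. s k y) \<longlonglongrightarrow> indicator ((\<Union>i. A i) \<inter> box a b) y" for y
    proof (rule tendsto_eventually)
      show "\<forall>\<^sub>F k in sequentially. s k y = indicator ((\<Union>i. A i) \<inter> box a b) y"
      proof (cases "\<exists>i. y \<in> A i")
        case True
        then obtain i where "y \<in> A i" by blast
        then show ?thesis unfolding eventually_sequentially s_def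
          by (intro exI[of _ "Suc i"]) (auto simp: indicator_def)
      qed (auto simp: s_def indicator_def)
    qed
    show "\<bar>indicator ((\<Union>i. A i) \<inter> box a b) y - s k y\<bar> \<le> indicator (box a b) y" for k y
      by (auto simp: s_def indicator_def)
  qed auto
qed

lemma equidistribution_L1:
  assumes "integrable lborel w"
  shows "equidistributed f w"
  using assms
proof (induction rule: integrable_induct)
  case (base A c)
  then have A[measurable]: "A \<in> sets borel" by simp
  have iA: "integrable lborel (indicator A :: real^'d \<Rightarrow> real)" using base by (intro integrable_real_indicator) auto
  let ?B = "\<lambda>k::nat. box (- (real k *\<^sub>R One)) (real k *\<^sub>R One) :: (real^'d) set"
  have "equidistributed f (indicator A)"
  proof (rule equidistributed_limit[where s="\<lambda>k. indicator (A \<inter> ?B k)", OF iA _ _ iA])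
    show "equidistributed f (indicator (A \<inter> ?B k))" for k by (rule equidistributed_indicator_bounded[OF A])
    show "(\<lambda>k. indicator (A \<inter> ?B k) y) \<longlonglongrightarrow> (indicator A y :: real)" for y
    proof (rule tendsto_eventually)
      obtain k0 :: nat where k0: "norm y < real k0" using reals_Archimedean2 by blast
      have "y \<in> ?B k" if "k \<ge> k0" for k
        unfolding mem_box
      proof (intro ballI)
        fix b :: "real^'d" assume b: "b \<in> Basis"
        then have "\<bar>y \<bullet> b\<bar> < real k" using Basis_le_norm[OF b, of y] k0 that by simp
        then show "- (real k *\<^sub>R One) \<bullet> b < y \<bullet> b \<and> y \<bullet> b < (real k *\<^sub>R One) \<bullet> b"
          using b by (auto simp: abs_less_iff minus_less_iff)
      qed
      then show "\<forall>\<^sub>F k in sequentially. indicator (A \<inter> ?B k) y = (indicator A y :: real)"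
        unfolding eventually_sequentially by (intro exI[of _ k0]) (auto simp: indicator_def)
    qed
  qed (auto simp: indicator_def)
  from equidistributed_scale[OF this, of c] show ?case by (simp add: mult.commute)
next
  case (add w u)
  then show ?case by (intro equidistributed_add)
next
  case (lim w s)
  show ?case
  \<comment> \<open>The simple functions supplied by the induction are bounded by twice
    \<open>\<bar>w\<bar>\<close>, whence the factor 3.\<close>
  proof (rule equidistributed_limit[where s=s and g="\<lambda>y. 3 * \<bar>w y\<bar>"])
    show "\<bar>w y - s k y\<bar> \<le> 3 * \<bar>w y\<bar>" for k y
    proof -
      have "\<bar>s k y\<bar> \<le> 2 * \<bar>w y\<bar>" using lim.hyps(3)[of y k] by simp
      then show ?thesis by linarith
    qed
  qed (use lim in auto)
qed

end

text \<open>For a bounded nonnegative \<open>W\<close>, the image under \<open>Y\<close> of the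
  measure with density \<open>W\<close> is absolutely continuous, and its Radon-Nikodym density is
  an L1 weight on Euclidean space to which equidistribution applies. A signed weight is treated as
  the difference of \<open>W + B\<close> and the constant \<open>B\<close>.\<close>

lemma weak_absolutely_continuous:
  fixes Y :: "'a \<Rightarrow> real^'d" and W :: "'a \<Rightarrow> real"
  assumes Y[measurable]: "Y \<in> borel_measurable M" and ac: "absolutely_continuous lborel (distr M borel Y)"
    and f[measurable]: "f \<in> borel_measurable borel" and C: "\<And>v. \<bar>f v\<bar> \<le> C"
    and W[measurable]: "W \<in> borel_measurable M" and B: "\<And>\<omega>. \<bar>W \<omega>\<bar> \<le> B"
  shows "(\<lambda>n. \<integral>\<omega>. W \<omega> * f (theta (real n *\<^sub>R Y \<omega>)) \<partial>M) \<longlonglongrightarrow> (\<integral>\<omega>. W \<omega> \<partial>M) * (\<integral>\<omega>. f (V \<omega>) \<partial>M)"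
proof -
  have pos: "(\<lambda>n. \<integral>\<omega>. W \<omega> * f (theta (real n *\<^sub>R Y \<omega>)) \<partial>M) \<longlonglongrightarrow> (\<integral>\<omega>. W \<omega> \<partial>M) * (\<integral>\<omega>. f (V \<omega>) \<partial>M)"
    if [measurable]: "W \<in> borel_measurable M" and B: "\<And>\<omega>. 0 \<le> W \<omega>" "\<And>\<omega>. W \<omega> \<le> b" for W :: "'a \<Rightarrow> real" and b :: real
  proof -
    define D where "D = distr (density M (\<lambda>\<omega>. ennreal (W \<omega>))) borel Y"
    have iW: "integrable M W" by (rule integrable_const_bound[where B=b]) (use B in auto)
    have emD: "emeasure D A = (\<integral>\<^sup>+\<omega>. ennreal (W \<omega>) * indicator (Y -` A \<inter> space M) \<omega> \<partial>M)" if [measurable]: "A \<in> sets borel" for A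
      unfolding D_def by (subst emeasure_distr) (auto simp: emeasure_density)
    have fin: "finite_measure D"
    proof
      have "emeasure D (space D) = (\<integral>\<^sup>+\<omega>. ennreal (W \<omega>) * indicator (Y -` UNIV \<inter> space M) \<omega> \<partial>M)"
        using emD[of UNIV] by (simp add: D_def)
      also have "\<dots> \<le> (\<integral>\<^sup>+\<omega>. ennreal b \<partial>M)"
        using B by (intro nn_integral_mono) (auto simp: indicator_def ennreal_leI)
      also have "\<dots> < \<infinity>" by (simp add: emeasure_space_1)
      finally show "emeasure D (space D) \<noteq> \<infinity>" by simp
    qed
    have acD: "absolutely_continuous lborel D"
      unfolding absolutely_continuous_def
    proof
      fix A assume A: "A \<in> null_sets (lborel :: (real^'d) measure)"
      then have [measurable]: "A \<in> sets borel" by auto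
      have "A \<in> null_sets (distr M borel Y)" using ac A by (auto simp: absolutely_continuous_def)
      then have "AE \<omega> in M. Y \<omega> \<notin> A" by (subst (asm) null_sets_distr_iff) (auto simp: AE_iff_null vimage_def Int_def conj_commute intro: AE_I')
      then have "(\<integral>\<^sup>+\<omega>. ennreal (W \<omega>) * indicator (Y -` A \<inter> space M) \<omega> \<partial>M) = (\<integral>\<^sup>+\<omega>. 0 \<partial>M)"
        by (intro nn_integral_cong_AE) (auto elim!: eventually_mono simp: indicator_def)
      then show "A \<in> null_sets D" by (intro null_setsI) (simp_all add: emD, simp add: D_def)
    qed
    have "sets D = sets lborel" by (simp add: D_def)
    from sigma_finite_measure.Radon_Nikodym[OF sigma_finite_lborel acD this] obtain w0 where w0[measurable]: "w0 \<in> borel_measurable lborel"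
      and Dw0: "density lborel w0 = D" by blast
    have w0fin: "(\<integral>\<^sup>+y. w0 y \<partial>lborel) \<noteq> \<infinity>"
      using finite_measure.emeasure_finite[OF fin, of "space D"] unfolding Dw0[symmetric]
      by (simp add: emeasure_density)
    define w where "w y = enn2real (w0 y)" for y
    have w0w: "AE y in lborel. w0 y = ennreal (w y)"
      using nn_integral_PInf_AE[OF w0 w0fin] by eventually_elim (simp add: w_def less_top)
    have [measurable]: "w \<in> borel_measurable borel" unfolding w_def by measurable
    have w_pos: "0 \<le> w y" for y by (simp add: w_def)
    have Dw: "D = density lborel (\<lambda>y. ennreal (w y))"
      unfolding Dw0[symmetric] by (rule density_cong) (use w0w in auto)
    have iw: "integrable lborel w"
    proof (rule integrableI_nonneg)
      have "(\<integral>\<^sup>+y. ennreal (w y) \<partial>lborel) = (\<integral>\<^sup>+y. w0 y \<partial>lborel)"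
        by (rule nn_integral_cong_AE) (use w0w in \<open>auto elim!: eventually_mono\<close>)
      then show "(\<integral>\<^sup>+y. ennreal (w y) \<partial>lborel) < \<infinity>" using w0fin by (simp add: less_top)
    qed (auto simp: w_pos)
    have transfer: "(\<integral>\<omega>. W \<omega> * g (Y \<omega>) \<partial>M) = (\<integral>y. w y * g y \<partial>lborel)" if [measurable]: "g \<in> borel_measurable borel" for g :: "real^'d \<Rightarrow> real"
    proof -
      have "(\<integral>\<omega>. W \<omega> * g (Y \<omega>) \<partial>M) = (\<integral>\<omega>. g (Y \<omega>) \<partial>density M (\<lambda>\<omega>. ennreal (W \<omega>)))"
        by (subst integral_density) (use B in auto)
      also have "\<dots> = (\<integral>y. g y \<partial>D)" unfolding D_def by (subst integral_distr) auto
      also have "\<dots> = (\<integral>y. w y * g y \<partial>lborel)"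
        unfolding Dw by (subst integral_density) (use w_pos in auto)
      finally show ?thesis .
    qed
    have "(\<integral>\<omega>. W \<omega> \<partial>M) = (\<integral>y. w y \<partial>lborel)" using transfer[of "\<lambda>_. 1"] by simp
    moreover have "(\<integral>\<omega>. W \<omega> * f (theta (real n *\<^sub>R Y \<omega>)) \<partial>M) = (\<integral>y. w y * f (theta (real n *\<^sub>R y)) \<partial>lborel)" for n
      by (rule transfer) measurable
    ultimately show ?thesis using equidistribution_L1[OF f C iw] by (simp add: equidistributed_def)
  qed
  have B0: "0 \<le> B" using B[of undefined] by linarith
  have 1: "(\<lambda>n. \<integral>\<omega>. (W \<omega> + B) * f (theta (real n *\<^sub>R Y \<omega>)) \<partial>M) \<longlonglongrightarrow> (\<integral>\<omega>. W \<omega> + B \<partial>M) * (\<integral>\<omega>. f (V \<omega>) \<partial>M)"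
  proof (rule pos[of "\<lambda>\<omega>. W \<omega> + B" "2 * B"])
    show "0 \<le> W \<omega> + B" "W \<omega> + B \<le> 2 * B" for \<omega> using B[of \<omega>] by (auto simp: abs_le_iff)
  qed measurable
  have 2: "(\<lambda>n. \<integral>\<omega>. B * f (theta (real n *\<^sub>R Y \<omega>)) \<partial>M) \<longlonglongrightarrow> (\<integral>\<omega>. B \<partial>M) * (\<integral>\<omega>. f (V \<omega>) \<partial>M)"
    by (rule pos[of "\<lambda>\<omega>. B" B]) (use B0 in auto)
  have iW: "integrable M W" by (rule integrable_const_bound[where B=B]) (use B in auto)
  have int: "integrable M (\<lambda>\<omega>. f (theta (real n *\<^sub>R Y \<omega>)))" for n
    by (rule integrable_const_bound[where B=C]) (use C in auto)
  have iWf: "integrable M (\<lambda>\<omega>. W \<omega> * f (theta (real n *\<^sub>R Y \<omega>)))" for n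
    by (rule integrable_mult_bounded[OF iW _ C]) measurable
  show ?thesis using tendsto_diff[OF 1 2] iW int iWf
    by (simp add: distrib_right prob_space)
qed

end

section \<open>Integration by parts against the sawtooth\<close>

lemma partial_deriv_mult:
  fixes f g :: "real^'d \<Rightarrow> real"
  assumes "\<And>x. f differentiable (at x)" "\<And>x. g differentiable (at x)"
  shows "partial_deriv i (\<lambda>x. f x * g x) = (\<lambda>x. partial_deriv i f x * g x + f x * partial_deriv i g x)"
proof
  fix x
  show "partial_deriv i (\<lambda>x. f x * g x) x = partial_deriv i f x * g x + f x * partial_deriv i g x"
    using DERIV_mult[OF DERIV_partial_deriv[OF assms(1), of x i 0] DERIV_partial_deriv[OF assms(2), of x i 0]]
    by (intro partial_deriv_eqI) (simp add: algebra_simps)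
qed

lemma partial_deriv_add:
  fixes f g :: "real^'d \<Rightarrow> real"
  assumes "\<And>x. f differentiable (at x)" "\<And>x. g differentiable (at x)"
  shows "partial_deriv i (\<lambda>x. f x + g x) = (\<lambda>x. partial_deriv i f x + partial_deriv i g x)"
proof
  fix x
  show "partial_deriv i (\<lambda>x. f x + g x) x = partial_deriv i f x + partial_deriv i g x"
    using DERIV_add[OF DERIV_partial_deriv[OF assms(1), of x i 0] DERIV_partial_deriv[OF assms(2), of x i 0]]
    by (intro partial_deriv_eqI) simp
qed

lemma of_class_C_add:
  "of_class_C k f \<Longrightarrow> of_class_C k g \<Longrightarrow> of_class_C k (\<lambda>x. f x + g x)"
proof (induction k arbitrary: f g)
  case (Suc k)
  then show ?case by (auto simp: partial_deriv_add)
qed (auto intro: continuous_intros)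

lemma of_class_C_mult:
  "of_class_C k f \<Longrightarrow> of_class_C k g \<Longrightarrow> of_class_C k (\<lambda>x. f x * g x)"
proof (induction k arbitrary: f g)
  case (Suc k)
  have "of_class_C k f" "of_class_C k g" using Suc.prems of_class_C_SucD by blast+
  with Suc show ?case by (auto simp: partial_deriv_mult intro!: of_class_C_add)
qed (auto intro: continuous_intros)

section \<open>C1 periodic approximations of the primitive of the sawtooth\<close>

text \<open>For \<open>r = 1\<close> this is the distance from t to the nearest integer, which folds
  \<open>frac t\<close> without changing the square of 1/2 minus it. A factor \<open>r < 1\<close>
  keeps the argument of \<open>arccos\<close> away from -1 and 1, where its derivative is infinite,
  and so rounds off the corners.\<close>

definition smooth_u :: "real \<Rightarrow> real \<Rightarrow> real" where
  "smooth_u r t = arccos (r * cos (2 * pi * t)) / (2 * pi)"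

definition smooth_Q :: "real \<Rightarrow> real \<Rightarrow> real" where
  "smooth_Q r t = (1/12 - (1/2 - smooth_u r t)\<^sup>2) / 2"

definition smooth_D :: "real \<Rightarrow> real \<Rightarrow> real" where
  "smooth_D r t = (1/2 - smooth_u r t) * (r * sin (2 * pi * t) / sqrt (1 - (r * cos (2 * pi * t))\<^sup>2))"

lemma abs_scaled_cos: fixes r x :: real shows "0 \<le> r \<Longrightarrow> r \<le> 1 \<Longrightarrow> \<bar>r * cos x\<bar> \<le> r"
  using mult_left_mono[OF abs_cos_le_one[of x], of r] by (simp add: abs_mult)

lemma smooth_u_range:
  assumes "0 \<le> r" "r \<le> 1"
  shows "0 \<le> smooth_u r t" "smooth_u r t \<le> 1/2"
proof -
  have "-1 \<le> r * cos (2 * pi * t) \<and> r * cos (2 * pi * t) \<le> 1"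
    using abs_scaled_cos[OF assms, of "2 * pi * t"] assms by linarith
  then have "0 \<le> arccos (r * cos (2 * pi * t)) \<and> arccos (r * cos (2 * pi * t)) \<le> pi"
    using arccos_lbound arccos_ubound by blast
  then show "0 \<le> smooth_u r t" "smooth_u r t \<le> 1/2"
    by (simp_all add: smooth_u_def field_simps)
qed

lemma abs_half_smooth_u:
  assumes "0 \<le> r" "r \<le> 1" shows "\<bar>1/2 - smooth_u r t\<bar> \<le> 1/2"
  using smooth_u_range[OF assms, of t] by linarith

lemma abs_smooth_Q_le:
  assumes "0 \<le> r" "r \<le> 1" shows "\<bar>smooth_Q r t\<bar> \<le> 1"
proof -
  have "(1/2 - smooth_u r t)\<^sup>2 \<le> (1/2)\<^sup>2"
    using abs_half_smooth_u[OF assms] by (simp add: abs_le_square_iff[symmetric])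
  then have "(1/2 - smooth_u r t)\<^sup>2 \<le> 1/4" by (simp add: power2_eq_square)
  moreover have "0 \<le> (1/2 - smooth_u r t)\<^sup>2" by simp
  moreover have "\<bar>(1/12 - z) / 2\<bar> \<le> 1" if "0 \<le> z" "z \<le> 1/4" for z :: real using that by (simp add: abs_if)
  ultimately show ?thesis unfolding smooth_Q_def by blast
qed

text \<open>The square of r sin x is r^2 minus the square of r cos x, hence at most 1 minus that
  square, so the quotient is at most 1. The bound is uniform in r and serves as domination when r
  tends to 1.\<close>

lemma abs_smooth_D_le:
  assumes "0 < r" "r < 1" shows "\<bar>smooth_D r t\<bar> \<le> 1"
proof -
  let ?x = "2 * pi * t"
  have pos: "(r * cos ?x)\<^sup>2 < 1"
    using abs_scaled_cos[of r ?x] assms by (simp add: abs_square_less_1)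
  have "(r * sin ?x)\<^sup>2 = r\<^sup>2 - (r * cos ?x)\<^sup>2"
    by (simp add: power_mult_distrib sin_squared_eq algebra_simps)
  also have "\<dots> \<le> 1 - (r * cos ?x)\<^sup>2" using assms by (simp add: power_le_one)
  finally have "\<bar>r * sin ?x\<bar>\<^sup>2 \<le> 1 - (r * cos ?x)\<^sup>2" by simp
  then have le: "\<bar>r * sin ?x\<bar> \<le> sqrt (1 - (r * cos ?x)\<^sup>2)" by (rule real_le_rsqrt)
  have S: "0 < sqrt (1 - (r * cos ?x)\<^sup>2)" using pos by simp
  have "\<bar>r * sin ?x / sqrt (1 - (r * cos ?x)\<^sup>2)\<bar> \<le> 1"
    unfolding abs_divide abs_of_pos[OF S] using le S by (simp only: divide_le_eq_1_pos)
  moreover have "\<bar>1/2 - smooth_u r t\<bar> \<le> 1" using abs_half_smooth_u[of r t] assms by simp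
  ultimately show ?thesis unfolding smooth_D_def abs_mult by (rule mult_le_one[rotated 2]) simp
qed

lemma smooth_Q_DERIV:
  assumes "0 < r" "r < 1"
  shows "(smooth_Q r has_real_derivative smooth_D r t) (at t)"
proof -
  let ?x = "2 * pi * t"
  have b: "-1 < r * cos ?x" "r * cos ?x < 1"
    using abs_scaled_cos[of r ?x] assms by linarith+
  have "((\<lambda>t. arccos (r * cos (2 * pi * t))) has_real_derivative
      inverse (- sqrt (1 - (r * cos ?x)\<^sup>2)) * (r * (- sin ?x * (2 * pi)))) (at t)"
    by (rule DERIV_chain2[where f=arccos and g="\<lambda>t. r * cos (2 * pi * t)", OF DERIV_arccos[OF b]]) (auto intro!: derivative_eq_intros)
  then have "(smooth_u r has_real_derivative
      inverse (- sqrt (1 - (r * cos ?x)\<^sup>2)) * (r * (- sin ?x * (2 * pi))) / (2 * pi)) (at t)"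
    unfolding smooth_u_def[abs_def] by (rule DERIV_cdivide)
  moreover have "inverse (- S) * (r * (- a * (2 * pi))) / (2 * pi) = r * a / S" for S a :: real
    by (simp add: field_simps)
  ultimately have u: "(smooth_u r has_real_derivative r * sin ?x / sqrt (1 - (r * cos ?x)\<^sup>2)) (at t)"
    by (simp only:)
  have "((\<lambda>t. (1/12 - (1/2 - u t)\<^sup>2) / 2) has_real_derivative (1/2 - u t) * d) (at t)"
    if "(u has_real_derivative d) (at t)" for u d
    using that by (auto intro!: derivative_eq_intros simp: field_simps)
  from this[OF u] show ?thesis unfolding smooth_Q_def[abs_def] smooth_D_def .
qed

lemma continuous_on_smooth_D:
  assumes "0 < r" "r < 1"
  shows "continuous_on UNIV (smooth_D r)"
proof -
  have b: "-1 < r * cos x" "r * cos x < 1" for x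
    using abs_scaled_cos[of r x] assms by linarith+
  then have "(r * cos x)\<^sup>2 < 1" for x by (simp add: abs_square_less_1 abs_less_iff minus_less_iff)
  then have nz: "sqrt (1 - (r * cos x)\<^sup>2) \<noteq> 0" for x using less_irrefl by (metis diff_gt_0_iff_gt real_sqrt_gt_zero)
  have "continuous_on UNIV (smooth_u r)" unfolding smooth_u_def
    by (intro continuous_on_divide continuous_on_arccos continuous_intros) (use b in \<open>auto intro: less_imp_le\<close>)
  then show ?thesis unfolding smooth_D_def
    by (intro continuous_intros) (use nz in auto)
qed

lemma smooth_u_1: "smooth_u 1 t = (if frac t \<le> 1/2 then frac t else 1 - frac t)"
proof -
  have "2 * pi * t = 2 * pi * frac t + 2 * pi * of_int \<lfloor>t\<rfloor>" by (simp add: frac_def algebra_simps)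
  then have c: "cos (2 * pi * t) = cos (2 * pi * frac t)"
    by (simp only: cos_add sin_int_2pin cos_int_2pin)
  have f: "0 \<le> frac t" "frac t < 1" by (auto simp: frac_lt_1)
  show ?thesis
  proof (cases "frac t \<le> 1/2")
    case True
    then have "arccos (cos (2 * pi * frac t)) = 2 * pi * frac t" using f by (intro arccos_cos) auto
    then show ?thesis using True by (simp add: smooth_u_def c)
  next
    case False
    have "cos (2 * pi * frac t) = cos (2 * pi * (1 - frac t))"
      by (simp add: right_diff_distrib cos_diff)
    moreover have "arccos (cos (2 * pi * (1 - frac t))) = 2 * pi * (1 - frac t)"
      using f False by (intro arccos_cos) (auto simp: field_simps)
    ultimately show ?thesis using False by (simp add: smooth_u_def c)
  qed
qed

lemma smooth_Q_1: "smooth_Q 1 t = (1/12 - (1/2 - frac t)\<^sup>2) / 2"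
proof -
  have "1/2 - (1 - frac t) = - (1/2 - frac t)" by simp
  then have "(1/2 - (1 - frac t))\<^sup>2 = (1/2 - frac t)\<^sup>2" by (simp only: power2_minus)
  then show ?thesis unfolding smooth_Q_def smooth_u_1 by presburger
qed

lemma smooth_u_tendsto:
  assumes "r \<longlonglongrightarrow> 1" "\<And>m. 0 < r m" "\<And>m. r m < 1"
  shows "(\<lambda>m. smooth_u (r m) t) \<longlonglongrightarrow> smooth_u 1 t"
proof -
  have "(\<lambda>m. r m * cos (2 * pi * t)) \<longlonglongrightarrow> 1 * cos (2 * pi * t)" by (intro tendsto_intros assms)
  then have "(\<lambda>m. arccos (r m * cos (2 * pi * t))) \<longlonglongrightarrow> arccos (1 * cos (2 * pi * t))"
  proof (rule continuous_on_tendsto_compose[OF continuous_on_arccos'])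
    have "\<bar>r m * cos (2 * pi * t)\<bar> \<le> 1" for m
      using abs_scaled_cos[of "r m" "2 * pi * t"] assms(2,3)[of m] by linarith
    then show "\<forall>\<^sub>F m in sequentially. r m * cos (2 * pi * t) \<in> {-1..1}"
      by (intro always_eventually allI) (simp add: abs_le_iff minus_le_iff)
  qed simp
  then show ?thesis unfolding smooth_u_def by (intro tendsto_intros) auto
qed

lemma smooth_Q_tendsto:
  assumes "r \<longlonglongrightarrow> 1" "\<And>m. 0 < r m" "\<And>m. r m < 1"
  shows "(\<lambda>m. smooth_Q (r m) t) \<longlonglongrightarrow> (1/12 - (1/2 - frac t)\<^sup>2) / 2"
proof -
  have "(\<lambda>m. smooth_Q (r m) t) \<longlonglongrightarrow> smooth_Q 1 t"
    unfolding smooth_Q_def by (intro tendsto_intros smooth_u_tendsto[OF assms]) auto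
  then show ?thesis by (simp only: smooth_Q_1)
qed

text \<open>The quotient tends to the sign of the sine, which restores the sign lost when
  \<open>arccos\<close> folds the period. Where \<open>frac t = 1/2\<close> the sine vanishes, but
  so does the sawtooth; at the integers the sine vanishes while the sawtooth does not, and they are
  excluded.\<close>

lemma smooth_D_tendsto:
  assumes r: "r \<longlonglongrightarrow> 1" "\<And>m. 0 < r m" "\<And>m. r m < 1" and t: "t \<notin> \<int>"
  shows "(\<lambda>m. smooth_D (r m) t) \<longlonglongrightarrow> 1/2 - frac t"
proof -
  have "2 * pi * t = 2 * pi * frac t + 2 * pi * of_int \<lfloor>t\<rfloor>" by (simp add: frac_def algebra_simps)
  then have s: "sin (2 * pi * t) = sin (2 * pi * frac t)"
    by (simp only: sin_add sin_int_2pin cos_int_2pin)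
  have f: "0 < frac t" "frac t < 1" using t by (auto simp: frac_gt_0_iff frac_lt_1)
  show ?thesis
  proof (cases "frac t = 1/2")
    case True
    then have "2 * pi * frac t = pi" by simp
    then have "sin (2 * pi * t) = 0" by (simp only: s sin_pi)
    then have "smooth_D (r m) t = 1/2 - frac t" for m using True by (simp only: smooth_D_def)
    then show ?thesis by (simp only: tendsto_const)
  next
    case False
    have sgn: "sgn (sin (2 * pi * t)) = (if frac t \<le> 1/2 then 1 else -1)"
    proof (cases "frac t \<le> 1/2")
      case True
      then have "sin (2 * pi * frac t) > 0" using f False by (intro sin_gt_zero) (auto simp: field_simps)
      then show ?thesis using True by (simp add: s)
    next
      case F: False
      then have "sin (2 * pi * frac t) < 0" using f by (intro sin_lt_zero) (auto simp: field_simps)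
      then show ?thesis using F by (simp add: s)
    qed
    then have nz: "sin (2 * pi * t) \<noteq> 0" by (auto split: if_splits)
    have "(\<lambda>m. sqrt (1 - (r m * cos (2 * pi * t))\<^sup>2)) \<longlonglongrightarrow> sqrt (1 - (1 * cos (2 * pi * t))\<^sup>2)"
      by (intro tendsto_intros r)
    also have "sqrt (1 - (1 * cos (2 * pi * t))\<^sup>2) = \<bar>sin (2 * pi * t)\<bar>"
      by (simp add: sin_squared_eq[symmetric])
    finally have "(\<lambda>m. smooth_D (r m) t) \<longlonglongrightarrow> (1/2 - smooth_u 1 t) * (1 * sin (2 * pi * t) / \<bar>sin (2 * pi * t)\<bar>)"
      unfolding smooth_D_def using nz by (intro tendsto_intros r smooth_u_tendsto[OF r]) auto
    also have "1 * sin (2 * pi * t) / \<bar>sin (2 * pi * t)\<bar> = sgn (sin (2 * pi * t))"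
      by (simp add: sgn_real_def)
    also have "(1/2 - smooth_u 1 t) * sgn (sin (2 * pi * t)) = 1/2 - frac t"
      by (simp add: sgn smooth_u_1)
    finally show ?thesis .
  qed
qed

lemma smooth_Q_component:
  fixes F :: "real^'d \<Rightarrow> real"
  assumes F: "of_class_C 1 F" and r: "0 < r" "r < 1"
  shows "of_class_C 1 (\<lambda>y. F y * smooth_Q r (c * y $ i))"
    and "partial_deriv i (\<lambda>y. F y * smooth_Q r (c * y $ i))
       = (\<lambda>y. partial_deriv i F y * smooth_Q r (c * y $ i) + F y * (c * smooth_D r (c * y $ i)))"
    and "of_class_C 1 (\<lambda>y::real^'d. smooth_Q r (c * y $ i))"
proof -
  let ?q = "\<lambda>y::real^'d. smooth_Q r (c * y $ i)"
  have d: "?q differentiable (at y)" for y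
  proof -
    have "(smooth_Q r has_derivative (*) (smooth_D r (c * y $ i))) (at (c * y $ i))"
      using smooth_Q_DERIV[OF r] by (simp add: has_field_derivative_def)
    moreover have "((\<lambda>y. c * y $ i) has_derivative (\<lambda>h. c * h $ i)) (at y)"
      by (intro has_derivative_mult_right bounded_linear_imp_has_derivative bounded_linear_vec_nth)
    ultimately show ?thesis unfolding differentiable_def by (intro exI) (rule has_derivative_compose)
  qed
  have p: "partial_deriv j ?q = (\<lambda>y. if j = i then c * smooth_D r (c * y $ i) else 0)" for j
  proof
    fix y
    have "((\<lambda>t. smooth_Q r (c * (y + t *\<^sub>R axis j 1) $ i)) has_real_derivative
       smooth_D r (c * (y + 0 *\<^sub>R axis j 1) $ i) * (c * (axis j 1 $ i))) (at 0)"
      by (rule DERIV_chain2[OF smooth_Q_DERIV[OF r]]) (auto intro!: derivative_eq_intros)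
    then show "partial_deriv j ?q y = (if j = i then c * smooth_D r (c * y $ i) else 0)"
      by (intro partial_deriv_eqI) (auto simp: axis_def mult.commute)
  qed
  have "continuous_on UNIV (\<lambda>y::real^'d. c * smooth_D r (c * y $ i))"
    by (intro continuous_intros continuous_on_compose2[OF continuous_on_smooth_D[OF r]]) auto
  then have "continuous_on UNIV (\<lambda>y::real^'d. if j = i then c * smooth_D r (c * y $ i) else 0)" for j
    by (cases "j = i") auto
  then show q: "of_class_C 1 ?q" using d by (simp add: p)
  then show "of_class_C 1 (\<lambda>y. F y * ?q y)" by (rule of_class_C_mult[OF F])
  show "partial_deriv i (\<lambda>y. F y * ?q y) = (\<lambda>y. partial_deriv i F y * ?q y + F y * (c * smooth_D r (c * y $ i)))"
    using F d by (subst partial_deriv_mult) (auto simp: p)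
qed

text \<open>Since \<open>theta\<close> is the derivative of \<open>(1/12 - theta\<^sup>2) / 2\<close> away from the integers, one
  integration by parts absorbs the factor \<open>n\<close>. The periodic function \<open>smooth_Q r\<close> is a
  continuously differentiable approximation of that primitive.\<close>

lemma theta_integration_by_parts:
  fixes F :: "real^'d \<Rightarrow> real"
  assumes sets[measurable_cong]: "sets \<mu> = sets borel" and F: "of_class_C 1 F"
    and int: "integrable \<mu> F" "integrable \<mu> (partial_deriv i F)" "integrable \<mu> (\<lambda>y. F y * \<rho> y)"
    and \<rho>[measurable]: "\<rho> \<in> borel_measurable borel"
    and null: "AE y in \<mu>. real n * y $ i \<notin> \<int>"
    and ibp: "\<And>r. 0 < r \<Longrightarrow> r < 1 \<Longrightarrow> (\<integral>y. partial_deriv i (\<lambda>y. F y * smooth_Q r (real n * y $ i)) y \<partial>\<mu>)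
        = - (\<integral>y. (F y * smooth_Q r (real n * y $ i)) * \<rho> y \<partial>\<mu>)"
  shows "real n * (\<integral>y. F y * theta (real n *\<^sub>R y) $ i \<partial>\<mu>)
     = - (\<integral>y. (partial_deriv i F y + F y * \<rho> y) * ((1/12 - (theta (real n *\<^sub>R y) $ i)\<^sup>2) / 2) \<partial>\<mu>)"
proof -
  have [measurable]: "F \<in> borel_measurable borel" "partial_deriv i F \<in> borel_measurable borel"
    using of_class_C_continuous[OF F] F by (auto intro: borel_measurable_continuous_onI)
  \<comment> \<open>With \<open>m + 2\<close> in the denominator, \<open>r 0 = 1/2\<close>, so every
    \<open>r m\<close> lies strictly between 0 and 1.\<close>
  define r where "r m = 1 - 1 / real (m + 2)" for m :: nat
  have r: "0 < r m" "r m < 1" for m by (simp_all add: r_def)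
  have "(\<lambda>m. 1 - 1 / real (m + 2)) \<longlonglongrightarrow> 1 - 0"
    using LIMSEQ_ignore_initial_segment[OF lim_1_over_n, of 2] by (intro tendsto_intros) simp
  then have r1: "r \<longlonglongrightarrow> 1" by (simp add: r_def[abs_def])
  have cD: "continuous_on UNIV (smooth_D (r m))" "continuous_on UNIV (smooth_Q (r m))" for m
    using continuous_on_smooth_D[OF r] smooth_Q_DERIV[OF r, of m]
    by (auto intro!: continuous_at_imp_continuous_on DERIV_isCont)
  have [measurable]: "smooth_D (r m) \<in> borel_measurable borel" "smooth_Q (r m) \<in> borel_measurable borel" for m
    using cD by (auto intro: borel_measurable_continuous_onI)
  have Qb: "\<bar>smooth_Q (r m) t\<bar> \<le> 1" "\<bar>smooth_D (r m) t\<bar> \<le> 1" for m t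
    using abs_smooth_Q_le abs_smooth_D_le r less_imp_le by blast+
  define H where "H y = partial_deriv i F y + F y * \<rho> y" for y
  have iH: "integrable \<mu> H" unfolding H_def using int by simp
  have [measurable]: "H \<in> borel_measurable borel" unfolding H_def by measurable
  have iFD: "integrable \<mu> (\<lambda>y. F y * smooth_D (r m) (real n * y $ i))"
    and iQ: "integrable \<mu> (\<lambda>y. partial_deriv i F y * smooth_Q (r m) (real n * y $ i))"
      "integrable \<mu> (\<lambda>y. (F y * \<rho> y) * smooth_Q (r m) (real n * y $ i))" for m
    by (rule integrable_mult_bounded[OF int(1) _ Qb(2)] integrable_mult_bounded[OF int(2) _ Qb(1)]
        integrable_mult_bounded[OF int(3) _ Qb(1)]; measurable)+
  have eq: "real n * (\<integral>y. F y * smooth_D (r m) (real n * y $ i) \<partial>\<mu>) = - (\<integral>y. H y * smooth_Q (r m) (real n * y $ i) \<partial>\<mu>)" for m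
  proof -
    have "(\<integral>y. partial_deriv i F y * smooth_Q (r m) (real n * y $ i) + real n * (F y * smooth_D (r m) (real n * y $ i)) \<partial>\<mu>)
       = (\<integral>y. partial_deriv i (\<lambda>y. F y * smooth_Q (r m) (real n * y $ i)) y \<partial>\<mu>)"
      unfolding smooth_Q_component(2)[OF F r] by (simp add: mult_ac)
    also have "\<dots> = - (\<integral>y. (F y * \<rho> y) * smooth_Q (r m) (real n * y $ i) \<partial>\<mu>)"
      using ibp[OF r, of m] by (simp add: mult_ac)
    finally have "(\<integral>y. partial_deriv i F y * smooth_Q (r m) (real n * y $ i) \<partial>\<mu>) + real n * (\<integral>y. F y * smooth_D (r m) (real n * y $ i) \<partial>\<mu>)
       = - (\<integral>y. (F y * \<rho> y) * smooth_Q (r m) (real n * y $ i) \<partial>\<mu>)"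
      using iFD iQ by simp
    moreover have "(\<integral>y. H y * smooth_Q (r m) (real n * y $ i) \<partial>\<mu>) = (\<integral>y. partial_deriv i F y * smooth_Q (r m) (real n * y $ i) \<partial>\<mu>)
       + (\<integral>y. (F y * \<rho> y) * smooth_Q (r m) (real n * y $ i) \<partial>\<mu>)"
      using iQ by (simp add: H_def distrib_right)
    ultimately show ?thesis by linarith
  qed
  \<comment> \<open>At the integers \<open>smooth_D\<close> is 0 while the sawtooth equals 1/2; this
    is where \<open>null\<close> enters. The primitive, in contrast, converges at every
    point.\<close>
  have 1: "(\<lambda>m. \<integral>y. F y * smooth_D (r m) (real n * y $ i) \<partial>\<mu>) \<longlonglongrightarrow> (\<integral>y. F y * theta (real n *\<^sub>R y) $ i \<partial>\<mu>)"
  proof (rule integral_dominated_convergence[where w="\<lambda>y. \<bar>F y\<bar>"])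
    show "AE y in \<mu>. (\<lambda>m. F y * smooth_D (r m) (real n * y $ i)) \<longlonglongrightarrow> F y * theta (real n *\<^sub>R y) $ i"
      using null by eventually_elim (simp add: theta_nth, intro tendsto_intros smooth_D_tendsto r1 r)
    show "AE y in \<mu>. norm (F y * smooth_D (r m) (real n * y $ i)) \<le> \<bar>F y\<bar>" for m
      using Qb(2) by (intro AE_I2) (simp add: abs_mult mult_left_le)
  qed (use int in auto)
  have 2: "(\<lambda>m. \<integral>y. H y * smooth_Q (r m) (real n * y $ i) \<partial>\<mu>) \<longlonglongrightarrow> (\<integral>y. H y * ((1/12 - (theta (real n *\<^sub>R y) $ i)\<^sup>2) / 2) \<partial>\<mu>)"
  proof (rule integral_dominated_convergence[where w="\<lambda>y. \<bar>H y\<bar>"])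
    show "AE y in \<mu>. (\<lambda>m. H y * smooth_Q (r m) (real n * y $ i)) \<longlonglongrightarrow> H y * ((1/12 - (theta (real n *\<^sub>R y) $ i)\<^sup>2) / 2)"
    proof (rule AE_I2)
      fix y
      show "(\<lambda>m. H y * smooth_Q (r m) (real n * y $ i)) \<longlonglongrightarrow> H y * ((1/12 - (theta (real n *\<^sub>R y) $ i)\<^sup>2) / 2)"
        using tendsto_mult[OF tendsto_const smooth_Q_tendsto[OF r1 r], of "H y" "real n * y $ i"] by (simp add: theta_nth)
    qed
    show "AE y in \<mu>. norm (H y * smooth_Q (r m) (real n * y $ i)) \<le> \<bar>H y\<bar>" for m
      using Qb(1) by (intro AE_I2) (simp add: abs_mult mult_left_le)
  qed (use iH in auto)
  have "(\<lambda>m. real n * (\<integral>y. F y * smooth_D (r m) (real n * y $ i) \<partial>\<mu>)) \<longlonglongrightarrow> real n * (\<integral>y. F y * theta (real n *\<^sub>R y) $ i \<partial>\<mu>)"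
    by (intro tendsto_intros 1)
  moreover have "(\<lambda>m. real n * (\<integral>y. F y * smooth_D (r m) (real n * y $ i) \<partial>\<mu>)) \<longlonglongrightarrow> - (\<integral>y. H y * ((1/12 - (theta (real n *\<^sub>R y) $ i)\<^sup>2) / 2) \<partial>\<mu>)"
    unfolding eq by (intro tendsto_intros 2)
  ultimately show ?thesis unfolding H_def by (rule LIMSEQ_unique)
qed

text \<open>Taylor's formula on the segment from y to \<open>graduated n y\<close>, whose length is
  of order 1/n: of the factor n^2, one power of n survives in the linear term and none in the
  quadratic term, whose coefficients are taken at an intermediate point.\<close>

lemma second_order_expansion:
  fixes \<phi> :: "real^'d \<Rightarrow> real" and y :: "real^'d"
  assumes \<phi>: "of_class_C 2 \<phi>" and n: "n > 0"
  defines "th \<equiv> theta (real n *\<^sub>R y)"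
  obtains s where "0 < s" "s \<le> 1"
    "(real n)\<^sup>2 * (\<phi> (graduated n y) - \<phi> y) = real n * (\<Sum>i\<in>UNIV. partial_deriv i \<phi> y * th $ i)
      + (\<Sum>i\<in>UNIV. \<Sum>j\<in>UNIV. partial_deriv j (partial_deriv i \<phi>) (y + s *\<^sub>R ((1 / real n) *\<^sub>R th)) * (th $ i * th $ j)) / 2"
proof -
  have d: "\<And>x. \<phi> differentiable (at x)" and d2: "\<And>i x. partial_deriv i \<phi> differentiable (at x)"
    using \<phi> unfolding of_class_C_2 of_class_C_1 by blast+
  define v where "v = (1 / real n) *\<^sub>R th"
  \<comment> \<open>The successive derivatives along the segment, indexed by their order as the
    Maclaurin formula expects; only the orders 0, 1 and 2 are used.\<close>
  define g where "g = (\<lambda>m::nat. if m = 0 then (\<lambda>t. \<phi> (y + t *\<^sub>R v)) else if m = 1 then (\<lambda>t. \<Sum>i\<in>UNIV. v $ i * partial_deriv i \<phi> (y + t *\<^sub>R v))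
    else (\<lambda>t. \<Sum>i\<in>UNIV. v $ i * (\<Sum>j\<in>UNIV. v $ j * partial_deriv j (partial_deriv i \<phi>) (y + t *\<^sub>R v))))"
  have "\<exists>t>0. t \<le> 1 \<and> g 0 1 = (\<Sum>m<2. g m 0 / fact m * 1 ^ m) + g 2 t / fact 2 * 1 ^ 2"
  proof (rule Maclaurin2)
    show "\<forall>m t. m < 2 \<and> 0 \<le> t \<and> t \<le> 1 \<longrightarrow> (g m has_real_derivative g (Suc m) t) (at t)"
    proof (intro allI impI)
      fix m :: nat and t :: real assume "m < 2 \<and> 0 \<le> t \<and> t \<le> 1"
      then consider "m = 0" | "m = 1" by linarith
      then show "(g m has_real_derivative g (Suc m) t) (at t)"
      proof cases
        case 1 then show ?thesis using DERIV_along_line[OF d] by (simp add: g_def)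
      next
        case 2 then show ?thesis by (auto simp: g_def intro!: DERIV_sum DERIV_cmult DERIV_along_line[OF d2])
      qed
    qed
  qed auto
  then obtain s where s: "0 < s" "s \<le> 1" and "g 0 1 = g 0 0 + g 1 0 + g 2 s / 2"
    by (auto simp: lessThan_Suc numeral_2_eq_2)
  then have "\<phi> (graduated n y) - \<phi> y = (\<Sum>i\<in>UNIV. v $ i * partial_deriv i \<phi> y)
     + (\<Sum>i\<in>UNIV. v $ i * (\<Sum>j\<in>UNIV. v $ j * partial_deriv j (partial_deriv i \<phi>) (y + s *\<^sub>R v))) / 2"
    by (simp add: g_def graduated_def v_def th_def)
  then have "(real n)\<^sup>2 * (\<phi> (graduated n y) - \<phi> y) = (real n)\<^sup>2 * (\<Sum>i\<in>UNIV. v $ i * partial_deriv i \<phi> y)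
     + (real n)\<^sup>2 * (\<Sum>i\<in>UNIV. v $ i * (\<Sum>j\<in>UNIV. v $ j * partial_deriv j (partial_deriv i \<phi>) (y + s *\<^sub>R v))) / 2"
    by (simp add: distrib_left)
  also have "(real n)\<^sup>2 * (\<Sum>i\<in>UNIV. v $ i * partial_deriv i \<phi> y) = real n * (\<Sum>i\<in>UNIV. partial_deriv i \<phi> y * th $ i)"
    using n by (simp add: v_def sum_distrib_left power2_eq_square mult_ac)
  also have "(real n)\<^sup>2 * (\<Sum>i\<in>UNIV. v $ i * (\<Sum>j\<in>UNIV. v $ j * partial_deriv j (partial_deriv i \<phi>) (y + s *\<^sub>R v)))
     = (\<Sum>i\<in>UNIV. \<Sum>j\<in>UNIV. partial_deriv j (partial_deriv i \<phi>) (y + s *\<^sub>R v) * (th $ i * th $ j))"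
    unfolding sum_distrib_left using n
    by (intro sum.cong refl) (simp add: v_def power2_eq_square)
  finally show thesis unfolding v_def by (rule that[OF s])
qed

section \<open>Test functions and logarithmic gradients\<close>

lemma of_class_C_const: "of_class_C k (\<lambda>x::real^'d. c)"
proof (induction k arbitrary: c)
  case (Suc k)
  have "partial_deriv i (\<lambda>x::real^'d. c) = (\<lambda>x. 0)" for i
    by (auto simp: partial_deriv_def)
  then show ?case using Suc by simp
qed simp

lemma of_class_C_prod:
  "finite I \<Longrightarrow> (\<And>i. i \<in> I \<Longrightarrow> of_class_C k (f i)) \<Longrightarrow> of_class_C k (\<lambda>x. \<Prod>i\<in>I. f i x)"
  by (induction rule: finite_induct) (auto simp: of_class_C_const intro: of_class_C_mult)

section \<open>Smooth bump functions, and how they determine a measure\<close>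

text \<open>Indexing by a polynomial makes the family closed under differentiation: with x = 1/t,
  the derivative is x^2 (p(x) - p'(x)) exp (-x). Smoothness of every order then follows by a single
  induction over all polynomials.\<close>

definition flat :: "real poly \<Rightarrow> real \<Rightarrow> real" where
  "flat p t = (if 0 < t then poly p (1 / t) * exp (- (1 / t)) else 0)"

lemma poly_exp_tendsto_0: "((\<lambda>s. poly p s * exp (- s)) \<longlongrightarrow> (0::real)) at_top"
proof (induction p)
  case (pCons a p)
  have "((\<lambda>s::real. a * (s ^ 0 / exp s) + (\<Sum>i\<le>degree p. coeff p i * (s ^ Suc i / exp s))) \<longlongrightarrow> a * 0 + (\<Sum>i\<le>degree p. coeff p i * 0)) at_top"
    by (intro tendsto_intros tendsto_power_div_exp_0)
  moreover have "a * (s ^ 0 / exp s) + (\<Sum>i\<le>degree p. coeff p i * (s ^ Suc i / exp s)) = poly (pCons a p) s * exp (- s)" for s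
    unfolding poly_pCons poly_altdef[of p]
    by (simp add: exp_minus divide_inverse distrib_left sum_distrib_left mult_ac)
  ultimately show ?case by simp
qed simp

lemma flat_DERIV: "(flat p has_real_derivative flat ([:0, 0, 1:] * (p - pderiv p)) t) (at t)"
proof -
  let ?q = "[:0, 0, 1:] * (p - pderiv p)"
  consider "t > 0" | "t < 0" | "t = 0" by linarith
  then show ?thesis
  proof cases
    case 1
    have "((\<lambda>t. poly p (1 / t)) has_real_derivative poly (pderiv p) (1 / t) * (- (1 / t ^ 2))) (at t)"
      by (rule DERIV_chain2[OF poly_DERIV]) (use 1 in \<open>auto intro!: derivative_eq_intros simp: power2_eq_square\<close>)
    moreover have "((\<lambda>t. exp (- (1 / t))) has_real_derivative exp (- (1 / t)) * (1 / t ^ 2)) (at t)"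
      using 1 by (auto intro!: derivative_eq_intros simp: power2_eq_square)
    ultimately have "((\<lambda>t. poly p (1 / t) * exp (- (1 / t))) has_real_derivative
        poly (pderiv p) (1 / t) * (- (1 / t ^ 2)) * exp (- (1 / t)) + exp (- (1 / t)) * (1 / t ^ 2) * poly p (1 / t)) (at t)"
      by (rule DERIV_mult)
    also have "poly (pderiv p) (1 / t) * (- (1 / t ^ 2)) * exp (- (1 / t)) + exp (- (1 / t)) * (1 / t ^ 2) * poly p (1 / t) = flat ?q t"
    proof -
      have "poly ?q x = x\<^sup>2 * (poly p x - poly (pderiv p) x)" for x
        by (simp add: power2_eq_square algebra_simps)
      then have "flat ?q t = (1 / t)\<^sup>2 * (poly p (1 / t) - poly (pderiv p) (1 / t)) * exp (- (1 / t))"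
        using 1 by (simp only: flat_def if_True)
      moreover have "A * (- x) * E + E * x * B = x * (B - A) * E" for A B E x :: real
        by (simp add: algebra_simps)
      ultimately show ?thesis by (simp only: power_one_over)
    qed
    finally show ?thesis
      by (rule has_field_derivative_transform_within_open[where S="{0<..}"]) (use 1 in \<open>auto simp: flat_def\<close>)
  next
    case 2
    have "((\<lambda>t. 0) has_real_derivative 0) (at t)" by simp
    then have "(flat p has_real_derivative 0) (at t)"
      by (rule has_field_derivative_transform_within_open[where S="{..<0}"]) (use 2 in \<open>auto simp: flat_def\<close>)
    moreover have "flat ?q t = 0" unfolding flat_def by (rule if_not_P) (use 2 in simp)
    ultimately show ?thesis by (simp only:)
  next
    case 3
    have "((\<lambda>h. flat p h / h) \<longlongrightarrow> 0) (at_right 0)"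
    proof -
      \<comment> \<open>Dividing by h multiplies the polynomial in 1/h by its variable, hence
        \<open>pCons 0 p\<close>.\<close>
      have "((\<lambda>h. poly (pCons 0 p) (inverse h) * exp (- inverse h)) \<longlongrightarrow> 0) (at_right 0)"
        by (rule filterlim_compose[OF poly_exp_tendsto_0 filterlim_inverse_at_top_right])
      moreover have "\<forall>\<^sub>F h in at_right 0. poly (pCons 0 p) (inverse h) * exp (- inverse h) = flat p h / h"
        using eventually_at_right_less[of "0::real"] by eventually_elim (simp add: flat_def divide_inverse)
      ultimately show ?thesis by (rule Lim_transform_eventually)
    qed
    moreover have "((\<lambda>h. flat p h / h) \<longlongrightarrow> 0) (at_left 0)"
      by (rule tendsto_eventually) (auto simp: eventually_at_left_field flat_def intro!: exI[of _ "-1"])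
    ultimately have "((\<lambda>h. flat p h / h) \<longlongrightarrow> 0) (at 0)" by (simp add: filterlim_split_at)
    moreover have "flat p 0 = 0" "flat ?q 0 = 0" by (simp_all only: flat_def less_irrefl if_False)
    ultimately show ?thesis unfolding 3 DERIV_def by (simp only: add_0 diff_zero)
  qed
qed

lemma of_class_C_flat: "of_class_C k (\<lambda>y::real^'d. flat p (c * y $ i + a))"
proof (induction k arbitrary: p)
  case 0
  have "continuous_on UNIV (flat p)"
    by (intro continuous_at_imp_continuous_on ballI) (rule DERIV_isCont[OF flat_DERIV])
  then have "continuous_on UNIV (\<lambda>y::real^'d. flat p (c * y $ i + a))"
    by (rule continuous_on_compose2) (auto intro!: continuous_intros)
  then show ?case by simp
next
  case (Suc k)
  let ?f = "\<lambda>p (y::real^'d). flat p (c * y $ i + a)"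
  let ?q = "[:0, 0, 1:] * (p - pderiv p)"
  have d: "?f p differentiable (at y)" for y
  proof -
    have "(flat p has_derivative (*) (flat ?q (c * y $ i + a))) (at (c * y $ i + a))"
      using flat_DERIV by (simp add: has_field_derivative_def)
    moreover have "((\<lambda>y. c * y $ i + a) has_derivative (\<lambda>h. c * h $ i + 0)) (at y)"
      by (intro has_derivative_add has_derivative_const has_derivative_mult_right bounded_linear_imp_has_derivative bounded_linear_vec_nth)
    ultimately show ?thesis unfolding differentiable_def by (intro exI) (rule has_derivative_compose)
  qed
  have "partial_deriv j (?f p) = (\<lambda>y. (if j = i then c else 0) * ?f ?q y)" for j
  proof
    fix y
    have "((\<lambda>t. flat p (c * (y + t *\<^sub>R axis j 1) $ i + a)) has_real_derivative
       flat ?q (c * (y + 0 *\<^sub>R axis j 1) $ i + a) * (c * (axis j 1 $ i))) (at 0)"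
      by (rule DERIV_chain2[OF flat_DERIV]) (auto intro!: derivative_eq_intros)
    then show "partial_deriv j (?f p) y = (if j = i then c else 0) * ?f ?q y"
      by (intro partial_deriv_eqI) (auto simp: axis_def mult.commute)
  qed
  then show ?case using d Suc[of ?q] by (auto intro: of_class_C_mult of_class_C_const)
qed

text \<open>For \<open>l > 0\<close> the function is positive exactly between a and b, and
  \<open>l\<close> only steepens its flanks: for large \<open>l\<close> it approaches the indicator
  of the interval, while \<open>l = 1\<close> serves for mollifiers and cutoffs.\<close>

definition bump1 :: "real \<Rightarrow> real \<Rightarrow> real \<Rightarrow> real \<Rightarrow> real" where
  "bump1 l a b t = flat 1 (l * t - l * a) * flat 1 (l * b - l * t)"

definition bump :: "real \<Rightarrow> real^'d \<Rightarrow> real^'d \<Rightarrow> real^'d \<Rightarrow> real" where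
  "bump l a b y = (\<Prod>i\<in>UNIV. bump1 l (a $ i) (b $ i) (y $ i))"

lemma flat_1: "0 \<le> flat 1 t" "flat 1 t \<le> 1" "flat 1 t = 0 \<longleftrightarrow> t \<le> 0"
  by (auto simp: flat_def)

lemma bump1_bounds: "0 \<le> bump1 l a b t" "bump1 l a b t \<le> 1"
  by (auto simp: bump1_def flat_1 mult_le_one)

lemma bump1_eq_0: "0 < l \<Longrightarrow> bump1 l a b t = 0 \<longleftrightarrow> t \<le> a \<or> b \<le> t"
  by (simp add: bump1_def flat_1 mult_le_cancel_left_pos)

lemma bump_bounds: "0 \<le> bump l a b y" "bump l a b y \<le> 1"
  unfolding bump_def by (auto intro!: prod_nonneg prod_le_1 simp: bump1_bounds)

lemma bump_eq_0: "0 < l \<Longrightarrow> bump l a b y = 0 \<longleftrightarrow> y \<notin> box a b"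
  by (auto simp: bump_def bump1_eq_0 mem_box_cart not_less)

lemma of_class_C_bump: "of_class_C k (bump l a (b :: real^'d))"
proof -
  have "of_class_C k (\<lambda>y::real^'d. bump1 l (a $ i) (b $ i) (y $ i))" for i
    using of_class_C_mult[OF of_class_C_flat[of k 1 l i "- (l * a $ i)"] of_class_C_flat[of k 1 "-l" i "l * b $ i"]]
    by (simp add: bump1_def)
  then show ?thesis unfolding bump_def[abs_def] by (intro of_class_C_prod) auto
qed

lemma test_function_bump: "0 < l \<Longrightarrow> test_function UNIV (bump l a b)"
  unfolding test_function_def
  by (intro conjI allI of_class_C_bump exI[of _ "cbox a b"]) (use box_subset_cbox[of a b] in \<open>auto simp: bump_eq_0\<close>)

lemma flat_1_tendsto: "filterlim x at_top F \<Longrightarrow> ((\<lambda>n. flat 1 (x n)) \<longlongrightarrow> 1) F"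
proof -
  assume x: "filterlim x at_top F"
  have "((\<lambda>n. exp (- inverse (x n))) \<longlongrightarrow> exp (- 0)) F"
    by (intro tendsto_intros tendsto_inverse_0_at_top x)
  moreover have "\<forall>\<^sub>F n in F. exp (- inverse (x n)) = flat 1 (x n)"
    using filterlim_at_top_dense[THEN iffD1, OF x, rule_format, of 0] by eventually_elim (simp add: flat_def divide_inverse)
  ultimately show ?thesis by (simp add: Lim_transform_eventually)
qed

lemma bump_tendsto_indicator: "(\<lambda>m. bump (real (Suc m)) a b y) \<longlonglongrightarrow> indicator (box a b) y"
proof (cases "y \<in> box a b")
  case True
  have "(\<lambda>m. bump1 (real (Suc m)) (a $ i) (b $ i) (y $ i)) \<longlonglongrightarrow> 1 * 1" for i
  proof -
    have pos: "y $ i - a $ i > 0" "b $ i - y $ i > 0" using True by (auto simp: mem_box_cart)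
    have "filterlim (\<lambda>m. real (Suc m) * c) at_top sequentially" if "c > 0" for c
      using that by (intro filterlim_at_top_mult_tendsto_pos[OF tendsto_const] filterlim_compose[OF filterlim_real_sequentially filterlim_Suc])
    from this[OF pos(1)] this[OF pos(2)] show ?thesis
      unfolding bump1_def right_diff_distrib[symmetric] by (intro tendsto_mult flat_1_tendsto)
  qed
  then have "(\<lambda>m. bump (real (Suc m)) a b y) \<longlonglongrightarrow> (\<Prod>i\<in>(UNIV::'a set). 1 * 1)"
    unfolding bump_def by (intro tendsto_prod)
  then show ?thesis using True by simp
next
  case False
  then have "bump (real (Suc m)) a b y = 0" for m using bump_eq_0[of "real (Suc m)" a b y] by simp
  then show ?thesis using False by simp
qed

lemma box_exhaust: "(\<lambda>k. indicator (box (\<chi> i. - real k) (\<chi> i. real k)) y) \<longlonglongrightarrow> (1::real)" for y :: "real^'d"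
proof (rule tendsto_eventually)
  obtain k0 :: nat where k0: "norm y < real k0" using reals_Archimedean2 by blast
  have "y \<in> box (\<chi> i. - real k) (\<chi> i. real k)" if "k \<ge> k0" for k
  proof -
    have "- real k < y $ i \<and> y $ i < real k" for i
      using component_le_norm_cart[of y i] k0 that by linarith
    then show ?thesis by (simp add: mem_box_cart)
  qed
  then show "\<forall>\<^sub>F k in sequentially. indicator (box (\<chi> i. - real k) (\<chi> i. real k)) y = (1::real)"
    unfolding eventually_sequentially by (intro exI[of _ k0]) auto
qed

text \<open>Bumps converge to indicators of boxes, so the integral of \<open>f\<close> over every
  box vanishes, and boxes determine the integral over all Borel sets. The complement step requires
  the total integral to vanish, which comes from exhausting the space by boxes.\<close>

lemma AE_eq_0_of_test_functions:
  fixes f :: "real^'d \<Rightarrow> real"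
  assumes sets[measurable_cong]: "sets \<mu> = sets borel" and f: "integrable \<mu> f"
    and test: "\<And>\<xi>. test_function UNIV \<xi> \<Longrightarrow> (\<integral>y. f y * \<xi> y \<partial>\<mu>) = 0"
  shows "AE y in \<mu>. f y = 0"
proof -
  have space: "space \<mu> = UNIV" using sets_eq_imp_space_eq[OF sets] by simp
  have [measurable]: "f \<in> borel_measurable borel" using borel_measurable_integrable[OF f] by measurable
  have [measurable]: "bump l a b \<in> borel_measurable borel" for l and a b :: "real^'d"
    using of_class_C_bump[of 0] by (auto intro: borel_measurable_continuous_onI)
  have int: "integrable \<mu> (\<lambda>y. f y * indicator A y)" if [measurable]: "A \<in> sets borel" for A
    by (rule integrable_mult_bounded[OF f, of _ 1]) (auto simp: indicator_def)
  have box: "(\<integral>y. f y * indicator (box a b) y \<partial>\<mu>) = 0" for a b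
  proof (rule LIMSEQ_unique)
    show "(\<lambda>m. \<integral>y. f y * bump (real (Suc m)) a b y \<partial>\<mu>) \<longlonglongrightarrow> (\<integral>y. f y * indicator (box a b) y \<partial>\<mu>)"
    proof (rule integral_dominated_convergence[where w="\<lambda>y. \<bar>f y\<bar>"])
      show "AE y in \<mu>. (\<lambda>m. f y * bump (real (Suc m)) a b y) \<longlonglongrightarrow> f y * indicator (box a b) y"
        by (intro AE_I2 tendsto_mult tendsto_const bump_tendsto_indicator)
      show "AE y in \<mu>. norm (f y * bump (real (Suc m)) a b y) \<le> \<bar>f y\<bar>" for m
        by (intro AE_I2) (simp add: abs_mult abs_of_nonneg bump_bounds mult_left_le)
    qed (use f in auto)
    show "(\<lambda>m. \<integral>y. f y * bump (real (Suc m)) a b y \<partial>\<mu>) \<longlonglongrightarrow> 0"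
      using test[OF test_function_bump] by simp
  qed
  have total: "(\<integral>y. f y \<partial>\<mu>) = 0"
  proof (rule LIMSEQ_unique)
    let ?B = "\<lambda>k::nat. box (\<chi> i. - real k) (\<chi> i. real k) :: (real^'d) set"
    show "(\<lambda>k. \<integral>y. f y * indicator (?B k) y \<partial>\<mu>) \<longlonglongrightarrow> (\<integral>y. f y \<partial>\<mu>)"
    proof (rule integral_dominated_convergence[where w="\<lambda>y. \<bar>f y\<bar>"])
      show "AE y in \<mu>. (\<lambda>k. f y * indicator (?B k) y) \<longlonglongrightarrow> f y"
      proof (rule AE_I2)
        show "(\<lambda>k. f y * indicator (?B k) y) \<longlonglongrightarrow> f y" for y
          using tendsto_mult[OF tendsto_const[of "f y"] box_exhaust[of y]] by simp
      qed
    qed (use f in \<open>auto simp: indicator_def\<close>)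
    show "(\<lambda>k. \<integral>y. f y * indicator (?B k) y \<partial>\<mu>) \<longlonglongrightarrow> 0" by (simp add: box)
  qed
  have all: "(\<integral>y. f y * indicator A y \<partial>\<mu>) = 0" if "A \<in> sets borel" for A
    using that
  proof (induction rule: borel_box_induct)
    case (compl A)
    have "(\<integral>y. f y * indicator (- A) y \<partial>\<mu>) = (\<integral>y. f y - f y * indicator A y \<partial>\<mu>)"
      by (intro Bochner_Integration.integral_cong) (auto simp: indicator_def)
    also have "\<dots> = 0" using int[OF compl(1)] f by (simp add: compl(2) total)
    finally show ?case .
  next
    case (union A)
    have A[measurable]: "A i \<in> sets borel" for i using union by auto
    show ?case
    proof (rule LIMSEQ_unique)
      show "(\<lambda>k. \<integral>y. f y * indicator (\<Union>i<k. A i) y \<partial>\<mu>) \<longlonglongrightarrow> (\<integral>y. f y * indicator (\<Union>i. A i) y \<partial>\<mu>)"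
      proof (rule integral_dominated_convergence[where w="\<lambda>y. \<bar>f y\<bar>"])
        show "AE y in \<mu>. (\<lambda>k. f y * indicator (\<Union>i<k. A i) y) \<longlonglongrightarrow> f y * indicator (\<Union>i. A i) y"
        proof (intro AE_I2 tendsto_mult tendsto_const tendsto_eventually)
          fix y
          show "\<forall>\<^sub>F k in sequentially. indicator (\<Union>i<k. A i) y = (indicator (\<Union>i. A i) y :: real)"
          proof (cases "\<exists>i. y \<in> A i")
            case True
            then obtain i where "y \<in> A i" by blast
            then show ?thesis unfolding eventually_sequentially
              by (intro exI[of _ "Suc i"]) (auto simp: indicator_def)
          qed (auto simp: indicator_def)
        qed
      qed (use f in \<open>auto simp: indicator_def\<close>)
      have "(\<integral>y. f y * indicator (\<Union>i<k. A i) y \<partial>\<mu>) = 0" for k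
      proof (induction k)
        case (Suc k)
        have "A k \<inter> A i = {}" if "i < k" for i using union(1) that by (auto simp: disjoint_family_on_def)
        then have "f y * indicator (\<Union>i<Suc k. A i) y = f y * indicator (\<Union>i<k. A i) y + f y * indicator (A k) y" for y
          by (auto simp: indicator_def less_Suc_eq)
        then show ?case using int[of "A k"] int[of "\<Union>i<k. A i"] Suc union(3)[of k] by simp
      qed simp
      then show "(\<lambda>k. \<integral>y. f y * indicator (\<Union>i<k. A i) y \<partial>\<mu>) \<longlonglongrightarrow> 0" by simp
    qed
  qed (simp_all add: box)
  show ?thesis
  proof (rule density_unique_real[OF f, of "\<lambda>_. 0"])
    fix A assume "A \<in> sets \<mu>"
    then show "(\<integral>y\<in>A. f y \<partial>\<mu>) = (\<integral>y\<in>A. 0 \<partial>\<mu>)"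
      using all[of A] by (simp add: set_lebesgue_integral_def mult.commute sets)
  qed simp
qed

section \<open>Mollification of C1 functions with compact support\<close>

text \<open>Integration over a fixed box keeps the domain compact, so the Leibniz rule needs only
  continuity of the derivative of the integrand. Either the mollifier or the function to be smoothed
  can later take the role of the differentiated factor \<open>g\<close>.\<close>

lemma convolution_derivative:
  fixes F g :: "real^'d \<Rightarrow> real" and a b :: "real^'d"
  assumes F: "continuous_on UNIV F" and g: "of_class_C 1 g"
  defines "\<psi> \<equiv> \<lambda>x. integral (cbox a b) (\<lambda>y. F y * g (x - y))"
  shows "\<psi> differentiable (at x)"
    and "partial_deriv i \<psi> x = integral (cbox a b) (\<lambda>y. F y * partial_deriv i g (x - y))"
proof -
  have gd: "\<And>x. g differentiable (at x)" and gc: "\<And>i. continuous_on UNIV (partial_deriv i g)"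
    using g by (auto simp: of_class_C_1)
  have gc0: "continuous_on UNIV g" by (rule of_class_C_continuous[OF g])
  have int: "(\<lambda>y. F y * g (x - y)) integrable_on cbox a b" for x
    by (intro integrable_continuous continuous_intros continuous_on_subset[OF F] continuous_on_compose2[OF gc0]) auto
  \<comment> \<open>The derivative in x as a bounded linear map, written as a finite sum so that its
    joint continuity is immediate.\<close>
  define fx where "fx x y = F y *\<^sub>R (\<Sum>i\<in>UNIV. partial_deriv i g (x - y) *\<^sub>R blinfun_inner_left (axis i 1 :: real^'d))" for x y :: "real^'d"
  have fx: "blinfun_apply (fx x y) h = F y * (\<Sum>i\<in>UNIV. h $ i * partial_deriv i g (x - y))" for x y h
    by (simp add: fx_def blinfun.scaleR_left blinfun.sum_left inner_axis mult.commute)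
  have "((\<lambda>x. integral (cbox a b) (\<lambda>y. F y * g (x - y))) has_derivative integral (cbox a b) (fx x)) (at x within UNIV)"
  proof (rule leibniz_rule[OF _ int])
    show "((\<lambda>x. F y * g (x - y)) has_derivative blinfun_apply (fx x y)) (at x within UNIV)" for x y
    proof -
      have "((\<lambda>x. x - y) has_derivative (\<lambda>h. h)) (at x)" by (auto intro!: derivative_eq_intros)
      then have "((\<lambda>x. g (x - y)) has_derivative (\<lambda>h. \<Sum>i\<in>UNIV. h $ i * partial_deriv i g (x - y))) (at x)"
        by (rule has_derivative_compose) (rule has_derivative_partial_deriv[OF gd])
      then have "((\<lambda>x. F y * g (x - y)) has_derivative (\<lambda>h. F y * (\<Sum>i\<in>UNIV. h $ i * partial_deriv i g (x - y)))) (at x)"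
        by (rule has_derivative_mult_right)
      then show ?thesis by (simp add: fx[abs_def])
    qed
    have "continuous_on (UNIV \<times> cbox a b) (\<lambda>z. fx (fst z) (snd z))"
      unfolding fx_def
      by (intro continuous_intros continuous_on_compose2[OF F] continuous_on_compose2[OF gc]) auto
    then show "continuous_on (UNIV \<times> cbox a b) (\<lambda>(x, y). fx x y)" by (simp add: split_beta)
  qed auto
  then show "\<psi> differentiable (at x)" unfolding \<psi>_def differentiable_def by auto
  have "((\<lambda>t. integral (cbox a b) (\<lambda>y. F y * g (x + t *\<^sub>R axis i 1 - y))) has_vector_derivative
      integral (cbox a b) (\<lambda>y. F y * partial_deriv i g (x + 0 *\<^sub>R axis i 1 - y))) (at 0 within UNIV)"
  proof (rule leibniz_rule_vector_derivative)
    show "((\<lambda>t. F y * g (x + t *\<^sub>R axis i 1 - y)) has_vector_derivative F y * partial_deriv i g (x + t *\<^sub>R axis i 1 - y)) (at t within UNIV)" for t y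
      using DERIV_cmult[OF DERIV_partial_deriv[OF gd, of "x - y" i t], of "F y"]
      by (simp add: has_real_derivative_iff_has_vector_derivative algebra_simps)
    show "(\<lambda>y. F y * g (x + t *\<^sub>R axis i 1 - y)) integrable_on cbox a b" for t by (rule int)
    have "continuous_on (UNIV \<times> cbox a b) (\<lambda>z. F (snd z) * partial_deriv i g (x + fst z *\<^sub>R axis i 1 - snd z))"
      by (intro continuous_intros continuous_on_compose2[OF F] continuous_on_compose2[OF gc]) auto
    then show "continuous_on (UNIV \<times> cbox a b) (\<lambda>(t, y). F y * partial_deriv i g (x + t *\<^sub>R axis i 1 - y))" by (simp add: split_beta)
  qed auto
  then show "partial_deriv i \<psi> x = integral (cbox a b) (\<lambda>y. F y * partial_deriv i g (x - y))"
    unfolding \<psi>_def by (intro partial_deriv_eqI) (simp add: has_real_derivative_iff_has_vector_derivative)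
qed

lemma of_class_C_convolution:
  fixes F g :: "real^'d \<Rightarrow> real"
  assumes F: "continuous_on UNIV F" and g: "\<And>k. of_class_C k g"
  shows "of_class_C k (\<lambda>x. integral (cbox a b) (\<lambda>y. F y * g (x - y)))"
  using g
proof (induction k arbitrary: g)
  case 0
  have gc: "continuous_on UNIV g" using 0[of 0] by simp
  have "continuous_on (UNIV \<times> cbox a b) (\<lambda>z. F (snd z) * g (fst z - snd z))"
    by (intro continuous_intros continuous_on_compose2[OF F] continuous_on_compose2[OF gc]) auto
  then show ?case by (simp, intro integral_continuous_on_param) (simp add: split_beta)
next
  case (Suc k)
  have "of_class_C 1 g" by (rule Suc.prems)
  note * = convolution_derivative[OF F this, where a=a and b=b]
  have "of_class_C m (partial_deriv i g)" for m i using Suc.prems[of "Suc m"] by simp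
  then show ?case using *(1) Suc.IH by (simp add: *(2)[abs_def])
qed

text \<open>The Leibniz rule concerns the gauge integral over a box, the estimates the Lebesgue
  integral over the whole space; on continuous functions supported in the box they agree.\<close>

lemma integral_eq_lborel:
  fixes f :: "real^'d \<Rightarrow> real"
  assumes f: "continuous_on UNIV f" and supp: "\<And>y. y \<notin> cbox a b \<Longrightarrow> f y = 0"
  shows "integral (cbox a b) f = (\<integral>y. f y \<partial>lborel)" and "integrable lborel f"
proof -
  have s: "set_integrable lborel (cbox a b) f"
    unfolding set_integrable_def by (rule borel_integrable_compact) (auto intro: continuous_on_subset[OF f])
  have eq: "(\<lambda>y. indicator (cbox a b) y *\<^sub>R f y) = f" by (auto simp: fun_eq_iff indicator_def supp)
  show "integral (cbox a b) f = (\<integral>y. f y \<partial>lborel)"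
    using set_borel_integral_eq_integral(2)[OF s] unfolding set_lebesgue_integral_def eq by (rule sym)
  show "integrable lborel f" using s unfolding set_integrable_def eq .
qed

lemma lborel_integral_reflect:
  fixes f :: "real^'d \<Rightarrow> real"
  assumes [measurable]: "f \<in> borel_measurable borel"
  shows "(\<integral>y. f (x - y) \<partial>lborel) = (\<integral>y. f y \<partial>lborel)"
proof -
  have "lborel = distr lborel borel (\<lambda>y::real^'d. x - y)"
    using lborel_affine[of "-1" x] by (simp add: density_1)
  then have "(\<integral>y. f y \<partial>lborel) = (\<integral>y. f y \<partial>distr lborel borel (\<lambda>y::real^'d. x - y))" by simp
  also have "\<dots> = (\<integral>y. f (x - y) \<partial>lborel)" by (subst integral_distr) auto
  finally show ?thesis by simp
qed

lemma partial_deriv_eq_0_outside: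
  fixes F :: "real^'d \<Rightarrow> real"
  assumes F: "\<And>y. norm y > R \<Longrightarrow> F y = 0" and y: "norm y > R"
  shows "partial_deriv i F y = 0"
proof (rule partial_deriv_eqI)
  have "((\<lambda>t. norm (y + t *\<^sub>R axis i 1)) \<longlongrightarrow> norm (y + 0 *\<^sub>R axis i 1)) (nhds (0::real))"
    by (intro tendsto_intros filterlim_ident)
  then have "\<forall>\<^sub>F t in nhds (0::real). norm (y + t *\<^sub>R axis i 1) > R"
    using y by (intro order_tendstoD) auto
  then have "\<forall>\<^sub>F t in nhds (0::real). 0 = F (y + t *\<^sub>R axis i 1)"
    by eventually_elim (simp add: F)
  then have "((\<lambda>t. 0) has_real_derivative 0) (at 0) \<longleftrightarrow> ((\<lambda>t. F (y + t *\<^sub>R axis i 1)) has_real_derivative 0) (at 0)"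
    by (intro DERIV_cong_ev) auto
  then show "((\<lambda>t. F (y + t *\<^sub>R axis i 1)) has_real_derivative 0) (at 0)" by simp
qed

lemma continuous_compact_support_bounded:
  fixes F :: "'a::euclidean_space \<Rightarrow> real"
  assumes c: "continuous_on UNIV F" and F: "\<And>y. norm y > R \<Longrightarrow> F y = 0"
  obtains B where "\<And>y. \<bar>F y\<bar> \<le> B"
proof -
  have "compact (F ` cball 0 R)" by (intro compact_continuous_image continuous_on_subset[OF c]) auto
  then obtain B where B: "\<And>y. y \<in> cball 0 R \<Longrightarrow> \<bar>F y\<bar> \<le> B"
    by (meson bounded_real compact_imp_bounded imageI)
  have "\<bar>F y\<bar> \<le> \<bar>B\<bar>" for y
    using B[of y] F[of y] by (cases "norm y \<le> R") auto
  then show thesis by (rule that)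
qed

text \<open>Guarantees a nonzero normalising constant for the mollifier: the bump is positive on the
  open box, and the box has positive volume.\<close>

lemma bump_integral_pos:
  assumes "\<And>i. a $ i < b $ i"
  shows "integrable lborel (bump 1 a (b :: real^'d))" "0 < (\<integral>y. bump 1 a b y \<partial>lborel)"
proof -
  have c: "continuous_on UNIV (bump 1 a b)" using of_class_C_bump[of 0] by simp
  have [measurable]: "bump 1 a b \<in> borel_measurable borel" using c by (rule borel_measurable_continuous_onI)
  show int: "integrable lborel (bump 1 a b)"
    by (rule integral_eq_lborel(2)[OF c, of a b]) (use bump_eq_0[of 1 a b] box_subset_cbox[of a b] in auto)
  have "(\<integral>y. bump 1 a b y \<partial>lborel) \<noteq> 0"
  proof
    assume "(\<integral>y. bump 1 a b y \<partial>lborel) = 0"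
    then have "AE y in lborel. bump 1 a b y = 0"
      using integral_nonneg_eq_0_iff_AE[OF int] by (simp add: bump_bounds)
    then have "AE y in lborel. y \<notin> box a b" by eventually_elim (simp add: bump_eq_0)
    then have "emeasure lborel (box a b) = 0"
      by (subst (asm) AE_iff_measurable[of "box a b"]) auto
    moreover have "emeasure lborel (box a b) = (\<Prod>e\<in>Basis. (b - a) \<bullet> e)"
      by (rule emeasure_lborel_box) (use assms in \<open>auto simp: Basis_vec_def inner_axis less_imp_le\<close>)
    ultimately have "(\<Prod>e\<in>Basis. (b - a) \<bullet> e) \<le> 0" by (simp add: ennreal_eq_0_iff)
    moreover have "0 < (\<Prod>e\<in>Basis. (b - a) \<bullet> e)"
      by (rule prod_pos) (use assms in \<open>auto simp: Basis_vec_def inner_axis\<close>)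
    ultimately show False by simp
  qed
  moreover have "0 \<le> (\<integral>y. bump 1 a b y \<partial>lborel)" by (simp add: bump_bounds)
  ultimately show "0 < (\<integral>y. bump 1 a b y \<partial>lborel)" by simp
qed

text \<open>The support shrinks like 1/(k + 1) but lies in one fixed cube for all k, over which
  every convolution integral can be taken.\<close>

definition mollifier :: "nat \<Rightarrow> real^'d \<Rightarrow> real" where
  "mollifier k z = bump 1 (\<chi> i. - 1 / real (Suc k)) (\<chi> i. 1 / real (Suc k)) z
     / (\<integral>y. bump 1 (\<chi> i. - 1 / real (Suc k)) (\<chi> i. 1 / real (Suc k)) (y :: real^'d) \<partial>lborel)"

lemma mollifier_properties:
  shows of_class_C_mollifier: "of_class_C m (mollifier k :: real^'d \<Rightarrow> real)"
    and mollifier_nonneg: "0 \<le> mollifier k (z :: real^'d)"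
    and mollifier_support: "mollifier k z \<noteq> 0 \<Longrightarrow> \<bar>z $ i\<bar> < 1 / real (Suc k)"
    and integrable_mollifier: "integrable lborel (mollifier k :: real^'d \<Rightarrow> real)"
    and integral_mollifier: "(\<integral>z. mollifier k (z :: real^'d) \<partial>lborel) = 1"
proof -
  let ?a = "(\<chi> i. - 1 / real (Suc k)) :: real^'d" and ?b = "(\<chi> i. 1 / real (Suc k)) :: real^'d"
  have "?a $ i < ?b $ i" for i by simp
  note p = bump_integral_pos[OF this]
  have eq: "mollifier k = (\<lambda>z::real^'d. bump 1 ?a ?b z * (1 / (\<integral>y. bump 1 ?a ?b y \<partial>lborel)))"
    by (simp add: mollifier_def[abs_def])
  show "of_class_C m (mollifier k :: real^'d \<Rightarrow> real)"
    unfolding eq by (intro of_class_C_mult of_class_C_const of_class_C_bump)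
  show "0 \<le> mollifier k z" using p(2) by (simp add: mollifier_def bump_bounds)
  show "\<bar>z $ i\<bar> < 1 / real (Suc k)" if "mollifier k z \<noteq> 0"
  proof -
    have "z \<in> box ?a ?b" using that bump_eq_0[of 1 ?a ?b z] by (auto simp: mollifier_def)
    then have "- (1 / real (Suc k)) < z $ i" "z $ i < 1 / real (Suc k)" by (auto simp: mem_box_cart)
    then show ?thesis by linarith
  qed
  show "integrable lborel (mollifier k :: real^'d \<Rightarrow> real)" unfolding eq using p(1) by simp
  show "(\<integral>z. mollifier k (z :: real^'d) \<partial>lborel) = 1" unfolding eq using p by simp
qed

lemma mollify_tendsto:
  fixes H :: "real^'d \<Rightarrow> real"
  assumes H: "continuous_on UNIV H" and B: "\<And>x. \<bar>H x\<bar> \<le> B"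
  defines "A \<equiv> \<lambda>k x. integral (cbox (\<chi> i. - 1) (\<chi> i. 1)) (\<lambda>z. mollifier k z * H (x - z))"
  shows "\<bar>A k x\<bar> \<le> B" and "(\<lambda>k. A k x) \<longlonglongrightarrow> H x"
proof -
  have mc: "continuous_on UNIV (mollifier k :: real^'d \<Rightarrow> real)" for k using of_class_C_mollifier[of 0] by simp
  have [measurable]: "mollifier k \<in> borel_measurable (borel :: (real^'d) measure)" "H \<in> borel_measurable borel" for k
    using mc H by (auto intro: borel_measurable_continuous_onI)
  have supp: "mollifier k z = 0" if z: "z \<notin> cbox (\<chi> i. - 1) (\<chi> i. 1)" for k and z :: "real^'d"
  proof (rule ccontr)
    assume "mollifier k z \<noteq> 0"
    then have "\<bar>z $ i\<bar> < 1 / real (Suc k)" for i by (rule mollifier_support)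
    moreover have "1 / real (Suc k) \<le> 1" by simp
    ultimately have "\<bar>z $ i\<bar> \<le> 1" for i by (meson less_imp_le order_trans)
    then have "z \<in> cbox (\<chi> i. - 1) (\<chi> i. 1)" by (auto simp: mem_box_cart abs_le_iff minus_le_iff)
    with z show False by simp
  qed
  have A: "A k x = (\<integral>z. mollifier k z * H (x - z) \<partial>lborel)" for k x
    unfolding A_def
    by (rule integral_eq_lborel) (auto intro!: continuous_intros mc continuous_on_compose2[OF H] simp: supp)
  have int: "integrable lborel (\<lambda>z. mollifier k z * h z)" if [measurable]: "h \<in> borel_measurable borel" and "\<And>z. \<bar>h z\<bar> \<le> C" for k h and C :: real
    by (rule integrable_mult_bounded[OF integrable_mollifier _ that(2)]) simp
  have m: "\<bar>mollifier k z * h\<bar> = mollifier k z * \<bar>h\<bar>" for k and z :: "real^'d" and h :: real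
    by (simp add: abs_mult mollifier_nonneg)
  have "\<bar>A k x\<bar> \<le> (\<integral>z. \<bar>mollifier k z * H (x - z)\<bar> \<partial>lborel)" unfolding A by (rule integral_abs_bound)
  also have "\<dots> \<le> (\<integral>z. mollifier k z * B \<partial>(lborel :: (real^'d) measure))"
    unfolding m by (rule integral_mono) (use int[of "\<lambda>z. \<bar>H (x - z)\<bar>" B] int[of "\<lambda>z. B" B] B in \<open>auto intro!: mult_left_mono mollifier_nonneg integrable_mollifier\<close>)
  finally show "\<bar>A k x\<bar> \<le> B" by (simp add: integral_mollifier)
  show "(\<lambda>k. A k x) \<longlonglongrightarrow> H x"
    unfolding LIMSEQ_iff
  proof (intro allI impI)
    fix e :: real assume e: "e > 0"
    have "isCont H x" using H by (simp add: continuous_on_eq_continuous_at)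
    then obtain d where d: "d > 0" "\<And>y. dist y x < d \<Longrightarrow> dist (H y) (H x) < e / 2"
      using e unfolding continuous_at_eps_delta by (metis half_gt_zero)
    \<comment> \<open>Points of the support have norm at most \<open>CARD('d) / (k + 1)\<close>,
      which is below the continuity modulus \<open>d\<close> for k at least
      \<open>N\<close>.\<close>
    obtain N :: nat where N: "real CARD('d) / d < real N" using reals_Archimedean2 by blast
    have close: "mollifier k z * \<bar>H (x - z) - H x\<bar> \<le> mollifier k z * (e / 2)" if k: "k \<ge> N" for k z
    proof (cases "mollifier k z = 0")
      case False
      then have "\<bar>z $ i\<bar> < 1 / real (Suc k)" for i by (rule mollifier_support)
      then have "(\<Sum>i\<in>UNIV. \<bar>z $ i\<bar>) \<le> (\<Sum>i\<in>(UNIV::'d set). 1 / real (Suc k))" by (intro sum_mono less_imp_le)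
      then have "norm z \<le> real CARD('d) / real (Suc k)" using norm_le_l1_cart[of z] by simp
      also have "\<dots> < d"
      proof -
        have "real CARD('d) < d * real N" using N d by (simp add: field_simps)
        also have "\<dots> \<le> d * real (Suc k)" using k d by simp
        finally show ?thesis by (simp add: field_simps)
      qed
      finally have "dist (H (x - z)) (H x) < e / 2" by (intro d) (simp add: dist_norm)
      then show ?thesis by (intro mult_left_mono mollifier_nonneg) (simp add: dist_real_def)
    qed simp
    have b2: "\<bar>H (x - z) - H x\<bar> \<le> 2 * B" for z using B[of "x - z"] B[of x] by linarith
    have "\<bar>A k x - H x\<bar> < e" if k: "k \<ge> N" for k
    proof -
      have "A k x - H x = (\<integral>z. mollifier k z * (H (x - z) - H x) \<partial>lborel)"
      proof -
        have i1: "integrable lborel (\<lambda>z. mollifier k z * H (x - z))" by (rule int[of _ B]) (use B in auto)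
        have i2: "integrable lborel (\<lambda>z. mollifier k z * H x)" by (rule int[of _ B]) (use B in auto)
        have "(\<integral>z. mollifier k (z :: real^'d) * H x \<partial>lborel) = H x" by (simp add: integral_mollifier)
        then show ?thesis unfolding A right_diff_distrib Bochner_Integration.integral_diff[OF i1 i2] by simp
      qed
      also have "\<bar>\<dots>\<bar> \<le> (\<integral>z. \<bar>mollifier k z * (H (x - z) - H x)\<bar> \<partial>lborel)" by (rule integral_abs_bound)
      also have "\<dots> \<le> (\<integral>z. mollifier k z * (e / 2) \<partial>(lborel :: (real^'d) measure))"
        unfolding m
      proof (rule integral_mono)
        show "integrable lborel (\<lambda>z. mollifier k z * \<bar>H (x - z) - H x\<bar>)"
          by (rule int[of _ "2 * B"]) (use b2 in auto)
        show "integrable lborel (\<lambda>z::real^'d. mollifier k z * (e / 2))"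
          by (rule integrable_mult_left, rule integrable_mollifier)
      qed (rule close[OF k])
      also have "\<dots> = e / 2" by (simp add: integral_mollifier)
      finally show ?thesis using e by simp
    qed
    then show "\<exists>N. \<forall>k\<ge>N. norm (A k x - H x) < e" by auto
  qed
qed

text \<open>The convolution can be differentiated on either factor. On the mollifier, this gives the
  approximants derivatives of all orders. On \<open>F\<close>, after the change of variables
  \<open>swap\<close>, it identifies their partial derivative with the mollified partial derivative
  of \<open>F\<close>, which converges and keeps its bound.\<close>

lemma test_function_approximation:
  fixes F :: "real^'d \<Rightarrow> real"
  assumes F: "of_class_C 1 F" and supp: "\<And>y. norm y > R \<Longrightarrow> F y = 0"
  obtains \<psi> B where "\<And>k. test_function UNIV (\<psi> k)"
    "\<And>k x. \<bar>\<psi> k x\<bar> \<le> B" "\<And>k x. \<bar>partial_deriv i (\<psi> k) x\<bar> \<le> B"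
    "\<And>x. (\<lambda>k. \<psi> k x) \<longlonglongrightarrow> F x" "\<And>x. (\<lambda>k. partial_deriv i (\<psi> k) x) \<longlonglongrightarrow> partial_deriv i F x"
proof -
  let ?c = "cbox (\<chi> i. - \<bar>R\<bar>) (\<chi> i. \<bar>R\<bar>) :: (real^'d) set"
  let ?u = "cbox (\<chi> i. - 1) (\<chi> i. 1) :: (real^'d) set"
  have Fc: "continuous_on UNIV F" and dFc: "continuous_on UNIV (partial_deriv i F)"
    using of_class_C_continuous[OF F] F by (auto simp: of_class_C_1)
  obtain B1 where B1: "\<And>y. \<bar>F y\<bar> \<le> B1" using continuous_compact_support_bounded[OF Fc supp] by blast
  obtain B2 where B2: "\<And>y. \<bar>partial_deriv i F y\<bar> \<le> B2"
  proof -
    have "partial_deriv i F y = 0" if "norm y > R" for y using supp that by (rule partial_deriv_eq_0_outside)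
    then show thesis using continuous_compact_support_bounded[OF dFc] that by blast
  qed
  have mc: "continuous_on UNIV (mollifier k :: real^'d \<Rightarrow> real)" for k using of_class_C_mollifier[of 0] by simp
  have [measurable]: "mollifier k \<in> borel_measurable (borel :: (real^'d) measure)" "F \<in> borel_measurable borel" for k
    using mc Fc by (auto intro: borel_measurable_continuous_onI)
  define \<psi> where "\<psi> k = (\<lambda>x. integral ?c (\<lambda>y. F y * mollifier k (x - y)))" for k
  have small: "\<bar>z $ i\<bar> \<le> 1" if "mollifier k z \<noteq> 0" for k i and z :: "real^'d"
    using mollifier_support[OF that, of i] by (rule order_trans[OF less_imp_le]) simp
  have F0: "F y = 0" if y: "y \<notin> ?c" for y
  proof -
    have "\<not> (\<forall>j. \<bar>y $ j\<bar> \<le> \<bar>R\<bar>)"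
    proof
      assume "\<forall>j. \<bar>y $ j\<bar> \<le> \<bar>R\<bar>"
      then have "y \<in> ?c" unfolding mem_box_cart by (auto simp: abs_le_iff minus_le_iff)
      with y show False by simp
    qed
    then obtain j where "\<bar>y $ j\<bar> > \<bar>R\<bar>" by (auto simp: not_le)
    then have "norm y > R" using component_le_norm_cart[of y j] by linarith
    then show ?thesis by (rule supp)
  qed
  have m0: "mollifier k z = 0" if z: "z \<notin> ?u" for k z
  proof (rule ccontr)
    assume "mollifier k z \<noteq> 0"
    then have "\<bar>z $ i\<bar> \<le> 1" for i by (rule small)
    then have "z \<in> ?u" unfolding mem_box_cart by (auto simp: abs_le_iff minus_le_iff)
    with z show False by simp
  qed
  have swap: "\<psi> k = (\<lambda>x. integral ?u (\<lambda>z. mollifier k z * F (x - z)))" for k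
  proof
    fix x
    have "\<psi> k x = (\<integral>y. F y * mollifier k (x - y) \<partial>lborel)"
      unfolding \<psi>_def by (rule integral_eq_lborel) (auto intro!: continuous_intros Fc continuous_on_compose2[OF mc] simp: F0)
    also have "\<dots> = (\<integral>z. F (x - z) * mollifier k (x - (x - z)) \<partial>lborel)"
      by (rule lborel_integral_reflect[symmetric]) measurable
    also have "\<dots> = (\<integral>z. mollifier k z * F (x - z) \<partial>lborel)" by (simp add: mult.commute)
    also have "\<dots> = integral ?u (\<lambda>z. mollifier k z * F (x - z))"
      by (rule integral_eq_lborel(1)[symmetric]) (auto intro!: continuous_intros mc continuous_on_compose2[OF Fc] simp: m0)
    finally show "\<psi> k x = integral ?u (\<lambda>z. mollifier k z * F (x - z))" .
  qed
  have d\<psi>: "partial_deriv i (\<psi> k) x = integral ?u (\<lambda>z. mollifier k z * partial_deriv i F (x - z))" for k x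
    unfolding swap by (rule convolution_derivative(2)[OF mc F])
  show thesis
  proof (rule that[where \<psi>=\<psi> and B="max B1 B2"])
    show "test_function UNIV (\<psi> k)" for k
      unfolding test_function_def
    proof (intro conjI allI exI[of _ "cball 0 (\<bar>R\<bar> + real CARD('d))"] impI)
      show "of_class_C m (\<psi> k)" for m unfolding \<psi>_def
        by (rule of_class_C_convolution[OF Fc of_class_C_mollifier])
      fix x :: "real^'d" assume x: "x \<notin> cball 0 (\<bar>R\<bar> + real CARD('d))"
      have "F y * mollifier k (x - y) = 0" for y
      proof (cases "mollifier k (x - y) = 0")
        case False
        then have "\<bar>(x - y) $ i\<bar> \<le> 1" for i by (rule small)
        then have "(\<Sum>i\<in>UNIV. \<bar>(x - y) $ i\<bar>) \<le> (\<Sum>i\<in>(UNIV::'d set). 1)" by (intro sum_mono)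
        then have "norm (x - y) \<le> real CARD('d)" using norm_le_l1_cart[of "x - y"] by simp
        moreover have "norm x \<le> norm y + norm (x - y)" using norm_triangle_ineq[of y "x - y"] by simp
        ultimately have "norm y > R" using x by simp
        then show ?thesis by (simp add: supp)
      qed simp
      then have "(\<lambda>y. F y * mollifier k (x - y)) = (\<lambda>y. 0)" by (rule ext)
      then show "\<psi> k x = 0" unfolding \<psi>_def by (simp only: integral_0)
    qed auto
    show "\<bar>\<psi> k x\<bar> \<le> max B1 B2" for k x
      using mollify_tendsto(1)[OF Fc B1, of k x] unfolding swap by simp
    show "\<bar>partial_deriv i (\<psi> k) x\<bar> \<le> max B1 B2" for k x
      using mollify_tendsto(1)[OF dFc B2, of k x] unfolding d\<psi> by simp
    show "(\<lambda>k. \<psi> k x) \<longlonglongrightarrow> F x" for x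
      using mollify_tendsto(2)[OF Fc B1, of x] unfolding swap .
    show "(\<lambda>k. partial_deriv i (\<psi> k) x) \<longlonglongrightarrow> partial_deriv i F x" for x
      using mollify_tendsto(2)[OF dFc B2, of x] unfolding d\<psi> .
  qed
qed

section \<open>Growing cutoffs and integration by parts without compact support\<close>

text \<open>For t > 0 and s = 1/t, the function is s^2 exp (-s), the derivative of exp (-1/t); the
  constant 2 comes from the lower bound 1 + s + s^2/2 for exp s.\<close>

lemma flat_derivative_bound: "\<bar>flat ([:0, 0, 1:] * (1 - pderiv 1)) t\<bar> \<le> 2"
  and flat_derivative_tendsto: "((\<lambda>t. flat ([:0, 0, 1:] * (1 - pderiv 1)) t) \<longlongrightarrow> 0) at_top"
proof -
  have eq: "flat ([:0, 0, 1:] * (1 - pderiv 1)) t = (1 / t)\<^sup>2 * exp (- (1 / t))" if "t > 0" for t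
    using that by (simp add: flat_def power2_eq_square pderiv_1)
  show "\<bar>flat ([:0, 0, 1:] * (1 - pderiv 1)) t\<bar> \<le> 2"
  proof (cases "t > 0")
    case True
    define s where "s = 1 / t"
    have s: "0 \<le> s" using True by (simp add: s_def)
    have "1 + s + s\<^sup>2 / 2 \<le> exp s" by (rule exp_lower_Taylor_quadratic[OF s])
    then have "s\<^sup>2 \<le> 2 * exp s" using s by simp
    then have "s\<^sup>2 * exp (- s) \<le> 2" by (simp add: exp_minus field_simps)
    then show ?thesis using eq[OF True] by (simp add: s_def[symmetric])
  next
    case False
    then have "flat ([:0, 0, 1:] * (1 - pderiv 1)) t = 0" unfolding flat_def by (rule if_not_P)
    then show ?thesis by simp
  qed
  show "((\<lambda>t. flat ([:0, 0, 1:] * (1 - pderiv 1)) t) \<longlongrightarrow> 0) at_top"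
  proof (rule Lim_null_comparison)
    have "((\<lambda>t::real. (1 / t)\<^sup>2) \<longlongrightarrow> 0\<^sup>2) at_top"
      by (intro tendsto_power tendsto_divide_0[OF tendsto_const] filterlim_at_top_imp_at_infinity filterlim_ident)
    then show "((\<lambda>t::real. (1 / t)\<^sup>2) \<longlongrightarrow> 0) at_top" by simp
    show "\<forall>\<^sub>F t in at_top. norm (flat ([:0, 0, 1:] * (1 - pderiv 1)) t) \<le> (1 / t)\<^sup>2"
      using eventually_gt_at_top[of 0]
    proof eventually_elim
      case (elim t)
      have "(1 / t)\<^sup>2 * exp (- (1 / t)) \<le> (1 / t)\<^sup>2 * 1"
        using elim by (intro mult_left_mono) auto
      then show ?case unfolding eq[OF elim] by simp
    qed
  qed
qed

lemma partial_deriv_bump: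
  fixes a b :: "real^'d"
  shows "partial_deriv i (bump 1 a b) y =
    (flat ([:0, 0, 1:] * (1 - pderiv 1)) (y $ i - a $ i) * flat 1 (b $ i - y $ i)
      - flat 1 (y $ i - a $ i) * flat ([:0, 0, 1:] * (1 - pderiv 1)) (b $ i - y $ i)) * (\<Prod>j\<in>UNIV - {i}. bump1 1 (a $ j) (b $ j) (y $ j))"
proof (rule partial_deriv_eqI)
  let ?q = "[:0, 0, 1:] * (1 - pderiv 1) :: real poly"
  let ?P = "\<Prod>j\<in>UNIV - {i}. bump1 1 (a $ j) (b $ j) (y $ j)"
  have eq: "bump 1 a b (y + t *\<^sub>R axis i 1) = flat 1 (y $ i + t - a $ i) * flat 1 (b $ i - (y $ i + t)) * ?P" for t
  proof -
    have "bump 1 a b (y + t *\<^sub>R axis i 1) = bump1 1 (a $ i) (b $ i) ((y + t *\<^sub>R axis i 1) $ i) * (\<Prod>j\<in>UNIV - {i}. bump1 1 (a $ j) (b $ j) ((y + t *\<^sub>R axis i 1) $ j))"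
      unfolding bump_def by (rule prod.remove) auto
    moreover have "(\<Prod>j\<in>UNIV - {i}. bump1 1 (a $ j) (b $ j) ((y + t *\<^sub>R axis i 1) $ j)) = ?P"
      by (rule prod.cong) (auto simp: axis_def)
    ultimately show ?thesis by (simp add: bump1_def axis_def)
  qed
  have 1: "((\<lambda>t. flat 1 (y $ i + t - a $ i)) has_real_derivative flat ?q (y $ i + 0 - a $ i) * 1) (at 0)"
    by (rule DERIV_chain2[OF flat_DERIV]) (auto intro!: derivative_eq_intros)
  have 2: "((\<lambda>t. flat 1 (b $ i - (y $ i + t))) has_real_derivative flat ?q (b $ i - (y $ i + 0)) * (-1)) (at 0)"
    by (rule DERIV_chain2[OF flat_DERIV]) (auto intro!: derivative_eq_intros)
  have "((\<lambda>t. flat 1 (y $ i + t - a $ i) * flat 1 (b $ i - (y $ i + t)) * ?P) has_real_derivative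
    ((flat ?q (y $ i + 0 - a $ i) * 1) * flat 1 (b $ i - (y $ i + 0)) + (flat ?q (b $ i - (y $ i + 0)) * (-1)) * flat 1 (y $ i + 0 - a $ i)) * ?P) (at 0)"
    by (intro DERIV_cmult_right DERIV_mult 1 2)
  moreover have "((flat ?q (y $ i + 0 - a $ i) * 1) * flat 1 (b $ i - (y $ i + 0)) + (flat ?q (b $ i - (y $ i + 0)) * (-1)) * flat 1 (y $ i + 0 - a $ i)) * ?P
    = (flat ?q (y $ i - a $ i) * flat 1 (b $ i - y $ i) - flat 1 (y $ i - a $ i) * flat ?q (b $ i - y $ i)) * ?P"
  proof -
    have "((A * 1) * B + (C * (-1)) * D) * Q = (A * B - D * C) * Q" for A B C D Q :: real by (simp add: algebra_simps)
    then show ?thesis by (simp only: add_0_right)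
  qed
  ultimately show "((\<lambda>t. bump 1 a b (y + t *\<^sub>R axis i 1)) has_real_derivative
    (flat ?q (y $ i - a $ i) * flat 1 (b $ i - y $ i) - flat 1 (y $ i - a $ i) * flat ?q (b $ i - y $ i)) * ?P) (at 0)"
    unfolding eq by (simp only:)
qed

text \<open>Only the box grows, the flanks keep their shape. The cutoff tends to 1 because exp
  (-1/t) tends to 1 at infinity, and its gradient tends to 0 because the derivative of exp (-1/t)
  does. The bound 4 collects two flanks, each contributing at most 2.\<close>

lemma growing_bump:
  fixes y :: "real^'d"
  defines "\<kappa> \<equiv> \<lambda>m::nat. bump 1 ((\<chi> i. - real m) :: real^'d) (\<chi> i. real m)"
  shows "(\<lambda>m. \<kappa> m y) \<longlonglongrightarrow> 1" "\<bar>partial_deriv i (\<kappa> m) y\<bar> \<le> 4" "(\<lambda>m. partial_deriv i (\<kappa> m) y) \<longlonglongrightarrow> 0"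
    and "norm y > real m * real CARD('d) \<Longrightarrow> \<kappa> m y = 0"
proof -
  let ?q = "[:0, 0, 1:] * (1 - pderiv 1) :: real poly"
  have up: "filterlim (\<lambda>m. t - - real m) at_top sequentially" "filterlim (\<lambda>m. real m - t) at_top sequentially" for t
    by (simp_all add: filterlim_tendsto_add_at_top[OF tendsto_const filterlim_real_sequentially])
       (use filterlim_tendsto_add_at_top[OF tendsto_const[of "-t"] filterlim_real_sequentially] in simp)
  have b1: "(\<lambda>m. bump1 1 (- real m) (real m) t) \<longlonglongrightarrow> 1" for t
    using tendsto_mult[OF flat_1_tendsto[OF up(1)[of t]] flat_1_tendsto[OF up(2)[of t]]] by (simp add: bump1_def)
  have "(\<lambda>m. \<kappa> m y) \<longlonglongrightarrow> (\<Prod>i\<in>(UNIV::'d set). 1)"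
    unfolding \<kappa>_def bump_def vec_lambda_beta by (intro tendsto_prod b1)
  then show "(\<lambda>m. \<kappa> m y) \<longlonglongrightarrow> 1" by simp
  define P where "P m = (\<Prod>j\<in>UNIV - {i}. bump1 1 (- real m) (real m) (y $ j))" for m
  have P: "0 \<le> P m" "P m \<le> 1" for m
    unfolding P_def by (auto intro!: prod_nonneg prod_le_1 simp: bump1_bounds)
  define u where "u m = flat ?q (y $ i - - real m) * flat 1 (real m - y $ i)
     - flat 1 (y $ i - - real m) * flat ?q (real m - y $ i)" for m
  have pd: "partial_deriv i (\<kappa> m) y = u m * P m" for m
    unfolding \<kappa>_def partial_deriv_bump u_def P_def vec_lambda_beta ..
  have u4: "\<bar>u m\<bar> \<le> 4" for m
  proof -
    have "\<bar>flat ?q s * flat 1 t\<bar> \<le> 2 * 1" for s t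
      unfolding abs_mult by (intro mult_mono flat_derivative_bound) (auto simp: flat_1 abs_of_nonneg)
    from this[of "y $ i - - real m" "real m - y $ i"] this[of "real m - y $ i" "y $ i - - real m"]
    show ?thesis unfolding u_def mult.commute[of "flat 1 (y $ i - - real m)"] by linarith
  qed
  show "\<bar>partial_deriv i (\<kappa> m) y\<bar> \<le> 4"
  proof -
    have "\<bar>u m\<bar> * \<bar>P m\<bar> \<le> 4 * 1" using P u4 by (intro mult_mono) auto
    then show ?thesis unfolding pd abs_mult by simp
  qed
  have "(\<lambda>m. u m) \<longlonglongrightarrow> 0 * 1 - 1 * 0"
    unfolding u_def by (intro tendsto_diff tendsto_mult flat_1_tendsto up filterlim_compose[OF flat_derivative_tendsto])
  then have u0: "(\<lambda>m. \<bar>u m\<bar>) \<longlonglongrightarrow> 0" by (simp add: tendsto_rabs_zero)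
  show "(\<lambda>m. partial_deriv i (\<kappa> m) y) \<longlonglongrightarrow> 0"
    by (rule Lim_null_comparison[OF _ u0]) (use P in \<open>auto simp: pd abs_mult mult_left_le\<close>)
  show "\<kappa> m y = 0" if y: "norm y > real m * real CARD('d)"
  proof (rule ccontr)
    assume "\<kappa> m y \<noteq> 0"
    then have "y \<in> box (\<chi> i. - real m) (\<chi> i. real m)" by (simp add: \<kappa>_def bump_eq_0)
    then have "- real m < y $ i \<and> y $ i < real m" for i by (simp add: mem_box_cart)
    then have "\<bar>y $ i\<bar> \<le> real m" for i by (simp add: abs_le_iff) (meson less_imp_le minus_less_iff)
    then have "(\<Sum>i\<in>UNIV. \<bar>y $ i\<bar>) \<le> (\<Sum>i\<in>(UNIV::'d set). real m)" by (intro sum_mono)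
    then show False using norm_le_l1_cart[of y] y by (simp add: mult.commute)
  qed
qed

text \<open>The definition tests only smooth functions of compact support. Mollification extends it
  to C1 functions of compact support, and multiplication by growing cutoffs to bounded C1 functions
  with bounded derivative. In both limits the integrable function \<rho>_i supplies the
  domination.\<close>

lemma logarithmic_gradient_C1:
  fixes G :: "real^'d \<Rightarrow> real"
  assumes "prob_space P" and sets[measurable_cong]: "sets P = sets borel"
    and \<rho>: "L2_logarithmic_gradient P \<rho>"
    and G: "of_class_C 1 G" and B: "\<And>y. \<bar>G y\<bar> \<le> B" "\<And>y. \<bar>partial_deriv i G y\<bar> \<le> B"
  shows "(\<integral>y. partial_deriv i G y \<partial>P) = - (\<integral>y. G y * \<rho> i y \<partial>P)"
proof -
  interpret prob_space P by fact
  have \<rho>m[measurable]: "\<rho> i \<in> borel_measurable P" and "integrable P (\<lambda>y. (\<rho> i y)\<^sup>2)"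
    using \<rho> by (auto simp: L2_logarithmic_gradient_def in_L2_def)
  then have i\<rho>: "integrable P (\<rho> i)" by (rule square_integrable_imp_integrable)
  have meas: "f \<in> borel_measurable P" "partial_deriv i f \<in> borel_measurable P" if "of_class_C 1 f" for f :: "real^'d \<Rightarrow> real"
  proof -
    have "f \<in> borel_measurable borel" "partial_deriv i f \<in> borel_measurable borel"
      using of_class_C_continuous[OF that] that by (auto simp: of_class_C_1 intro: borel_measurable_continuous_onI)
    then show "f \<in> borel_measurable P" "partial_deriv i f \<in> borel_measurable P" by measurable
  qed
  have compact_case: "(\<integral>y. partial_deriv i F y \<partial>P) = - (\<integral>y. F y * \<rho> i y \<partial>P)"
    if F: "of_class_C 1 F" and supp: "\<And>y. norm y > R \<Longrightarrow> F y = 0" for F R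
  proof -
    obtain \<psi> C where \<psi>: "\<And>k. test_function UNIV (\<psi> k)" "\<And>k x. \<bar>\<psi> k x\<bar> \<le> C" "\<And>k x. \<bar>partial_deriv i (\<psi> k) x\<bar> \<le> C"
      "\<And>x. (\<lambda>k. \<psi> k x) \<longlonglongrightarrow> F x" "\<And>x. (\<lambda>k. partial_deriv i (\<psi> k) x) \<longlonglongrightarrow> partial_deriv i F x"
      using test_function_approximation[OF F supp, where i=i] by blast
    have \<psi>1: "of_class_C 1 (\<psi> k)" for k using \<psi>(1) unfolding test_function_def by blast
    note [measurable] = meas[OF F] meas[OF \<psi>1]
    have "(\<lambda>k. \<integral>y. partial_deriv i (\<psi> k) y \<partial>P) \<longlonglongrightarrow> (\<integral>y. partial_deriv i F y \<partial>P)"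
      by (rule integral_dominated_convergence[where w="\<lambda>_. C"]) (use \<psi> in auto)
    moreover have "(\<lambda>k. \<integral>y. \<psi> k y * \<rho> i y \<partial>P) \<longlonglongrightarrow> (\<integral>y. F y * \<rho> i y \<partial>P)"
    proof (rule integral_dominated_convergence[where w="\<lambda>y. C * \<bar>\<rho> i y\<bar>"])
      show "AE y in P. (\<lambda>k. \<psi> k y * \<rho> i y) \<longlonglongrightarrow> F y * \<rho> i y"
        by (intro AE_I2 tendsto_mult tendsto_const \<psi>)
      show "AE y in P. norm (\<psi> k y * \<rho> i y) \<le> C * \<bar>\<rho> i y\<bar>" for k
        using \<psi>(2) by (intro AE_I2) (simp add: abs_mult mult_right_mono)
    qed (use i\<rho> in auto)
    then have "(\<lambda>k. - (\<integral>y. \<psi> k y * \<rho> i y \<partial>P)) \<longlonglongrightarrow> - (\<integral>y. F y * \<rho> i y \<partial>P)" by (rule tendsto_minus)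
    moreover have "(\<integral>y. partial_deriv i (\<psi> k) y \<partial>P) = - (\<integral>y. \<psi> k y * \<rho> i y \<partial>P)" for k
      using \<rho> \<psi>(1) by (simp add: L2_logarithmic_gradient_def)
    ultimately show ?thesis by (simp add: LIMSEQ_unique)
  qed
  define \<kappa> where "\<kappa> m = bump 1 ((\<chi> i. - real m) :: real^'d) (\<chi> i. real m)" for m :: nat
  note \<kappa> = growing_bump[where ?'d='d, folded \<kappa>_def]
  have \<kappa>C: "of_class_C k (\<kappa> m)" for k m unfolding \<kappa>_def by (rule of_class_C_bump)
  have \<kappa>b: "0 \<le> \<kappa> m y" "\<kappa> m y \<le> 1" for m y unfolding \<kappa>_def by (rule bump_bounds)+
  note [measurable] = meas[OF G] meas[OF \<kappa>C[of 1]]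
  have pd: "partial_deriv i (\<lambda>y. G y * \<kappa> m y) = (\<lambda>y. partial_deriv i G y * \<kappa> m y + G y * partial_deriv i (\<kappa> m) y)" for m
    using G \<kappa>C[of 1 m] by (intro partial_deriv_mult) (auto simp: of_class_C_1)
  have B0: "0 \<le> B" using B(1)[of 0] by linarith
  have eq: "(\<integral>y. partial_deriv i G y * \<kappa> m y + G y * partial_deriv i (\<kappa> m) y \<partial>P) = - (\<integral>y. (G y * \<kappa> m y) * \<rho> i y \<partial>P)" for m
    using compact_case[OF of_class_C_mult[OF G \<kappa>C[of 1 m]], of "real m * real CARD('d)"] \<kappa>(4) unfolding pd by simp
  have "(\<lambda>m. \<integral>y. partial_deriv i G y * \<kappa> m y + G y * partial_deriv i (\<kappa> m) y \<partial>P) \<longlonglongrightarrow> (\<integral>y. partial_deriv i G y \<partial>P)"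
  proof (rule integral_dominated_convergence[where w="\<lambda>_. B + B * 4"])
    show "AE y in P. (\<lambda>m. partial_deriv i G y * \<kappa> m y + G y * partial_deriv i (\<kappa> m) y) \<longlonglongrightarrow> partial_deriv i G y"
    proof (rule AE_I2)
      fix y
      have "(\<lambda>m. partial_deriv i G y * \<kappa> m y + G y * partial_deriv i (\<kappa> m) y) \<longlonglongrightarrow> partial_deriv i G y * 1 + G y * 0"
        by (intro tendsto_intros \<kappa>)
      then show "(\<lambda>m. partial_deriv i G y * \<kappa> m y + G y * partial_deriv i (\<kappa> m) y) \<longlonglongrightarrow> partial_deriv i G y" by simp
    qed
    show "AE y in P. norm (partial_deriv i G y * \<kappa> m y + G y * partial_deriv i (\<kappa> m) y) \<le> B + B * 4" for m
    proof (rule AE_I2)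
      fix y
      have "\<bar>partial_deriv i G y * \<kappa> m y\<bar> \<le> B * 1" unfolding abs_mult using B \<kappa>b B0 by (intro mult_mono) auto
      moreover have "\<bar>G y * partial_deriv i (\<kappa> m) y\<bar> \<le> B * 4" unfolding abs_mult using B \<kappa>(2) B0 by (intro mult_mono) auto
      ultimately show "norm (partial_deriv i G y * \<kappa> m y + G y * partial_deriv i (\<kappa> m) y) \<le> B + B * 4"
        unfolding real_norm_def by linarith
    qed
  qed auto
  moreover have "(\<lambda>m. - (\<integral>y. (G y * \<kappa> m y) * \<rho> i y \<partial>P)) \<longlonglongrightarrow> - (\<integral>y. G y * \<rho> i y \<partial>P)"
  proof (rule tendsto_minus, rule integral_dominated_convergence[where w="\<lambda>y. B * \<bar>\<rho> i y\<bar>"])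
    show "AE y in P. (\<lambda>m. (G y * \<kappa> m y) * \<rho> i y) \<longlonglongrightarrow> G y * \<rho> i y"
    proof (rule AE_I2)
      fix y
      have "(\<lambda>m. (G y * \<kappa> m y) * \<rho> i y) \<longlonglongrightarrow> (G y * 1) * \<rho> i y" by (intro tendsto_intros \<kappa>)
      then show "(\<lambda>m. (G y * \<kappa> m y) * \<rho> i y) \<longlonglongrightarrow> G y * \<rho> i y" by simp
    qed
    show "AE y in P. norm ((G y * \<kappa> m y) * \<rho> i y) \<le> B * \<bar>\<rho> i y\<bar>" for m
    proof (rule AE_I2)
      fix y
      have "\<bar>G y\<bar> * \<bar>\<kappa> m y\<bar> \<le> B * 1" using B \<kappa>b B0 by (intro mult_mono) auto
      then show "norm ((G y * \<kappa> m y) * \<rho> i y) \<le> B * \<bar>\<rho> i y\<bar>"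
        unfolding real_norm_def abs_mult by (intro mult_right_mono) auto
    qed
  qed (use i\<rho> in auto)
  ultimately show ?thesis unfolding eq by (rule LIMSEQ_unique)
qed

section \<open>Second order limits\<close>

text \<open>By translation invariance every difference quotient of \<open>G\<close> has integral
  zero. The mean value theorem bounds the quotients by the supremum of the partial derivative on a
  ball of radius R + 1, so the limit may be taken inside.\<close>

lemma integral_partial_deriv_lborel:
  fixes G :: "real^'d \<Rightarrow> real"
  assumes G: "of_class_C 1 G" and supp: "\<And>y. norm y > R \<Longrightarrow> G y = 0"
  shows "(\<integral>y. partial_deriv i G y \<partial>lborel) = 0"
proof -
  have d: "\<And>x. G differentiable (at x)" and c: "continuous_on UNIV (partial_deriv i G)"
    using G by (auto simp: of_class_C_1)
  have Gc: "continuous_on UNIV G" by (rule of_class_C_continuous[OF G])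
  have [measurable]: "G \<in> borel_measurable borel" "partial_deriv i G \<in> borel_measurable borel"
    using Gc c by (auto intro: borel_measurable_continuous_onI)
  have psupp: "partial_deriv i G y = 0" if "norm y > R" for y using supp that by (rule partial_deriv_eq_0_outside)
  obtain B where B: "\<And>y. \<bar>partial_deriv i G y\<bar> \<le> B" using continuous_compact_support_bounded[OF c psupp] by blast
  have B0: "0 \<le> B" using B[of 0] by linarith
  have iG: "integrable lborel G"
  proof -
    have "integrable lborel (\<lambda>x. indicator (cball 0 R) x *\<^sub>R G x)"
      by (rule borel_integrable_compact) (auto intro: continuous_on_subset[OF Gc])
    moreover have "(\<lambda>x. indicator (cball 0 R) x *\<^sub>R G x) = G"
      by (auto simp: fun_eq_iff indicator_def not_le supp)
    ultimately show ?thesis by simp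
  qed
  define t where "t k = 1 / real (Suc k)" for k
  have t: "0 < t k" "t k \<le> 1" for k by (simp_all add: t_def)
  have t0: "t \<longlonglongrightarrow> 0" unfolding t_def[abs_def] using LIMSEQ_inverse_real_of_nat by (simp add: inverse_eq_divide)
  define f where "f k y = (G (y + t k *\<^sub>R axis i 1) - G y) / t k" for k y
  have shift: "integrable lborel (\<lambda>y. G (y + h))" "(\<integral>y. G (y + h) \<partial>lborel) = (\<integral>y. G y \<partial>lborel)" for h
  proof -
    have "integrable (distr lborel borel ((+) h)) G" using iG by (simp add: lborel_distr_plus)
    then show "integrable lborel (\<lambda>y. G (y + h))" by (subst (asm) integrable_distr_eq) (auto simp: add.commute)
    have "(\<integral>y. G y \<partial>lborel) = (\<integral>y. G y \<partial>distr lborel borel ((+) h))" by (simp add: lborel_distr_plus)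
    also have "\<dots> = (\<integral>y. G (y + h) \<partial>lborel)" by (subst integral_distr) (auto simp: add.commute)
    finally show "(\<integral>y. G (y + h) \<partial>lborel) = (\<integral>y. G y \<partial>lborel)" by simp
  qed
  have f0: "(\<integral>y. f k y \<partial>lborel) = 0" for k
    unfolding f_def using shift[of "t k *\<^sub>R axis i 1"] iG by simp
  have "(\<lambda>k. \<integral>y. f k y \<partial>lborel) \<longlonglongrightarrow> (\<integral>y. partial_deriv i G y \<partial>lborel)"
  proof (rule integral_dominated_convergence[where w="\<lambda>y. indicator (cball 0 (R + 1)) y * B"])
    show "integrable lborel (\<lambda>y::real^'d. indicator (cball 0 (R + 1)) y * B)"
      by (intro integrable_mult_left) (auto intro!: integrable_real_indicator emeasure_bounded_finite)
    show "AE y in lborel. (\<lambda>k. f k y) \<longlonglongrightarrow> partial_deriv i G y"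
    proof (rule AE_I2)
      fix y
      have "((\<lambda>t. G (y + t *\<^sub>R axis i 1)) has_real_derivative partial_deriv i G y) (at 0)"
        using DERIV_partial_deriv[OF d, of y i 0] by simp
      then have "((\<lambda>t. (G (y + t *\<^sub>R axis i 1) - G y) / t) \<longlongrightarrow> partial_deriv i G y) (at 0)"
        by (simp add: DERIV_def)
      then show "(\<lambda>k. f k y) \<longlonglongrightarrow> partial_deriv i G y" unfolding f_def
        by (rule filterlim_compose) (use t0 t(1) in \<open>auto simp: filterlim_at less_imp_neq[symmetric] intro!: always_eventually\<close>)
    qed
    show "AE y in lborel. norm (f k y) \<le> indicator (cball 0 (R + 1)) y * B" for k
    proof (rule AE_I2)
      fix y
      have "\<exists>s. 0 < s \<and> s < t k \<and> G (y + t k *\<^sub>R axis i 1) - G (y + 0 *\<^sub>R axis i 1) = (t k - 0) * partial_deriv i G (y + s *\<^sub>R axis i 1)"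
        by (rule MVT2) (use t DERIV_partial_deriv[OF d] in auto)
      then obtain s where s: "0 < s" "s < t k" "G (y + t k *\<^sub>R axis i 1) - G y = t k * partial_deriv i G (y + s *\<^sub>R axis i 1)"
        by auto
      have f: "f k y = partial_deriv i G (y + s *\<^sub>R axis i 1)" unfolding f_def s(3) using t(1)[of k] by simp
      show "norm (f k y) \<le> indicator (cball 0 (R + 1)) y * B"
      proof (cases "y \<in> cball 0 (R + 1)")
        case True then show ?thesis using B by (simp add: f)
      next
        case False
        have "norm y \<le> norm (y + s *\<^sub>R axis i 1) + norm (s *\<^sub>R (axis i 1 :: real^'d))"
          using norm_triangle_ineq4[of "y + s *\<^sub>R axis i 1" "s *\<^sub>R axis i 1"] by simp
        also have "norm (s *\<^sub>R (axis i 1 :: real^'d)) \<le> 1" using s t(2)[of k] by simp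
        finally have "norm (y + s *\<^sub>R axis i 1) > R" using False by simp
        then show ?thesis using B0 by (simp add: f psupp)
      qed
    qed
  qed (auto simp: f_def)
  then show ?thesis unfolding f0 using LIMSEQ_unique tendsto_const by blast
qed

text \<open>A continuous \<open>f\<close> may be unbounded on the whole space, but
  \<open>theta\<close> stays in the closed cube and \<open>V\<close> does so almost surely; so
  \<open>f\<close> may be set to 0 outside the cube, which makes it bounded and Borel.\<close>

lemma (in uniform_vector) equidistribution_cube:
  fixes w f :: "real^'d \<Rightarrow> real"
  assumes w: "continuous_on UNIV w" and supp: "\<And>y. norm y > R \<Longrightarrow> w y = 0"
    and f: "continuous_on UNIV f"
  shows "(\<lambda>n. \<integral>y. w y * f (theta (real n *\<^sub>R y)) \<partial>lborel) \<longlonglongrightarrow> (\<integral>y. w y \<partial>lborel) * (\<integral>\<omega>. f (V \<omega>) \<partial>M)"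
proof -
  have [measurable]: "f \<in> borel_measurable borel" using f by (rule borel_measurable_continuous_onI)
  obtain C where C: "\<And>v. \<forall>i. \<bar>v $ i\<bar> \<le> 1/2 \<Longrightarrow> \<bar>f v\<bar> \<le> C" using continuous_bounded_on_cube[OF f] by blast
  define g where "g v = (if \<forall>i. \<bar>v $ i\<bar> \<le> 1/2 then f v else 0)" for v
  have [measurable]: "g \<in> borel_measurable borel" unfolding g_def by measurable
  have "\<bar>g v\<bar> \<le> \<bar>C\<bar>" for v using C[of v] by (auto simp: g_def)
  then have "(\<lambda>n. \<integral>y. w y * g (theta (real n *\<^sub>R y)) \<partial>lborel) \<longlonglongrightarrow> (\<integral>y. w y \<partial>lborel) * (\<integral>\<omega>. g (V \<omega>) \<partial>M)"
    by (intro equidistribution_continuous(2)[OF w supp]) auto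
  moreover have "g (theta y) = f (theta y)" for y :: "real^'d" using abs_theta_nth_le by (auto simp: g_def)
  moreover have "(\<integral>\<omega>. g (V \<omega>) \<partial>M) = (\<integral>\<omega>. f (V \<omega>) \<partial>M)"
    by (rule integral_cong_AE) (use AE_V in \<open>auto simp: g_def less_imp_le elim!: eventually_mono\<close>)
  ultimately show ?thesis by simp
qed

lemma AE_lborel_not_integer:
  assumes "n > 0"
  shows "AE y in lborel. real n * (y :: real^'d) $ i \<notin> \<int>"
proof -
  have "AE y in lborel. (y :: real^'d) $ i \<noteq> c" for c
  proof -
    have "negligible {y :: real^'d. y $ i = c}" using negligible_standard_hyperplane[of "axis i 1 :: real^'d" c] by (simp add: inner_axis)
    moreover have "closed {y :: real^'d. y $ i = c}" by (intro closed_Collect_eq continuous_intros)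
    then have "{y :: real^'d. y $ i = c} \<in> sets lborel" by simp
    ultimately have "{y :: real^'d. y $ i = c} \<in> null_sets lborel"
      by (simp add: negligible_iff_null_sets null_sets_completion_iff)
    then show ?thesis by (rule AE_I') auto
  qed
  then have "AE y in lborel. \<forall>m::int. (y :: real^'d) $ i \<noteq> of_int m / real n"
    by (subst AE_all_countable) blast
  then show ?thesis
    by eventually_elim (use assms in \<open>auto simp: field_simps elim!: Ints_cases\<close>)
qed

text \<open>Common core for Lebesgue measure and for the law of \<open>Y\<close>:
  \<open>first\<close> and \<open>second\<close> collect everything that depends on the oscillation,
  and \<open>dom\<close> controls second derivatives at the intermediate points of Taylor's formula,
  which lie within \<open>CARD('d)\<close> of y. The factor 1/24 is the variance 1/12 times the
  Taylor factor 1/2.\<close>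

lemma graduated_second_order_limit:
  fixes \<phi> \<eta> g :: "real^'d \<Rightarrow> real"
  assumes sets[measurable_cong]: "sets \<mu> = sets borel" and \<phi>: "of_class_C 2 \<phi>" and \<eta>[measurable]: "\<eta> \<in> borel_measurable borel"
    and int1: "\<And>i. integrable \<mu> (\<lambda>y. partial_deriv i \<phi> y * \<eta> y)"
    and first: "\<And>i. (\<lambda>n. real n * (\<integral>y. (partial_deriv i \<phi> y * \<eta> y) * theta (real n *\<^sub>R y) $ i \<partial>\<mu>)) \<longlonglongrightarrow> 0"
    and second: "\<And>i j. (\<lambda>n. \<integral>y. (partial_deriv j (partial_deriv i \<phi>) y * \<eta> y) * (theta (real n *\<^sub>R y) $ i * theta (real n *\<^sub>R y) $ j) \<partial>\<mu>)
        \<longlonglongrightarrow> (\<integral>y. partial_deriv j (partial_deriv i \<phi>) y * \<eta> y \<partial>\<mu>) * (if i = j then 1/12 else 0)"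
    and dom: "integrable \<mu> g" "\<And>i j y h. norm h \<le> real CARD('d) \<Longrightarrow> \<bar>partial_deriv j (partial_deriv i \<phi>) (y + h) * \<eta> y\<bar> \<le> g y"
  shows "(\<lambda>n. (real n)\<^sup>2 * (\<integral>y. (\<phi> (graduated n y) - \<phi> y) * \<eta> y \<partial>\<mu>)) \<longlonglongrightarrow> (\<integral>y. 1/24 * laplacian \<phi> y * \<eta> y \<partial>\<mu>)"
proof -
  let ?D = "\<lambda>i j. partial_deriv j (partial_deriv i \<phi>)"
  have cD: "continuous_on UNIV (?D i j)" for i j using \<phi> unfolding of_class_C_2 of_class_C_1 by blast
  have \<phi>1: "of_class_C 1 (partial_deriv i \<phi>)" for i using \<phi> unfolding of_class_C_2 by blast
  have [measurable]: "\<phi> \<in> borel_measurable borel" "partial_deriv i \<phi> \<in> borel_measurable borel" "?D i j \<in> borel_measurable borel" for i j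
    using of_class_C_continuous[OF \<phi>] of_class_C_continuous[OF \<phi>1] cD by (auto intro: borel_measurable_continuous_onI)
  define th where "th n y = theta (real n *\<^sub>R y)" for n and y :: "real^'d"
  have [measurable]: "th n \<in> borel_measurable borel" for n unfolding th_def by measurable
  have th1: "\<bar>th n y $ i\<bar> \<le> 1" for n y i unfolding th_def by (rule order_trans[OF abs_theta_nth_le]) simp
  have thth: "\<bar>th n y $ i * th n y $ j\<bar> \<le> 1" for n y i j by (simp add: abs_mult mult_le_one th1)
  have intD: "integrable \<mu> (\<lambda>y. ?D i j y * \<eta> y)" for i j
  proof (rule Bochner_Integration.integrable_bound[OF dom(1)])
    show "AE y in \<mu>. norm (?D i j y * \<eta> y) \<le> norm (g y)"
    proof (rule AE_I2)
      show "norm (?D i j y * \<eta> y) \<le> norm (g y)" for y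
        using dom(2)[of 0 j i y] by simp
    qed
  qed measurable
  have iD: "integrable \<mu> (\<lambda>y. (?D i j y * \<eta> y) * (th n y $ i * th n y $ j))" for i j n
    by (rule integrable_mult_bounded[OF intD _ thth]) measurable
  have i1: "integrable \<mu> (\<lambda>y. (partial_deriv i \<phi> y * \<eta> y) * th n y $ i)" for i n
    by (rule integrable_mult_bounded[OF int1 _ th1]) measurable
  define A where "A n = (\<lambda>y. (\<Sum>i\<in>UNIV. (partial_deriv i \<phi> y * \<eta> y) * th n y $ i))" for n
  define E where "E n = (\<lambda>y. (\<Sum>i\<in>UNIV. \<Sum>j\<in>UNIV. (?D i j y * \<eta> y) * (th n y $ i * th n y $ j)) / 2)" for n
  define T where "T n = (\<lambda>y. (real n)\<^sup>2 * (\<phi> (graduated n y) - \<phi> y) * \<eta> y)" for n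
  \<comment> \<open>What remains after removing the linear term and the quadratic term frozen at y.
    It tends to 0 pointwise, whereas \<open>A\<close> and \<open>E\<close> have limits only after
    integration.\<close>
  define r where "r n = (\<lambda>y. T n y - real n * A n y - E n y)" for n
  have [measurable]: "A n \<in> borel_measurable borel" "E n \<in> borel_measurable borel" "T n \<in> borel_measurable borel" for n
    unfolding A_def E_def T_def by measurable
  have [measurable]: "r n \<in> borel_measurable borel" for n unfolding r_def by measurable
  have "integrable \<mu> (A n)" for n
    unfolding A_def by (rule Bochner_Integration.integrable_sum) (rule i1)
  moreover have "integrable \<mu> (E n)" for n
    unfolding E_def by (rule integrable_divide, rule Bochner_Integration.integrable_sum, rule Bochner_Integration.integrable_sum) (rule iD)
  ultimately have iA: "integrable \<mu> (A n)" "integrable \<mu> (E n)" for n by blast+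
  have remainder: "\<exists>s. 0 < s \<and> s \<le> 1 \<and> r n y = (\<Sum>i\<in>UNIV. \<Sum>j\<in>UNIV.
      (?D i j (y + s *\<^sub>R ((1 / real n) *\<^sub>R th n y)) * \<eta> y - ?D i j y * \<eta> y) * (th n y $ i * th n y $ j)) / 2"
    if n: "n > 0" for n y
  proof -
    obtain s where s: "0 < s" "s \<le> 1" and eq: "(real n)\<^sup>2 * (\<phi> (graduated n y) - \<phi> y) = real n * (\<Sum>i\<in>UNIV. partial_deriv i \<phi> y * th n y $ i)
      + (\<Sum>i\<in>UNIV. \<Sum>j\<in>UNIV. ?D i j (y + s *\<^sub>R ((1 / real n) *\<^sub>R th n y)) * (th n y $ i * th n y $ j)) / 2"
      unfolding th_def by (rule second_order_expansion[OF \<phi> n, of y])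
    have "T n y = real n * A n y + (\<Sum>i\<in>UNIV. \<Sum>j\<in>UNIV. (?D i j (y + s *\<^sub>R ((1 / real n) *\<^sub>R th n y)) * \<eta> y) * (th n y $ i * th n y $ j)) / 2"
      unfolding T_def eq A_def
      by (simp only: distrib_right times_divide_eq_left) (simp add: sum_distrib_left sum_distrib_right mult_ac)
    then have "r n y = (\<Sum>i\<in>UNIV. \<Sum>j\<in>UNIV.
      (?D i j (y + s *\<^sub>R ((1 / real n) *\<^sub>R th n y)) * \<eta> y - ?D i j y * \<eta> y) * (th n y $ i * th n y $ j)) / 2"
      unfolding r_def E_def by (simp add: sum_subtractf left_diff_distrib diff_divide_distrib)
    with s show ?thesis by blast
  qed
  \<comment> \<open>Number of pairs (i, j): each contributes at most 2 g, and the 2 is cancelled by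
    the Taylor factor 1/2.\<close>
  define K where "K = real CARD('d) * real CARD('d)"
  have small: "norm (s *\<^sub>R ((1 / real n) *\<^sub>R th n y)) \<le> real CARD('d)" if "0 < s" "s \<le> 1" "n > 0" for s n y
  proof -
    have "\<bar>s\<bar> * (1 / real n * norm (th n y)) \<le> 1 * (1 * real CARD('d))"
      unfolding th_def using that by (intro mult_mono norm_theta_le) (auto simp: field_simps)
    then show ?thesis by simp
  qed
  have r_bound: "\<bar>r n y\<bar> \<le> K * g y" if n: "n > 0" for n y
  proof -
    obtain s where s: "0 < s" "s \<le> 1" and eq: "r n y = (\<Sum>i\<in>UNIV. \<Sum>j\<in>UNIV.
      (?D i j (y + s *\<^sub>R ((1 / real n) *\<^sub>R th n y)) * \<eta> y - ?D i j y * \<eta> y) * (th n y $ i * th n y $ j)) / 2"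
      using remainder[OF n] by blast
    have summand: "\<bar>(?D i j (y + s *\<^sub>R ((1 / real n) *\<^sub>R th n y)) * \<eta> y - ?D i j y * \<eta> y) * (th n y $ i * th n y $ j)\<bar> \<le> 2 * g y" for i j
    proof -
      have "\<bar>?D i j (y + s *\<^sub>R ((1 / real n) *\<^sub>R th n y)) * \<eta> y\<bar> \<le> g y" "\<bar>?D i j (y + 0) * \<eta> y\<bar> \<le> g y"
        by (rule dom(2), rule small[OF s n]) (rule dom(2), simp)
      then have "\<bar>?D i j (y + s *\<^sub>R ((1 / real n) *\<^sub>R th n y)) * \<eta> y - ?D i j y * \<eta> y\<bar> \<le> 2 * g y" by simp
      then have "\<bar>?D i j (y + s *\<^sub>R ((1 / real n) *\<^sub>R th n y)) * \<eta> y - ?D i j y * \<eta> y\<bar> * \<bar>th n y $ i * th n y $ j\<bar> \<le> (2 * g y) * 1"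
        using thth by (intro mult_mono) auto
      then show ?thesis by (simp add: abs_mult)
    qed
    have "\<bar>\<Sum>i\<in>UNIV. \<Sum>j\<in>UNIV. (?D i j (y + s *\<^sub>R ((1 / real n) *\<^sub>R th n y)) * \<eta> y - ?D i j y * \<eta> y) * (th n y $ i * th n y $ j)\<bar>
      \<le> (\<Sum>i\<in>(UNIV::'d set). \<Sum>j\<in>(UNIV::'d set). 2 * g y)"
      by (intro order_trans[OF sum_abs] sum_mono order_trans[OF sum_abs] summand)
    then show ?thesis unfolding eq by (simp add: K_def)
  qed
  have r_lim: "(\<lambda>n. r n y) \<longlonglongrightarrow> 0" for y
  proof -
    have "\<forall>n. \<exists>s. n > 0 \<longrightarrow> 0 < s \<and> s \<le> 1 \<and> r n y = (\<Sum>i\<in>UNIV. \<Sum>j\<in>UNIV.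
      (?D i j (y + s *\<^sub>R ((1 / real n) *\<^sub>R th n y)) * \<eta> y - ?D i j y * \<eta> y) * (th n y $ i * th n y $ j)) / 2"
      using remainder by blast
    from choice[OF this] obtain s where s: "\<And>n. n > 0 \<Longrightarrow> 0 < s n \<and> s n \<le> 1 \<and> r n y = (\<Sum>i\<in>UNIV. \<Sum>j\<in>UNIV.
      (?D i j (y + s n *\<^sub>R ((1 / real n) *\<^sub>R th n y)) * \<eta> y - ?D i j y * \<eta> y) * (th n y $ i * th n y $ j)) / 2" by blast
    define h where "h n = (if n > 0 then s n *\<^sub>R ((1 / real n) *\<^sub>R th n y) else 0)" for n
    have "h \<longlonglongrightarrow> 0"
    proof (rule Lim_null_comparison)
      show "(\<lambda>n. 1 / real n * real CARD('d)) \<longlonglongrightarrow> 0" by (intro tendsto_mult_left_zero lim_1_over_n)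
      have "norm (h n) \<le> 1 / real n * real CARD('d)" for n
      proof (cases "n > 0")
        case True
        then have "\<bar>s n\<bar> * (1 / real n * norm (th n y)) \<le> 1 * (1 / real n * real CARD('d))"
          using s[OF True] unfolding th_def by (intro mult_mono norm_theta_le) auto
        then show ?thesis using True by (simp add: h_def)
      qed (simp add: h_def)
      then show "\<forall>\<^sub>F n in sequentially. norm (h n) \<le> 1 / real n * real CARD('d)" by simp
    qed
    from tendsto_add[OF tendsto_const[of y] this] have "(\<lambda>n. y + h n) \<longlonglongrightarrow> y" by simp
    then have D0: "(\<lambda>n. \<bar>(?D i j (y + h n) - ?D i j y) * \<eta> y\<bar>) \<longlonglongrightarrow> 0" for i j
      by (intro tendsto_rabs_zero tendsto_mult_left_zero LIM_zero continuous_on_tendsto_compose[OF cD]) auto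
    have "(\<lambda>n. ((?D i j (y + h n) - ?D i j y) * \<eta> y) * (th n y $ i * th n y $ j)) \<longlonglongrightarrow> 0" for i j
    proof (rule Lim_null_comparison[OF always_eventually D0], rule allI)
      fix n
      show "norm (((?D i j (y + h n) - ?D i j y) * \<eta> y) * (th n y $ i * th n y $ j)) \<le> \<bar>(?D i j (y + h n) - ?D i j y) * \<eta> y\<bar>"
        unfolding real_norm_def abs_mult[of _ "th n y $ i * th n y $ j"] by (rule mult_left_le[OF thth abs_ge_zero])
    qed
    then have "(\<lambda>n. (\<Sum>i\<in>UNIV. \<Sum>j\<in>UNIV. ((?D i j (y + h n) - ?D i j y) * \<eta> y) * (th n y $ i * th n y $ j)) / 2) \<longlonglongrightarrow> 0 / 2"
      by (intro tendsto_divide tendsto_const tendsto_null_sum) auto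
    moreover have "\<forall>\<^sub>F n in sequentially. (\<Sum>i\<in>UNIV. \<Sum>j\<in>UNIV. ((?D i j (y + h n) - ?D i j y) * \<eta> y) * (th n y $ i * th n y $ j)) / 2 = r n y"
      using eventually_gt_at_top[of 0] by eventually_elim (use s in \<open>simp add: h_def left_diff_distrib\<close>)
    ultimately have "(\<lambda>n. r n y) \<longlonglongrightarrow> 0 / 2" by (rule Lim_transform_eventually)
    then show ?thesis by simp
  qed
  have ir: "integrable \<mu> (r n)" if "n > 0" for n
    by (rule Bochner_Integration.integrable_bound[OF integrable_mult_right[OF dom(1), of K]])
       (use r_bound[OF that] in \<open>auto intro: order_trans[OF _ abs_ge_self]\<close>)
  \<comment> \<open>The index is shifted because the bound on the remainder is available from n = 1
    on.\<close>
  have "(\<lambda>n. \<integral>y. r (Suc n) y \<partial>\<mu>) \<longlonglongrightarrow> (\<integral>y. 0 \<partial>\<mu>)"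
    by (rule integral_dominated_convergence[where w="\<lambda>y. K * g y"])
       (use r_bound dom(1) LIMSEQ_Suc[OF r_lim] in auto)
  then have 0: "(\<lambda>n. \<integral>y. r n y \<partial>\<mu>) \<longlonglongrightarrow> 0"
    unfolding Bochner_Integration.integral_zero by (rule LIMSEQ_imp_Suc)
  have "(\<lambda>n. \<Sum>i\<in>UNIV. real n * (\<integral>y. (partial_deriv i \<phi> y * \<eta> y) * th n y $ i \<partial>\<mu>)) \<longlonglongrightarrow> 0"
    unfolding th_def by (intro tendsto_null_sum first)
  then have 1: "(\<lambda>n. real n * (\<integral>y. A n y \<partial>\<mu>)) \<longlonglongrightarrow> 0"
    unfolding A_def using i1 by (simp add: sum_distrib_left)
  have "(\<lambda>n. (\<Sum>i\<in>UNIV. \<Sum>j\<in>UNIV. \<integral>y. (?D i j y * \<eta> y) * (th n y $ i * th n y $ j) \<partial>\<mu>) / 2)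
     \<longlonglongrightarrow> (\<Sum>i\<in>UNIV. \<Sum>j\<in>UNIV. (\<integral>y. ?D i j y * \<eta> y \<partial>\<mu>) * (if i = j then 1/12 else 0)) / 2"
    unfolding th_def by (intro tendsto_divide tendsto_sum second tendsto_const) auto
  also have "(\<lambda>n. (\<Sum>i\<in>UNIV. \<Sum>j\<in>UNIV. \<integral>y. (?D i j y * \<eta> y) * (th n y $ i * th n y $ j) \<partial>\<mu>) / 2) = (\<lambda>n. \<integral>y. E n y \<partial>\<mu>)"
    unfolding E_def using iD by simp
  also have "(\<Sum>i\<in>UNIV. \<Sum>j\<in>UNIV. (\<integral>y. ?D i j y * \<eta> y \<partial>\<mu>) * (if i = j then 1/12 else 0)) / 2 = (\<Sum>i\<in>UNIV. (\<integral>y. ?D i i y * \<eta> y \<partial>\<mu>) * (1/24))"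
    by (simp add: if_distrib sum_divide_distrib cong: if_cong)
  also have "\<dots> = (\<integral>y. (\<Sum>i\<in>UNIV. (?D i i y * \<eta> y) * (1/24)) \<partial>\<mu>)" using intD by simp
  also have "\<dots> = (\<integral>y. 1/24 * laplacian \<phi> y * \<eta> y \<partial>\<mu>)"
    by (intro Bochner_Integration.integral_cong refl) (simp add: laplacian_def sum_distrib_left sum_distrib_right)
  finally have 2: "(\<lambda>n. \<integral>y. E n y \<partial>\<mu>) \<longlonglongrightarrow> (\<integral>y. 1/24 * laplacian \<phi> y * \<eta> y \<partial>\<mu>)" .
  have "(\<lambda>n. (\<integral>y. r n y \<partial>\<mu>) + real n * (\<integral>y. A n y \<partial>\<mu>) + (\<integral>y. E n y \<partial>\<mu>)) \<longlonglongrightarrow> 0 + 0 + (\<integral>y. 1/24 * laplacian \<phi> y * \<eta> y \<partial>\<mu>)"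
    by (intro tendsto_add 0 1 2)
  moreover have "\<forall>\<^sub>F n in sequentially. (\<integral>y. r n y \<partial>\<mu>) + real n * (\<integral>y. A n y \<partial>\<mu>) + (\<integral>y. E n y \<partial>\<mu>)
     = (real n)\<^sup>2 * (\<integral>y. (\<phi> (graduated n y) - \<phi> y) * \<eta> y \<partial>\<mu>)"
    using eventually_gt_at_top[of 0]
  proof eventually_elim
    case (elim n)
    have "(\<integral>y. r n y \<partial>\<mu>) + real n * (\<integral>y. A n y \<partial>\<mu>) + (\<integral>y. E n y \<partial>\<mu>) = (\<integral>y. r n y + real n * A n y + E n y \<partial>\<mu>)"
      using ir[OF elim] iA by simp
    also have "\<dots> = (\<integral>y. (real n)\<^sup>2 * ((\<phi> (graduated n y) - \<phi> y) * \<eta> y) \<partial>\<mu>)" by (simp add: r_def T_def mult.assoc)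
    finally show ?case by simp
  qed
  ultimately have "(\<lambda>n. (real n)\<^sup>2 * (\<integral>y. (\<phi> (graduated n y) - \<phi> y) * \<eta> y \<partial>\<mu>)) \<longlonglongrightarrow> 0 + 0 + (\<integral>y. 1/24 * laplacian \<phi> y * \<eta> y \<partial>\<mu>)"
    by (rule Lim_transform_eventually)
  then show ?thesis by simp
qed

section \<open>Convergence in the sense of distributions and the deterministic version\<close>

context uniform_vector
begin

text \<open>The additive constant 1/12 in the primitive of the sawtooth is chosen for this: it is
  the second moment of a coordinate of \<open>V\<close>, so the boundary-free remainder of the
  integration by parts tends to 0.\<close>

lemma integral_corrector: "(\<integral>\<omega>. (1/12 - (V \<omega> $ i)\<^sup>2) / 2 \<partial>M) = 0"
proof -
  have "integrable M (\<lambda>\<omega>. (V \<omega> $ i)\<^sup>2)"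
  proof (rule integrable_bounded_V[where f="\<lambda>v. (v $ i)\<^sup>2" and C=1])
    fix v :: "real^'d" assume "\<forall>i. \<bar>v $ i\<bar> \<le> 1/2"
    then have "\<bar>v $ i\<bar> \<le> 1/2" by blast
    then have "\<bar>v $ i\<bar> \<le> 1" by linarith
    then show "\<bar>(v $ i)\<^sup>2\<bar> \<le> 1" by (simp add: abs_square_le_1)
  qed measurable
  then show ?thesis using integral_V_nth_square[of i] by (simp add: prob_space power2_eq_square)
qed

text \<open>A C2 function may grow arbitrarily, so all bounds are local. As \<open>graduated\<close>
  moves a point by at most \<open>CARD('d)\<close>, it suffices to control \<phi> and its second
  derivatives on a ball of radius \<open>R + CARD('d)\<close>, where \<open>R\<close> bounds the
  support of the test function.\<close>

lemma converges_in_distributions_laplacian: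
  fixes \<phi> :: "real^'d \<Rightarrow> real"
  assumes \<phi>: "of_class_C 2 \<phi>"
  shows "converges_in_distributions (\<lambda>n y. (real n)\<^sup>2 * (\<phi> (graduated n y) - \<phi> y)) (\<lambda>y. 1/24 * laplacian \<phi> y)"
  unfolding converges_in_distributions_def
proof (intro allI impI)
  fix \<xi> :: "real^'d \<Rightarrow> real" assume \<xi>: "test_function UNIV \<xi>"
  then have \<xi>C: "of_class_C k \<xi>" for k by (simp add: test_function_def)
  obtain K where cK: "compact K" and K: "\<And>x. x \<notin> K \<Longrightarrow> \<xi> x = 0" using \<xi> by (auto simp: test_function_def)
  obtain R where "\<And>x. x \<in> K \<Longrightarrow> norm x \<le> R" using compact_imp_bounded[OF cK] by (auto simp: bounded_iff)
  with K have supp: "\<xi> x = 0" if "norm x > R" for x using that by force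
  let ?D = "\<lambda>i j. partial_deriv j (partial_deriv i \<phi>)"
  have cD: "continuous_on UNIV (?D i j)" for i j using \<phi> unfolding of_class_C_2 of_class_C_1 by blast
  have \<phi>1: "of_class_C 1 (partial_deriv i \<phi>)" for i using \<phi> unfolding of_class_C_2 by blast
  have c\<phi>: "continuous_on UNIV \<phi>" "continuous_on UNIV \<xi>" using of_class_C_continuous[OF \<phi>] of_class_C_continuous[OF \<xi>C] by auto
  have [measurable]: "\<phi> \<in> borel_measurable borel" "\<xi> \<in> borel_measurable borel" "?D i j \<in> borel_measurable borel" for i j
    using c\<phi> cD by (auto intro: borel_measurable_continuous_onI)
  obtain Bx where Bx: "\<And>y. \<bar>\<xi> y\<bar> \<le> Bx" using continuous_compact_support_bounded[OF c\<phi>(2) supp] by blast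
  have Bx0: "0 \<le> Bx" using Bx[of 0] by linarith
  have local: "\<exists>C. \<forall>y. norm y \<le> r \<longrightarrow> \<bar>f y\<bar> \<le> C" if "continuous_on UNIV f" for f :: "real^'d \<Rightarrow> real" and r
  proof -
    have "compact (f ` cball 0 r)" by (intro compact_continuous_image continuous_on_subset[OF that]) auto
    then obtain C where "\<And>y. y \<in> cball 0 r \<Longrightarrow> \<bar>f y\<bar> \<le> C" by (meson bounded_real compact_imp_bounded imageI)
    then show ?thesis by auto
  qed
  have bounded_integrable: "integrable lborel (\<lambda>y. f y * \<xi> y)"
    if [measurable]: "f \<in> borel_measurable borel" and f: "\<And>y. norm y \<le> R \<Longrightarrow> \<bar>f y\<bar> \<le> C" for f C
  proof (rule Bochner_Integration.integrable_bound[where f="\<lambda>y::real^'d. indicator (cball 0 R) y * (\<bar>C\<bar> * Bx)"])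
    show "integrable lborel (\<lambda>y::real^'d. indicator (cball 0 R) y * (\<bar>C\<bar> * Bx))"
      by (intro integrable_mult_left) (auto intro!: integrable_real_indicator emeasure_bounded_finite)
    show "AE y in lborel. norm (f y * \<xi> y) \<le> norm (indicator (cball 0 R) y * (\<bar>C\<bar> * Bx))"
    proof (rule AE_I2)
      fix y
      show "norm (f y * \<xi> y) \<le> norm (indicator (cball 0 R) y * (\<bar>C\<bar> * Bx))"
      proof (cases "norm y \<le> R")
        case True
        then have "\<bar>f y\<bar> * \<bar>\<xi> y\<bar> \<le> \<bar>C\<bar> * Bx" using f[OF True] Bx by (intro mult_mono) auto
        then show ?thesis using True Bx0 by (simp add: abs_mult)
      qed (simp add: supp)
    qed
  qed measurable
  obtain Cp where Cp: "\<And>y. norm y \<le> R + real CARD('d) \<Longrightarrow> \<bar>\<phi> y\<bar> \<le> Cp" using local[OF c\<phi>(1)] by metis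
  have gr: "norm (graduated n y) \<le> norm y + real CARD('d)" for n and y :: "real^'d"
  proof -
    have "norm (graduated n y) \<le> norm y + 1 / real n * norm (theta (real n *\<^sub>R y))"
      unfolding graduated_def using norm_triangle_ineq[of y "(1 / real n) *\<^sub>R theta (real n *\<^sub>R y)"] by simp
    moreover have "1 / real n * norm (theta (real n *\<^sub>R y)) \<le> 1 * real CARD('d)"
      by (intro mult_mono norm_theta_le) (auto simp: divide_le_eq_1)
    ultimately show ?thesis by simp
  qed
  have lap: "continuous_on UNIV (\<lambda>y. 1/24 * laplacian \<phi> y)" unfolding laplacian_def by (intro continuous_intros cD)
  have "\<forall>i j. \<exists>C. \<forall>y. norm y \<le> R + real CARD('d) \<longrightarrow> \<bar>?D i j y\<bar> \<le> C" using local[OF cD] by blast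
  then obtain Cd where Cd: "\<And>i j y. norm y \<le> R + real CARD('d) \<Longrightarrow> \<bar>?D i j y\<bar> \<le> Cd i j" by metis
  define C where "C = (\<Sum>i\<in>UNIV. \<Sum>j\<in>UNIV. \<bar>Cd i j\<bar>)"
  have C: "\<bar>?D i j y\<bar> \<le> C" if "norm y \<le> R + real CARD('d)" for i j y
  proof -
    have "\<bar>?D i j y\<bar> \<le> \<bar>Cd i j\<bar>" using Cd[OF that, of j i] by linarith
    also have "\<dots> \<le> (\<Sum>j\<in>UNIV. \<bar>Cd i j\<bar>)" by (rule member_le_sum) auto
    also have "\<dots> \<le> C" unfolding C_def by (rule member_le_sum[of i UNIV "\<lambda>i. \<Sum>j\<in>UNIV. \<bar>Cd i j\<bar>"]) (auto intro: sum_nonneg)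
    finally show ?thesis .
  qed
  have C0: "0 \<le> C" unfolding C_def by (intro sum_nonneg) auto
  show "(\<forall>n. integrable lborel (\<lambda>y. (real n)\<^sup>2 * (\<phi> (graduated n y) - \<phi> y) * \<xi> y)) \<and>
    integrable lborel (\<lambda>y. 1/24 * laplacian \<phi> y * \<xi> y) \<and>
    (\<lambda>n. \<integral>y. (real n)\<^sup>2 * (\<phi> (graduated n y) - \<phi> y) * \<xi> y \<partial>lborel) \<longlonglongrightarrow> (\<integral>y. 1/24 * laplacian \<phi> y * \<xi> y \<partial>lborel)"
  proof (intro conjI allI)
    show "integrable lborel (\<lambda>y. (real n)\<^sup>2 * (\<phi> (graduated n y) - \<phi> y) * \<xi> y)" for n
    proof (rule bounded_integrable[of _ "(real n)\<^sup>2 * (2 * Cp)"])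
      fix y :: "real^'d" assume y: "norm y \<le> R"
      have "\<bar>\<phi> (graduated n y)\<bar> \<le> Cp" "\<bar>\<phi> y\<bar> \<le> Cp" using gr[of n y] y by (auto intro!: Cp order_trans[OF y])
      then have "\<bar>\<phi> (graduated n y) - \<phi> y\<bar> \<le> 2 * Cp" by linarith
      then have "(real n)\<^sup>2 * \<bar>\<phi> (graduated n y) - \<phi> y\<bar> \<le> (real n)\<^sup>2 * (2 * Cp)" by (rule mult_left_mono) simp
      then show "\<bar>(real n)\<^sup>2 * (\<phi> (graduated n y) - \<phi> y)\<bar> \<le> (real n)\<^sup>2 * (2 * Cp)" by (simp add: abs_mult)
    qed measurable
    obtain Cl where "\<And>y. norm y \<le> R \<Longrightarrow> \<bar>1/24 * laplacian \<phi> y\<bar> \<le> Cl" using local[OF lap] by metis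
    then show "integrable lborel (\<lambda>y. 1/24 * laplacian \<phi> y * \<xi> y)"
      using lap by (intro bounded_integrable[of _ Cl]) (auto intro: borel_measurable_continuous_onI)
    have "(\<lambda>n. (real n)\<^sup>2 * (\<integral>y. (\<phi> (graduated n y) - \<phi> y) * \<xi> y \<partial>lborel)) \<longlonglongrightarrow> (\<integral>y. 1/24 * laplacian \<phi> y * \<xi> y \<partial>lborel)"
    proof (rule graduated_second_order_limit[OF _ \<phi>, where g="\<lambda>y. indicator (cball 0 R) y * (C * Bx)"])
      fix i
      define F where "F = (\<lambda>y. partial_deriv i \<phi> y * \<xi> y)"
      have F: "of_class_C 1 F" unfolding F_def by (rule of_class_C_mult[OF \<phi>1 \<xi>C])
      have Fs: "F y = 0" if "norm y > R" for y using supp[OF that] by (simp add: F_def)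
      have Fc: "continuous_on UNIV F" "continuous_on UNIV (partial_deriv i F)"
        using of_class_C_continuous[OF F] F by (auto simp: of_class_C_1)
      have pFs: "partial_deriv i F y = 0" if "norm y > R" for y using Fs that by (rule partial_deriv_eq_0_outside)
      \<comment> \<open>Only the integrability part of \<open>equidistribution_continuous\<close> is
        used, with the dummy choice f = 0.\<close>
      have iF: "integrable lborel F" "integrable lborel (partial_deriv i F)"
        by (rule equidistribution_continuous(1)[where f="\<lambda>_. 0" and C=0 and R=R]; use Fc Fs pFs in auto)+
      then show "integrable lborel (\<lambda>y. partial_deriv i \<phi> y * \<xi> y)" by (simp add: F_def)
      have "(\<lambda>n. - (\<integral>y. partial_deriv i F y * ((1/12 - (theta (real n *\<^sub>R y) $ i)\<^sup>2) / 2) \<partial>lborel))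
        \<longlonglongrightarrow> - ((\<integral>y. partial_deriv i F y \<partial>lborel) * (\<integral>\<omega>. (1/12 - (V \<omega> $ i)\<^sup>2) / 2 \<partial>M))"
        by (intro tendsto_minus equidistribution_cube[OF Fc(2) pFs, where f="\<lambda>v. (1/12 - (v $ i)\<^sup>2) / 2"])
           (auto intro!: continuous_intros)
      then have "(\<lambda>n. - (\<integral>y. partial_deriv i F y * ((1/12 - (theta (real n *\<^sub>R y) $ i)\<^sup>2) / 2) \<partial>lborel)) \<longlonglongrightarrow> 0"
        by (simp only: integral_corrector) simp
      moreover have "\<forall>\<^sub>F n in sequentially. - (\<integral>y. partial_deriv i F y * ((1/12 - (theta (real n *\<^sub>R y) $ i)\<^sup>2) / 2) \<partial>lborel)
        = real n * (\<integral>y. F y * theta (real n *\<^sub>R y) $ i \<partial>lborel)"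
        using eventually_gt_at_top[of 0]
      proof eventually_elim
        case (elim n)
        have "real n * (\<integral>y. F y * theta (real n *\<^sub>R y) $ i \<partial>lborel)
          = - (\<integral>y. (partial_deriv i F y + F y * 0) * ((1/12 - (theta (real n *\<^sub>R y) $ i)\<^sup>2) / 2) \<partial>lborel)"
        proof (rule theta_integration_by_parts[OF _ F iF])
          fix r :: real assume r: "0 < r" "r < 1"
          have "(\<integral>y. partial_deriv i (\<lambda>y. F y * smooth_Q r (real n * y $ i)) y \<partial>lborel) = 0"
            by (rule integral_partial_deriv_lborel[OF smooth_Q_component(1)[OF F r], where R=R]) (simp add: Fs)
          then show "(\<integral>y. partial_deriv i (\<lambda>y. F y * smooth_Q r (real n * y $ i)) y \<partial>lborel)
            = - (\<integral>y. (F y * smooth_Q r (real n * y $ i)) * 0 \<partial>lborel)" by simp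
        qed (use AE_lborel_not_integer[OF elim] in auto)
        then show ?case by simp
      qed
      ultimately have "(\<lambda>n. real n * (\<integral>y. F y * theta (real n *\<^sub>R y) $ i \<partial>lborel)) \<longlonglongrightarrow> 0"
        by (rule Lim_transform_eventually)
      then show "(\<lambda>n. real n * (\<integral>y. (partial_deriv i \<phi> y * \<xi> y) * theta (real n *\<^sub>R y) $ i \<partial>lborel)) \<longlonglongrightarrow> 0"
        by (simp add: F_def)
    next
      fix i j
      have "(\<lambda>n. \<integral>y. (?D i j y * \<xi> y) * (theta (real n *\<^sub>R y) $ i * theta (real n *\<^sub>R y) $ j) \<partial>lborel)
        \<longlonglongrightarrow> (\<integral>y. ?D i j y * \<xi> y \<partial>lborel) * (\<integral>\<omega>. V \<omega> $ i * V \<omega> $ j \<partial>M)"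
        by (rule equidistribution_cube[where f="\<lambda>v. v $ i * v $ j" and R=R]) (auto intro!: continuous_intros cD c\<phi> simp: supp)
      then show "(\<lambda>n. \<integral>y. (?D i j y * \<xi> y) * (theta (real n *\<^sub>R y) $ i * theta (real n *\<^sub>R y) $ j) \<partial>lborel)
        \<longlonglongrightarrow> (\<integral>y. ?D i j y * \<xi> y \<partial>lborel) * (if i = j then 1/12 else 0)"
        by (simp only: integral_V_nth_mult)
    next
      show "integrable lborel (\<lambda>y::real^'d. indicator (cball 0 R) y * (C * Bx))"
        by (intro integrable_mult_left) (auto intro!: integrable_real_indicator emeasure_bounded_finite)
      fix i j and y h :: "real^'d" assume h: "norm h \<le> real CARD('d)"
      show "\<bar>?D i j (y + h) * \<xi> y\<bar> \<le> indicator (cball 0 R) y * (C * Bx)"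
      proof (cases "norm y \<le> R")
        case True
        have "norm (y + h) \<le> R + real CARD('d)" using norm_triangle_ineq[of y h] h True by linarith
        then have "\<bar>?D i j (y + h)\<bar> * \<bar>\<xi> y\<bar> \<le> C * Bx" using C Bx C0 by (intro mult_mono) auto
        then show ?thesis using True by (simp add: abs_mult)
      qed (simp add: supp)
    qed auto
    then show "(\<lambda>n. \<integral>y. (real n)\<^sup>2 * (\<phi> (graduated n y) - \<phi> y) * \<xi> y \<partial>lborel) \<longlonglongrightarrow> (\<integral>y. 1/24 * laplacian \<phi> y * \<xi> y \<partial>lborel)"
      by (simp add: mult.assoc)
  qed
qed

text \<open>For an arbitrary C2 function the increment at \<open>Y\<close> may fail to be
  integrable. The argument therefore works with positive and negative parts: each is measurable for
  the sigma-algebra of \<open>Y\<close>, hence its own nonnegative conditional expectation, and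
  \<open>real_cond_exp\<close> is their difference.\<close>

lemma cond_exp_version_function:
  fixes Y :: "'a \<Rightarrow> 'b::topological_space"
  assumes [measurable]: "Y \<in> borel_measurable M" "g \<in> borel_measurable borel"
  shows "cond_exp_version M Y (\<lambda>\<omega>. g (Y \<omega>)) g"
proof -
  define F where "F = vimage_algebra (space M) Y borel"
  have "subalgebra M F"
    unfolding F_def subalgebra_def using assms(1) by (auto simp: sets_vimage_algebra2 measurable_sets)
  then interpret sub: finite_measure_subalgebra M F by unfold_locales
  have Y_F[measurable]: "Y \<in> borel_measurable F" unfolding F_def by (rule measurable_vimage_algebra1) auto
  have "AE \<omega> in M. nn_cond_exp M F (\<lambda>\<omega>. ennreal (g (Y \<omega>))) \<omega> = ennreal (g (Y \<omega>))"
    "AE \<omega> in M. nn_cond_exp M F (\<lambda>\<omega>. ennreal (- g (Y \<omega>))) \<omega> = ennreal (- g (Y \<omega>))"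
    by (rule AE_symmetric[OF sub.nn_cond_exp_F_meas]; measurable)+
  then have "AE \<omega> in M. real_cond_exp M F (\<lambda>\<omega>. g (Y \<omega>)) \<omega> = g (Y \<omega>)"
    unfolding real_cond_exp_def
  proof eventually_elim
    case (elim \<omega>)
    then show ?case by (cases "0 \<le> g (Y \<omega>)") (auto simp: ennreal_neg)
  qed
  then show ?thesis by (simp add: cond_exp_version_def F_def)
qed

end

section \<open>Bias operators\<close>

lemma C2_boundedE:
  assumes "\<phi> \<in> C2_bounded"
  obtains B where "0 \<le> B" "\<And>y. \<bar>\<phi> y\<bar> \<le> B" "\<And>i y. \<bar>partial_deriv i \<phi> y\<bar> \<le> B"
    "\<And>i j y. \<bar>partial_deriv j (partial_deriv i \<phi>) y\<bar> \<le> B"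
proof -
  define S where "S = range \<phi> \<union> (\<Union>i. range (partial_deriv i \<phi>)) \<union> (\<Union>i. \<Union>j. range (partial_deriv j (partial_deriv i \<phi>)))"
  have "bounded S" unfolding S_def
    using assms by (auto simp: C2_bounded_def intro!: bounded_UN)
  then obtain B where B: "\<bar>x\<bar> \<le> B" if "x \<in> S" for x
    unfolding bounded_iff real_norm_def by blast
  have B: "\<And>y. \<bar>\<phi> y\<bar> \<le> B" "\<And>i y. \<bar>partial_deriv i \<phi> y\<bar> \<le> B" "\<And>i j y. \<bar>partial_deriv j (partial_deriv i \<phi>) y\<bar> \<le> B"
    by (rule B, unfold S_def, blast)+
  moreover have "0 \<le> B" using B(1)[of undefined] by linarith
  ultimately show thesis using that by blast
qed

lemma C2_boundedI:
  assumes "of_class_C 2 \<phi>" "\<And>y. \<bar>\<phi> y\<bar> \<le> A" "\<And>i y. \<bar>partial_deriv i \<phi> y\<bar> \<le> B"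
    "\<And>i j y. \<bar>partial_deriv j (partial_deriv i \<phi>) y\<bar> \<le> C"
  shows "\<phi> \<in> C2_bounded"
  using assms unfolding C2_bounded_def bounded_iff by fastforce

lemma C2_bounded_class:
  assumes "\<phi> \<in> C2_bounded"
  shows "of_class_C 2 \<phi>" "of_class_C 1 \<phi>" "of_class_C 1 (partial_deriv i \<phi>)"
    "\<phi> differentiable (at x)" "partial_deriv i \<phi> differentiable (at x)"
    "\<phi> \<in> borel_measurable borel" "partial_deriv i \<phi> \<in> borel_measurable borel"
    "partial_deriv j (partial_deriv i \<phi>) \<in> borel_measurable borel"
proof -
  show 2: "of_class_C 2 \<phi>" using assms by (simp add: C2_bounded_def)
  then have "of_class_C (Suc 1) \<phi>" by (simp add: numeral_2_eq_2)
  then show 1: "of_class_C 1 \<phi>" by (rule of_class_C_SucD)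
  show p: "of_class_C 1 (partial_deriv i \<phi>)" using 2 unfolding of_class_C_2 by blast
  show "\<phi> differentiable (at x)" "partial_deriv i \<phi> differentiable (at x)"
    using 1 p unfolding of_class_C_1 by blast+
  have "continuous_on UNIV (partial_deriv j (partial_deriv i \<phi>))" using p unfolding of_class_C_1 by blast
  with of_class_C_continuous[OF 1] of_class_C_continuous[OF p]
  show "\<phi> \<in> borel_measurable borel" "partial_deriv i \<phi> \<in> borel_measurable borel"
    "partial_deriv j (partial_deriv i \<phi>) \<in> borel_measurable borel"
    by (auto intro: borel_measurable_continuous_onI)
qed

lemma C2_bounded_lipschitz:
  assumes \<phi>: "(\<phi> :: real^'d \<Rightarrow> real) \<in> C2_bounded"
  obtains L where "L-lipschitz_on UNIV \<phi>"
proof -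
  obtain B where B: "0 \<le> B" "\<And>i y. \<bar>partial_deriv i \<phi> y\<bar> \<le> B" using C2_boundedE[OF \<phi>] by metis
  have "(real CARD('d) * B)-lipschitz_on UNIV \<phi>"
  proof (rule lipschitz_onI)
    fix x y :: "real^'d"
    obtain s where "\<phi> (y + (x - y)) - \<phi> y = (\<Sum>i\<in>UNIV. (x - y) $ i * partial_deriv i \<phi> (y + s *\<^sub>R (x - y)))"
      by (rule mean_value_partial_deriv[of \<phi> y "x - y"]) (rule C2_bounded_class[OF \<phi>])
    then have "\<bar>\<phi> x - \<phi> y\<bar> \<le> (\<Sum>i\<in>UNIV. \<bar>(x - y) $ i * partial_deriv i \<phi> (y + s *\<^sub>R (x - y))\<bar>)"
      by (simp add: sum_abs)
    also have "\<dots> \<le> (\<Sum>i\<in>(UNIV::'d set). norm (x - y) * B)"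
      unfolding abs_mult using B by (intro sum_mono mult_mono component_le_norm_cart) auto
    finally show "dist (\<phi> x) (\<phi> y) \<le> real CARD('d) * B * dist x y" by (simp add: dist_real_def dist_norm mult_ac)
  qed (use B in simp)
  then show thesis by (rule that)
qed

lemma partial_deriv_mult_twice:
  assumes "\<phi> \<in> C2_bounded" "\<eta> \<in> C2_bounded"
  shows "partial_deriv i (\<lambda>y. \<phi> y * \<eta> y) = (\<lambda>y. partial_deriv i \<phi> y * \<eta> y + \<phi> y * partial_deriv i \<eta> y)"
    and "partial_deriv j (partial_deriv i (\<lambda>y. \<phi> y * \<eta> y)) = (\<lambda>y.
      (partial_deriv j (partial_deriv i \<phi>) y * \<eta> y + partial_deriv i \<phi> y * partial_deriv j \<eta> y)
      + (partial_deriv j \<phi> y * partial_deriv i \<eta> y + \<phi> y * partial_deriv j (partial_deriv i \<eta>) y))"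
proof -
  note d = C2_bounded_class(4,5)[OF assms(1)] C2_bounded_class(4,5)[OF assms(2)]
  show 1: "partial_deriv i (\<lambda>y. \<phi> y * \<eta> y) = (\<lambda>y. partial_deriv i \<phi> y * \<eta> y + \<phi> y * partial_deriv i \<eta> y)" for i
    by (rule partial_deriv_mult) (rule d)+
  have dm: "(\<lambda>y. partial_deriv i \<phi> y * \<eta> y) differentiable (at x)" "(\<lambda>y. \<phi> y * partial_deriv i \<eta> y) differentiable (at x)" for x
    by (intro differentiable_mult d)+
  show "partial_deriv j (partial_deriv i (\<lambda>y. \<phi> y * \<eta> y)) = (\<lambda>y.
      (partial_deriv j (partial_deriv i \<phi>) y * \<eta> y + partial_deriv i \<phi> y * partial_deriv j \<eta> y)
      + (partial_deriv j \<phi> y * partial_deriv i \<eta> y + \<phi> y * partial_deriv j (partial_deriv i \<eta>) y))"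
    unfolding 1 partial_deriv_add[OF dm] by (simp only: partial_deriv_mult d)
qed

lemma C2_bounded_mult:
  assumes \<phi>: "\<phi> \<in> C2_bounded" and \<eta>: "\<eta> \<in> C2_bounded"
  shows "(\<lambda>y. \<phi> y * \<eta> y) \<in> C2_bounded"
proof -
  obtain A where A: "0 \<le> A" "\<And>y. \<bar>\<phi> y\<bar> \<le> A" "\<And>i y. \<bar>partial_deriv i \<phi> y\<bar> \<le> A"
    "\<And>i j y. \<bar>partial_deriv j (partial_deriv i \<phi>) y\<bar> \<le> A" using C2_boundedE[OF \<phi>] by blast
  obtain B where B: "0 \<le> B" "\<And>y. \<bar>\<eta> y\<bar> \<le> B" "\<And>i y. \<bar>partial_deriv i \<eta> y\<bar> \<le> B"
    "\<And>i j y. \<bar>partial_deriv j (partial_deriv i \<eta>) y\<bar> \<le> B" using C2_boundedE[OF \<eta>] by blast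
  have m: "\<bar>a * b\<bar> \<le> A * B" if "\<bar>a\<bar> \<le> A" "\<bar>b\<bar> \<le> B" for a b
    unfolding abs_mult using that A(1) by (intro mult_mono) auto
  have two: "\<bar>a + b\<bar> \<le> X + Y" if "\<bar>a\<bar> \<le> X" "\<bar>b\<bar> \<le> Y" for a b X Y :: real using that by linarith
  show ?thesis
  proof (rule C2_boundedI)
    show "of_class_C 2 (\<lambda>y. \<phi> y * \<eta> y)" by (intro of_class_C_mult C2_bounded_class \<phi> \<eta>)
    show "\<bar>\<phi> y * \<eta> y\<bar> \<le> A * B" for y by (intro m A B)
    show "\<bar>partial_deriv i (\<lambda>y. \<phi> y * \<eta> y) y\<bar> \<le> A * B + A * B" for i y
      unfolding partial_deriv_mult_twice(1)[OF \<phi> \<eta>] by (intro two m A B)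
    show "\<bar>partial_deriv j (partial_deriv i (\<lambda>y. \<phi> y * \<eta> y)) y\<bar> \<le> (A * B + A * B) + (A * B + A * B)" for i j y
      unfolding partial_deriv_mult_twice(2)[OF \<phi> \<eta>] by (intro two m A B)
  qed
qed

text \<open>The failure of the Laplacian to be a derivation is the origin of the square field: the
  extra term is twice the squared gradient, and the factor 1/24 of the bias turns it into
  1/12.\<close>

lemma laplacian_square:
  assumes \<phi>: "\<phi> \<in> C2_bounded"
  shows "laplacian (\<lambda>z. (\<phi> z)\<^sup>2) y = 2 * \<phi> y * laplacian \<phi> y + 2 * (\<Sum>i\<in>UNIV. (partial_deriv i \<phi> y)\<^sup>2)"
    and "partial_deriv i (\<lambda>z. (\<phi> z)\<^sup>2) y = 2 * \<phi> y * partial_deriv i \<phi> y"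
proof -
  have sq: "(\<lambda>z. (\<phi> z)\<^sup>2) = (\<lambda>z. \<phi> z * \<phi> z)" by (simp add: power2_eq_square)
  show "partial_deriv i (\<lambda>z. (\<phi> z)\<^sup>2) y = 2 * \<phi> y * partial_deriv i \<phi> y"
    unfolding sq partial_deriv_mult_twice(1)[OF \<phi> \<phi>] by simp
  have "laplacian (\<lambda>z. (\<phi> z)\<^sup>2) y = (\<Sum>i\<in>UNIV. 2 * \<phi> y * partial_deriv i (partial_deriv i \<phi>) y + 2 * (partial_deriv i \<phi> y)\<^sup>2)"
    unfolding laplacian_def sq partial_deriv_mult_twice(2)[OF \<phi> \<phi>]
    by (intro sum.cong refl) (simp add: power2_eq_square)
  then show "laplacian (\<lambda>z. (\<phi> z)\<^sup>2) y = 2 * \<phi> y * laplacian \<phi> y + 2 * (\<Sum>i\<in>UNIV. (partial_deriv i \<phi> y)\<^sup>2)"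
    by (simp add: laplacian_def sum.distrib sum_distrib_left)
qed

lemma test_function_C2_bounded:
  assumes \<xi>: "test_function UNIV \<xi>"
  shows "\<xi> \<in> C2_bounded"
proof -
  have C: "of_class_C k \<xi>" for k using \<xi> by (simp add: test_function_def)
  obtain K where cK: "compact K" and K: "\<And>x. x \<notin> K \<Longrightarrow> \<xi> x = 0" using \<xi> by (auto simp: test_function_def)
  obtain R where "\<And>x. x \<in> K \<Longrightarrow> norm x \<le> R" using compact_imp_bounded[OF cK] by (auto simp: bounded_iff)
  with K have 0: "\<xi> x = 0" if "norm x > R" for x using that by force
  have 1: "partial_deriv i \<xi> x = 0" if "norm x > R" for i x using 0 that by (rule partial_deriv_eq_0_outside)
  have 2: "partial_deriv j (partial_deriv i \<xi>) x = 0" if "norm x > R" for i j x using 1 that by (rule partial_deriv_eq_0_outside)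
  have "of_class_C 2 \<xi>" by (rule C)
  then have c: "continuous_on UNIV \<xi>" "continuous_on UNIV (partial_deriv i \<xi>)" "continuous_on UNIV (partial_deriv j (partial_deriv i \<xi>))" for i j
    unfolding of_class_C_2 by (auto intro: of_class_C_continuous[OF C[of 0]] of_class_C_continuous[of 1] simp: of_class_C_1)
  have bd: "bounded (range f)" if c: "continuous_on UNIV f" and z: "\<And>x. norm x > R \<Longrightarrow> f x = 0" for f :: "real^'a \<Rightarrow> real"
  proof -
    obtain B where "\<And>y. \<bar>f y\<bar> \<le> B" using continuous_compact_support_bounded[OF c z] by blast
    then show ?thesis by (auto simp: bounded_iff)
  qed
  show ?thesis unfolding C2_bounded_def
    using C[of 2] bd[OF c(1) 0] bd[OF c(2) 1] bd[OF c(3) 2] by blast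
qed

section \<open>Square-integrable functions and the logarithmic gradient in case (ii)\<close>

lemma in_L2_bounded:
  assumes "finite_measure P" "f \<in> borel_measurable P" "\<And>y. \<bar>f y\<bar> \<le> B"
  shows "in_L2 P f"
proof -
  interpret finite_measure P by fact
  have "(f y)\<^sup>2 \<le> B\<^sup>2" for y using power_mono[OF assms(3) abs_ge_zero, of y 2] by simp
  then show ?thesis unfolding in_L2_def using assms(2)
    by (auto intro!: integrable_const_bound[where B="B\<^sup>2"])
qed

lemma in_L2_mult_bounded:
  assumes "in_L2 P f" "g \<in> borel_measurable P" "\<And>y. \<bar>g y\<bar> \<le> B"
  shows "in_L2 P (\<lambda>y. g y * f y)"
proof -
  have "(g y)\<^sup>2 \<le> B\<^sup>2" for y using power_mono[OF assms(3) abs_ge_zero, of y 2] by simp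
  then have "integrable P (\<lambda>y. (f y)\<^sup>2 * (g y)\<^sup>2)"
    using assms by (intro integrable_mult_bounded[where C="B\<^sup>2"]) (auto simp: in_L2_def)
  moreover have "(\<lambda>y. g y * f y) \<in> borel_measurable P" using assms by (auto simp: in_L2_def)
  ultimately show ?thesis by (simp add: in_L2_def power_mult_distrib mult.commute)
qed

lemma in_L2_add:
  assumes "in_L2 P f" "in_L2 P g"
  shows "in_L2 P (\<lambda>y. f y + g y)"
proof -
  have [measurable]: "f \<in> borel_measurable P" "g \<in> borel_measurable P" using assms by (auto simp: in_L2_def)
  have i: "integrable P (\<lambda>y. 2 * (f y)\<^sup>2 + 2 * (g y)\<^sup>2)" using assms by (auto simp: in_L2_def)
  have "(f y + g y)\<^sup>2 \<le> 2 * (f y)\<^sup>2 + 2 * (g y)\<^sup>2" for y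
    using zero_le_power2[of "f y - g y"] by (simp add: power2_eq_square algebra_simps)
  then have "integrable P (\<lambda>y. (f y + g y)\<^sup>2)"
    by (intro Bochner_Integration.integrable_bound[OF i]) (auto intro: order_trans[OF _ abs_ge_self])
  then show ?thesis by (simp add: in_L2_def)
qed

lemma in_L2_sum:
  assumes "finite I" "\<And>i. i \<in> I \<Longrightarrow> in_L2 P (f i)"
  shows "in_L2 P (\<lambda>y. \<Sum>i\<in>I. f i y)"
  using assms
proof (induction rule: finite_induct)
  case empty then show ?case by (simp add: in_L2_def)
next
  case (insert i I) then show ?case by (simp add: in_L2_add)
qed

lemma in_L2_integrable:
  assumes "finite_measure P" "in_L2 P f" shows "integrable P f"
  using finite_measure.square_integrable_imp_integrable[OF assms(1)] assms(2) by (auto simp: in_L2_def)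

text \<open>The class contains all test functions, so pairings with it determine an integrable
  function almost everywhere. This makes the operators in (H1) and (H3) unique up to null
  sets.\<close>

lemma AE_eq_of_C2_bounded:
  fixes f g :: "real^'d \<Rightarrow> real"
  assumes "sets P = sets borel" "integrable P f" "integrable P g"
    and eq: "\<And>\<eta>. \<eta> \<in> C2_bounded \<Longrightarrow> (\<integral>y. f y * \<eta> y \<partial>P) = (\<integral>y. g y * \<eta> y \<partial>P)"
  shows "AE y in P. f y = g y"
proof -
  have "AE y in P. f y - g y = 0"
  proof (rule AE_eq_0_of_test_functions[OF assms(1)])
    fix \<xi> :: "real^'d \<Rightarrow> real" assume "test_function UNIV \<xi>"
    then have \<xi>: "\<xi> \<in> C2_bounded" by (rule test_function_C2_bounded)
    obtain B where B: "\<And>y. \<bar>\<xi> y\<bar> \<le> B" using C2_boundedE[OF \<xi>] by metis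
    have m: "\<xi> \<in> borel_measurable P" using C2_bounded_class(6)[OF \<xi>] assms(1) by (simp cong: measurable_cong_sets)
    have "integrable P (\<lambda>y. f y * \<xi> y)" "integrable P (\<lambda>y. g y * \<xi> y)"
      by (rule integrable_mult_bounded[OF assms(2) m B] integrable_mult_bounded[OF assms(3) m B])+
    then show "(\<integral>y. (f y - g y) * \<xi> y \<partial>P) = 0" using eq[OF \<xi>] by (simp add: left_diff_distrib)
  qed (use assms in simp)
  then show ?thesis by simp
qed

text \<open>Weak differentiation of the density gives \<open>dh i\<close>, and dividing by
  \<open>h\<close> rewrites it relative to \<open>P\<close>; the normalising constant cancels.
  Extension by zero lies in H1 of the whole space, so test functions that do not vanish near the
  boundary of \<open>G\<close> are allowed. The indicators make the quotient Borel everywhere, with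
  value 0/0 = 0 off \<open>G\<close>.\<close>

lemma sobolev_density_logarithmic_gradient:
  fixes P :: "(real^'d) measure"
  assumes sets: "sets P = sets borel" and S: "sobolev_density P G h dh"
  defines "\<rho> \<equiv> \<lambda>i y. (indicator G y * dh i y) / (indicator G y * h y)"
  shows "L2_logarithmic_gradient P \<rho>" and "AE y in P. y \<in> G"
proof -
  define h' where "h' y = indicator G y * h y" for y
  define d' where "d' i y = indicator G y * dh i y" for i y
  define c where "c = measure lborel G"
  have P: "P = density lborel (\<lambda>y. ennreal (h' y / c))"
    using S by (simp add: sobolev_density_def h'_def c_def mult.commute)
  have H: "sobolev_H1 UNIV h' d'" using S by (simp add: sobolev_density_def h'_def[abs_def] d'_def[abs_def])
  have hm[measurable]: "h' \<in> borel_measurable borel" and dm[measurable]: "\<And>i. d' i \<in> borel_measurable borel"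
    using H by (auto simp: sobolev_H1_def set_borel_measurable_def)
  have pos: "AE y in lborel. y \<in> G \<longrightarrow> 0 < h y" using S by (simp add: sobolev_density_def)
  have c0: "0 \<le> c" by (simp add: c_def)
  have nn: "AE y in lborel. 0 \<le> h' y / c"
    using pos by eventually_elim (use c0 in \<open>auto simp: h'_def indicator_def\<close>)
  have \<rho>: "\<rho> i = (\<lambda>y. d' i y / h' y)" for i by (simp add: \<rho>_def h'_def d'_def)
  have \<rho>m[measurable]: "\<rho> i \<in> borel_measurable borel" for i unfolding \<rho> by measurable
  have mP: "f \<in> borel_measurable P" if "f \<in> borel_measurable borel" for f :: "real^'d \<Rightarrow> real"
    using that by (simp add: sets cong: measurable_cong_sets)
  show "AE y in P. y \<in> G"
  proof -
    have "(\<lambda>y. ennreal (h' y / c)) \<in> borel_measurable lborel" by measurable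
    then show ?thesis unfolding P by (simp only: AE_density) (auto simp: h'_def indicator_def)
  qed
  show "L2_logarithmic_gradient P \<rho>"
    unfolding L2_logarithmic_gradient_def
  proof (intro allI conjI impI)
    fix i
    have "set_integrable P G (\<lambda>y. (dh i y / h y)\<^sup>2)" using S unfolding sobolev_density_def by blast
    moreover have "(\<lambda>y. indicator G y *\<^sub>R (dh i y / h y)\<^sup>2) = (\<lambda>y. (\<rho> i y)\<^sup>2)"
      by (auto simp: \<rho>_def indicator_def)
    ultimately show "in_L2 P (\<rho> i)" unfolding in_L2_def set_integrable_def using mP[OF \<rho>m] by simp
    fix \<xi> :: "real^'d \<Rightarrow> real" assume \<xi>: "test_function UNIV \<xi>"
    then have \<xi>b: "\<xi> \<in> C2_bounded" by (rule test_function_C2_bounded)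
    note [measurable] = C2_bounded_class(6,7)[OF \<xi>b]
    have ibp: "(\<integral>y. h' y * partial_deriv i \<xi> y \<partial>lborel) = - (\<integral>y. d' i y * \<xi> y \<partial>lborel)"
      using H \<xi> by (simp add: sobolev_H1_def set_lebesgue_integral_def)
    have "(\<integral>y. partial_deriv i \<xi> y \<partial>P) = (\<integral>y. (h' y / c) *\<^sub>R partial_deriv i \<xi> y \<partial>lborel)"
      unfolding P by (rule integral_density) (use nn in auto)
    also have "\<dots> = (1 / c) * (\<integral>y. h' y * partial_deriv i \<xi> y \<partial>lborel)"
      by (subst integral_mult_right_zero[symmetric]) simp
    also have "\<dots> = - ((1 / c) * (\<integral>y. d' i y * \<xi> y \<partial>lborel))" unfolding ibp by simp
    also have "(1 / c) * (\<integral>y. d' i y * \<xi> y \<partial>lborel) = (\<integral>y. (1 / c) * (d' i y * \<xi> y) \<partial>lborel)" by simp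
    also have "\<dots> = (\<integral>y. (h' y / c) *\<^sub>R (\<xi> y * \<rho> i y) \<partial>lborel)"
    proof (rule integral_cong_AE)
      \<comment> \<open>Cancelling \<open>h\<close> requires that it be nonzero, which holds almost
        everywhere on \<open>G\<close>; off \<open>G\<close> both sides are 0.\<close>
      show "AE y in lborel. 1 / c * (d' i y * \<xi> y) = (h' y / c) *\<^sub>R (\<xi> y * \<rho> i y)"
        using pos by eventually_elim (auto simp: \<rho> h'_def d'_def indicator_def)
    qed measurable
    also have "\<dots> = (\<integral>y. \<xi> y * \<rho> i y \<partial>P)"
      unfolding P by (rule integral_density[symmetric]) (use nn in auto)
    finally show "(\<integral>y. partial_deriv i \<xi> y \<partial>P) = - (\<integral>y. \<xi> y * \<rho> i y \<partial>P)" .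
  qed
qed

section \<open>First and second order limits tested against the algebra\<close>

context rajchman_vector
begin

text \<open>A Rajchman law charges no hyperplane y_i = c. On the event Y_i = c, of probability p,
  the function cos (m Y_i + \<beta>) is the constant cos (m c + \<beta>), so weak convergence to 0
  forces p cos (m c + \<beta>) to 0. For the phases 0 and -pi/2 the squares add up to p^2. Countably
  many hyperplanes are then removed.\<close>

lemma AE_law_not_integer:
  assumes n: "n > 0"
  shows "AE y in distr M borel Y. real n * y $ i \<notin> \<int>"
proof -
  have null: "AE \<omega> in M. Y \<omega> $ i \<noteq> c" for c
  proof -
    define A where "A = {\<omega> \<in> space M. Y \<omega> $ i = c}"
    have [measurable]: "A \<in> sets M" unfolding A_def by measurable
    define p where "p = measure M A"
    have v: "(axis i 1 :: real^'d) \<noteq> 0" by (simp add: axis_eq_0_iff)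
    have W2: "integrable M (\<lambda>\<omega>. (indicator A \<omega> :: real)\<^sup>2)"
      by (rule integrable_const_bound[where B=1]) (auto simp: indicator_def)
    have "(\<integral>\<omega>. indicator A \<omega> * cos (real m * (axis i 1 \<bullet> Y \<omega>) + \<beta>) \<partial>M) = p * cos (real m * c + \<beta>)" for m \<beta>
    proof -
      have "(\<integral>\<omega>. indicator A \<omega> * cos (real m * (axis i 1 \<bullet> Y \<omega>) + \<beta>) \<partial>M) = (\<integral>\<omega>. indicator A \<omega> * cos (real m * c + \<beta>) \<partial>M)"
        by (intro Bochner_Integration.integral_cong) (auto simp: indicator_def A_def inner_axis')
      then show ?thesis by (simp add: p_def)
    qed
    then have lim: "(\<lambda>m. p * cos (real m * c + \<beta>)) \<longlonglongrightarrow> 0" for \<beta>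
      using rajchman_weak_cos[OF prob_space_axioms Y_measurable rajchman v _ W2, of \<beta>] by simp
    have "(\<lambda>m. (p * cos (real m * c + 0))\<^sup>2 + (p * cos (real m * c + (- pi / 2)))\<^sup>2) \<longlonglongrightarrow> 0\<^sup>2 + 0\<^sup>2"
      by (intro tendsto_add tendsto_power lim)
    moreover have "(p * cos (real m * c + 0))\<^sup>2 + (p * cos (real m * c + (- pi / 2)))\<^sup>2 = p\<^sup>2" for m
    proof -
      have "cos (real m * c + (- pi / 2)) = sin (real m * c)" by (simp add: cos_diff)
      then have "(p * cos (real m * c + 0))\<^sup>2 + (p * cos (real m * c + (- pi / 2)))\<^sup>2
        = p\<^sup>2 * ((sin (real m * c))\<^sup>2 + (cos (real m * c))\<^sup>2)"
        unfolding add_0_right by (simp only: power_mult_distrib distrib_left add.commute)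
      then show ?thesis by simp
    qed
    ultimately have "p\<^sup>2 = 0" by (simp add: LIMSEQ_const_iff)
    then have "emeasure M A = 0" by (simp add: p_def emeasure_eq_measure)
    then show ?thesis by (intro AE_I[where N=A]) (auto simp: A_def)
  qed
  then have "AE \<omega> in M. \<forall>m::int. Y \<omega> $ i \<noteq> of_int m / real n" by (subst AE_all_countable) blast
  then have "AE \<omega> in M. real n * Y \<omega> $ i \<notin> \<int>"
    by eventually_elim (use n in \<open>auto simp: field_simps elim!: Ints_cases\<close>)
  moreover have "{y :: real^'d. real n * y $ i \<notin> \<int>} \<in> sets borel"
  proof -
    have "{y \<in> space borel. frac (real n * (y :: real^'d) $ i) \<noteq> 0} \<in> sets borel" by measurable
    then show ?thesis by (simp add: frac_eq_0_iff)
  qed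
  ultimately show ?thesis by (subst AE_distr_iff) auto
qed

lemma prob_law: "prob_space (distr M borel Y)"
  by (rule prob_space_distr) measurable

lemma finite_law: "finite_measure (distr M borel Y)"
  using prob_law by (rule prob_space.finite_measure)

text \<open>After the integration by parts the weight \<open>H\<close> contains \<rho>_i and may be
  unbounded, which is why the stable limit is available for integrable weights. The factor n is
  gone, and the mean zero of the corrector makes the limit vanish; only the Laplacian term
  remains.\<close>

lemma first_order_limit:
  assumes \<rho>: "L2_logarithmic_gradient (distr M borel Y) \<rho>"
    and \<phi>: "\<phi> \<in> C2_bounded" and \<eta>: "\<eta> \<in> C2_bounded"
  shows "(\<lambda>n. (real n)\<^sup>2 * (\<integral>\<omega>. (\<phi> (graduated n (Y \<omega>)) - \<phi> (Y \<omega>)) * \<eta> (Y \<omega>) \<partial>M))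
      \<longlonglongrightarrow> (\<integral>y. 1/24 * laplacian \<phi> y * \<eta> y \<partial>distr M borel Y)"
proof -
  let ?P = "distr M borel Y"
  interpret P: prob_space ?P by (rule prob_law)
  note [measurable] = C2_bounded_class(6,7,8)[OF \<phi>] C2_bounded_class(6,7,8)[OF \<eta>]
  obtain A where A: "0 \<le> A" "\<And>y. \<bar>\<phi> y\<bar> \<le> A" "\<And>i y. \<bar>partial_deriv i \<phi> y\<bar> \<le> A"
    "\<And>i j y. \<bar>partial_deriv j (partial_deriv i \<phi>) y\<bar> \<le> A" using C2_boundedE[OF \<phi>] by blast
  obtain B where B: "0 \<le> B" "\<And>y. \<bar>\<eta> y\<bar> \<le> B" "\<And>i y. \<bar>partial_deriv i \<eta> y\<bar> \<le> B" using C2_boundedE[OF \<eta>] by metis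
  have m: "\<bar>a * b\<bar> \<le> A * B" if "\<bar>a\<bar> \<le> A" "\<bar>b\<bar> \<le> B" for a b
    unfolding abs_mult using that A(1) by (intro mult_mono) auto
  have two: "\<bar>a + b\<bar> \<le> X + Y" if "\<bar>a\<bar> \<le> X" "\<bar>b\<bar> \<le> Y" for a b X Y :: real using that by linarith
  have bint: "integrable ?P f" if "f \<in> borel_measurable borel" "\<And>y. \<bar>f y\<bar> \<le> C" for f :: "real^'d \<Rightarrow> real" and C :: real
    by (rule P.integrable_const_bound[where B=C]) (use that in auto)
  have "(\<lambda>n. (real n)\<^sup>2 * (\<integral>y. (\<phi> (graduated n y) - \<phi> y) * \<eta> y \<partial>?P)) \<longlonglongrightarrow> (\<integral>y. 1/24 * laplacian \<phi> y * \<eta> y \<partial>?P)"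
  proof (rule graduated_second_order_limit[OF _ C2_bounded_class(1)[OF \<phi>], where g="\<lambda>_. A * B"])
    fix i
    define F where "F = (\<lambda>y. partial_deriv i \<phi> y * \<eta> y)"
    have F: "of_class_C 1 F" unfolding F_def by (intro of_class_C_mult C2_bounded_class[OF \<phi>] C2_bounded_class[OF \<eta>])
    have pF: "partial_deriv i F = (\<lambda>y. partial_deriv i (partial_deriv i \<phi>) y * \<eta> y + partial_deriv i \<phi> y * partial_deriv i \<eta> y)"
      unfolding F_def by (intro partial_deriv_mult C2_bounded_class[OF \<phi>] C2_bounded_class[OF \<eta>])
    have Fm[measurable]: "F \<in> borel_measurable borel" "partial_deriv i F \<in> borel_measurable borel"
      unfolding pF by (simp_all add: F_def)
    have Fb: "\<bar>F y\<bar> \<le> A * B" for y unfolding F_def by (intro m A B)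
    have pFb: "\<bar>partial_deriv i F y\<bar> \<le> A * B + A * B" for y unfolding pF by (intro two m A B)
    have \<rho>L: "in_L2 ?P (\<rho> i)" using \<rho> by (simp add: L2_logarithmic_gradient_def)
    then have \<rho>m[measurable]: "\<rho> i \<in> borel_measurable borel" by (simp add: in_L2_def)
    have i\<rho>: "integrable ?P (\<rho> i)" by (rule in_L2_integrable[OF P.finite_measure_axioms \<rho>L])
    have iF: "integrable ?P F" "integrable ?P (partial_deriv i F)"
      by (rule bint, measurable, rule Fb) (rule bint, measurable, rule pFb)
    have iF\<rho>: "integrable ?P (\<lambda>y. F y * \<rho> i y)"
      using integrable_mult_bounded[OF i\<rho> _ Fb] by (simp add: mult.commute)
    show "integrable ?P (\<lambda>y. partial_deriv i \<phi> y * \<eta> y)" using iF(1) by (simp add: F_def)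
    define H where "H y = partial_deriv i F y + F y * \<rho> i y" for y
    have [measurable]: "H \<in> borel_measurable borel" unfolding H_def by measurable
    have "integrable ?P H" unfolding H_def using iF iF\<rho> by simp
    then have iH: "integrable M (\<lambda>\<omega>. H (Y \<omega>))" by (subst (asm) integrable_distr_eq) auto
    have "(\<lambda>n. - (\<integral>\<omega>. H (Y \<omega>) * ((1/12 - (osc n \<omega> $ i)\<^sup>2) / 2) \<partial>M)) \<longlonglongrightarrow> - ((\<integral>\<omega>. H (Y \<omega>) \<partial>M) * (\<integral>\<omega>. (1/12 - (V \<omega> $ i)\<^sup>2) / 2 \<partial>M))"
      by (intro tendsto_minus weak_continuous[where f="\<lambda>v. (1/12 - (v $ i)\<^sup>2) / 2"] iH) (auto intro!: continuous_intros)
    then have "(\<lambda>n. - (\<integral>\<omega>. H (Y \<omega>) * ((1/12 - (osc n \<omega> $ i)\<^sup>2) / 2) \<partial>M)) \<longlonglongrightarrow> 0"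
      by (simp only: integral_corrector) simp
    moreover have "\<forall>\<^sub>F n in sequentially. - (\<integral>\<omega>. H (Y \<omega>) * ((1/12 - (osc n \<omega> $ i)\<^sup>2) / 2) \<partial>M)
      = real n * (\<integral>y. F y * theta (real n *\<^sub>R y) $ i \<partial>?P)"
      using eventually_gt_at_top[of 0]
    proof eventually_elim
      case (elim n)
      have "real n * (\<integral>y. F y * theta (real n *\<^sub>R y) $ i \<partial>?P)
        = - (\<integral>y. (partial_deriv i F y + F y * \<rho> i y) * ((1/12 - (theta (real n *\<^sub>R y) $ i)\<^sup>2) / 2) \<partial>?P)"
      proof (rule theta_integration_by_parts[OF _ F iF iF\<rho> \<rho>m AE_law_not_integer[OF elim]])
        fix r :: real assume r: "0 < r" "r < 1"
        let ?G = "\<lambda>y. F y * smooth_Q r (real n * y $ i)"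
        have Q: "\<bar>smooth_Q r t\<bar> \<le> 1" "\<bar>smooth_D r t\<bar> \<le> 1" for t
          using abs_smooth_Q_le[of r t] abs_smooth_D_le[OF r, of t] r by auto
        have AB: "0 \<le> A * B" using A(1) B(1) by simp
        \<comment> \<open>Bounds the product and its partial derivative; the term with
          \<open>real n\<close> is the inner derivative of \<open>smooth_Q\<close>. Dependence on n
          is harmless, since \<open>logarithmic_gradient_C1\<close> is applied for fixed n and
          r.\<close>
        define C where "C = (A * B + A * B) + (A * B) * real n + A * B"
        show "(\<integral>y. partial_deriv i ?G y \<partial>?P) = - (\<integral>y. ?G y * \<rho> i y \<partial>?P)"
        proof (rule logarithmic_gradient_C1[OF prob_law _ \<rho> smooth_Q_component(1)[OF F r], where B=C])
          fix y
          have "\<bar>F y\<bar> * \<bar>smooth_Q r (real n * y $ i)\<bar> \<le> (A * B) * 1" using Fb Q AB by (intro mult_mono) auto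
          then have "\<bar>F y\<bar> * \<bar>smooth_Q r (real n * y $ i)\<bar> \<le> A * B" by (simp only: mult_1_right)
          moreover have "0 \<le> (A * B) * real n" using AB by simp
          ultimately show "\<bar>F y * smooth_Q r (real n * y $ i)\<bar> \<le> C" using AB unfolding C_def abs_mult by linarith
          have "\<bar>partial_deriv i F y\<bar> * \<bar>smooth_Q r (real n * y $ i)\<bar> \<le> (A * B + A * B) * 1"
            using pFb Q AB by (intro mult_mono) auto
          moreover have "\<bar>F y\<bar> * (real n * \<bar>smooth_D r (real n * y $ i)\<bar>) \<le> (A * B) * (real n * 1)"
            using Fb Q AB by (intro mult_mono mult_left_mono) auto
          ultimately have "\<bar>partial_deriv i F y * smooth_Q r (real n * y $ i)\<bar> + \<bar>F y * (real n * smooth_D r (real n * y $ i))\<bar> \<le> C"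
            using AB by (simp add: abs_mult C_def)
          then show "\<bar>partial_deriv i ?G y\<bar> \<le> C"
            unfolding smooth_Q_component(2)[OF F r] by linarith
        qed simp
      qed simp
      also have "\<dots> = - (\<integral>\<omega>. H (Y \<omega>) * ((1/12 - (osc n \<omega> $ i)\<^sup>2) / 2) \<partial>M)"
        unfolding H_def[symmetric] by (subst integral_distr) auto
      finally show ?case by simp
    qed
    ultimately have "(\<lambda>n. real n * (\<integral>y. F y * theta (real n *\<^sub>R y) $ i \<partial>?P)) \<longlonglongrightarrow> 0" by (rule Lim_transform_eventually)
    then show "(\<lambda>n. real n * (\<integral>y. (partial_deriv i \<phi> y * \<eta> y) * theta (real n *\<^sub>R y) $ i \<partial>?P)) \<longlonglongrightarrow> 0" by (simp add: F_def)
  next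
    fix i j
    have "integrable ?P (\<lambda>y. partial_deriv j (partial_deriv i \<phi>) y * \<eta> y)"
      by (rule bint, measurable, rule m[OF A(4) B(2)])
    then have iD: "integrable M (\<lambda>\<omega>. partial_deriv j (partial_deriv i \<phi>) (Y \<omega>) * \<eta> (Y \<omega>))" by (subst (asm) integrable_distr_eq) auto
    have "(\<lambda>n. \<integral>\<omega>. (partial_deriv j (partial_deriv i \<phi>) (Y \<omega>) * \<eta> (Y \<omega>)) * (osc n \<omega> $ i * osc n \<omega> $ j) \<partial>M)
      \<longlonglongrightarrow> (\<integral>\<omega>. partial_deriv j (partial_deriv i \<phi>) (Y \<omega>) * \<eta> (Y \<omega>) \<partial>M) * (\<integral>\<omega>. V \<omega> $ i * V \<omega> $ j \<partial>M)"
      by (rule weak_continuous[where f="\<lambda>v. v $ i * v $ j", OF _ iD]) (intro continuous_intros)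
    then show "(\<lambda>n. \<integral>y. (partial_deriv j (partial_deriv i \<phi>) y * \<eta> y) * (theta (real n *\<^sub>R y) $ i * theta (real n *\<^sub>R y) $ j) \<partial>?P)
      \<longlonglongrightarrow> (\<integral>y. partial_deriv j (partial_deriv i \<phi>) y * \<eta> y \<partial>?P) * (if i = j then 1/12 else 0)"
      by (simp only: integral_V_nth_mult) (simp add: integral_distr)
  next
    fix i j and y h :: "real^'d"
    show "\<bar>partial_deriv j (partial_deriv i \<phi>) (y + h) * \<eta> y\<bar> \<le> A * B" by (rule m[OF A(4) B(2)])
  qed (auto simp: C2_bounded_class(6)[OF \<eta>])
  moreover have "(\<integral>y. (\<phi> (graduated n y) - \<phi> y) * \<eta> y \<partial>?P) = (\<integral>\<omega>. (\<phi> (graduated n (Y \<omega>)) - \<phi> (Y \<omega>)) * \<eta> (Y \<omega>) \<partial>M)" for n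
    by (rule integral_distr) auto
  ultimately show ?thesis by simp
qed

lemma carre_du_champ_limit:
  assumes \<phi>: "\<phi> \<in> C2_bounded" and \<eta>: "\<eta> \<in> C2_bounded"
  shows "(\<lambda>n. (real n)\<^sup>2 * (\<integral>\<omega>. (\<phi> (graduated n (Y \<omega>)) - \<phi> (Y \<omega>)) * (\<eta> (graduated n (Y \<omega>)) - \<eta> (Y \<omega>)) \<partial>M))
      \<longlonglongrightarrow> (\<integral>y. 1/12 * (\<Sum>i\<in>UNIV. partial_deriv i \<phi> y * partial_deriv i \<eta> y) \<partial>distr M borel Y)"
proof -
  note [measurable] = C2_bounded_class(7)[OF \<phi>] C2_bounded_class(7)[OF \<eta>]
  obtain L K where L: "L-lipschitz_on UNIV \<phi>" "K-lipschitz_on UNIV \<eta>"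
    using C2_bounded_lipschitz[OF \<phi>] C2_bounded_lipschitz[OF \<eta>] by metis
  have "(\<integral>y. 1/12 * (\<Sum>i\<in>UNIV. partial_deriv i \<phi> y * partial_deriv i \<eta> y) \<partial>distr M borel Y)
    = (\<integral>\<omega>. 1/12 * (\<Sum>i\<in>UNIV. partial_deriv i \<phi> (Y \<omega>) * partial_deriv i \<eta> (Y \<omega>)) * 1 \<partial>M)"
    by (subst integral_distr) auto
  then show ?thesis
    using quadratic_increment[OF C2_bounded_class(2)[OF \<phi>] L(1) C2_bounded_class(2)[OF \<eta>] L(2), of "\<lambda>_. 1" 1] by simp
qed

end

section \<open>The bias operators of (H1) to (H4)\<close>

text \<open>One formula for both cases of (d): in case (ii), \<open>\<rho> i\<close> is
  \<open>dh i / h\<close> on \<open>G\<close>. It is 1/24 times the diffusion operator that is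
  symmetric for a measure with logarithmic gradient \<rho>.\<close>

definition symmetric_bias :: "('d \<Rightarrow> real^'d \<Rightarrow> real) \<Rightarrow> (real^'d \<Rightarrow> real) \<Rightarrow> real^'d \<Rightarrow> real" where
  "symmetric_bias \<rho> \<phi> y = 1/24 * laplacian \<phi> y + 1/24 * (\<Sum>i\<in>UNIV. partial_deriv i \<phi> y * \<rho> i y)"

lemma in_L2_laplacian:
  fixes P :: "(real^'d) measure"
  assumes "finite_measure P" and [measurable_cong]: "sets P = sets borel" and \<phi>: "\<phi> \<in> C2_bounded"
  shows "in_L2 P (\<lambda>y. 1/24 * laplacian \<phi> y)"
proof -
  note [measurable] = C2_bounded_class(8)[OF \<phi>]
  obtain A where A: "\<And>i j y. \<bar>partial_deriv j (partial_deriv i \<phi>) y\<bar> \<le> A" using C2_boundedE[OF \<phi>] by metis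
  show ?thesis unfolding laplacian_def sum_distrib_left
  proof (intro in_L2_sum in_L2_bounded[OF assms(1), where B=A])
    fix i y
    show "(\<lambda>y. 1/24 * partial_deriv i (partial_deriv i \<phi>) y) \<in> borel_measurable P" by measurable
    show "\<bar>1/24 * partial_deriv i (partial_deriv i \<phi>) y\<bar> \<le> A" using A[of i i y] by (simp add: abs_mult)
  qed simp
qed

lemma in_L2_symmetric_bias:
  fixes P :: "(real^'d) measure"
  assumes "finite_measure P" and s[measurable_cong]: "sets P = sets borel" and \<phi>: "\<phi> \<in> C2_bounded"
    and \<rho>: "L2_logarithmic_gradient P \<rho>"
  shows "in_L2 P (symmetric_bias \<rho> \<phi>)"
proof -
  note [measurable] = C2_bounded_class(7)[OF \<phi>]
  obtain A where A: "\<And>i y. \<bar>partial_deriv i \<phi> y\<bar> \<le> A" using C2_boundedE[OF \<phi>] by metis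
  have "in_L2 P (\<lambda>y. \<Sum>i\<in>UNIV. (1/24 * partial_deriv i \<phi> y) * \<rho> i y)"
  proof (intro in_L2_sum in_L2_mult_bounded[where B=A])
    fix i y
    show "in_L2 P (\<rho> i)" using \<rho> by (simp add: L2_logarithmic_gradient_def)
    show "(\<lambda>y. 1/24 * partial_deriv i \<phi> y) \<in> borel_measurable P" by measurable
    show "\<bar>1/24 * partial_deriv i \<phi> y\<bar> \<le> A" using A[of i y] by (simp add: abs_mult)
  qed simp
  from in_L2_add[OF in_L2_laplacian[OF assms(1) s \<phi>] this]
  show ?thesis by (simp add: symmetric_bias_def[abs_def] sum_distrib_left mult.assoc)
qed

text \<open>Integration by parts of the product of a partial derivative of \<phi> with \<eta> moves
  the derivative off \<eta>, at the price of the term with \<rho>_i. The constants match because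
  1/12 is twice 1/24.\<close>

lemma symmetric_bias_integral:
  fixes P :: "(real^'d) measure"
  assumes "prob_space P" and s[measurable_cong]: "sets P = sets borel" and \<rho>: "L2_logarithmic_gradient P \<rho>"
    and \<phi>: "\<phi> \<in> C2_bounded" and \<eta>: "\<eta> \<in> C2_bounded"
  shows "(\<integral>y. 1/12 * (\<Sum>i\<in>UNIV. partial_deriv i \<phi> y * partial_deriv i \<eta> y) \<partial>P) = - 2 * (\<integral>y. symmetric_bias \<rho> \<phi> y * \<eta> y \<partial>P)"
proof -
  interpret prob_space P by fact
  have m: "f \<in> borel_measurable P" if "f \<in> borel_measurable borel" for f :: "real^'d \<Rightarrow> real"
    using that by measurable
  note [measurable] = C2_bounded_class(6,7,8)[OF \<phi>, THEN m] C2_bounded_class(6,7,8)[OF \<eta>, THEN m]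
  obtain A where A: "0 \<le> A" "\<And>y. \<bar>\<phi> y\<bar> \<le> A" "\<And>i y. \<bar>partial_deriv i \<phi> y\<bar> \<le> A"
    "\<And>i j y. \<bar>partial_deriv j (partial_deriv i \<phi>) y\<bar> \<le> A" using C2_boundedE[OF \<phi>] by blast
  obtain B where B: "0 \<le> B" "\<And>y. \<bar>\<eta> y\<bar> \<le> B" "\<And>i y. \<bar>partial_deriv i \<eta> y\<bar> \<le> B" using C2_boundedE[OF \<eta>] by metis
  have ab: "\<bar>a * b\<bar> \<le> A * B" if "\<bar>a\<bar> \<le> A" "\<bar>b\<bar> \<le> B" for a b
    unfolding abs_mult using that A(1) by (intro mult_mono) auto
  have AB: "0 \<le> A * B" using A(1) B(1) by simp
  have two: "\<bar>a + b\<bar> \<le> X + Y" if "\<bar>a\<bar> \<le> X" "\<bar>b\<bar> \<le> Y" for a b X Y :: real using that by linarith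
  have i1: "integrable P (\<lambda>y. partial_deriv i (partial_deriv i \<phi>) y * \<eta> y)" for i
    by (rule integrable_const_bound[where B="A * B"]) (auto intro!: ab A B)
  have i2: "integrable P (\<lambda>y. partial_deriv i \<phi> y * partial_deriv i \<eta> y)" for i
    by (rule integrable_const_bound[where B="A * B"]) (auto intro!: ab A B)
  have i3: "integrable P (\<lambda>y. (partial_deriv i \<phi> y * \<eta> y) * \<rho> i y)" for i
  proof -
    have "integrable P (\<rho> i)"
      using \<rho> by (intro in_L2_integrable[OF finite_measure_axioms]) (simp add: L2_logarithmic_gradient_def)
    from integrable_mult_bounded[OF this _ ab[OF A(3) B(2)]] show ?thesis
      by (subst mult.commute) simp
  qed
  have ibp: "(\<integral>y. partial_deriv i \<phi> y * partial_deriv i \<eta> y \<partial>P)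
     = - (\<integral>y. partial_deriv i (partial_deriv i \<phi>) y * \<eta> y + (partial_deriv i \<phi> y * \<eta> y) * \<rho> i y \<partial>P)" for i
  proof -
    have pF: "partial_deriv i (\<lambda>y. partial_deriv i \<phi> y * \<eta> y) = (\<lambda>y. partial_deriv i (partial_deriv i \<phi>) y * \<eta> y + partial_deriv i \<phi> y * partial_deriv i \<eta> y)"
      by (intro partial_deriv_mult C2_bounded_class[OF \<phi>] C2_bounded_class[OF \<eta>])
    have "(\<integral>y. partial_deriv i (\<lambda>y. partial_deriv i \<phi> y * \<eta> y) y \<partial>P) = - (\<integral>y. (partial_deriv i \<phi> y * \<eta> y) * \<rho> i y \<partial>P)"
    proof (rule logarithmic_gradient_C1[OF prob_space_axioms s \<rho>, where B="A * B + A * B"])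
      show "of_class_C 1 (\<lambda>y. partial_deriv i \<phi> y * \<eta> y)" by (intro of_class_C_mult C2_bounded_class[OF \<phi>] C2_bounded_class[OF \<eta>])
      show "\<bar>partial_deriv i \<phi> y * \<eta> y\<bar> \<le> A * B + A * B" for y using ab[OF A(3) B(2), of i y y] AB by linarith
      show "\<bar>partial_deriv i (\<lambda>y. partial_deriv i \<phi> y * \<eta> y) y\<bar> \<le> A * B + A * B" for y
        unfolding pF by (intro two ab A B)
    qed
    then show ?thesis unfolding pF using i1 i2 i3 by simp
  qed
  have "(\<integral>y. 1/12 * (\<Sum>i\<in>UNIV. partial_deriv i \<phi> y * partial_deriv i \<eta> y) \<partial>P) = 1/12 * (\<Sum>i\<in>UNIV. \<integral>y. partial_deriv i \<phi> y * partial_deriv i \<eta> y \<partial>P)"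
    using i2 by simp
  also have "\<dots> = - (1/12 * (\<Sum>i\<in>UNIV. \<integral>y. partial_deriv i (partial_deriv i \<phi>) y * \<eta> y + (partial_deriv i \<phi> y * \<eta> y) * \<rho> i y \<partial>P))"
    unfolding ibp by (simp add: sum_negf)
  also have "\<dots> = - 2 * (\<integral>y. 1/24 * (\<Sum>i\<in>UNIV. partial_deriv i (partial_deriv i \<phi>) y * \<eta> y + (partial_deriv i \<phi> y * \<eta> y) * \<rho> i y) \<partial>P)"
    using i1 i3 by simp
  also have "(\<integral>y. 1/24 * (\<Sum>i\<in>UNIV. partial_deriv i (partial_deriv i \<phi>) y * \<eta> y + (partial_deriv i \<phi> y * \<eta> y) * \<rho> i y) \<partial>P) = (\<integral>y. symmetric_bias \<rho> \<phi> y * \<eta> y \<partial>P)"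
    by (intro Bochner_Integration.integral_cong refl)
       (simp add: symmetric_bias_def laplacian_def sum.distrib sum_distrib_left sum_distrib_right algebra_simps)
  finally show ?thesis .
qed

context rajchman_vector
begin

context
  fixes \<rho> assumes \<rho>: "L2_logarithmic_gradient (distr M borel Y) \<rho>"
begin

lemma hyp_H1_laplacian:
  "hyp_H1 M Y (\<lambda>n \<omega>. graduated n (Y \<omega>)) (\<lambda>n. (real n)\<^sup>2) C2_bounded (\<lambda>\<phi> y. 1/24 * laplacian \<phi> y)"
  unfolding hyp_H1_def using in_L2_laplacian[OF finite_law] first_order_limit[OF \<rho>] by simp

lemma hyp_H3_symmetric_bias:
  "hyp_H3 M Y (\<lambda>n \<omega>. graduated n (Y \<omega>)) (\<lambda>n. (real n)\<^sup>2) C2_bounded (symmetric_bias \<rho>)"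
  unfolding hyp_H3_def
proof (intro ballI conjI)
  fix \<phi> :: "real^'d \<Rightarrow> real" assume \<phi>: "\<phi> \<in> C2_bounded"
  show "in_L2 (distr M borel Y) (symmetric_bias \<rho> \<phi>)" by (rule in_L2_symmetric_bias[OF finite_law _ \<phi> \<rho>]) simp
  fix \<eta> :: "real^'d \<Rightarrow> real" assume \<eta>: "\<eta> \<in> C2_bounded"
  show "(\<lambda>n. (real n)\<^sup>2 * (\<integral>\<omega>. (\<phi> (graduated n (Y \<omega>)) - \<phi> (Y \<omega>)) * (\<eta> (graduated n (Y \<omega>)) - \<eta> (Y \<omega>)) \<partial>M))
       \<longlonglongrightarrow> - 2 * (\<integral>y. symmetric_bias \<rho> \<phi> y * \<eta> y \<partial>distr M borel Y)"
    using carre_du_champ_limit[OF \<phi> \<eta>] symmetric_bias_integral[OF prob_law _ \<rho> \<phi> \<eta>] by simp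
qed

lemma increment_integrable:
  assumes \<phi>: "\<phi> \<in> C2_bounded" and \<eta>: "\<eta> \<in> C2_bounded"
  shows "integrable M (\<lambda>\<omega>. (\<phi> (graduated n (Y \<omega>)) - \<phi> (Y \<omega>)) * \<eta> (graduated n (Y \<omega>)))"
    "integrable M (\<lambda>\<omega>. (\<phi> (graduated n (Y \<omega>)) - \<phi> (Y \<omega>)) * \<eta> (Y \<omega>))"
proof -
  note [measurable] = C2_bounded_class(6)[OF \<phi>] C2_bounded_class(6)[OF \<eta>]
  obtain A where A: "0 \<le> A" "\<And>y. \<bar>\<phi> y\<bar> \<le> A" using C2_boundedE[OF \<phi>] by metis
  obtain B where B: "0 \<le> B" "\<And>y. \<bar>\<eta> y\<bar> \<le> B" using C2_boundedE[OF \<eta>] by metis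
  have b: "\<bar>(\<phi> x - \<phi> y) * \<eta> z\<bar> \<le> (2 * A) * B" for x y z
  proof -
    have "\<bar>\<phi> x - \<phi> y\<bar> \<le> 2 * A" using A(2)[of x] A(2)[of y] by linarith
    then show ?thesis unfolding abs_mult using B A by (intro mult_mono) auto
  qed
  show "integrable M (\<lambda>\<omega>. (\<phi> (graduated n (Y \<omega>)) - \<phi> (Y \<omega>)) * \<eta> (graduated n (Y \<omega>)))"
    "integrable M (\<lambda>\<omega>. (\<phi> (graduated n (Y \<omega>)) - \<phi> (Y \<omega>)) * \<eta> (Y \<omega>))"
    by (rule integrable_const_bound[where B="(2 * A) * B"]; use b in auto)+
qed

lemma bias_combination:
  assumes \<phi>: "\<phi> \<in> C2_bounded" and \<eta>: "\<eta> \<in> C2_bounded"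
  shows "in_L2 (distr M borel Y) (\<lambda>y. a * symmetric_bias \<rho> \<phi> y + b * (1/24 * laplacian \<phi> y))"
    and "(\<integral>y. (a * symmetric_bias \<rho> \<phi> y + b * (1/24 * laplacian \<phi> y)) * \<eta> y \<partial>distr M borel Y)
      = a * (\<integral>y. symmetric_bias \<rho> \<phi> y * \<eta> y \<partial>distr M borel Y) + b * (\<integral>y. 1/24 * laplacian \<phi> y * \<eta> y \<partial>distr M borel Y)"
proof -
  let ?P = "distr M borel Y"
  have s: "in_L2 ?P (symmetric_bias \<rho> \<phi>)" by (rule in_L2_symmetric_bias[OF finite_law _ \<phi> \<rho>]) simp
  have l: "in_L2 ?P (\<lambda>y. 1/24 * laplacian \<phi> y)" by (rule in_L2_laplacian[OF finite_law _ \<phi>]) simp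
  show "in_L2 ?P (\<lambda>y. a * symmetric_bias \<rho> \<phi> y + b * (1/24 * laplacian \<phi> y))"
    by (rule in_L2_add[OF in_L2_mult_bounded[OF s, where g="\<lambda>_. a" and B="\<bar>a\<bar>"] in_L2_mult_bounded[OF l, where g="\<lambda>_. b" and B="\<bar>b\<bar>"]]) auto
  note [measurable] = C2_bounded_class(6)[OF \<eta>]
  obtain B where B: "\<And>y. \<bar>\<eta> y\<bar> \<le> B" using C2_boundedE[OF \<eta>] by metis
  have "integrable ?P (\<lambda>y. symmetric_bias \<rho> \<phi> y * \<eta> y)" "integrable ?P (\<lambda>y. 1/24 * laplacian \<phi> y * \<eta> y)"
    by (rule integrable_mult_bounded[OF in_L2_integrable[OF finite_law s] _ B], simp)
       (rule integrable_mult_bounded[OF in_L2_integrable[OF finite_law l] _ B], simp)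
  note sum = Bochner_Integration.integral_add[OF integrable_mult_right[OF this(1), of a] integrable_mult_right[OF this(2), of b]]
  have eq: "(a * symmetric_bias \<rho> \<phi> y + b * (1/24 * laplacian \<phi> y)) * \<eta> y
      = a * (symmetric_bias \<rho> \<phi> y * \<eta> y) + b * (1/24 * laplacian \<phi> y * \<eta> y)" for y
    by (simp only: distrib_right mult.assoc)
  have "(\<integral>y. (a * symmetric_bias \<rho> \<phi> y + b * (1/24 * laplacian \<phi> y)) * \<eta> y \<partial>?P)
      = (\<integral>y. a * (symmetric_bias \<rho> \<phi> y * \<eta> y) \<partial>?P) + (\<integral>y. b * (1/24 * laplacian \<phi> y * \<eta> y) \<partial>?P)"
    unfolding eq by (rule sum)
  also have "\<dots> = a * (\<integral>y. symmetric_bias \<rho> \<phi> y * \<eta> y \<partial>?P) + b * (\<integral>y. 1/24 * laplacian \<phi> y * \<eta> y \<partial>?P)"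
    by (intro arg_cong2[where f="(+)"] integral_mult_right_zero)
  finally show "(\<integral>y. (a * symmetric_bias \<rho> \<phi> y + b * (1/24 * laplacian \<phi> y)) * \<eta> y \<partial>?P)
      = a * (\<integral>y. symmetric_bias \<rho> \<phi> y * \<eta> y \<partial>?P) + b * (\<integral>y. 1/24 * laplacian \<phi> y * \<eta> y \<partial>?P)"
    .
qed

lemma increment_integrals:
  assumes \<phi>: "\<phi> \<in> C2_bounded" and \<eta>: "\<eta> \<in> C2_bounded"
  shows "(\<integral>\<omega>. (\<phi> (graduated n (Y \<omega>)) - \<phi> (Y \<omega>)) * (\<eta> (graduated n (Y \<omega>)) - \<eta> (Y \<omega>)) \<partial>M)
      = (\<integral>\<omega>. (\<phi> (graduated n (Y \<omega>)) - \<phi> (Y \<omega>)) * \<eta> (graduated n (Y \<omega>)) \<partial>M) - (\<integral>\<omega>. (\<phi> (graduated n (Y \<omega>)) - \<phi> (Y \<omega>)) * \<eta> (Y \<omega>) \<partial>M)"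
    and "(\<integral>\<omega>. (\<phi> (graduated n (Y \<omega>)) - \<phi> (Y \<omega>)) * (\<eta> (graduated n (Y \<omega>)) + \<eta> (Y \<omega>)) \<partial>M)
      = (\<integral>\<omega>. (\<phi> (graduated n (Y \<omega>)) - \<phi> (Y \<omega>)) * \<eta> (graduated n (Y \<omega>)) \<partial>M) + (\<integral>\<omega>. (\<phi> (graduated n (Y \<omega>)) - \<phi> (Y \<omega>)) * \<eta> (Y \<omega>) \<partial>M)"
    and "(\<integral>\<omega>. (\<phi> (Y \<omega>) - \<phi> (graduated n (Y \<omega>))) * \<eta> (graduated n (Y \<omega>)) \<partial>M)
      = - (\<integral>\<omega>. (\<phi> (graduated n (Y \<omega>)) - \<phi> (Y \<omega>)) * \<eta> (graduated n (Y \<omega>)) \<partial>M)"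
proof -
  note i = increment_integrable[OF \<phi> \<eta>, of n]
  show "(\<integral>\<omega>. (\<phi> (graduated n (Y \<omega>)) - \<phi> (Y \<omega>)) * (\<eta> (graduated n (Y \<omega>)) - \<eta> (Y \<omega>)) \<partial>M)
      = (\<integral>\<omega>. (\<phi> (graduated n (Y \<omega>)) - \<phi> (Y \<omega>)) * \<eta> (graduated n (Y \<omega>)) \<partial>M) - (\<integral>\<omega>. (\<phi> (graduated n (Y \<omega>)) - \<phi> (Y \<omega>)) * \<eta> (Y \<omega>) \<partial>M)"
    using Bochner_Integration.integral_diff[OF i] by (simp only: right_diff_distrib)
  show "(\<integral>\<omega>. (\<phi> (graduated n (Y \<omega>)) - \<phi> (Y \<omega>)) * (\<eta> (graduated n (Y \<omega>)) + \<eta> (Y \<omega>)) \<partial>M)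
      = (\<integral>\<omega>. (\<phi> (graduated n (Y \<omega>)) - \<phi> (Y \<omega>)) * \<eta> (graduated n (Y \<omega>)) \<partial>M) + (\<integral>\<omega>. (\<phi> (graduated n (Y \<omega>)) - \<phi> (Y \<omega>)) * \<eta> (Y \<omega>) \<partial>M)"
    using Bochner_Integration.integral_add[OF i] by (simp only: distrib_left)
  have "(\<integral>\<omega>. (\<phi> (Y \<omega>) - \<phi> (graduated n (Y \<omega>))) * \<eta> (graduated n (Y \<omega>)) \<partial>M)
      = (\<integral>\<omega>. - ((\<phi> (graduated n (Y \<omega>)) - \<phi> (Y \<omega>)) * \<eta> (graduated n (Y \<omega>))) \<partial>M)"
    by (intro Bochner_Integration.integral_cong refl) (simp add: algebra_simps)
  then show "(\<integral>\<omega>. (\<phi> (Y \<omega>) - \<phi> (graduated n (Y \<omega>))) * \<eta> (graduated n (Y \<omega>)) \<partial>M)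
      = - (\<integral>\<omega>. (\<phi> (graduated n (Y \<omega>)) - \<phi> (Y \<omega>)) * \<eta> (graduated n (Y \<omega>)) \<partial>M)" by simp
qed

text \<open>Splitting \<eta>(Yn) as \<eta>(Y) plus its increment shows that the limit is minus the
  one in (H3) minus the one in (H1). Hence the operator is twice the symmetric bias minus the
  Laplacian term.\<close>

lemma hyp_H2_bias:
  "hyp_H2 M Y (\<lambda>n \<omega>. graduated n (Y \<omega>)) (\<lambda>n. (real n)\<^sup>2) C2_bounded
     (\<lambda>\<phi> y. 2 * symmetric_bias \<rho> \<phi> y + (- 1) * (1/24 * laplacian \<phi> y))"
  unfolding hyp_H2_def
proof (intro ballI conjI)
  fix \<phi> :: "real^'d \<Rightarrow> real" assume \<phi>: "\<phi> \<in> C2_bounded"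
  show "in_L2 (distr M borel Y) (\<lambda>y. 2 * symmetric_bias \<rho> \<phi> y + (- 1) * (1/24 * laplacian \<phi> y))"
    by (rule bias_combination(1)[OF \<phi> \<phi>])
  fix \<eta> :: "real^'d \<Rightarrow> real" assume \<eta>: "\<eta> \<in> C2_bounded"
  let ?I = "\<integral>y. symmetric_bias \<rho> \<phi> y * \<eta> y \<partial>distr M borel Y" and ?J = "\<integral>y. 1/24 * laplacian \<phi> y * \<eta> y \<partial>distr M borel Y"
  have 1: "(\<lambda>n. (real n)\<^sup>2 * (\<integral>\<omega>. (\<phi> (graduated n (Y \<omega>)) - \<phi> (Y \<omega>)) * (\<eta> (graduated n (Y \<omega>)) - \<eta> (Y \<omega>)) \<partial>M))
       \<longlonglongrightarrow> - 2 * (\<integral>y. symmetric_bias \<rho> \<phi> y * \<eta> y \<partial>distr M borel Y)"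
    using hyp_H3_symmetric_bias \<phi> \<eta> unfolding hyp_H3_def by blast
  have 2: "(\<lambda>n. - ((real n)\<^sup>2 * (\<integral>\<omega>. (\<phi> (graduated n (Y \<omega>)) - \<phi> (Y \<omega>)) * (\<eta> (graduated n (Y \<omega>)) - \<eta> (Y \<omega>)) \<partial>M))
      - (real n)\<^sup>2 * (\<integral>\<omega>. (\<phi> (graduated n (Y \<omega>)) - \<phi> (Y \<omega>)) * \<eta> (Y \<omega>) \<partial>M))
     \<longlonglongrightarrow> - (- 2 * (\<integral>y. symmetric_bias \<rho> \<phi> y * \<eta> y \<partial>distr M borel Y)) - (\<integral>y. 1/24 * laplacian \<phi> y * \<eta> y \<partial>distr M borel Y)"
    by (intro tendsto_diff tendsto_minus 1 first_order_limit[OF \<rho> \<phi> \<eta>])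
  have eq: "- ((real n)\<^sup>2 * (\<integral>\<omega>. (\<phi> (graduated n (Y \<omega>)) - \<phi> (Y \<omega>)) * (\<eta> (graduated n (Y \<omega>)) - \<eta> (Y \<omega>)) \<partial>M))
      - (real n)\<^sup>2 * (\<integral>\<omega>. (\<phi> (graduated n (Y \<omega>)) - \<phi> (Y \<omega>)) * \<eta> (Y \<omega>) \<partial>M)
    = (real n)\<^sup>2 * (\<integral>\<omega>. (\<phi> (Y \<omega>) - \<phi> (graduated n (Y \<omega>))) * \<eta> (graduated n (Y \<omega>)) \<partial>M)" for n
    unfolding increment_integrals[OF \<phi> \<eta>] by (simp only: right_diff_distrib minus_diff_eq mult_minus_right)
  have lim: "2 * ?I + (- 1) * ?J = - (- 2 * ?I) - ?J"
    by (simp only: mult_minus_left mult_1 minus_minus diff_conv_add_uminus)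
  show "(\<lambda>n. (real n)\<^sup>2 * (\<integral>\<omega>. (\<phi> (Y \<omega>) - \<phi> (graduated n (Y \<omega>))) * \<eta> (graduated n (Y \<omega>)) \<partial>M))
    \<longlonglongrightarrow> (\<integral>y. (2 * symmetric_bias \<rho> \<phi> y + (- 1) * (1/24 * laplacian \<phi> y)) * \<eta> y \<partial>distr M borel Y)"
    unfolding bias_combination(2)[OF \<phi> \<eta>, of 2 "- 1"] unfolding lim by (rule 2[unfolded eq])
qed

text \<open>The sum \<eta>(Yn) + \<eta>(Y) is the increment of \<eta> plus 2 \<eta>(Y), so the limit
  is the one in (H3) plus twice the one in (H1). The Laplacians cancel in the resulting operator,
  which is of first order.\<close>

lemma hyp_H4_bias:
  "hyp_H4 M Y (\<lambda>n \<omega>. graduated n (Y \<omega>)) (\<lambda>n. (real n)\<^sup>2) C2_bounded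
     (\<lambda>\<phi> y. (- 1) * symmetric_bias \<rho> \<phi> y + 1 * (1/24 * laplacian \<phi> y))"
  unfolding hyp_H4_def
proof (intro ballI conjI)
  fix \<phi> :: "real^'d \<Rightarrow> real" assume \<phi>: "\<phi> \<in> C2_bounded"
  show "in_L2 (distr M borel Y) (\<lambda>y. (- 1) * symmetric_bias \<rho> \<phi> y + 1 * (1/24 * laplacian \<phi> y))"
    by (rule bias_combination(1)[OF \<phi> \<phi>])
  fix \<eta> :: "real^'d \<Rightarrow> real" assume \<eta>: "\<eta> \<in> C2_bounded"
  let ?I = "\<integral>y. symmetric_bias \<rho> \<phi> y * \<eta> y \<partial>distr M borel Y" and ?J = "\<integral>y. 1/24 * laplacian \<phi> y * \<eta> y \<partial>distr M borel Y"
  have 1: "(\<lambda>n. (real n)\<^sup>2 * (\<integral>\<omega>. (\<phi> (graduated n (Y \<omega>)) - \<phi> (Y \<omega>)) * (\<eta> (graduated n (Y \<omega>)) - \<eta> (Y \<omega>)) \<partial>M))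
       \<longlonglongrightarrow> - 2 * (\<integral>y. symmetric_bias \<rho> \<phi> y * \<eta> y \<partial>distr M borel Y)"
    using hyp_H3_symmetric_bias \<phi> \<eta> unfolding hyp_H3_def by blast
  have 2: "(\<lambda>n. (real n)\<^sup>2 * (\<integral>\<omega>. (\<phi> (graduated n (Y \<omega>)) - \<phi> (Y \<omega>)) * (\<eta> (graduated n (Y \<omega>)) - \<eta> (Y \<omega>)) \<partial>M)
      + 2 * ((real n)\<^sup>2 * (\<integral>\<omega>. (\<phi> (graduated n (Y \<omega>)) - \<phi> (Y \<omega>)) * \<eta> (Y \<omega>) \<partial>M)))
     \<longlonglongrightarrow> - 2 * (\<integral>y. symmetric_bias \<rho> \<phi> y * \<eta> y \<partial>distr M borel Y) + 2 * (\<integral>y. 1/24 * laplacian \<phi> y * \<eta> y \<partial>distr M borel Y)"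
    by (intro tendsto_add tendsto_mult tendsto_const 1 first_order_limit[OF \<rho> \<phi> \<eta>])
  have eq: "(real n)\<^sup>2 * (\<integral>\<omega>. (\<phi> (graduated n (Y \<omega>)) - \<phi> (Y \<omega>)) * (\<eta> (graduated n (Y \<omega>)) - \<eta> (Y \<omega>)) \<partial>M)
      + 2 * ((real n)\<^sup>2 * (\<integral>\<omega>. (\<phi> (graduated n (Y \<omega>)) - \<phi> (Y \<omega>)) * \<eta> (Y \<omega>) \<partial>M))
    = (real n)\<^sup>2 * (\<integral>\<omega>. (\<phi> (graduated n (Y \<omega>)) - \<phi> (Y \<omega>)) * (\<eta> (graduated n (Y \<omega>)) + \<eta> (Y \<omega>)) \<partial>M)" for n
    unfolding increment_integrals[OF \<phi> \<eta>] by (simp only: right_diff_distrib distrib_left)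
  have lim: "2 * ((- 1) * ?I + 1 * ?J) = - 2 * ?I + 2 * ?J"
    by (simp only: distrib_left mult_minus_left mult_minus_right mult_1)
  show "(\<lambda>n. (real n)\<^sup>2 * (\<integral>\<omega>. (\<phi> (graduated n (Y \<omega>)) - \<phi> (Y \<omega>)) * (\<eta> (graduated n (Y \<omega>)) + \<eta> (Y \<omega>)) \<partial>M))
    \<longlonglongrightarrow> 2 * (\<integral>y. ((- 1) * symmetric_bias \<rho> \<phi> y + 1 * (1/24 * laplacian \<phi> y)) * \<eta> y \<partial>distr M borel Y)"
    unfolding bias_combination(2)[OF \<phi> \<eta>, of "- 1" 1] unfolding lim by (rule 2[unfolded eq])
qed

section \<open>Uniqueness of the biases and the square field operator\<close>

lemma hyp_H1_unique:
  assumes A: "hyp_H1 M Y (\<lambda>n \<omega>. graduated n (Y \<omega>)) (\<lambda>n. (real n)\<^sup>2) C2_bounded A" and \<phi>: "\<phi> \<in> C2_bounded"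
  shows "AE y in distr M borel Y. A \<phi> y = 1/24 * laplacian \<phi> y"
proof (rule AE_eq_of_C2_bounded)
  show "integrable (distr M borel Y) (A \<phi>)"
  proof (rule in_L2_integrable[OF finite_law])
    show "in_L2 (distr M borel Y) (A \<phi>)" using A \<phi> unfolding hyp_H1_def by blast
  qed
  show "integrable (distr M borel Y) (\<lambda>y. 1/24 * laplacian \<phi> y)"
    by (rule in_L2_integrable[OF finite_law in_L2_laplacian[OF finite_law _ \<phi>]]) simp
  fix \<eta> :: "real^'d \<Rightarrow> real" assume \<eta>: "\<eta> \<in> C2_bounded"
  show "(\<integral>y. A \<phi> y * \<eta> y \<partial>distr M borel Y) = (\<integral>y. 1/24 * laplacian \<phi> y * \<eta> y \<partial>distr M borel Y)"
  proof (rule LIMSEQ_unique[OF _ first_order_limit[OF \<rho> \<phi> \<eta>]])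
    show "(\<lambda>n. (real n)\<^sup>2 * (\<integral>\<omega>. (\<phi> (graduated n (Y \<omega>)) - \<phi> (Y \<omega>)) * \<eta> (Y \<omega>) \<partial>M)) \<longlonglongrightarrow> (\<integral>y. A \<phi> y * \<eta> y \<partial>distr M borel Y)"
      using A \<phi> \<eta> unfolding hyp_H1_def by blast
  qed
qed simp

lemma hyp_H3_unique:
  assumes A: "hyp_H3 M Y (\<lambda>n \<omega>. graduated n (Y \<omega>)) (\<lambda>n. (real n)\<^sup>2) C2_bounded A" and \<phi>: "\<phi> \<in> C2_bounded"
  shows "AE y in distr M borel Y. A \<phi> y = symmetric_bias \<rho> \<phi> y"
proof (rule AE_eq_of_C2_bounded)
  show "integrable (distr M borel Y) (A \<phi>)"
  proof (rule in_L2_integrable[OF finite_law])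
    show "in_L2 (distr M borel Y) (A \<phi>)" using A \<phi> unfolding hyp_H3_def by blast
  qed
  show "integrable (distr M borel Y) (symmetric_bias \<rho> \<phi>)"
    by (rule in_L2_integrable[OF finite_law in_L2_symmetric_bias[OF finite_law _ \<phi> \<rho>]]) simp
  fix \<eta> :: "real^'d \<Rightarrow> real" assume \<eta>: "\<eta> \<in> C2_bounded"
  have "- 2 * (\<integral>y. A \<phi> y * \<eta> y \<partial>distr M borel Y) = - 2 * (\<integral>y. symmetric_bias \<rho> \<phi> y * \<eta> y \<partial>distr M borel Y)"
  proof (rule LIMSEQ_unique)
    show "(\<lambda>n. (real n)\<^sup>2 * (\<integral>\<omega>. (\<phi> (graduated n (Y \<omega>)) - \<phi> (Y \<omega>)) * (\<eta> (graduated n (Y \<omega>)) - \<eta> (Y \<omega>)) \<partial>M)) \<longlonglongrightarrow> - 2 * (\<integral>y. A \<phi> y * \<eta> y \<partial>distr M borel Y)"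
      using A \<phi> \<eta> unfolding hyp_H3_def by blast
    show "(\<lambda>n. (real n)\<^sup>2 * (\<integral>\<omega>. (\<phi> (graduated n (Y \<omega>)) - \<phi> (Y \<omega>)) * (\<eta> (graduated n (Y \<omega>)) - \<eta> (Y \<omega>)) \<partial>M)) \<longlonglongrightarrow> - 2 * (\<integral>y. symmetric_bias \<rho> \<phi> y * \<eta> y \<partial>distr M borel Y)"
      using hyp_H3_symmetric_bias \<phi> \<eta> unfolding hyp_H3_def by blast
  qed
  then show "(\<integral>y. A \<phi> y * \<eta> y \<partial>distr M borel Y) = (\<integral>y. symmetric_bias \<rho> \<phi> y * \<eta> y \<partial>distr M borel Y)" by simp
qed simp

text \<open>The first order term with \<rho> is a derivation, so it cancels in \<Gamma>, and the
  Laplacian leaves only its squared gradient. As \<open>A\<close> is any operator satisfying (H3),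
  uniqueness is applied twice, to \<phi> and to its square.\<close>

lemma square_field_gradient:
  assumes A: "hyp_H3 M Y (\<lambda>n \<omega>. graduated n (Y \<omega>)) (\<lambda>n. (real n)\<^sup>2) C2_bounded A" and \<phi>: "\<phi> \<in> C2_bounded"
  shows "AE y in distr M borel Y. square_field A \<phi> y = 1/12 * (\<Sum>i\<in>UNIV. (partial_deriv i \<phi> y)\<^sup>2)"
proof -
  have "(\<lambda>z. (\<phi> z)\<^sup>2) \<in> C2_bounded" using C2_bounded_mult[OF \<phi> \<phi>] by (simp add: power2_eq_square)
  from hyp_H3_unique[OF A this] hyp_H3_unique[OF A \<phi>] show ?thesis
  proof eventually_elim
    case (elim y)
    have "(\<Sum>i\<in>UNIV. partial_deriv i (\<lambda>z. (\<phi> z)\<^sup>2) y * \<rho> i y) = 2 * \<phi> y * (\<Sum>i\<in>UNIV. partial_deriv i \<phi> y * \<rho> i y)"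
      by (simp add: laplacian_square(2)[OF \<phi>] sum_distrib_left mult.assoc)
    then show ?case
      unfolding square_field_def elim symmetric_bias_def laplacian_square(1)[OF \<phi>] by (simp add: algebra_simps)
  qed
qed

end

end

text \<open>Composing a bounded continuous test function with a Borel \<psi> gives a bounded Borel
  function with no continuity, so the limit rests on \<open>weak_absolutely_continuous\<close>; the
  joint statement then follows from product test functions.\<close>

lemma (in uniform_vector) law_function:
  fixes X :: "'a \<Rightarrow> real^'m" and Y :: "'a \<Rightarrow> real^'d" and \<psi> :: "real^'d \<Rightarrow> real"
  assumes ind: "indep_rvs V (\<lambda>\<omega>. (X \<omega>, Y \<omega>))" and Y[measurable]: "Y \<in> borel_measurable M"
    and ac: "absolutely_continuous lborel (distr M borel Y)" and \<psi>[measurable]: "\<psi> \<in> borel_measurable borel"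
  shows "converges_in_law M (\<lambda>n \<omega>. (X \<omega>, \<psi> (real n *\<^sub>R (graduated n (Y \<omega>) - Y \<omega>)))) (\<lambda>\<omega>. (X \<omega>, \<psi> (V \<omega>)))"
proof -
  note indX = indep_rvs_fst[OF ind]
  then have X[measurable]: "X \<in> borel_measurable M" by (simp add: indep_rvs_def)
  have meas: "(\<lambda>\<omega>. \<psi> (real n *\<^sub>R (graduated n (Y \<omega>) - Y \<omega>))) \<in> borel_measurable M" for n by measurable
  show ?thesis unfolding converges_in_law_def
  proof (intro conjI allI impI)
    fix F :: "(real^'m) \<times> real \<Rightarrow> real"
    assume F: "continuous_on UNIV F" "bounded (range F)"
    show "(\<lambda>n. \<integral>\<omega>. F (X \<omega>, \<psi> (real n *\<^sub>R (graduated n (Y \<omega>) - Y \<omega>))) \<partial>M) \<longlonglongrightarrow> (\<integral>\<omega>. F (X \<omega>, \<psi> (V \<omega>)) \<partial>M)"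
    proof (rule converges_jointly[OF prob_space_axioms X meas _ _ F])
      fix g :: "real^'m \<Rightarrow> real" and f :: "real \<Rightarrow> real"
      assume gf: "continuous_on UNIV g" "bounded (range g)" "continuous_on UNIV f" "bounded (range f)"
      then have [measurable]: "g \<in> borel_measurable borel" "f \<in> borel_measurable borel"
        by (auto intro: borel_measurable_continuous_onI)
      obtain A B where bd: "\<And>x. \<bar>f x\<bar> \<le> A" "\<And>x. \<bar>g x\<bar> \<le> B" using gf by (auto simp: bounded_iff)
      have "(\<lambda>n. \<integral>\<omega>. g (X \<omega>) * f (\<psi> (theta (real n *\<^sub>R Y \<omega>))) \<partial>M) \<longlonglongrightarrow> (\<integral>\<omega>. g (X \<omega>) \<partial>M) * (\<integral>\<omega>. f (\<psi> (V \<omega>)) \<partial>M)"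
        by (rule weak_absolutely_continuous[OF Y ac, where f="\<lambda>v. f (\<psi> v)" and C=A and B=B]) (use bd in auto)
      also have "(\<integral>\<omega>. g (X \<omega>) \<partial>M) * (\<integral>\<omega>. f (\<psi> (V \<omega>)) \<partial>M) = (\<integral>\<omega>. g (X \<omega>) * f (\<psi> (V \<omega>)) \<partial>M)"
        by (rule indep_rvs_integral_mult[OF indX, where f="\<lambda>v. f (\<psi> v)" and A=A and B=B, symmetric]) (use bd in auto)
      finally show "(\<lambda>n. \<integral>\<omega>. g (X \<omega>) * f (\<psi> (real n *\<^sub>R (graduated n (Y \<omega>) - Y \<omega>))) \<partial>M) \<longlonglongrightarrow> (\<integral>\<omega>. g (X \<omega>) * f (\<psi> (V \<omega>)) \<partial>M)"
      proof (rule Lim_transform_eventually)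
        show "\<forall>\<^sub>F n in sequentially. (\<integral>\<omega>. g (X \<omega>) * f (\<psi> (theta (real n *\<^sub>R Y \<omega>))) \<partial>M)
          = (\<integral>\<omega>. g (X \<omega>) * f (\<psi> (real n *\<^sub>R (graduated n (Y \<omega>) - Y \<omega>))) \<partial>M)"
          using eventually_gt_at_top[of 0] by eventually_elim (simp add: graduated_def)
      qed
    qed measurable
  qed measurable
qed

theorem theorem4:
  fixes M :: "'a measure"
    and X :: "'a \<Rightarrow> real^'m"
    and Y :: "'a \<Rightarrow> real^'d"
    and V :: "'a \<Rightarrow> real^'d"
  defines "P\<^sub>Y \<equiv> distr M borel Y"
    and "Yn \<equiv> \<lambda>n \<omega>. graduated n (Y \<omega>)"
  assumes M: "prob_space M"
    and X: "X \<in> borel_measurable M"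
    and Y: "Y \<in> borel_measurable M"
    and V_uniform: "\<And>i. distr M borel (\<lambda>\<omega>. V \<omega> $ i) = uniform_measure lborel {-1/2<..<1/2}"
    and V_indep: "prob_space.indep_vars M (\<lambda>_. borel) (\<lambda>i \<omega>. V \<omega> $ i) UNIV"
    and V_indep_XY: "prob_space.indep_set M (sets (vimage_algebra (space M) V borel))
            (sets (vimage_algebra (space M) (\<lambda>\<omega>. (X \<omega>, Y \<omega>)) borel))"
  shows
    "(rajchman P\<^sub>Y \<longrightarrow>
        converges_in_law M (\<lambda>n \<omega>. (X \<omega>, real n *\<^sub>R (Yn n \<omega> - Y \<omega>))) (\<lambda>\<omega>. (X \<omega>, V \<omega>))
        \<and> (\<forall>\<phi>. of_class_C 1 \<phi> \<and> (\<exists>L. L-lipschitz_on UNIV \<phi>) \<longrightarrow>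
             converges_in_law M (\<lambda>n \<omega>. (X \<omega>, real n * (\<phi> (Yn n \<omega>) - \<phi> (Y \<omega>))))
               (\<lambda>\<omega>. (X \<omega>, \<Sum>i\<in>UNIV. V \<omega> $ i * partial_deriv i \<phi> (Y \<omega>)))
             \<and> (\<forall>g. (\<forall>n. cond_exp_version M Y (\<lambda>\<omega>. (\<phi> (Yn n \<omega>) - \<phi> (Y \<omega>))\<^sup>2) (g n)) \<longrightarrow>
                  converges_weakly_L1 P\<^sub>Y (\<lambda>n y. (real n)\<^sup>2 * g n y)
                    (\<lambda>y. 1/12 * (\<Sum>i\<in>UNIV. (partial_deriv i \<phi> y)\<^sup>2)))
             \<and> (\<lambda>n. (real n)\<^sup>2 * (\<integral>\<omega>. (\<phi> (Yn n \<omega>) - \<phi> (Y \<omega>))\<^sup>2 \<partial>M))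
                 \<longlonglongrightarrow> (\<integral>y. 1/12 * (\<Sum>i\<in>UNIV. (partial_deriv i \<phi> y)\<^sup>2) \<partial>P\<^sub>Y)))
     \<and> (\<forall>\<phi>. of_class_C 2 \<phi> \<longrightarrow>
        (\<forall>n. cond_exp_version M Y (\<lambda>\<omega>. (real n)\<^sup>2 * (\<phi> (Yn n \<omega>) - \<phi> (Y \<omega>)))
               (\<lambda>y. (real n)\<^sup>2 * (\<phi> (y + (1 / real n) *\<^sub>R theta (real n *\<^sub>R y)) - \<phi> y)))
        \<and> converges_in_distributions
            (\<lambda>n y. (real n)\<^sup>2 * (\<phi> (y + (1 / real n) *\<^sub>R theta (real n *\<^sub>R y)) - \<phi> y))
            (\<lambda>y. 1/24 * laplacian \<phi> y))
     \<and> (absolutely_continuous lborel P\<^sub>Y \<longrightarrow>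
        (\<forall>\<psi>::real^'d \<Rightarrow> real. \<psi> \<in> borel_measurable borel \<and> set_integrable lborel open_cube \<psi> \<longrightarrow>
           converges_in_law M (\<lambda>n \<omega>. (X \<omega>, \<psi> (real n *\<^sub>R (Yn n \<omega> - Y \<omega>))))
             (\<lambda>\<omega>. (X \<omega>, \<psi> (V \<omega>)))))
     \<and> (rajchman P\<^sub>Y \<and>
          ((\<exists>\<rho>. L2_logarithmic_gradient P\<^sub>Y \<rho>) \<or> (\<exists>G h dh. sobolev_density P\<^sub>Y G h dh)) \<longrightarrow>
        (\<exists>A. hyp_H1 M Y Yn (\<lambda>n. (real n)\<^sup>2) C2_bounded A)
        \<and> (\<exists>A. hyp_H2 M Y Yn (\<lambda>n. (real n)\<^sup>2) C2_bounded A)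
        \<and> (\<exists>A. hyp_H3 M Y Yn (\<lambda>n. (real n)\<^sup>2) C2_bounded A)
        \<and> (\<exists>A. hyp_H4 M Y Yn (\<lambda>n. (real n)\<^sup>2) C2_bounded A)
        \<and> (\<forall>A. hyp_H1 M Y Yn (\<lambda>n. (real n)\<^sup>2) C2_bounded A \<longrightarrow>
             (\<forall>\<phi>\<in>C2_bounded. AE y in P\<^sub>Y. A \<phi> y = 1/24 * laplacian \<phi> y))
        \<and> (\<forall>A. hyp_H3 M Y Yn (\<lambda>n. (real n)\<^sup>2) C2_bounded A \<longrightarrow>
             (\<forall>\<phi>\<in>C2_bounded.
                (AE y in P\<^sub>Y. square_field A \<phi> y = 1/12 * (\<Sum>i\<in>UNIV. (partial_deriv i \<phi> y)\<^sup>2))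
                \<and> (\<forall>\<rho>. L2_logarithmic_gradient P\<^sub>Y \<rho> \<longrightarrow>
                     (AE y in P\<^sub>Y. A \<phi> y = 1/24 * laplacian \<phi> y
                        + 1/24 * (\<Sum>i\<in>UNIV. partial_deriv i \<phi> y * \<rho> i y)))
                \<and> (\<forall>G h dh. sobolev_density P\<^sub>Y G h dh \<longrightarrow>
                     (AE y in P\<^sub>Y. A \<phi> y = 1/24 * laplacian \<phi> y
                        + 1/24 * (1 / h y) * (\<Sum>i\<in>UNIV. dh i y * partial_deriv i \<phi> y))))))"
proof -
  interpret prob_space M by (rule M)
  interpret uniform_vector M V by unfold_locales (rule V_uniform V_indep)+
  have XY: "(\<lambda>\<omega>. (X \<omega>, Y \<omega>)) \<in> borel_measurable M" using X Y by measurable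
  have ind: "indep_rvs V (\<lambda>\<omega>. (X \<omega>, Y \<omega>))"
    unfolding indep_rvs_def using XY V_measurable V_indep_XY by blast
  have a: "converges_in_law M (\<lambda>n \<omega>. (X \<omega>, real n *\<^sub>R (Yn n \<omega> - Y \<omega>))) (\<lambda>\<omega>. (X \<omega>, V \<omega>))
        \<and> (\<forall>\<phi>. of_class_C 1 \<phi> \<and> (\<exists>L. L-lipschitz_on UNIV \<phi>) \<longrightarrow>
             converges_in_law M (\<lambda>n \<omega>. (X \<omega>, real n * (\<phi> (Yn n \<omega>) - \<phi> (Y \<omega>))))
               (\<lambda>\<omega>. (X \<omega>, \<Sum>i\<in>UNIV. V \<omega> $ i * partial_deriv i \<phi> (Y \<omega>)))
             \<and> (\<forall>g. (\<forall>n. cond_exp_version M Y (\<lambda>\<omega>. (\<phi> (Yn n \<omega>) - \<phi> (Y \<omega>))\<^sup>2) (g n)) \<longrightarrow>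
                  converges_weakly_L1 P\<^sub>Y (\<lambda>n y. (real n)\<^sup>2 * g n y)
                    (\<lambda>y. 1/12 * (\<Sum>i\<in>UNIV. (partial_deriv i \<phi> y)\<^sup>2)))
             \<and> (\<lambda>n. (real n)\<^sup>2 * (\<integral>\<omega>. (\<phi> (Yn n \<omega>) - \<phi> (Y \<omega>))\<^sup>2 \<partial>M))
                 \<longlonglongrightarrow> (\<integral>y. 1/12 * (\<Sum>i\<in>UNIV. (partial_deriv i \<phi> y)\<^sup>2) \<partial>P\<^sub>Y))"
    if R: "rajchman P\<^sub>Y"
  proof -
    interpret rajchman_vector M V Y by unfold_locales (use Y R in \<open>simp_all add: P\<^sub>Y_def\<close>)
    show ?thesis unfolding P\<^sub>Y_def Yn_def
    proof (intro conjI allI impI)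
      show "converges_in_law M (\<lambda>n \<omega>. (X \<omega>, real n *\<^sub>R (graduated n (Y \<omega>) - Y \<omega>))) (\<lambda>\<omega>. (X \<omega>, V \<omega>))"
        by (rule law_osc[OF ind])
      fix \<phi> :: "real^'d \<Rightarrow> real" assume "of_class_C 1 \<phi> \<and> (\<exists>L. L-lipschitz_on UNIV \<phi>)"
      then obtain L where \<phi>: "of_class_C 1 \<phi>" "L-lipschitz_on UNIV \<phi>" by blast
      show "converges_in_law M (\<lambda>n \<omega>. (X \<omega>, real n * (\<phi> (graduated n (Y \<omega>)) - \<phi> (Y \<omega>))))
               (\<lambda>\<omega>. (X \<omega>, \<Sum>i\<in>UNIV. V \<omega> $ i * partial_deriv i \<phi> (Y \<omega>)))"
        by (rule law_increment[OF ind \<phi>])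
      show "(\<lambda>n. (real n)\<^sup>2 * (\<integral>\<omega>. (\<phi> (graduated n (Y \<omega>)) - \<phi> (Y \<omega>))\<^sup>2 \<partial>M))
          \<longlonglongrightarrow> (\<integral>y. 1/12 * (\<Sum>i\<in>UNIV. (partial_deriv i \<phi> y)\<^sup>2) \<partial>distr M borel Y)"
        by (rule mean_square_increment[OF \<phi>])
      fix g assume "\<forall>n. cond_exp_version M Y (\<lambda>\<omega>. (\<phi> (graduated n (Y \<omega>)) - \<phi> (Y \<omega>))\<^sup>2) (g n)"
      then show "converges_weakly_L1 (distr M borel Y) (\<lambda>n y. (real n)\<^sup>2 * g n y)
          (\<lambda>y. 1/12 * (\<Sum>i\<in>UNIV. (partial_deriv i \<phi> y)\<^sup>2))"
        by (intro weak_L1_increment[OF \<phi>]) blast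
    qed
  qed
  have b: "(\<forall>n. cond_exp_version M Y (\<lambda>\<omega>. (real n)\<^sup>2 * (\<phi> (Yn n \<omega>) - \<phi> (Y \<omega>)))
               (\<lambda>y. (real n)\<^sup>2 * (\<phi> (y + (1 / real n) *\<^sub>R theta (real n *\<^sub>R y)) - \<phi> y)))
        \<and> converges_in_distributions
            (\<lambda>n y. (real n)\<^sup>2 * (\<phi> (y + (1 / real n) *\<^sub>R theta (real n *\<^sub>R y)) - \<phi> y))
            (\<lambda>y. 1/24 * laplacian \<phi> y)"
    if \<phi>: "of_class_C 2 \<phi>" for \<phi> :: "real^'d \<Rightarrow> real"
  proof -
    have [measurable]: "\<phi> \<in> borel_measurable borel"
      by (intro borel_measurable_continuous_onI of_class_C_continuous[OF \<phi>])
    have "(\<lambda>y. (real n)\<^sup>2 * (\<phi> (graduated n y) - \<phi> y)) \<in> borel_measurable borel" for n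
      unfolding graduated_def by measurable
    from cond_exp_version_function[OF Y this] converges_in_distributions_laplacian[OF \<phi>]
    show ?thesis unfolding Yn_def graduated_def[symmetric] by blast
  qed
  have c: "converges_in_law M (\<lambda>n \<omega>. (X \<omega>, \<psi> (real n *\<^sub>R (Yn n \<omega> - Y \<omega>)))) (\<lambda>\<omega>. (X \<omega>, \<psi> (V \<omega>)))"
    if "absolutely_continuous lborel P\<^sub>Y" "\<psi> \<in> borel_measurable borel" for \<psi> :: "real^'d \<Rightarrow> real"
    unfolding Yn_def by (rule law_function[OF ind Y that[unfolded P\<^sub>Y_def]])
  have d: "(\<exists>A. hyp_H1 M Y Yn (\<lambda>n. (real n)\<^sup>2) C2_bounded A)
        \<and> (\<exists>A. hyp_H2 M Y Yn (\<lambda>n. (real n)\<^sup>2) C2_bounded A)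
        \<and> (\<exists>A. hyp_H3 M Y Yn (\<lambda>n. (real n)\<^sup>2) C2_bounded A)
        \<and> (\<exists>A. hyp_H4 M Y Yn (\<lambda>n. (real n)\<^sup>2) C2_bounded A)
        \<and> (\<forall>A. hyp_H1 M Y Yn (\<lambda>n. (real n)\<^sup>2) C2_bounded A \<longrightarrow>
             (\<forall>\<phi>\<in>C2_bounded. AE y in P\<^sub>Y. A \<phi> y = 1/24 * laplacian \<phi> y))
        \<and> (\<forall>A. hyp_H3 M Y Yn (\<lambda>n. (real n)\<^sup>2) C2_bounded A \<longrightarrow>
             (\<forall>\<phi>\<in>C2_bounded.
                (AE y in P\<^sub>Y. square_field A \<phi> y = 1/12 * (\<Sum>i\<in>UNIV. (partial_deriv i \<phi> y)\<^sup>2))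
                \<and> (\<forall>\<rho>. L2_logarithmic_gradient P\<^sub>Y \<rho> \<longrightarrow>
                     (AE y in P\<^sub>Y. A \<phi> y = 1/24 * laplacian \<phi> y
                        + 1/24 * (\<Sum>i\<in>UNIV. partial_deriv i \<phi> y * \<rho> i y)))
                \<and> (\<forall>G h dh. sobolev_density P\<^sub>Y G h dh \<longrightarrow>
                     (AE y in P\<^sub>Y. A \<phi> y = 1/24 * laplacian \<phi> y
                        + 1/24 * (1 / h y) * (\<Sum>i\<in>UNIV. dh i y * partial_deriv i \<phi> y)))))"
    if R: "rajchman P\<^sub>Y" and cases: "(\<exists>\<rho>. L2_logarithmic_gradient P\<^sub>Y \<rho>) \<or> (\<exists>G h dh. sobolev_density P\<^sub>Y G h dh)"
  proof -
    interpret rajchman_vector M V Y by unfold_locales (use Y R in \<open>simp_all add: P\<^sub>Y_def\<close>)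
    have sets: "sets P\<^sub>Y = sets borel" by (simp add: P\<^sub>Y_def)
    \<comment> \<open>Either case supplies a logarithmic gradient, in case (ii) the quotient of
      \<open>dh\<close> by \<open>h\<close>; the existence claims are proved from it
      uniformly.\<close>
    obtain \<rho> where \<rho>: "L2_logarithmic_gradient P\<^sub>Y \<rho>"
      using cases sobolev_density_logarithmic_gradient(1)[OF sets] by blast
    note \<rho>' = \<rho>[unfolded P\<^sub>Y_def]
    show ?thesis
    proof (intro conjI)
      show "\<exists>A. hyp_H1 M Y Yn (\<lambda>n. (real n)\<^sup>2) C2_bounded A"
        unfolding Yn_def by (rule exI, rule hyp_H1_laplacian[OF \<rho>'])
      show "\<exists>A. hyp_H2 M Y Yn (\<lambda>n. (real n)\<^sup>2) C2_bounded A"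
        unfolding Yn_def by (rule exI, rule hyp_H2_bias[OF \<rho>'])
      show "\<exists>A. hyp_H3 M Y Yn (\<lambda>n. (real n)\<^sup>2) C2_bounded A"
        unfolding Yn_def by (rule exI, rule hyp_H3_symmetric_bias[OF \<rho>'])
      show "\<exists>A. hyp_H4 M Y Yn (\<lambda>n. (real n)\<^sup>2) C2_bounded A"
        unfolding Yn_def by (rule exI, rule hyp_H4_bias[OF \<rho>'])
      show "\<forall>A. hyp_H1 M Y Yn (\<lambda>n. (real n)\<^sup>2) C2_bounded A \<longrightarrow>
             (\<forall>\<phi>\<in>C2_bounded. AE y in P\<^sub>Y. A \<phi> y = 1/24 * laplacian \<phi> y)"
        unfolding Yn_def P\<^sub>Y_def by (intro allI impI ballI, rule hyp_H1_unique[OF \<rho>'])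
    next
      show "\<forall>A. hyp_H3 M Y Yn (\<lambda>n. (real n)\<^sup>2) C2_bounded A \<longrightarrow>
             (\<forall>\<phi>\<in>C2_bounded.
                (AE y in P\<^sub>Y. square_field A \<phi> y = 1/12 * (\<Sum>i\<in>UNIV. (partial_deriv i \<phi> y)\<^sup>2))
                \<and> (\<forall>\<rho>. L2_logarithmic_gradient P\<^sub>Y \<rho> \<longrightarrow>
                     (AE y in P\<^sub>Y. A \<phi> y = 1/24 * laplacian \<phi> y
                        + 1/24 * (\<Sum>i\<in>UNIV. partial_deriv i \<phi> y * \<rho> i y)))
                \<and> (\<forall>G h dh. sobolev_density P\<^sub>Y G h dh \<longrightarrow>
                     (AE y in P\<^sub>Y. A \<phi> y = 1/24 * laplacian \<phi> y
                        + 1/24 * (1 / h y) * (\<Sum>i\<in>UNIV. dh i y * partial_deriv i \<phi> y))))"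
      proof (intro allI impI ballI conjI)
        fix A and \<phi> :: "real^'d \<Rightarrow> real"
        assume A: "hyp_H3 M Y Yn (\<lambda>n. (real n)\<^sup>2) C2_bounded A" and \<phi>: "\<phi> \<in> C2_bounded"
        note A' = A[unfolded Yn_def]
        show "AE y in P\<^sub>Y. square_field A \<phi> y = 1/12 * (\<Sum>i\<in>UNIV. (partial_deriv i \<phi> y)\<^sup>2)"
          unfolding P\<^sub>Y_def by (rule square_field_gradient[OF \<rho>' A' \<phi>])
        \<comment> \<open>Formulated for every logarithmic gradient \<sigma>, not just the one fixed
          above: case (i) quantifies over all of them, and case (ii) uses the one built from the
          density.\<close>
        have unique: "AE y in P\<^sub>Y. A \<phi> y = 1/24 * laplacian \<phi> y + 1/24 * (\<Sum>i\<in>UNIV. partial_deriv i \<phi> y * \<sigma> i y)"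
          if "L2_logarithmic_gradient P\<^sub>Y \<sigma>" for \<sigma>
          using hyp_H3_unique[OF that[unfolded P\<^sub>Y_def] A' \<phi>] unfolding P\<^sub>Y_def symmetric_bias_def .
        then show "AE y in P\<^sub>Y. A \<phi> y = 1/24 * laplacian \<phi> y + 1/24 * (\<Sum>i\<in>UNIV. partial_deriv i \<phi> y * \<sigma> i y)"
          if "L2_logarithmic_gradient P\<^sub>Y \<sigma>" for \<sigma> using that .
        fix G h dh assume S: "sobolev_density P\<^sub>Y G h dh"
        from unique[OF sobolev_density_logarithmic_gradient(1)[OF sets S]] sobolev_density_logarithmic_gradient(2)[OF sets S]
        show "AE y in P\<^sub>Y. A \<phi> y = 1/24 * laplacian \<phi> y + 1/24 * (1 / h y) * (\<Sum>i\<in>UNIV. dh i y * partial_deriv i \<phi> y)"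
        proof eventually_elim
          case (elim y)
          then show ?case by (simp add: sum_distrib_left sum_divide_distrib mult_ac)
        qed
      qed
    qed
  qed
  show ?thesis
    by (intro conjI) (rule impI, erule a, rule allI, rule impI, erule b,
      rule impI, rule allI, rule impI, erule conjE, rule c, assumption+,
      rule impI, erule conjE, rule d, assumption+)
qed

end
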